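(* Let $(u_0,v_0,F_0)\in V\times H\times{\mathcal S}$ and assume $F_0\in\Gamma{\mathcal P}$. Then a function $u$ is a solution to the equation with memory with initial state $(u_0,v_0,F_0)$ (in the sense defined in the context) if and only if $$(u(t),\partial_tu(t),\xi^t)=S(t)(u_0,v_0,\xi_0)\quad\text{for all }t\ge0,\qquad\text{where }\ \xi_0(\tau)=\mu(\tau)u_0+DF_0(\tau),$$ and $\xi^t(\tau)=\xi_0(t+\tau)+\mu(\tau)u(t)-\mu(t+\tau)u_0+\int_0^t\mu'(\tau+s)u(t-s){\rm d}s$. Conversely, if $u$ is a solution with initial state $(u_0,v_0,F_0)$ and $F_0\notin\Gamma{\mathcal P}$, then there is no $\xi_0\in{\mathcal V}$ such that $u(t)$ is the first component of $S(t)(u_0,v_0,\xi_0)$ for all $t\ge0$.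
   Context: $H$ is a separable real Hilbert space, $A$ a selfadjoint strictly positive operator on $H$ with compact inverse and dense domain ${\mathcal D}(A)$, $V={\mathcal D}(A^{1/2})$ with $\langle u,w\rangle_V=\langle A^{1/2}u,A^{1/2}w\rangle_H$; $V^*$ is its dual and $\langle\cdot,\cdot\rangle$ the $V^*$–$V$ duality. Let $\ell\in(0,\infty]$, $\Omega=(0,\ell)$, and $\mu:\Omega\to(0,\infty)$ nonincreasing, summable, absolutely continuous on every closed subinterval of $\Omega$, and, if $\ell<\infty$, continuous at $\ell$ with $\mu(\ell)=0$; functions on $\Omega$ are $0$ outside $\Omega$. $M(s)=\int_s^\ell\mu$, and $\alpha>0$ satisfies $\alpha-M(0)=1$. $\nu=1/\mu$, ${\mathcal V}=L^2_\nu(\Omega;V)$ (norm $\int_0^\ell\nu\|\xi\|_V^2$), $D$ the distributional derivative, $P\xi=D\xi$ with ${\mathcal D}(P)=\{\xi\in{\mathcal V}:D\xi\in{\mathcal V},\ \lim_{\tau\to\ell}\xi(\tau)=0\}$, ${\mathfrak A}=V\times H\times{\mathcal V}$, and $S(t)$ is the contraction semigroup on ${\mathfrak A}$ generated by ${\mathbb A}(u,v,\xi)=(v,-A[u+\int_0^\ell\xi\,{\rm d}\tau],P\xi+\mu v)$ with domain $\{(u,v,\xi)\in{\mathfrak A}: v\in V,\ u+\int_0^\ell\xi\,{\rm d}\tau\in{\mathcal D}(A),\ \xi\in{\mathcal D}(P)\}$. ${\mathcal A}=\{\phi:\Omega\to V:\ t\mapsto\int_0^\ell\mu(t+s)\phi(s){\rm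 d}s\in L^1_{\rm loc}([0,\infty);V)\}$, $\Lambda\phi(t)=\int_0^\ell\mu(t+s)\phi(s){\rm d}s$, ${\mathcal S}=\Lambda{\mathcal A}$. Proper states: ${\mathcal P}=\{\xi\in{\mathcal V}:\xi=DF\text{ for some }F\in{\mathcal S}\}$; $\Gamma:{\mathcal P}\to{\mathcal S}$, $\Gamma\xi(t)=-\int_t^\ell\xi(\tau){\rm d}\tau$. Solution with initial state $(u_0,v_0,F_0)\in V\times H\times{\mathcal S}$: a function $u\in C([0,\infty),V)\cap C^1([0,\infty),H)$ with $u(0)=u_0$, $\partial_tu(0)=v_0$, and $\langle\partial_{tt}u(t),w\rangle+\alpha\langle u(t),w\rangle_V-\int_0^t\mu(s)\langle u(t-s),w\rangle_V{\rm d}s-\langle F_0(t),w\rangle_V=0$ for every $w\in V$ and almost every $t>0$. *)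

theory Defs
  imports "HOL-Analysis.Analysis"
begin

section \<open>States: triples (u, v, xi) in V x H x calV, represented by functions\<close>

type_synonym 'h st = "'h \<times> 'h \<times> (real \<Rightarrow> 'h)"

definition Omega :: "ereal \<Rightarrow> real set" where
  "Omega l = {\<tau>. 0 < \<tau> \<and> ereal \<tau> < l}"

definition Ivl :: "real \<Rightarrow> ereal \<Rightarrow> real set" where
  "Ivl s l = {\<tau>. s < \<tau> \<and> ereal \<tau> < l}"

definition to_l :: "ereal \<Rightarrow> real filter" where
  "to_l l = (if l = \<infinity> then at_top else at_left (real_of_ereal l))"

definition lin_on :: "'h::real_vector set \<Rightarrow> ('h \<Rightarrow> 'h) \<Rightarrow> bool" where
  "lin_on D f \<longleftrightarrow> subspace D \<and>
     (\<forall>x\<in>D. \<forall>y\<in>D. f (x + y) = f x + f y) \<and> (\<forall>x\<in>D. \<forall>c. f (c *\<^sub>R x) = c *\<^sub>R f x)"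

text \<open>Densely defined selfadjoint operator with domain D: symmetric and D(A^*) = D.\<close>
definition selfadjoint_op :: "('h::real_inner \<Rightarrow> 'h) \<Rightarrow> 'h set \<Rightarrow> bool" where
  "selfadjoint_op A D \<longleftrightarrow> lin_on D A \<and> closure D = UNIV \<and>
     (\<forall>u\<in>D. \<forall>w\<in>D. inner (A u) w = inner u (A w)) \<and>
     (\<forall>u z. (\<forall>w\<in>D. inner u (A w) = inner z w) \<longrightarrow> u \<in> D \<and> A u = z)"

definition strictly_positive_op :: "('h::real_inner \<Rightarrow> 'h) \<Rightarrow> 'h set \<Rightarrow> bool" where
  "strictly_positive_op A D \<longleftrightarrow> (\<forall>u\<in>D. u \<noteq> 0 \<longrightarrow> inner (A u) u > 0)"

definition positive_op :: "('h::real_inner \<Rightarrow> 'h) \<Rightarrow> 'h set \<Rightarrow> bool" where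
  "positive_op A D \<longleftrightarrow> (\<forall>u\<in>D. inner (A u) u \<ge> 0)"

definition compact_op :: "('h::real_normed_vector \<Rightarrow> 'h) \<Rightarrow> bool" where
  "compact_op K \<longleftrightarrow> linear K \<and> (\<forall>S. bounded S \<longrightarrow> compact (closure (K ` S)))"

definition has_compact_inverse :: "('h::real_normed_vector \<Rightarrow> 'h) \<Rightarrow> 'h set \<Rightarrow> bool" where
  "has_compact_inverse A D \<longleftrightarrow> inj_on A D \<and> A ` D = UNIV \<and> compact_op (inv_into D A)"

definition is_op_sqrt :: "('h::real_inner \<Rightarrow> 'h) \<Rightarrow> 'h set \<Rightarrow> ('h \<Rightarrow> 'h) \<Rightarrow> 'h set \<Rightarrow> bool" where
  "is_op_sqrt B DB A DA \<longleftrightarrow> selfadjoint_op B DB \<and> positive_op B DB \<and>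
     DA = {u \<in> DB. B u \<in> DB} \<and> (\<forall>u\<in>DA. A u = B (B u))"

text \<open>V = D(A^(1/2)) = DB with inner product <u,w>_V = <Bu, Bw>.\<close>
definition innerV :: "('h::real_inner \<Rightarrow> 'h) \<Rightarrow> 'h \<Rightarrow> 'h \<Rightarrow> real" where
  "innerV B u w = inner (B u) (B w)"

definition abs_cont_on :: "real \<Rightarrow> real \<Rightarrow> (real \<Rightarrow> real) \<Rightarrow> bool" where
  "abs_cont_on a b f \<longleftrightarrow> (\<forall>\<epsilon>>0. \<exists>\<delta>>0. \<forall>(n::nat) (I :: nat \<Rightarrow> real \<times> real).
     (\<forall>i<n. a \<le> fst (I i) \<and> fst (I i) \<le> snd (I i) \<and> snd (I i) \<le> b) \<and>
     (\<forall>i<n. \<forall>j<n. i \<noteq> j \<longrightarrow> snd (I i) \<le> fst (I j) \<or> snd (I j) \<le> fst (I i)) \<and>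
     (\<Sum>i<n. snd (I i) - fst (I i)) < \<delta> \<longrightarrow>
     (\<Sum>i<n. \<bar>f (snd (I i)) - f (fst (I i))\<bar>) < \<epsilon>)"

definition memory_kernel :: "ereal \<Rightarrow> (real \<Rightarrow> real) \<Rightarrow> bool" where
  "memory_kernel l \<mu> \<longleftrightarrow>
     (\<forall>\<tau>\<in>Omega l. \<mu> \<tau> > 0) \<and>
     (\<forall>\<tau>. \<tau> \<notin> Omega l \<longrightarrow> \<mu> \<tau> = 0) \<and>
     antimono_on (Omega l) \<mu> \<and>
     integrable (lebesgue_on (Omega l)) \<mu> \<and>
     (\<forall>a b. a \<le> b \<longrightarrow> {a..b} \<subseteq> Omega l \<longrightarrow> abs_cont_on a b \<mu>) \<and>
     (l < \<infinity> \<longrightarrow> isCont \<mu> (real_of_ereal l))"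

definition Mk :: "ereal \<Rightarrow> (real \<Rightarrow> real) \<Rightarrow> real \<Rightarrow> real" where
  "Mk l \<mu> s = integral\<^sup>L (lebesgue_on (Ivl s l)) \<mu>"

section \<open>The space calV = L^2_nu(Omega; V), nu = 1/mu (elements = representatives)\<close>

definition normV2 :: "ereal \<Rightarrow> (real \<Rightarrow> real) \<Rightarrow> ('h::real_normed_vector \<Rightarrow> 'h) \<Rightarrow> (real \<Rightarrow> 'h) \<Rightarrow> ennreal" where
  "normV2 l \<mu> B \<xi> = (\<integral>\<^sup>+ \<tau>. indicator (Omega l) \<tau> * ennreal ((norm (B (\<xi> \<tau>)))\<^sup>2 / \<mu> \<tau>) \<partial>lebesgue)"

definition in_calV :: "ereal \<Rightarrow> (real \<Rightarrow> real) \<Rightarrow> ('h::{real_normed_vector,second_countable_topology} \<Rightarrow> 'h) \<Rightarrow> 'h set \<Rightarrow> (real \<Rightarrow> 'h) \<Rightarrow> bool" where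
  "in_calV l \<mu> B DB \<xi> \<longleftrightarrow> (AE \<tau> in lebesgue_on (Omega l). \<xi> \<tau> \<in> DB) \<and>
     \<xi> \<in> borel_measurable (lebesgue_on (Omega l)) \<and>
     (\<lambda>\<tau>. B (\<xi> \<tau>)) \<in> borel_measurable (lebesgue_on (Omega l)) \<and>
     normV2 l \<mu> B \<xi> < \<infinity>"

definition test_fun :: "real set \<Rightarrow> (real \<Rightarrow> real) \<Rightarrow> bool" where
  "test_fun U \<phi> \<longleftrightarrow> (\<forall>n x. ((deriv ^^ n) \<phi>) differentiable (at x)) \<and>
     (\<exists>K. compact K \<and> K \<subseteq> U \<and> (\<forall>x. x \<notin> K \<longrightarrow> \<phi> x = 0))"

definition dist_deriv :: "real set \<Rightarrow> (real \<Rightarrow> 'h::{banach,second_countable_topology}) \<Rightarrow> (real \<Rightarrow> 'h) \<Rightarrow> bool" where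
  "dist_deriv U f g \<longleftrightarrow> (\<forall>\<phi>. test_fun U \<phi> \<longrightarrow>
     integrable (lebesgue_on U) (\<lambda>x. deriv \<phi> x *\<^sub>R f x) \<and>
     integrable (lebesgue_on U) (\<lambda>x. \<phi> x *\<^sub>R g x) \<and>
     integral\<^sup>L (lebesgue_on U) (\<lambda>x. deriv \<phi> x *\<^sub>R f x) = - integral\<^sup>L (lebesgue_on U) (\<lambda>x. \<phi> x *\<^sub>R g x))"

definition Lam :: "ereal \<Rightarrow> (real \<Rightarrow> real) \<Rightarrow> (real \<Rightarrow> 'h::{banach,second_countable_topology}) \<Rightarrow> real \<Rightarrow> 'h" where
  "Lam l \<mu> \<phi> t = integral\<^sup>L (lebesgue_on (Omega l)) (\<lambda>s. \<mu> (t + s) *\<^sub>R \<phi> s)"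

definition loc_int_V :: "('h::{banach,second_countable_topology} \<Rightarrow> 'h) \<Rightarrow> 'h set \<Rightarrow> (real \<Rightarrow> 'h) \<Rightarrow> bool" where
  "loc_int_V B DB F \<longleftrightarrow> (AE t in lebesgue_on {0..}. F t \<in> DB) \<and>
     (\<forall>T\<ge>0. integrable (lebesgue_on {0..T}) F \<and> integrable (lebesgue_on {0..T}) (\<lambda>t. B (F t)))"

definition in_calA :: "ereal \<Rightarrow> (real \<Rightarrow> real) \<Rightarrow> ('h::{banach,second_countable_topology} \<Rightarrow> 'h) \<Rightarrow> 'h set \<Rightarrow> (real \<Rightarrow> 'h) \<Rightarrow> bool" where
  "in_calA l \<mu> B DB \<phi> \<longleftrightarrow> (\<forall>s\<in>Omega l. \<phi> s \<in> DB) \<and>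
     (AE t in lebesgue_on {0..}.
        integrable (lebesgue_on (Omega l)) (\<lambda>s. \<mu> (t + s) *\<^sub>R \<phi> s) \<and>
        integrable (lebesgue_on (Omega l)) (\<lambda>s. \<mu> (t + s) *\<^sub>R B (\<phi> s))) \<and>
     loc_int_V B DB (Lam l \<mu> \<phi>)"

text \<open>calS = Lambda calA (as elements of L^1_loc, i.e. up to null sets).\<close>
definition in_calS :: "ereal \<Rightarrow> (real \<Rightarrow> real) \<Rightarrow> ('h::{banach,second_countable_topology} \<Rightarrow> 'h) \<Rightarrow> 'h set \<Rightarrow> (real \<Rightarrow> 'h) \<Rightarrow> bool" where
  "in_calS l \<mu> B DB F \<longleftrightarrow> (\<exists>\<phi>. in_calA l \<mu> B DB \<phi> \<and>
     (AE t in lebesgue_on {0..}. F t = Lam l \<mu> \<phi> t))"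

definition in_calP :: "ereal \<Rightarrow> (real \<Rightarrow> real) \<Rightarrow> ('h::{banach,second_countable_topology} \<Rightarrow> 'h) \<Rightarrow> 'h set \<Rightarrow> (real \<Rightarrow> 'h) \<Rightarrow> bool" where
  "in_calP l \<mu> B DB \<xi> \<longleftrightarrow> in_calV l \<mu> B DB \<xi> \<and>
     (\<exists>F. in_calS l \<mu> B DB F \<and> dist_deriv {0<..} F (\<lambda>\<tau>. if \<tau> \<in> Omega l then \<xi> \<tau> else 0))"

definition Gam :: "ereal \<Rightarrow> (real \<Rightarrow> 'h::{banach,second_countable_topology}) \<Rightarrow> real \<Rightarrow> 'h" where
  "Gam l \<xi> t = - integral\<^sup>L (lebesgue_on (Ivl t l)) \<xi>"

text \<open>F in Gamma calP (equality in L^1_loc, i.e. almost everywhere on [0, infinity)).\<close>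
definition in_GammaP :: "ereal \<Rightarrow> (real \<Rightarrow> real) \<Rightarrow> ('h::{banach,second_countable_topology} \<Rightarrow> 'h) \<Rightarrow> 'h set \<Rightarrow> (real \<Rightarrow> 'h) \<Rightarrow> bool" where
  "in_GammaP l \<mu> B DB F \<longleftrightarrow> (\<exists>\<xi>. in_calP l \<mu> B DB \<xi> \<and>
     (AE t in lebesgue_on {0..}. F t = Gam l \<xi> t))"

definition in_frakA :: "ereal \<Rightarrow> (real \<Rightarrow> real) \<Rightarrow> ('h::{banach,second_countable_topology} \<Rightarrow> 'h) \<Rightarrow> 'h set \<Rightarrow> 'h st \<Rightarrow> bool" where
  "in_frakA l \<mu> B DB x \<longleftrightarrow> fst x \<in> DB \<and> in_calV l \<mu> B DB (snd (snd x))"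

text \<open>Squared distance in frakA (a seminorm on representatives; ennreal-valued).\<close>
definition distA2 :: "ereal \<Rightarrow> (real \<Rightarrow> real) \<Rightarrow> ('h::real_normed_vector \<Rightarrow> 'h) \<Rightarrow> 'h st \<Rightarrow> 'h st \<Rightarrow> ennreal" where
  "distA2 l \<mu> B x y = ennreal ((norm (B (fst x - fst y)))\<^sup>2) + ennreal ((norm (fst (snd x) - fst (snd y)))\<^sup>2)
     + normV2 l \<mu> B (\<lambda>\<tau>. snd (snd x) \<tau> - snd (snd y) \<tau>)"

definition st_lin :: "real \<Rightarrow> 'h::real_vector st \<Rightarrow> real \<Rightarrow> 'h st \<Rightarrow> 'h st" where
  "st_lin a x b y = (a *\<^sub>R fst x + b *\<^sub>R fst y, a *\<^sub>R fst (snd x) + b *\<^sub>R fst (snd y),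
      \<lambda>\<tau>. a *\<^sub>R snd (snd x) \<tau> + b *\<^sub>R snd (snd y) \<tau>)"

definition st_zero :: "'h::real_vector st" where
  "st_zero = (0, 0, \<lambda>_. 0)"

text \<open>gen_rel x y: x belongs to the domain of the operator bbA and y equals bbA x in frakA.\<close>
definition gen_rel :: "ereal \<Rightarrow> (real \<Rightarrow> real) \<Rightarrow> ('h::{real_inner,banach,second_countable_topology} \<Rightarrow> 'h) \<Rightarrow> 'h set
     \<Rightarrow> ('h \<Rightarrow> 'h) \<Rightarrow> 'h set \<Rightarrow> 'h st \<Rightarrow> 'h st \<Rightarrow> bool" where
  "gen_rel l \<mu> A DA B DB x y \<longleftrightarrow>
     (case x of (u, v, \<xi>) \<Rightarrow>
        in_frakA l \<mu> B DB x \<and> v \<in> DB \<and>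
        integrable (lebesgue_on (Omega l)) \<xi> \<and>
        u + integral\<^sup>L (lebesgue_on (Omega l)) \<xi> \<in> DA \<and>
        (\<exists>\<eta>. dist_deriv (Omega l) \<xi> \<eta> \<and> in_calV l \<mu> B DB \<eta> \<and>
           (\<exists>\<zeta>. (AE \<tau> in lebesgue_on (Omega l). \<zeta> \<tau> = \<xi> \<tau>) \<and>
                 (\<forall>\<^sub>F \<tau> in to_l l. \<zeta> \<tau> \<in> DB) \<and> ((\<lambda>\<tau>. B (\<zeta> \<tau>)) \<longlongrightarrow> 0) (to_l l)) \<and>
           distA2 l \<mu> B y (v, - A (u + integral\<^sup>L (lebesgue_on (Omega l)) \<xi>), \<lambda>\<tau>. \<eta> \<tau> + \<mu> \<tau> *\<^sub>R v) = 0))"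

definition is_generated_semigroup :: "ereal \<Rightarrow> (real \<Rightarrow> real) \<Rightarrow> ('h::{real_inner,banach,second_countable_topology} \<Rightarrow> 'h) \<Rightarrow> 'h set
     \<Rightarrow> ('h \<Rightarrow> 'h) \<Rightarrow> 'h set \<Rightarrow> (real \<Rightarrow> 'h st \<Rightarrow> 'h st) \<Rightarrow> bool" where
  "is_generated_semigroup l \<mu> A DA B DB S \<longleftrightarrow>
     (\<forall>t\<ge>0. \<forall>x. in_frakA l \<mu> B DB x \<longrightarrow> in_frakA l \<mu> B DB (S t x)) \<and>
     (\<forall>t\<ge>0. \<forall>x y a b. in_frakA l \<mu> B DB x \<longrightarrow> in_frakA l \<mu> B DB y \<longrightarrow>
        distA2 l \<mu> B (S t (st_lin a x b y)) (st_lin a (S t x) b (S t y)) = 0) \<and>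
     (\<forall>t\<ge>0. \<forall>x. in_frakA l \<mu> B DB x \<longrightarrow> distA2 l \<mu> B (S t x) st_zero \<le> distA2 l \<mu> B x st_zero) \<and>
     (\<forall>x. in_frakA l \<mu> B DB x \<longrightarrow> distA2 l \<mu> B (S 0 x) x = 0) \<and>
     (\<forall>t\<ge>0. \<forall>s\<ge>0. \<forall>x. in_frakA l \<mu> B DB x \<longrightarrow> distA2 l \<mu> B (S (t + s) x) (S t (S s x)) = 0) \<and>
     (\<forall>x. in_frakA l \<mu> B DB x \<longrightarrow> (\<forall>t0\<ge>0. ((\<lambda>t. distA2 l \<mu> B (S t x) (S t0 x)) \<longlongrightarrow> 0) (at t0 within {0..}))) \<and>
     (\<forall>x y. in_frakA l \<mu> B DB x \<longrightarrow> in_frakA l \<mu> B DB y \<longrightarrow>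
        (gen_rel l \<mu> A DA B DB x y \<longleftrightarrow>
         ((\<lambda>h. distA2 l \<mu> B (st_lin (1/h) (S h x) (-1/h) x) y) \<longlongrightarrow> 0) (at_right 0)))"

definition in_Vdual :: "('h::real_inner \<Rightarrow> 'h) \<Rightarrow> 'h set \<Rightarrow> ('h \<Rightarrow> real) \<Rightarrow> bool" where
  "in_Vdual B DB \<psi> \<longleftrightarrow> (\<forall>x\<in>DB. \<forall>y\<in>DB. \<forall>a b. \<psi> (a *\<^sub>R x + b *\<^sub>R y) = a * \<psi> x + b * \<psi> y) \<and>
     (\<exists>C. \<forall>w\<in>DB. \<bar>\<psi> w\<bar> \<le> C * norm (B w))"

definition is_solution :: "ereal \<Rightarrow> (real \<Rightarrow> real) \<Rightarrow> real \<Rightarrow> ('h::{real_inner,banach,second_countable_topology} \<Rightarrow> 'h) \<Rightarrow> 'h set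
     \<Rightarrow> (real \<Rightarrow> 'h) \<Rightarrow> 'h \<Rightarrow> 'h \<Rightarrow> (real \<Rightarrow> 'h) \<Rightarrow> bool" where
  "is_solution l \<mu> \<alpha> B DB F0 u0 v0 u \<longleftrightarrow>
     \<comment> \<open>u in C([0,infinity), V)\<close>
     (\<forall>t\<ge>0. u t \<in> DB) \<and> continuous_on {0..} (\<lambda>t. B (u t)) \<and>
     \<comment> \<open>u in C^1([0,infinity), H)\<close>
     (\<forall>t\<ge>0. u differentiable (at t within {0..})) \<and>
     continuous_on {0..} (\<lambda>t. vector_derivative u (at t within {0..})) \<and>
     u 0 = u0 \<and> vector_derivative u (at 0 within {0..}) = v0 \<and>
     \<comment> \<open>the second derivative u'' (V^*-valued, in the distributional sense) satisfies the equation\<close>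
     (\<exists>u2 :: real \<Rightarrow> 'h \<Rightarrow> real.
        (AE t in lebesgue_on {0..}. in_Vdual B DB (u2 t)) \<and>
        (\<forall>w\<in>DB. \<forall>t\<ge>0. set_integrable lborel {0..t} (\<lambda>s. u2 s w) \<and>
            inner (vector_derivative u (at t within {0..})) w
              = inner v0 w + (LINT s:{0..t}|lborel. u2 s w)) \<and>
        (\<forall>w\<in>DB. AE t in lebesgue_on {0<..}.
            u2 t w + \<alpha> * innerV B (u t) w
              - (LINT s:{0..t}|lborel. \<mu> s * innerV B (u (t - s)) w)
              - innerV B (F0 t) w = 0))"

definition xi_t :: "(real \<Rightarrow> real) \<Rightarrow> (real \<Rightarrow> 'h::{banach,second_countable_topology}) \<Rightarrow> 'h \<Rightarrow> (real \<Rightarrow> 'h) \<Rightarrow> real \<Rightarrow> real \<Rightarrow> 'h" where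
  "xi_t \<mu> \<xi>0 u0 u t \<tau> = \<xi>0 (t + \<tau>) + \<mu> \<tau> *\<^sub>R u t - \<mu> (t + \<tau>) *\<^sub>R u0
      + (LINT s:{0..t}|lborel. deriv \<mu> (\<tau> + s) *\<^sub>R u (t - s))"

end

(* Write V = D(B), R = B^{-1}, and let b = B xi_0 for the initial history xi_0. Testing the history
   component against smooth functions transported along characteristics gives, for every orbit
   (u, v, xi) of the semigroup,
     xi^t(tau) = xi_0(t + tau) + int_0^t mu(tau + t - s) v(s) ds   for almost every tau,
   and integration by parts in s turns this into the stated formula for xi^t. Integrating over tau
   shows that the restoring force B(u + int xi^t) equals alpha B u - mu * (B u) - B F, where
   B F(t) = - int_t^l (b - mu B u_0). So the first component of every orbit solves the equation with
   forcing F = Gamma(xi_0 - mu u_0), and xi_0 = mu u_0 + D F_0 yields exactly the forcing F_0.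

   Solutions are unique because the equation is its own adjoint: the difference y of two solutions,
   paired with the time-reversed orbit psi issued from (0, v_1, 0), makes
   <y'(t - s), psi(s)> + <y(t - s), psi'(s)> have integral-zero derivative on [0, t], by the symmetry
   of the convolution; comparing end points gives <y(t), v_1> = 0.

   Conversely a solution determines B F_0 almost everywhere, so if u is the first component of an
   orbit with initial history xi_0 then F_0 = Gamma(xi_0 - mu u_0), which is a proper state. *)
theory Submission
  imports Defs "HOL-Computational_Algebra.Polynomial"
begin

section \<open>Absolutely continuous monotone functions\<close>

text \<open>The semigroup is known only through its axioms, so nothing can be computed directly
  along an arbitrary orbit: identities are verified on the domain of the generator and carried over
  by density, which costs an approximation theorem in the weighted history space. To extend to every
  orbit they must involve bounded functionals only; v lies merely in H, hence the ubiquitous R,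
  which turns A into B and B v into v. In the uniqueness argument the same obstacle means that
  velocities are differentiable only after R, and the product rule has to put R on one factor and B
  on the other. The kernel may be unbounded at 0 and is absolutely continuous only inside Omega, so
  its derivative is used on intervals with a positive left end; that \<open>deriv \<mu>\<close>
  exists a.e. and integrates to the increments of \<mu> is proved from Vitali's covering theorem and
  Radon-Nikodym. States are functions rather than classes: equality of states is distance zero, and
  each history is handled through a Borel representative of B xi that is 0 outside Omega.\<close>

lemma AE_zero_if_Ioc_integrals_zero:
  fixes f :: "real \<Rightarrow> 'b::{second_countable_topology, banach}"
  assumes f: "integrable lborel f"
    and z: "\<And>a b. a \<le> b \<Longrightarrow> (LINT x:{a<..b}|lborel. f x) = 0"
  shows "AE x in lborel. f x = 0"
proof (rule sigma_finite_measure.density_zero[OF sigma_finite_lborel f])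
  \<comment> \<open>The total integral serves the complement step of the Dynkin argument below, in
    which the half-open intervals form the intersection-stable generator.\<close>
  have tot: "(LINT x|lborel. f x) = 0"
  proof -
    have "(\<lambda>n. LINT x|lborel. indicator {-real n<..real n} x *\<^sub>R f x) \<longlonglongrightarrow> (LINT x|lborel. f x)"
    proof (rule integral_dominated_convergence[where w="\<lambda>x. norm (f x)"])
      show "AE x in lborel. (\<lambda>n. indicator {-real n<..real n} x *\<^sub>R f x) \<longlonglongrightarrow> f x"
      proof (intro AE_I2 tendsto_eventually)
        fix x :: real
        obtain N where N: "\<bar>x\<bar> < real N" using reals_Archimedean2 by blast
        show "\<forall>\<^sub>F n in sequentially. indicator {-real n<..real n} x *\<^sub>R f x = f x"
          using eventually_ge_at_top[of N] by eventually_elim (use N in \<open>auto simp: indicator_def\<close>)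
      qed
      show "AE x in lborel. norm (indicator {-real n<..real n} x *\<^sub>R f x) \<le> norm (f x)" for n
        by (auto simp: indicator_def)
    qed (use f in \<open>auto intro: borel_measurable_integrable\<close>)
    moreover have "(LINT x|lborel. indicator {-real n<..real n} x *\<^sub>R f x) = 0" for n
      using z[of "-real n" "real n"] by (simp add: set_lebesgue_integral_def)
    ultimately show ?thesis by (simp add: LIMSEQ_const_iff)
  qed
  fix A :: "real set" assume "A \<in> sets lborel"
  then have A: "A \<in> sigma_sets UNIV ((\<lambda>(a, b). {a<..b::real}) ` UNIV)"
    by (simp add: borel_sigma_sets_Ioc)
  have "Int_stable ((\<lambda>(a, b). {a<..b::real}) ` UNIV)"
    by (auto simp: Int_stable_def)
  moreover have "(\<lambda>(a, b). {a<..b::real}) ` UNIV \<subseteq> Pow UNIV" by simp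
  ultimately show "(LINT x:A|lborel. f x) = 0" using A
  proof (induction rule: sigma_sets_induct_disjoint[consumes 3])
    case (basic A)
    then obtain a b where "A = {a<..b}" by auto
    then show ?case using z[of a b] by (cases "a \<le> b") (auto simp: set_lebesgue_integral_def)
  next
    case empty then show ?case by (simp add: set_lebesgue_integral_def)
  next
    case (compl A)
    then have [measurable]: "A \<in> sets borel" by (simp add: borel_sigma_sets_Ioc)
    have "(LINT x:UNIV - A|lborel. f x) = (LINT x:UNIV|lborel. f x) - (LINT x:A|lborel. f x)"
    proof -
      have "(LINT x|lborel. indicator UNIV x *\<^sub>R f x) - (LINT x|lborel. indicator A x *\<^sub>R f x)
          = (LINT x|lborel. indicator UNIV x *\<^sub>R f x - indicator A x *\<^sub>R f x)"
        by (rule Bochner_Integration.integral_diff[symmetric]) (intro integrable_mult_indicator f; simp)+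
      also have "\<dots> = (LINT x|lborel. indicator (UNIV - A) x *\<^sub>R f x)"
        by (intro Bochner_Integration.integral_cong) (auto simp: indicator_def)
      finally show ?thesis by (simp add: set_lebesgue_integral_def)
    qed
    with compl tot show ?case by (simp add: set_lebesgue_integral_def)
  next
    case (union A)
    have [measurable]: "A i \<in> sets borel" for i using union by (auto simp: borel_sigma_sets_Ioc)
    have "(LINT x:(\<Union>i. A i)|lborel. f x) = (\<Sum>i. LINT x:A i|lborel. f x)"
      by (rule lebesgue_integral_countable_add)
         (use union in \<open>auto simp: disjoint_family_on_def set_integrable_def intro!: integrable_mult_indicator f\<close>)
    with union show ?case by simp
  qed
qed

text \<open>Simple functions have Borel versions. On a common null set N the versions are replaced
  by 0, so that their limit exists everywhere and is Borel.\<close>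

lemma completion_ex_borel_measurable_banach:
  fixes g :: "'a \<Rightarrow> 'b::{second_countable_topology, banach}"
  assumes g: "g \<in> borel_measurable (completion M)"
  shows "\<exists>g'\<in>borel_measurable M. AE x in M. g x = g' x"
proof -
  obtain s where s: "\<And>i. simple_function (completion M) (s i)"
      and lim: "\<And>x. x \<in> space (completion M) \<Longrightarrow> (\<lambda>i. s i x) \<longlonglongrightarrow> g x"
    using borel_measurable_implies_sequence_metric[OF g, of 0] by blast
  have "\<exists>f'. simple_function M f' \<and> (AE x in M. s i x = f' x)" for i
    using completion_ex_simple_function[OF s[of i]] by blast
  then obtain t where t: "\<And>i. simple_function M (t i)" "\<And>i. AE x in M. s i x = t i x" by metis
  have [measurable]: "t i \<in> borel_measurable M" for i
    using borel_measurable_simple_function[OF t(1)] .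
  have "AE x in M. \<forall>i. s i x = t i x" using t(2) by (simp add: AE_all_countable)
  then obtain N where N: "N \<in> null_sets M" "\<And>x. x \<in> space M - N \<Longrightarrow> \<forall>i. s i x = t i x"
    by (elim AE_E3) blast
  have [measurable]: "N \<in> sets M" using N by auto
  define g' where "g' x = lim (\<lambda>i. indicator (space M - N) x *\<^sub>R t i x)" for x
  have "(\<lambda>i. indicator (space M - N) x *\<^sub>R t i x) \<longlonglongrightarrow> (if x \<in> space M - N then g x else 0)" for x
    using N(2)[of x] lim[of x] by (auto simp: indicator_def)
  then have g'eq: "g' x = (if x \<in> space M - N then g x else 0)" for x
    unfolding g'_def by (rule limI)
  have "g' \<in> borel_measurable M"
  proof (rule borel_measurable_LIMSEQ_metric)
    show "(\<lambda>i. indicator (space M - N) x *\<^sub>R t i x) \<longlonglongrightarrow> g' x" for x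
      unfolding g'eq by fact
  qed simp
  moreover have "AE x in M. g x = g' x"
    using AE_not_in[OF N(1)] AE_space by eventually_elim (simp add: g'eq)
  ultimately show ?thesis by blast
qed

section \<open>Lebesgue differentiation of indefinite integrals\<close>

text \<open>Truncation: above a suitable level n the function contributes less than e/2, and below
  it at most n times the measure of W.\<close>

lemma integral_small_on_small_sets:
  fixes h :: "'a \<Rightarrow> real"
  assumes h: "integrable M h" and "e > 0"
  obtains d where "d > 0" "\<And>W. W \<in> sets M \<Longrightarrow> emeasure M W < ennreal d \<Longrightarrow> (LINT x:W|M. \<bar>h x\<bar>) < e"
proof -
  have [measurable]: "h \<in> borel_measurable M" using h by auto
  have "(\<lambda>n. LINT x|M. indicator {x. real n < \<bar>h x\<bar>} x * \<bar>h x\<bar>) \<longlonglongrightarrow> (LINT x|M. 0)"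
  proof (rule integral_dominated_convergence[where w="\<lambda>x. \<bar>h x\<bar>"])
    show "AE x in M. (\<lambda>n. indicator {x. real n < \<bar>h x\<bar>} x * \<bar>h x\<bar>) \<longlonglongrightarrow> 0"
    proof (intro AE_I2 tendsto_eventually)
      fix x
      obtain N where N: "\<bar>h x\<bar> < real N" using reals_Archimedean2 by blast
      show "\<forall>\<^sub>F n in sequentially. indicator {x. real n < \<bar>h x\<bar>} x * \<bar>h x\<bar> = 0"
        using eventually_ge_at_top[of N] by eventually_elim (use N in \<open>auto simp: indicator_def\<close>)
    qed
  qed (use h in \<open>auto simp: indicator_def\<close>)
  then have "\<forall>\<^sub>F n in sequentially. (LINT x|M. indicator {x. real n < \<bar>h x\<bar>} x * \<bar>h x\<bar>) < e / 2"
    using \<open>e > 0\<close> by (intro order_tendstoD(2)[where y=0]) auto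
  then obtain n where n: "(LINT x|M. indicator {x. real n < \<bar>h x\<bar>} x * \<bar>h x\<bar>) < e / 2"
    by (auto simp: eventually_sequentially)
  show thesis
  proof (rule that[of "e / (2 * (real n + 1))"])
    show "0 < e / (2 * (real n + 1))" using \<open>e > 0\<close> by simp
    fix W assume W[measurable]: "W \<in> sets M" and mW: "emeasure M W < ennreal (e / (2 * (real n + 1)))"
    have fin: "emeasure M W < \<infinity>" using mW by (auto simp: less_top[symmetric])
    have mW': "measure M W < e / (2 * (real n + 1))"
      using mW fin \<open>e > 0\<close> by (subst (asm) emeasure_eq_ennreal_measure) (auto simp: ennreal_less_iff)
    have iW: "integrable M (indicator W :: _ \<Rightarrow> real)" using fin by (simp add: integrable_indicator_iff W)
    have ih: "integrable M (\<lambda>x. indicator {x. real n < \<bar>h x\<bar>} x * \<bar>h x\<bar>)"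
      by (rule Bochner_Integration.integrable_bound[OF h]) (auto simp: indicator_def)
    have "(LINT x:W|M. \<bar>h x\<bar>) \<le> (LINT x|M. indicator {x. real n < \<bar>h x\<bar>} x * \<bar>h x\<bar> + real n * indicator W x)"
      unfolding set_lebesgue_integral_def
    proof (rule integral_mono)
      show "integrable M (\<lambda>x. indicat_real W x *\<^sub>R \<bar>h x\<bar>)"
        by (rule Bochner_Integration.integrable_bound[OF h]) (auto simp: indicator_def)
    next
      show "integrable M (\<lambda>x. indicator {x. real n < \<bar>h x\<bar>} x * \<bar>h x\<bar> + real n * indicator W x)"
        by (intro Bochner_Integration.integrable_add ih integrable_mult_right iW)
    qed (auto simp: indicator_def)
    also have "\<dots> = (LINT x|M. indicator {x. real n < \<bar>h x\<bar>} x * \<bar>h x\<bar>) + real n * measure M W"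
      using ih iW W by simp
    also have "real n * measure M W \<le> (real n + 1) * measure M W" by (simp add: mult_right_mono)
    also have "\<dots> \<le> e / 2" using mW' by (simp add: field_simps)
    finally show "(LINT x:W|M. \<bar>h x\<bar>) < e" using n by simp
  qed
qed

text \<open>Vitali covering of the set where the averages exceed \<open>q\<close> by intervals inside an open set that
  barely exceeds \<open>{f < p}\<close>.\<close>
lemma negligible_large_averages:
  fixes f :: "real \<Rightarrow> real"
  assumes f: "integrable lborel f" and [measurable]: "f \<in> borel_measurable borel" and pq: "p < q"
  shows "negligible {x. f x < p \<and> (\<forall>d>0. \<exists>c e. c \<le> x \<and> x \<le> e \<and> c < e \<and> e - c < d \<and>
            q * (e - c) \<le> (LINT y:{c..e}|lborel. f y))}" (is "negligible ?E")
proof -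
  define I where "I n = {-real n<..<real n}" for n
  have negn: "negligible (?E \<inter> I n)" for n
  proof (subst negligible_outer_le, intro allI impI)
    fix e0 :: real assume e0: "e0 > 0"
    \<comment> \<open>The final bound is |W| \<le> |W \<inter> A| + |U - A| \<le> e/(q - p) + d with
      d \<le> e; this choice makes both summands at most e0/2.\<close>
    define e where "e = min (e0/2) (e0 * (q-p) / 2)"
    have e: "e > 0" "e \<le> e0/2" "e / (q-p) \<le> e0/2" using e0 pq by (auto simp: e_def min_def field_simps)
    \<comment> \<open>The integral of f - q over each selected interval is nonnegative, hence so is
      that of h over W. On A one has h < p - q, so (q - p)|W \<inter> A| is at most the integral of
      |h| over U - A, which is small because U - A is.\<close>
    define h where "h x = indicator (I n) x * (f x - q)" for x
    have bdI: "emeasure lborel (I n) < \<infinity>" by (simp add: I_def)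
    have Ib[measurable]: "I n \<in> sets borel" by (simp add: I_def)
    have ih: "integrable lborel h"
    proof -
      have "integrable lborel (\<lambda>x. indicator (I n) x *\<^sub>R f x - q * indicator (I n) x)"
        by (intro Bochner_Integration.integrable_diff integrable_mult_indicator f integrable_mult_right)
           (use bdI in \<open>auto simp: integrable_indicator_iff\<close>)
      then show ?thesis by (simp add: h_def[abs_def] algebra_simps)
    qed
    obtain d0 where d0: "d0 > 0" and d0': "\<And>W. W \<in> sets lborel \<Longrightarrow> emeasure lborel W < ennreal d0 \<Longrightarrow> (LINT x:W|lborel. \<bar>h x\<bar>) < e"
      using integral_small_on_small_sets[OF ih e(1)] by blast
    define d where "d = min d0 e"
    have d: "d > 0" "d \<le> e" "d \<le> d0" using d0 e by (auto simp: d_def)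
    define A where "A = {x. f x < p} \<inter> I n"
    have A[measurable]: "A \<in> sets borel" by (simp add: A_def)
    have "A \<in> sets lebesgue" using A by simp
    then obtain U0 where U0: "open U0" "A \<subseteq> U0" "emeasure lebesgue (U0 - A) < ennreal d"
      using sets_lebesgue_outer_open[OF _ d(1), of A] by metis
    define U where "U = U0 \<inter> I n"
    have U: "open U" "A \<subseteq> U" using U0 by (auto simp: U_def I_def A_def)
    have [measurable]: "U \<in> sets borel" "U0 \<in> sets borel" using U U0 by auto
    have "emeasure lborel (U - A) \<le> emeasure lborel (U0 - A)" by (intro emeasure_mono) (auto simp: U_def)
    also have "\<dots> < ennreal d" using U0(3) by simp
    finally have UA: "emeasure lborel (U - A) < ennreal d" .
    define K where "K = {(c,e). c < e \<and> {c..e} \<subseteq> U \<and> q * (e - c) \<le> (LINT y:{c..e}|lborel. f y)}"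
    \<comment> \<open>Vitali's theorem is about balls: an interval is the ball around its midpoint,
      and the point to be covered need not be the centre.\<close>
    define a where "a = (\<lambda>(c::real,e). (c + e) / 2)"
    define r where "r = (\<lambda>(c::real,e). (e - c) / 2)"
    have cb: "cball (a i) (r i) = {fst i..snd i}" for i
      by (cases i) (auto simp: a_def r_def cball_eq_atLeastAtMost field_simps)
    obtain C where C: "countable C" "C \<subseteq> K"
       "pairwise (\<lambda>i j. disjnt (cball (a i) (r i)) (cball (a j) (r j))) C"
       "negligible((?E \<inter> I n) - (\<Union>i \<in> C. cball (a i) (r i)))"
    proof (rule Vitali_covering_theorem_cballs[of K r "?E \<inter> I n" a])
      show "0 < r i" if "i \<in> K" for i using that by (auto simp: K_def r_def)
      fix x dd :: real assume x: "x \<in> ?E \<inter> I n" and dd: "0 < dd"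
      then have "x \<in> U" using U by (auto simp: A_def)
      then obtain s where s: "s > 0" "ball x s \<subseteq> U" using U(1) open_contains_ball by blast
      obtain c e where ce: "c \<le> x" "x \<le> e" "c < e" "e - c < min s dd" "q * (e - c) \<le> (LINT y:{c..e}|lborel. f y)"
      proof -
        have "\<forall>d>0. \<exists>c e. c \<le> x \<and> x \<le> e \<and> c < e \<and> e - c < d \<and>
            q * (e - c) \<le> (LINT y:{c..e}|lborel. f y)" using x by simp
        moreover have "min s dd > 0" using s dd by simp
        ultimately show ?thesis using that by blast
      qed
      have "{c..e} \<subseteq> ball x s" using ce by (auto simp: dist_real_def)
      then have "(c,e) \<in> K" using ce s by (auto simp: K_def)
      moreover have "x \<in> cball (a (c,e)) (r (c,e))" using ce by (simp add: cb)
      moreover have "r (c,e) < dd" using ce by (simp add: r_def)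
      ultimately show "\<exists>i. i \<in> K \<and> x \<in> cball (a i) (r i) \<and> r i < dd" by blast
    qed blast
    define W where "W = (\<Union>i \<in> C. cball (a i) (r i))"
    have Wb[measurable]: "W \<in> sets borel" unfolding W_def using C(1) by (intro sets.countable_UN') auto
    have "cball (a i) (r i) \<subseteq> U" if "i \<in> C" for i
    proof -
      have "i \<in> K" using that C(2) by blast
      then show ?thesis unfolding cb by (cases i) (auto simp: K_def)
    qed
    then have WU: "W \<subseteq> U" unfolding W_def by blast
    have hW: "0 \<le> (LINT x:W|lborel. h x)"
    proof -
      define B where "B m = (if m \<in> to_nat_on C ` C then cball (a (from_nat_into C m)) (r (from_nat_into C m)) else {})" for m
      have WB: "W = (\<Union>m. B m)"
        unfolding W_def B_def using C(1) by (auto simp: from_nat_into_to_nat_on split: if_splits)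
      have disj: "B m \<inter> B m' = {}" if "m \<noteq> m'" for m m'
      proof (cases "m \<in> to_nat_on C ` C \<and> m' \<in> to_nat_on C ` C")
        case True
        then obtain i j where ij: "i \<in> C" "m = to_nat_on C i" "j \<in> C" "m' = to_nat_on C j" by blast
        then have "i \<noteq> j" using that by auto
        then have "disjnt (cball (a i) (r i)) (cball (a j) (r j))" using C(3) ij by (auto simp: pairwise_def)
        then show ?thesis using ij C(1) by (simp add: B_def disjnt_def)
      qed (auto simp: B_def)
      have Bm[measurable]: "B m \<in> sets borel" for m by (simp add: B_def)
      have iS: "set_integrable lborel S h" if "S \<in> sets borel" for S
        using that ih unfolding set_integrable_def by (intro integrable_mult_indicator) auto
      have nn: "0 \<le> (LINT x:B m|lborel. h x)" for m
      proof (cases "m \<in> to_nat_on C ` C")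
        case True
        then obtain c e where i: "(c,e) \<in> C" "B m = {c..e}"
          using C(1) by (auto simp: B_def from_nat_into_to_nat_on cb)
        then have k: "c < e" "{c..e} \<subseteq> U" "q * (e - c) \<le> (LINT y:{c..e}|lborel. f y)" using C(2) by (auto simp: K_def)
        have "(LINT x:B m|lborel. h x) = (LINT x:{c..e}|lborel. f x - q)"
          unfolding i by (rule set_lebesgue_integral_cong) (use k in \<open>auto simp: h_def U_def\<close>)
        also have "\<dots> = (LINT x:{c..e}|lborel. f x) - (LINT x:{c..e}|lborel. q)"
          by (rule set_integral_diff) (use k in \<open>auto simp: set_integrable_def integrable_indicator_iff intro!: integrable_mult_indicator[of _ _ f, simplified] f\<close>)
        also have "(LINT x:{c..e}|lborel. q) = q * (e - c)" using k by (simp add: set_lebesgue_integral_def)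
        finally show ?thesis using k by simp
      next
        case False then show ?thesis by (simp add: B_def set_lebesgue_integral_def)
      qed
      have "(\<lambda>n. LINT x:(\<Union>m<n. B m)|lborel. h x) \<longlonglongrightarrow> (LINT x:(\<Union>n. \<Union>m<n. B m)|lborel. h x)"
        by (rule set_integral_cont_up) (auto intro!: iS simp: incseq_def intro: order.strict_trans2)
      moreover have "(\<Union>n. \<Union>m<n. B m) = W" unfolding WB by auto
      moreover have "0 \<le> (LINT x:(\<Union>m<n. B m)|lborel. h x)" for n
      proof -
        have "(LINT x:(\<Union>m<n. B m)|lborel. h x) = (\<Sum>m<n. LINT x:B m|lborel. h x)"
          by (rule set_integral_finite_Union) (auto simp: disjoint_family_on_def disj intro: iS)
        then show ?thesis using nn by (simp add: sum_nonneg)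
      qed
      ultimately show ?thesis by (simp add: LIMSEQ_le_const)
    qed
    have iS: "set_integrable lborel S h" if "S \<in> sets borel" for S
      using that ih unfolding set_integrable_def by (intro integrable_mult_indicator) auto
    have mWA: "measure lborel (W \<inter> A) * (q - p) \<le> e"
    proof -
      have fin: "emeasure lborel (W \<inter> A) < \<infinity>"
        by (rule order.strict_trans1[OF emeasure_mono bdI]) (auto simp: A_def)
      have "(LINT x:W|lborel. h x) = (LINT x:W \<inter> A|lborel. h x) + (LINT x:W - A|lborel. h x)"
        using set_integral_Un[of "W \<inter> A" "W - A" lborel h] iS by (simp add: Int_Diff_Un Int_Diff_disjoint)
      moreover have "(LINT x:W \<inter> A|lborel. h x) \<le> (LINT x:W \<inter> A|lborel. p - q)"
        by (rule set_integral_mono) (use iS fin in \<open>auto simp: set_integrable_def h_def A_def integrable_indicator_iff\<close>)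
      moreover have "(LINT x:W \<inter> A|lborel. p - q) = (p - q) * measure lborel (W \<inter> A)"
        by (simp add: set_lebesgue_integral_def)
      moreover have "(LINT x:W - A|lborel. h x) \<le> (LINT x:U - A|lborel. \<bar>h x\<bar>)"
      proof -
        have "(LINT x:W - A|lborel. h x) \<le> (LINT x:W - A|lborel. \<bar>h x\<bar>)"
          by (rule set_integral_mono) (use iS set_integrable_abs[OF iS] in auto)
        also have "\<dots> \<le> (LINT x:U - A|lborel. \<bar>h x\<bar>)"
          unfolding set_lebesgue_integral_def
          by (rule integral_mono) (use set_integrable_abs[OF iS] in \<open>simp add: set_integrable_def\<close>,
              use set_integrable_abs[OF iS] in \<open>simp add: set_integrable_def\<close>, use WU in \<open>auto simp: indicator_def\<close>)
        finally show ?thesis .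
      qed
      moreover have "(LINT x:U - A|lborel. \<bar>h x\<bar>) < e"
        by (rule d0') (use UA d in \<open>auto intro: order.strict_trans2 ennreal_leI\<close>)
      ultimately show ?thesis using hW by (simp add: algebra_simps)
    qed
    have mW: "measure lborel W \<le> e0" and Wfin: "emeasure lborel W < \<infinity>"
    proof -
      show Wfin: "emeasure lborel W < \<infinity>"
        by (rule order.strict_trans1[OF emeasure_mono bdI]) (use WU in \<open>auto simp: U_def\<close>)
      have UAfin: "emeasure lborel (U - A) < \<infinity>"
        by (rule order.strict_trans1[OF emeasure_mono bdI]) (auto simp: U_def)
      have "measure lborel W \<le> measure lborel ((W \<inter> A) \<union> (U - A))"
      proof (rule measure_mono_fmeasurable)
        have "emeasure lborel ((W \<inter> A) \<union> (U - A)) \<le> emeasure lborel (I n)"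
          by (rule emeasure_mono) (use WU in \<open>auto simp: U_def\<close>)
        then show "(W \<inter> A) \<union> (U - A) \<in> fmeasurable lborel" using bdI by (auto simp: fmeasurable_def)
      qed (use WU in auto)
      also have "\<dots> \<le> measure lborel (W \<inter> A) + measure lborel (U - A)"
        by (rule measure_Un_le) auto
      also have "measure lborel (U - A) \<le> d"
        using UA UAfin d by (subst (asm) emeasure_eq_ennreal_measure) (auto simp: ennreal_less_iff)
      also have "measure lborel (W \<inter> A) \<le> e / (q - p)" using mWA pq by (simp add: field_simps)
      finally show "measure lborel W \<le> e0" using e d by linarith
    qed
    let ?N = "(?E \<inter> I n) - W"
    have N: "?N \<in> null_sets lebesgue" using C(4) by (simp add: W_def negligible_iff_null_sets)
    have "W \<in> lmeasurable" using Wfin by (auto simp: fmeasurable_def)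
    moreover have "measure lebesgue (W \<union> ?N) = measure lebesgue W"
      using N by (intro measure_Un_null_set) auto
    moreover have "?N \<in> lmeasurable" using N by (auto simp: fmeasurable_def null_sets_def)
    ultimately have "W \<union> ?N \<in> lmeasurable" "measure lebesgue (W \<union> ?N) \<le> e0"
      using mW Wb by (auto intro: fmeasurable.Un simp del: Un_Diff_cancel)
    then show "\<exists>T. ?E \<inter> I n \<subseteq> T \<and> T \<in> lmeasurable \<and> measure lebesgue T \<le> e0"
      by (intro exI[of _ "W \<union> ?N"] conjI) auto
  qed
  have "?E \<subseteq> (\<Union>n. ?E \<inter> I n)"
  proof
    fix x assume "x \<in> ?E"
    obtain N where N: "\<bar>x\<bar> < real N" using reals_Archimedean2 by blast
    then show "x \<in> (\<Union>n. ?E \<inter> I n)" using \<open>x \<in> ?E\<close> by (auto simp: I_def intro!: exI[of _ N])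
  qed
  moreover have "negligible (\<Union>n. ?E \<inter> I n)" using negn by (intro negligible_countable_Union) auto
  ultimately show ?thesis by (rule negligible_subset[rotated])
qed

text \<open>A failure at x for some \<epsilon> would yield rationals with f x < p < q < f x +
  \<epsilon> and so put x into one of countably many negligible sets.\<close>

lemma AE_averages_less:
  fixes f :: "real \<Rightarrow> real"
  assumes f: "integrable lborel f" and [measurable]: "f \<in> borel_measurable borel"
  shows "AE x in lborel. \<forall>\<epsilon>>0. \<exists>d>0. \<forall>c e. c \<le> x \<longrightarrow> x \<le> e \<longrightarrow> c < e \<longrightarrow> e - c < d \<longrightarrow>
            (LINT y:{c..e}|lborel. f y) < (f x + \<epsilon>) * (e - c)"
proof -
  define E where "E p q = {x. f x < p \<and> (\<forall>d>0. \<exists>c e. c \<le> x \<and> x \<le> e \<and> c < e \<and> e - c < d \<and>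
            q * (e - c) \<le> (LINT y:{c..e}|lborel. f y))}" for p q
  have "negligible (E (of_rat p) (of_rat q))" if "p < q" for p q
    unfolding E_def by (rule negligible_large_averages[OF f]) (use that in \<open>auto simp: of_rat_less\<close>)
  then have "AE x in lborel. p < q \<longrightarrow> x \<notin> E (of_rat p) (of_rat q)" for p q :: rat
    by (subst AE_completion_iff[symmetric]) (auto simp: negligible_iff_null_sets dest: AE_not_in)
  then have "AE x in lborel. \<forall>p q. p < q \<longrightarrow> x \<notin> E (of_rat p) (of_rat q)"
    by (simp add: AE_all_countable)
  then show ?thesis
  proof eventually_elim
    case (elim x)
    show ?case
    proof (intro allI impI)
      fix \<epsilon> :: real assume "\<epsilon> > 0"
      obtain p where p: "f x < of_rat p" "of_rat p < f x + \<epsilon>" using of_rat_dense[of "f x" "f x + \<epsilon>"] \<open>\<epsilon> > 0\<close> by auto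
      obtain q where q: "of_rat p < (of_rat q :: real)" "of_rat q < f x + \<epsilon>" using of_rat_dense p by blast
      have "p < q" using q by (simp add: of_rat_less)
      then have "x \<notin> E (of_rat p) (of_rat q)" using elim by blast
      then obtain d where d: "d > 0" "\<forall>c e. \<not> (c \<le> x \<and> x \<le> e \<and> c < e \<and> e - c < d \<and>
            of_rat q * (e - c) \<le> (LINT y:{c..e}|lborel. f y))" using p by (auto simp: E_def)
      have "(LINT y:{c..e}|lborel. f y) < (f x + \<epsilon>) * (e - c)"
        if "c \<le> x" "x \<le> e" "c < e" "e - c < d" for c e
      proof -
        have "(LINT y:{c..e}|lborel. f y) < of_rat q * (e - c)" using d that by fastforce
        also have "\<dots> < (f x + \<epsilon>) * (e - c)" using q that by (simp add: mult_strict_right_mono)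
        finally show ?thesis .
      qed
      then show "\<exists>d>0. \<forall>c e. c \<le> x \<longrightarrow> x \<le> e \<longrightarrow> c < e \<longrightarrow> e - c < d \<longrightarrow>
            (LINT y:{c..e}|lborel. f y) < (f x + \<epsilon>) * (e - c)" using d(1) by blast
    qed
  qed
qed

text \<open>The upper bounds for f and for -f squeeze the difference quotients. Since they hold for
  all short intervals that contain x, increments of both signs are covered at once.\<close>

theorem AE_has_real_derivative_integral:
  fixes f F :: "real \<Rightarrow> real"
  assumes f: "integrable lborel f" and fm[measurable]: "f \<in> borel_measurable borel"
    and F: "\<And>c e. c \<in> I \<Longrightarrow> e \<in> I \<Longrightarrow> c \<le> e \<Longrightarrow> F e - F c = (LINT y:{c..e}|lborel. f y)"
    and "open I"
  shows "AE x in lborel. x \<in> I \<longrightarrow> (F has_real_derivative f x) (at x)"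
proof -
  have "AE x in lborel. \<forall>\<epsilon>>0. \<exists>d>0. \<forall>c e. c \<le> x \<longrightarrow> x \<le> e \<longrightarrow> c < e \<longrightarrow> e - c < d \<longrightarrow>
            (LINT y:{c..e}|lborel. - f y) < (- f x + \<epsilon>) * (e - c)"
    by (rule AE_averages_less) (use f in auto)
  with AE_averages_less[OF f fm] show ?thesis
  proof (eventually_elim, intro impI)
    fix x
    assume up: "\<forall>\<epsilon>>0. \<exists>d>0. \<forall>c e. c \<le> x \<longrightarrow> x \<le> e \<longrightarrow> c < e \<longrightarrow> e - c < d \<longrightarrow>
            (LINT y:{c..e}|lborel. f y) < (f x + \<epsilon>) * (e - c)"
      and lo: "\<forall>\<epsilon>>0. \<exists>d>0. \<forall>c e. c \<le> x \<longrightarrow> x \<le> e \<longrightarrow> c < e \<longrightarrow> e - c < d \<longrightarrow>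
            (LINT y:{c..e}|lborel. - f y) < (- f x + \<epsilon>) * (e - c)"
      and xI: "x \<in> I"
    obtain r where r: "r > 0" "ball x r \<subseteq> I" using xI \<open>open I\<close> open_contains_ball by blast
    show "(F has_real_derivative f x) (at x)"
      unfolding has_field_derivative_iff LIM_eq
    proof (intro allI impI)
      fix \<epsilon> :: real assume "\<epsilon> > 0"
      obtain d1 where d1: "d1 > 0" "\<And>c e. c \<le> x \<Longrightarrow> x \<le> e \<Longrightarrow> c < e \<Longrightarrow> e - c < d1 \<Longrightarrow>
            (LINT y:{c..e}|lborel. f y) < (f x + \<epsilon>) * (e - c)" using up \<open>\<epsilon> > 0\<close> by metis
      obtain d2 where d2: "d2 > 0" "\<And>c e. c \<le> x \<Longrightarrow> x \<le> e \<Longrightarrow> c < e \<Longrightarrow> e - c < d2 \<Longrightarrow>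
            (LINT y:{c..e}|lborel. - f y) < (- f x + \<epsilon>) * (e - c)" using lo \<open>\<epsilon> > 0\<close> by metis
      show "\<exists>s>0. \<forall>y. y \<noteq> x \<and> norm (y - x) < s \<longrightarrow> norm ((F y - F x) / (y - x) - f x) < \<epsilon>"
      proof (intro exI[of _ "min r (min d1 d2)"] conjI allI impI)
        show "0 < min r (min d1 d2)" using d1 d2 r by simp
        fix y assume y: "y \<noteq> x \<and> norm (y - x) < min r (min d1 d2)"
        define c e where "c = min x y" and "e = max x y"
        have ce: "c \<le> x" "x \<le> e" "c < e" "e - c < d1" "e - c < d2" using y by (auto simp: c_def e_def min_def max_def split: if_splits)
        have yI: "y \<in> I" using y r by (auto simp: dist_real_def subset_iff)
        have "F e - F c = (LINT y:{c..e}|lborel. f y)" by (rule F) (use xI yI ce in \<open>auto simp: c_def e_def min_def max_def\<close>)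
        moreover have "(LINT y:{c..e}|lborel. - f y) = - (LINT y:{c..e}|lborel. f y)"
          by (simp add: set_lebesgue_integral_def)
        ultimately have "F e - F c < (f x + \<epsilon>) * (e - c)" "- (F e - F c) < (- f x + \<epsilon>) * (e - c)"
          using d1(2)[OF ce(1-4)] d2(2)[OF ce(1-3,5)] by auto
        then have "\<bar>(F e - F c) / (e - c) - f x\<bar> < \<epsilon>"
          using ce by (auto simp: field_simps abs_less_iff)
        moreover have "(F e - F c) / (e - c) = (F y - F x) / (y - x)"
          by (auto simp: c_def e_def min_def max_def) (metis minus_diff_eq minus_divide_divide)
        ultimately show "norm ((F y - F x) / (y - x) - f x) < \<epsilon>" by simp
      qed
    qed
  qed
qed

section \<open>Absolutely continuous monotone functions as indefinite integrals\<close>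

lemma abs_cont_onE:
  assumes "abs_cont_on a b g" "\<epsilon> > 0"
  obtains \<delta> where "\<delta> > 0"
   "\<And>(n::nat) I. (\<forall>i<n. a \<le> fst (I i) \<and> fst (I i) \<le> snd (I i) \<and> snd (I i) \<le> b) \<Longrightarrow>
     (\<forall>i<n. \<forall>j<n. i \<noteq> j \<longrightarrow> snd (I i) \<le> fst (I j) \<or> snd (I j) \<le> fst (I i)) \<Longrightarrow>
     (\<Sum>i<n. snd (I i) - fst (I i)) < \<delta> \<Longrightarrow> (\<Sum>i<n. \<bar>g (snd (I i)) - g (fst (I i))\<bar>) < \<epsilon>"
proof -
  from assms obtain \<delta> where "\<delta> > 0"
    "\<forall>(n::nat) I. (\<forall>i<n. a \<le> fst (I i) \<and> fst (I i) \<le> snd (I i) \<and> snd (I i) \<le> b) \<and>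
     (\<forall>i<n. \<forall>j<n. i \<noteq> j \<longrightarrow> snd (I i) \<le> fst (I j) \<or> snd (I j) \<le> fst (I i)) \<and>
     (\<Sum>i<n. snd (I i) - fst (I i)) < \<delta> \<longrightarrow> (\<Sum>i<n. \<bar>g (snd (I i)) - g (fst (I i))\<bar>) < \<epsilon>"
    unfolding abs_cont_on_def by blast
  then show thesis by (intro that[of \<delta>]) blast+
qed

text \<open>Clamping is monotone and 1-Lipschitz, so it carries non-overlapping intervals to
  non-overlapping intervals of no larger total length. It provides a function on the whole line,
  from which an interval measure can be built.\<close>

lemma abs_cont_on_clamp:
  assumes ac: "abs_cont_on a b g" and ab: "a \<le> b"
  shows "abs_cont_on c d (\<lambda>x. g (max a (min b x)))"
  unfolding abs_cont_on_def
proof (intro allI impI)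
  fix \<epsilon> :: real assume "\<epsilon> > 0"
  note \<epsilon> = this
  obtain \<delta> where \<delta>: "\<delta> > 0"
   "\<And>(n::nat) I. (\<forall>i<n. a \<le> fst (I i) \<and> fst (I i) \<le> snd (I i) \<and> snd (I i) \<le> b) \<Longrightarrow>
     (\<forall>i<n. \<forall>j<n. i \<noteq> j \<longrightarrow> snd (I i) \<le> fst (I j) \<or> snd (I j) \<le> fst (I i)) \<Longrightarrow>
     (\<Sum>i<n. snd (I i) - fst (I i)) < \<delta> \<Longrightarrow> (\<Sum>i<n. \<bar>g (snd (I i)) - g (fst (I i))\<bar>) < \<epsilon>"
    using abs_cont_onE[OF ac \<epsilon>] by blast
  define k where "k x = max a (min b x)" for x
  have k: "a \<le> k x" "k x \<le> b" "x \<le> y \<Longrightarrow> k x \<le> k y" "x \<le> y \<Longrightarrow> k y - k x \<le> y - x" for x y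
    using ab by (auto simp: k_def)
  show "\<exists>\<delta>>0. \<forall>(n::nat) I. (\<forall>i<n. c \<le> fst (I i) \<and> fst (I i) \<le> snd (I i) \<and> snd (I i) \<le> d) \<and>
       (\<forall>i<n. \<forall>j<n. i \<noteq> j \<longrightarrow> snd (I i) \<le> fst (I j) \<or> snd (I j) \<le> fst (I i)) \<and>
       (\<Sum>i<n. snd (I i) - fst (I i)) < \<delta> \<longrightarrow>
       (\<Sum>i<n. \<bar>g (max a (min b (snd (I i)))) - g (max a (min b (fst (I i))))\<bar>) < \<epsilon>"
  proof (intro exI[of _ \<delta>] conjI allI impI \<delta>(1))
    fix n :: nat and I :: "nat \<Rightarrow> real \<times> real"
    assume I: "(\<forall>i<n. c \<le> fst (I i) \<and> fst (I i) \<le> snd (I i) \<and> snd (I i) \<le> d) \<and>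
       (\<forall>i<n. \<forall>j<n. i \<noteq> j \<longrightarrow> snd (I i) \<le> fst (I j) \<or> snd (I j) \<le> fst (I i)) \<and>
       (\<Sum>i<n. snd (I i) - fst (I i)) < \<delta>"
    have "(\<Sum>i<n. k (snd (I i)) - k (fst (I i))) \<le> (\<Sum>i<n. snd (I i) - fst (I i))"
      by (rule sum_mono) (use I k(4) in auto)
    then have s: "(\<Sum>i<n. k (snd (I i)) - k (fst (I i))) < \<delta>" using I by linarith
    have 1: "\<forall>i<n. a \<le> k (fst (I i)) \<and> k (fst (I i)) \<le> k (snd (I i)) \<and> k (snd (I i)) \<le> b"
      using I k(1,2) by (auto intro: k(3))
    have 2: "\<forall>i<n. \<forall>j<n. i \<noteq> j \<longrightarrow> k (snd (I i)) \<le> k (fst (I j)) \<or> k (snd (I j)) \<le> k (fst (I i))"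
      using I k(3) by blast
    have "(\<Sum>i<n. \<bar>g (snd (k (fst (I i)), k (snd (I i)))) - g (fst (k (fst (I i)), k (snd (I i))))\<bar>) < \<epsilon>"
      by (rule \<delta>(2)) (use 1 2 s in simp_all)
    then show "(\<Sum>i<n. \<bar>g (max a (min b (snd (I i)))) - g (max a (min b (fst (I i))))\<bar>) < \<epsilon>"
      by (simp add: k_def)
  qed
qed

lemma abs_cont_on_imp_continuous_on:
  assumes "abs_cont_on a b g"
  shows "continuous_on {a..b} g"
  unfolding continuous_on_iff
proof (intro ballI allI impI)
  fix x \<epsilon> :: real assume x: "x \<in> {a..b}" and "\<epsilon> > 0"
  note \<epsilon> = this
  obtain \<delta> where \<delta>: "\<delta> > 0"
   "\<And>(n::nat) I. (\<forall>i<n. a \<le> fst (I i) \<and> fst (I i) \<le> snd (I i) \<and> snd (I i) \<le> b) \<Longrightarrow>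
     (\<forall>i<n. \<forall>j<n. i \<noteq> j \<longrightarrow> snd (I i) \<le> fst (I j) \<or> snd (I j) \<le> fst (I i)) \<Longrightarrow>
     (\<Sum>i<n. snd (I i) - fst (I i)) < \<delta> \<Longrightarrow> (\<Sum>i<n. \<bar>g (snd (I i)) - g (fst (I i))\<bar>) < \<epsilon>"
    using abs_cont_onE[OF assms \<open>\<epsilon> > 0\<close>] by blast
  show "\<exists>d>0. \<forall>x'\<in>{a..b}. dist x' x < d \<longrightarrow> dist (g x') (g x) < \<epsilon>"
  proof (intro exI[of _ \<delta>] conjI ballI impI \<delta>(1))
    fix y assume y: "y \<in> {a..b}" "dist y x < \<delta>"
    have *: "\<bar>g q - g p\<bar> < \<epsilon>" if "a \<le> p" "p \<le> q" "q \<le> b" "q - p < \<delta>" for p q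
      using \<delta>(2)[of "Suc 0" "\<lambda>_. (p, q)"] that by simp
    show "dist (g y) (g x) < \<epsilon>"
    proof (cases "x \<le> y")
      case True then show ?thesis using *[of x y] x y by (simp add: dist_real_def)
    next
      case False then show ?thesis using *[of y x] x y by (simp add: dist_real_def abs_minus_commute)
    qed
  qed
qed

text \<open>The interval measure of the clamped function -g is absolutely continuous with respect to
  Lebesgue measure, so Radon-Nikodym supplies the density.\<close>

lemma antimono_abs_cont_density:
  fixes g :: "real \<Rightarrow> real"
  assumes ab: "a \<le> b" and anti: "\<And>x y. a \<le> x \<Longrightarrow> x \<le> y \<Longrightarrow> y \<le> b \<Longrightarrow> g y \<le> g x"
    and ac: "abs_cont_on a b g"
  obtains f where "f \<in> borel_measurable borel" "integrable lborel f" "\<And>x. 0 \<le> f x"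
    "\<And>x y. a \<le> x \<Longrightarrow> x \<le> y \<Longrightarrow> y \<le> b \<Longrightarrow> (LINT z:{x..y}|lborel. f z) = g x - g y"
proof -
  define G where "G x = - g (max a (min b x))" for x
  have G_eq: "G x = - g x" if "a \<le> x" "x \<le> b" for x using that by (simp add: G_def)
  have G_mono: "G x \<le> G y" if "x \<le> y" for x y
    unfolding G_def using that ab by (simp add: anti min_def max_def)
  have "continuous_on UNIV (\<lambda>x. - g (max a (min b x)))"
    by (intro continuous_on_minus continuous_on_compose2[OF abs_cont_on_imp_continuous_on[OF ac]] continuous_intros)
       (use ab in auto)
  then have G_cont: "continuous_on UNIV G" by (simp add: G_def[abs_def])
  define N where "N = interval_measure G"
  have sN[measurable_cong]: "sets N = sets borel" by (simp add: N_def)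
  have N_Icc: "emeasure N {u..v} = ennreal (G v - G u)" if "u \<le> v" for u v
    unfolding N_def by (rule emeasure_interval_measure_Icc[OF that G_mono G_cont])
  \<comment> \<open>A null set is enclosed in an open U of measure below \<delta>. The definition of
    absolute continuity asks for non-overlapping intervals; the covering lemma for gauges provides
    them inside U, and every finite part of the family then has measure at most \<epsilon>.\<close>
  have small: "emeasure N (Z \<inter> cbox (-real n) (real n)) = 0" if Z: "Z \<in> null_sets lborel" and n: "n > 0" for Z n
  proof -
    have "emeasure N (Z \<inter> cbox (-real n) (real n)) \<le> 0 + ennreal \<epsilon>" if eps: "\<epsilon> > 0" for \<epsilon>
    proof -
      obtain \<delta> where \<delta>: "\<delta> > 0" "\<And>(k::nat) I. (\<forall>i<k. -real n \<le> fst (I i) \<and> fst (I i) \<le> snd (I i) \<and> snd (I i) \<le> real n) \<Longrightarrow>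
         (\<forall>i<k. \<forall>j<k. i \<noteq> j \<longrightarrow> snd (I i) \<le> fst (I j) \<or> snd (I j) \<le> fst (I i)) \<Longrightarrow>
         (\<Sum>i<k. snd (I i) - fst (I i)) < \<delta> \<Longrightarrow>
         (\<Sum>i<k. \<bar>g (max a (min b (snd (I i)))) - g (max a (min b (fst (I i))))\<bar>) < \<epsilon>"
        using abs_cont_onE[OF abs_cont_on_clamp[OF ac ab] eps] by blast
      have [measurable]: "Z \<in> sets borel" using Z by auto
      have "Z \<in> sets lebesgue" using Z by (auto simp: null_sets_def)
      then obtain U where U: "open U" "Z \<subseteq> U" "emeasure lebesgue (U - Z) < ennreal \<delta>"
        using sets_lebesgue_outer_open[OF _ \<delta>(1), of Z] by metis
      have [measurable]: "U \<in> sets borel" using U by auto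
      have "emeasure lborel U \<le> emeasure lborel (Z \<union> (U - Z))" by (rule emeasure_mono) auto
      also have "\<dots> \<le> emeasure lborel Z + emeasure lborel (U - Z)" by (rule emeasure_subadditive) auto
      also have "\<dots> = emeasure lborel (U - Z)" using Z by (auto simp: null_sets_def)
      also have "\<dots> < ennreal \<delta>" using U by simp
      finally have mU: "emeasure lborel U < ennreal \<delta>" .
      have "\<exists>e>0. ball x e \<subseteq> U" if "x \<in> U" for x using that U open_contains_ball by blast
      then obtain r where r: "\<And>x. x \<in> U \<Longrightarrow> r x > 0" "\<And>x. x \<in> U \<Longrightarrow> ball x (r x) \<subseteq> U" by metis
      \<comment> \<open>This gauge forces every interval of the covering that is tagged by a point
        of U to lie in U.\<close>
      define \<gamma> where "\<gamma> x = (if x \<in> U then ball x (r x) else ball x 1)" for x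
      have \<gamma>: "gauge \<gamma>" using r(1) by (auto simp: gauge_def \<gamma>_def)
      obtain D where D: "countable D" "\<Union>D \<subseteq> cbox (-real n) (real n)"
        "\<And>K. K \<in> D \<Longrightarrow> interior K \<noteq> {} \<and> (\<exists>c d. K = cbox c d)"
        "pairwise (\<lambda>A B. interior A \<inter> interior B = {}) D"
        "\<And>K. K \<in> D \<Longrightarrow> \<exists>x \<in> (Z \<inter> cbox (-real n) (real n)) \<inter> K. K \<subseteq> \<gamma> x"
        "Z \<inter> cbox (-real n) (real n) \<subseteq> \<Union>D"
        by (rule covering_lemma[of "Z \<inter> cbox (-real n) (real n)" "-real n" "real n" \<gamma>]) (use n \<gamma> in auto)
      define P where "P m \<longleftrightarrow> m \<in> to_nat_on D ` D" for m
      define J where "J m = (if P m then from_nat_into D m else {})" for m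
      \<comment> \<open>Indices that enumerate nothing get a degenerate interval at -n: it has
        length and increment 0 and overlaps no other interval, so initial segments of the
        enumeration are admissible families.\<close>
      define I where "I m = (if P m then (Inf (J m), Sup (J m)) else (-real n, -real n))" for m
      have JD: "J m \<in> D" if "P m" for m
        using that D(1) by (auto simp: J_def P_def from_nat_into_to_nat_on)
      have J_inj: "J m \<noteq> J m'" if "P m" "P m'" "m \<noteq> m'" for m m'
        using that D(1) by (auto simp: J_def P_def)
      have JI: "J m = {fst (I m)..snd (I m)} \<and> fst (I m) < snd (I m) \<and> -real n \<le> fst (I m) \<and> snd (I m) \<le> real n" if P: "P m" for m
      proof -
        obtain c d where cd: "J m = {c..d}" "c < d" using D(3)[OF JD[OF P]] by auto
        have "J m \<subseteq> cbox (-real n) (real n)" using D(2) JD[OF P] by blast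
        then have "{c..d} \<subseteq> {-real n..real n}" using cd by simp
        then show ?thesis using cd P by (auto simp: I_def)
      qed
      have JU: "J m \<subseteq> U" if P: "P m" for m
      proof -
        obtain x where "x \<in> Z" "J m \<subseteq> \<gamma> x" using D(5)[OF JD[OF P]] by auto
        then have "x \<in> U" using U(2) by blast
        then show ?thesis using \<open>J m \<subseteq> \<gamma> x\<close> r(2)[of x] by (auto simp: \<gamma>_def)
      qed
      have disj: "{fst (I i)<..<snd (I i)} \<inter> {fst (I j)<..<snd (I j)} = {}" if "i \<noteq> j" for i j
      proof (cases "P i \<and> P j")
        case True
        then have *: "interior (J i) \<inter> interior (J j) = {}"
          using pairwiseD[OF D(4), of "J i" "J j"] JD[of i] JD[of j] J_inj[of i j] that by simp
        have "J i = {fst (I i)..snd (I i)}" "J j = {fst (I j)..snd (I j)}" using JI True by auto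
        then have "interior (J i) = {fst (I i)<..<snd (I i)}" "interior (J j) = {fst (I j)<..<snd (I j)}"
          by (simp_all only: interior_atLeastAtMost_real)
        then show ?thesis using * by simp
      qed (auto simp: I_def)
      have I1: "-real n \<le> fst (I i) \<and> fst (I i) \<le> snd (I i) \<and> snd (I i) \<le> real n" for i
        using JI[of i] by (cases "P i") (auto simp: I_def)
      have I2: "snd (I i) \<le> fst (I j) \<or> snd (I j) \<le> fst (I i)" if "i \<noteq> j" for i j
      proof (cases "P i \<and> P j")
        case True
        show ?thesis
        proof (rule ccontr)
          assume "\<not> ?thesis"
          then have "max (fst (I i)) (fst (I j)) < min (snd (I i)) (snd (I j))" using JI[of i] JI[of j] True by auto
          then obtain z where "max (fst (I i)) (fst (I j)) < z" "z < min (snd (I i)) (snd (I j))" using dense by blast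
          then have "z \<in> {fst (I i)<..<snd (I i)} \<inter> {fst (I j)<..<snd (I j)}" by auto
          then show False using disj[OF that] by blast
        qed
      next
        case False then show ?thesis using I1[of i] I1[of j] by (auto simp: I_def)
      qed
      have part: "(\<Sum>m<k. emeasure N (J m)) \<le> ennreal \<epsilon>" for k
      proof -
        have "(\<Sum>i<k. snd (I i) - fst (I i)) < \<delta>"
        proof -
          have "ennreal (\<Sum>i<k. snd (I i) - fst (I i)) = (\<Sum>i<k. emeasure lborel {fst (I i)<..<snd (I i)})"
            using I1 by (simp add: sum_ennreal)
          also have "\<dots> = emeasure lborel (\<Union>i<k. {fst (I i)<..<snd (I i)})"
            by (rule sum_emeasure) (use disj in \<open>auto simp: disjoint_family_on_def\<close>)
          also have "\<dots> \<le> emeasure lborel U"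
          proof (rule emeasure_mono)
            show "(\<Union>i<k. {fst (I i)<..<snd (I i)}) \<subseteq> U"
            proof (rule UN_least)
              fix i show "{fst (I i)<..<snd (I i)} \<subseteq> U"
                using JI[of i] JU[of i] by (cases "P i") (auto simp: I_def)
            qed
          qed simp
          also note mU
          finally show ?thesis by (rule ennreal_less_iff[THEN iffD1, rotated]) (use I1 in \<open>auto intro!: sum_nonneg\<close>)
        qed
        then have *: "(\<Sum>i<k. \<bar>g (max a (min b (snd (I i)))) - g (max a (min b (fst (I i))))\<bar>) < \<epsilon>"
          by (intro \<delta>(2)) (use I1 I2 in auto)
        have "emeasure N (J m) = ennreal (G (snd (I m)) - G (fst (I m)))" for m
          using JI[of m] N_Icc[of "fst (I m)" "snd (I m)"] by (cases "P m") (auto simp: J_def I_def)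
        then have "(\<Sum>m<k. emeasure N (J m)) = ennreal (\<Sum>m<k. G (snd (I m)) - G (fst (I m)))"
          using I1 G_mono by (simp add: sum_ennreal)
        also have "(\<Sum>m<k. G (snd (I m)) - G (fst (I m))) \<le> (\<Sum>i<k. \<bar>g (max a (min b (snd (I i)))) - g (max a (min b (fst (I i))))\<bar>)"
          by (rule sum_mono) (simp add: G_def)
        finally show ?thesis using * by (meson ennreal_leI less_imp_le order_trans)
      qed
      have Jm[measurable]: "J m \<in> sets borel" for m using JI[of m] by (cases "P m") (auto simp: J_def)
      have "\<Union>D \<subseteq> (\<Union>m. J m)"
      proof
        fix x assume "x \<in> \<Union>D"
        then obtain K where K: "K \<in> D" "x \<in> K" by blast
        then have "J (to_nat_on D K) = K" using D(1) by (simp add: J_def P_def)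
        then show "x \<in> (\<Union>m. J m)" using K(2) by (intro UN_I[of "to_nat_on D K"]) auto
      qed
      then have "emeasure N (Z \<inter> cbox (-real n) (real n)) \<le> emeasure N (\<Union>m. J m)"
        using D(6) by (intro emeasure_mono) auto
      also have "\<dots> \<le> (\<Sum>m. emeasure N (J m))" by (rule emeasure_subadditive_countably) (auto simp: sN)
      also have "\<dots> \<le> ennreal \<epsilon>" by (rule suminf_le_const) (use part in auto)
      finally show ?thesis by simp
    qed
    then have "emeasure N (Z \<inter> cbox (-real n) (real n)) \<le> 0" by (rule ennreal_le_epsilon)
    then show ?thesis by simp
  qed
  have "absolutely_continuous lborel N"
    unfolding absolutely_continuous_def
  proof
    fix Z :: "real set" assume Z: "Z \<in> null_sets lborel"
    then have [measurable]: "Z \<in> sets borel" by auto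
    have "(\<Union>n::nat. Z \<inter> cbox (-real (Suc n)) (real (Suc n))) \<in> null_sets N"
    proof (rule null_sets_UN)
      fix n :: nat show "Z \<inter> cbox (-real (Suc n)) (real (Suc n)) \<in> null_sets N"
        by (intro null_setsI small Z) (simp_all add: sN)
    qed
    moreover have "(\<Union>n. Z \<inter> cbox (-real (Suc n)) (real (Suc n))) = Z"
    proof -
      have "\<exists>n. x \<in> cbox (-real (Suc n)) (real (Suc n))" for x
      proof -
        obtain n where "\<bar>x\<bar> < real n" using reals_Archimedean2 by blast
        then show ?thesis by (intro exI[of _ n]) auto
      qed
      then show ?thesis by blast
    qed
    ultimately show "Z \<in> null_sets N" by simp
  qed
  then obtain h where h[measurable]: "h \<in> borel_measurable borel" and hN: "density lborel h = N"
    using sigma_finite_measure.Radon_Nikodym[OF sigma_finite_lborel, of N] by (auto simp: sN)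
  have h_Icc: "(\<integral>\<^sup>+ z\<in>{x..y}. h z \<partial>lborel) = ennreal (G y - G x)" if "x \<le> y" for x y
    using N_Icc[OF that] emeasure_density[of h lborel "{x..y}"] by (simp add: hN)
  \<comment> \<open>The Radon-Nikodym density may be infinite; on {a..b} its integral is finite, so
    it is finite a.e. there and \<open>enn2real\<close> loses nothing.\<close>
  define f where "f x = indicator {a..b} x * enn2real (h x)" for x
  have f[measurable]: "f \<in> borel_measurable borel" by (simp add: f_def[abs_def])
  have fin: "AE x in lborel. x \<in> {a..b} \<longrightarrow> h x < \<infinity>"
  proof -
    have "AE x in lborel. h x * indicator {a..b} x \<noteq> \<infinity>"
      by (rule nn_integral_PInf_AE) (use h_Icc[OF ab] in auto)
    then show ?thesis by eventually_elim (auto simp: less_top)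
  qed
  have nnf: "(\<integral>\<^sup>+ z. ennreal (indicator {x..y} z * f z) \<partial>lborel) = ennreal (g x - g y)" if "a \<le> x" "x \<le> y" "y \<le> b" for x y
  proof -
    have "(\<integral>\<^sup>+ z. ennreal (indicator {x..y} z * f z) \<partial>lborel) = (\<integral>\<^sup>+ z\<in>{x..y}. h z \<partial>lborel)"
      by (rule nn_integral_cong_AE, use fin in eventually_elim) (use that in \<open>auto simp: f_def indicator_def\<close>)
    then show ?thesis using h_Icc[of x y] that by (simp add: G_eq)
  qed
  have f0: "0 \<le> f x" for x by (simp add: f_def)
  have "integrable lborel (\<lambda>z. indicator {a..b} z * f z)"
    by (rule integrableI_nonneg) (use nnf[of a b] ab f0 in auto)
  moreover have "(\<lambda>z. indicator {a..b} z * f z) = f" by (auto simp: f_def fun_eq_iff indicator_def)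
  ultimately have "integrable lborel f" by simp
  moreover have "(LINT z:{x..y}|lborel. f z) = g x - g y" if "a \<le> x" "x \<le> y" "y \<le> b" for x y
    unfolding set_lebesgue_integral_def
    by (subst integral_eq_nn_integral) (use nnf[of x y] that f0 anti[of x y] in auto)
  ultimately show thesis using that f f0 by blast
qed

text \<open>The points of differentiability are those where the difference quotients satisfy a
  Cauchy condition, which is Borel. There the derivative is a limit along 1/(n+1); elsewhere
  \<open>deriv\<close>, being defined by choice, takes one and the same value.\<close>

lemma deriv_borel_measurable:
  fixes g :: "real \<Rightarrow> real"
  assumes g: "continuous_on UNIV g"
  shows "deriv g \<in> borel_measurable borel"
proof -
  have [measurable]: "g \<in> borel_measurable borel" using g by (rule borel_measurable_continuous_onI)
  have inv0: "(\<lambda>n. 1 / real (Suc n)) \<longlonglongrightarrow> 0" by (rule LIMSEQ_Suc[OF lim_1_over_n])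
  define q where "q x h = (g (x + h) - g x) / h" for x h
  have qc: "continuous (at h) (q x)" if "h \<noteq> 0" for x h
  proof -
    have "continuous (at h) (\<lambda>h. g (x + h))"
      by (rule continuous_within_compose2[where g=g]) (use g in \<open>auto simp: continuous_on_eq_continuous_at\<close>)
    then show ?thesis using that unfolding q_def by (intro continuous_intros) auto
  qed
  \<comment> \<open>Only rational increments occur, so the condition is a countable combination of
    Borel ones. Continuity of the quotient in a nonzero increment extends it to real increments
    (\<open>real\<close> below).\<close>
  define C where "C x \<longleftrightarrow> (\<forall>k::nat. \<exists>m::nat. \<forall>p r::rat. 0 < \<bar>p\<bar> \<and> \<bar>p\<bar> < 1/of_nat (Suc m) \<and> 0 < \<bar>r\<bar> \<and> \<bar>r\<bar> < 1/of_nat (Suc m) \<longrightarrow>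
     \<bar>q x (of_rat p) - q x (of_rat r)\<bar> \<le> 1 / real (Suc k))" for x
  have Cm: "Measurable.pred borel C" unfolding C_def q_def by measurable
  have C1: "C x" if D: "(g has_real_derivative L) (at x)" for x L
    unfolding C_def
  proof
    fix k :: nat
    have "(q x \<longlongrightarrow> L) (at 0)" using D by (simp add: DERIV_def q_def[abs_def])
    then obtain d where d: "d > 0" "\<And>h. h \<noteq> 0 \<Longrightarrow> \<bar>h\<bar> < d \<Longrightarrow> \<bar>q x h - L\<bar> < 1 / (2 * real (Suc k))"
      using LIM_D[of "q x" L 0 "1 / (2 * real (Suc k))"] by auto
    obtain m where m: "1 / real (Suc m) < d" using nat_approx_posE[OF d(1)] by auto
    show "\<exists>m::nat. \<forall>p r::rat. 0 < \<bar>p\<bar> \<and> \<bar>p\<bar> < 1/of_nat (Suc m) \<and> 0 < \<bar>r\<bar> \<and> \<bar>r\<bar> < 1/of_nat (Suc m) \<longrightarrow>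
     \<bar>q x (of_rat p) - q x (of_rat r)\<bar> \<le> 1 / real (Suc k)"
    proof (intro exI[of _ m] allI impI)
      fix p r :: rat
      assume pr: "0 < \<bar>p\<bar> \<and> \<bar>p\<bar> < 1/of_nat (Suc m) \<and> 0 < \<bar>r\<bar> \<and> \<bar>r\<bar> < 1/of_nat (Suc m)"
      have conv: "\<bar>of_rat s :: real\<bar> < d" if "\<bar>s\<bar> < 1/of_nat (Suc m)" for s :: rat
      proof -
        have "(of_rat \<bar>s\<bar> :: real) < of_rat (1/of_nat (Suc m))" using that by (simp only: of_rat_less)
        also have "\<dots> = 1 / real (Suc m)" by (simp add: of_rat_divide of_rat_add)
        finally show ?thesis using m by simp
      qed
      define e where "e = 1 / real (Suc k)"
      have h: "1 / (2 * real (Suc k)) = e / 2" by (simp add: e_def)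
      have "\<bar>q x (of_rat p) - L\<bar> < e / 2" "\<bar>q x (of_rat r) - L\<bar> < e / 2"
        unfolding h[symmetric] using d(2)[of "of_rat p"] d(2)[of "of_rat r"] conv pr by auto
      then have "\<bar>q x (of_rat p) - q x (of_rat r)\<bar> \<le> e" by linarith
      then show "\<bar>q x (of_rat p) - q x (of_rat r)\<bar> \<le> 1 / real (Suc k)" by (simp add: e_def)
    qed
  qed
  have C2: "\<exists>L. (g has_real_derivative L) (at x)" if "C x" for x
  proof -
    have real: "\<exists>d>0. \<forall>h h'. h \<noteq> 0 \<and> \<bar>h\<bar> < d \<and> h' \<noteq> 0 \<and> \<bar>h'\<bar> < d \<longrightarrow> \<bar>q x h - q x h'\<bar> \<le> e" if "e > 0" for e
    proof -
      obtain k where k: "1 / real (Suc k) < e" using nat_approx_posE[OF \<open>e > 0\<close>] by auto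
      obtain m where m: "\<And>p r::rat. 0 < \<bar>p\<bar> \<Longrightarrow> \<bar>p\<bar> < 1/of_nat (Suc m) \<Longrightarrow> 0 < \<bar>r\<bar> \<Longrightarrow> \<bar>r\<bar> < 1/of_nat (Suc m) \<Longrightarrow>
         \<bar>q x (of_rat p) - q x (of_rat r)\<bar> \<le> 1 / real (Suc k)" using \<open>C x\<close> unfolding C_def by meson
      define d where "d = 1 / real (Suc m)"
      have approx: "\<exists>s. (\<lambda>n. of_rat (s n) :: real) \<longlonglongrightarrow> h \<and> (\<forall>n. 0 < \<bar>s n\<bar> \<and> \<bar>s n\<bar> < 1/of_nat (Suc m))"
        if h: "h \<noteq> 0" "\<bar>h\<bar> < d" for h :: real
      proof -
        define e0 where "e0 = min \<bar>h\<bar> (d - \<bar>h\<bar>)"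
        have e0: "e0 > 0" using h by (simp add: e0_def)
        have "\<exists>s::rat. h < of_rat s \<and> of_rat s < h + e0 / real (Suc n)" for n
          using of_rat_dense[of h "h + e0 / real (Suc n)"] e0 by auto
        then obtain s :: "nat \<Rightarrow> rat" where s: "\<And>n. h < of_rat (s n)" "\<And>n. of_rat (s n) < h + e0 / real (Suc n)" by metis
        have up: "(\<lambda>n. h + e0 * (1 / real (Suc n))) \<longlonglongrightarrow> h"
          using tendsto_add[OF tendsto_const tendsto_mult[OF tendsto_const inv0], of h e0] by simp
        have "(\<lambda>n. of_rat (s n) :: real) \<longlonglongrightarrow> h"
        proof (rule tendsto_sandwich[OF _ _ _ up])
          show "\<forall>\<^sub>F n in sequentially. h \<le> of_rat (s n)" using s(1) by (simp add: less_imp_le)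
          show "\<forall>\<^sub>F n in sequentially. of_rat (s n) \<le> h + e0 * (1 / real (Suc n))"
            using s(2) by (simp add: less_imp_le)
        qed (rule tendsto_const)
        moreover have "0 < \<bar>s n\<bar> \<and> \<bar>s n\<bar> < 1/of_nat (Suc m)" for n
        proof -
          have "e0 / real (Suc n) \<le> e0" using e0 by (simp add: field_simps)
          then have b: "h < of_rat (s n)" "of_rat (s n) < h + e0" using s[of n] by linarith+
          then have "(of_rat (s n) :: real) \<noteq> 0" "\<bar>of_rat (s n) :: real\<bar> < d"
            unfolding e0_def by linarith+
          then have "s n \<noteq> 0" "(of_rat \<bar>s n\<bar> :: real) < of_rat (1/of_nat (Suc m))"
            by (auto simp: d_def of_rat_divide of_rat_add)
          then show ?thesis by (simp only: of_rat_less) simp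
        qed
        ultimately show ?thesis by blast
      qed
      have "\<bar>q x h - q x h'\<bar> \<le> e" if hh: "h \<noteq> 0" "\<bar>h\<bar> < d" "h' \<noteq> 0" "\<bar>h'\<bar> < d" for h h'
      proof -
        obtain s where s: "(\<lambda>n. of_rat (s n) :: real) \<longlonglongrightarrow> h" "\<And>n. 0 < \<bar>s n\<bar> \<and> \<bar>s n\<bar> < 1/of_nat (Suc m)"
          using approx[OF hh(1,2)] by blast
        obtain t where t: "(\<lambda>n. of_rat (t n) :: real) \<longlonglongrightarrow> h'" "\<And>n. 0 < \<bar>t n\<bar> \<and> \<bar>t n\<bar> < 1/of_nat (Suc m)"
          using approx[OF hh(3,4)] by blast
        have "(\<lambda>n. q x (of_rat (s n))) \<longlonglongrightarrow> q x h" "(\<lambda>n. q x (of_rat (t n))) \<longlonglongrightarrow> q x h'"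
          using qc hh s(1) t(1) by (auto intro: isCont_tendsto_compose)
        then have "(\<lambda>n. \<bar>q x (of_rat (s n)) - q x (of_rat (t n))\<bar>) \<longlonglongrightarrow> \<bar>q x h - q x h'\<bar>" by (intro tendsto_intros)
        moreover have "\<bar>q x (of_rat (s n)) - q x (of_rat (t n))\<bar> \<le> e" for n
          using m[of "s n" "t n"] s(2)[of n] t(2)[of n] k by auto
        ultimately show ?thesis by (intro LIMSEQ_le_const2) auto
      qed
      moreover have "d > 0" by (simp add: d_def)
      ultimately show ?thesis by blast
    qed
    have "Cauchy (\<lambda>n. q x (1 / real (Suc n)))"
    proof (rule CauchyI')
      fix e :: real assume "e > 0"
      obtain d where d: "d > 0" "\<And>h h'. h \<noteq> 0 \<Longrightarrow> \<bar>h\<bar> < d \<Longrightarrow> h' \<noteq> 0 \<Longrightarrow> \<bar>h'\<bar> < d \<Longrightarrow> \<bar>q x h - q x h'\<bar> \<le> e/2"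
        using real[of "e/2"] \<open>e > 0\<close> by auto
      obtain M where M: "1 / real (Suc M) < d" using nat_approx_posE[OF d(1)] by auto
      have b: "\<bar>1 / real (Suc n)\<bar> < d" if "n \<ge> M" for n
      proof -
        have "1 / real (Suc n) \<le> 1 / real (Suc M)" using that by (simp add: frac_le)
        then show ?thesis using M by simp
      qed
      show "\<exists>M. \<forall>m\<ge>M. \<forall>n>m. dist (q x (1 / real (Suc m))) (q x (1 / real (Suc n))) < e"
      proof (intro exI[of _ M] allI impI)
        fix m n assume "M \<le> m" "m < n"
        then have "\<bar>q x (1 / real (Suc m)) - q x (1 / real (Suc n))\<bar> \<le> e/2"
          by (intro d(2) b) auto
        then show "dist (q x (1 / real (Suc m))) (q x (1 / real (Suc n))) < e" using \<open>e > 0\<close> by (simp add: dist_real_def)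
      qed
    qed
    then obtain L where L: "(\<lambda>n. q x (1 / real (Suc n))) \<longlonglongrightarrow> L" using Cauchy_convergent convergent_def by blast
    have "(q x \<longlongrightarrow> L) (at 0)"
      unfolding LIM_eq
    proof (intro allI impI)
      fix e :: real assume "e > 0"
      obtain d where d: "d > 0" "\<And>h h'. h \<noteq> 0 \<Longrightarrow> \<bar>h\<bar> < d \<Longrightarrow> h' \<noteq> 0 \<Longrightarrow> \<bar>h'\<bar> < d \<Longrightarrow> \<bar>q x h - q x h'\<bar> \<le> e/2"
        using real[of "e/2"] \<open>e > 0\<close> by auto
      have "\<bar>q x h - L\<bar> \<le> e/2" if h: "h \<noteq> 0" "\<bar>h\<bar> < d" for h
      proof (rule LIMSEQ_le_const2)
        show "(\<lambda>n. \<bar>q x h - q x (1 / real (Suc n))\<bar>) \<longlonglongrightarrow> \<bar>q x h - L\<bar>" by (intro tendsto_intros L)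
        obtain M where M: "1 / real (Suc M) < d" using nat_approx_posE[OF d(1)] by auto
        have "\<bar>q x h - q x (1 / real (Suc n))\<bar> \<le> e/2" if "n \<ge> M" for n
        proof -
          have "1 / real (Suc n) \<le> 1 / real (Suc M)" using that by (simp add: frac_le)
          then show ?thesis using M h by (intro d(2)) auto
        qed
        then show "\<exists>N. \<forall>n\<ge>N. \<bar>q x h - q x (1 / real (Suc n))\<bar> \<le> e/2" by blast
      qed
      then have "\<forall>h. h \<noteq> 0 \<and> norm (h - 0) < d \<longrightarrow> norm (q x h - L) < e" using \<open>e > 0\<close> by fastforce
      then show "\<exists>s>0. \<forall>h. h \<noteq> 0 \<and> norm (h - 0) < s \<longrightarrow> norm (q x h - L) < e" using d(1) by blast
    qed
    then show ?thesis unfolding DERIV_def q_def[abs_def] by blast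
  qed
  have "deriv g x = (if C x then lim (\<lambda>n. q x (1 / real (Suc n))) else (SOME D. False))" for x
  proof (cases "C x")
    case True
    then obtain L where L: "(g has_real_derivative L) (at x)" using C2 by blast
    have "(q x \<longlongrightarrow> L) (at 0)" using L by (simp add: DERIV_def q_def[abs_def])
    moreover have "filterlim (\<lambda>n. 1 / real (Suc n)) (at 0) sequentially"
      by (rule filterlim_atI) (use inv0 in auto)
    ultimately have "(\<lambda>n. q x (1 / real (Suc n))) \<longlonglongrightarrow> L" by (rule filterlim_compose)
    then show ?thesis using True DERIV_imp_deriv[OF L] by (simp add: limI)
  next
    case False
    then have "(\<lambda>D. (g has_real_derivative D) (at x)) = (\<lambda>D. False)" using C1 by auto
    then show ?thesis using False by (simp add: deriv_def)
  qed
  then have "deriv g = (\<lambda>x. if C x then lim (\<lambda>n. q x (1 / real (Suc n))) else (SOME D. False))" by auto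
  moreover have "(\<lambda>x. lim (\<lambda>n. q x (1 / real (Suc n)))) \<in> borel_measurable borel"
    by (rule borel_measurable_lim_metric) (simp add: q_def)
  ultimately show ?thesis using Cm by (auto intro!: measurable_If simp del: of_nat_Suc)
qed

lemma deriv_cong_open:
  assumes "open I" "x \<in> I" "\<And>y. y \<in> I \<Longrightarrow> f y = g y"
  shows "deriv f x = deriv g x"
  by (rule deriv_cong_ev) (use assms eventually_nhds in \<open>auto intro!: eventually_nhds[THEN iffD2]\<close>)

text \<open>The density of the interval measure reproduces the increments of g, and the
  differentiation theorem identifies it a.e. with minus the derivative.\<close>

theorem antimono_abs_cont_FTC:
  fixes g :: "real \<Rightarrow> real"
  assumes ab: "a \<le> b" and anti: "\<And>x y. a \<le> x \<Longrightarrow> x \<le> y \<Longrightarrow> y \<le> b \<Longrightarrow> g y \<le> g x"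
    and ac: "abs_cont_on a b g"
  shows "set_integrable lborel {a<..<b} (deriv g)" "(LINT x:{a<..<b}|lborel. deriv g x) = g b - g a"
    "AE x in lborel. x \<in> {a<..<b} \<longrightarrow> deriv g x \<le> 0"
proof -
  obtain f where f: "f \<in> borel_measurable borel" "integrable lborel f" "\<And>x. 0 \<le> f x"
    "\<And>x y. a \<le> x \<Longrightarrow> x \<le> y \<Longrightarrow> y \<le> b \<Longrightarrow> (LINT z:{x..y}|lborel. f z) = g x - g y"
    by (rule antimono_abs_cont_density[OF ab _ ac]) (use anti in blast)+
  have [measurable]: "f \<in> borel_measurable borel" by fact
  have "AE x in lborel. x \<in> {a<..<b} \<longrightarrow> ((\<lambda>x. - g x) has_real_derivative f x) (at x)"
    by (rule AE_has_real_derivative_integral[OF f(2,1)]) (use f(4) in auto)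
  then have AEd: "AE x in lborel. x \<in> {a<..<b} \<longrightarrow> deriv g x = - f x"
  proof eventually_elim
    case (elim x)
    show ?case
    proof
      assume "x \<in> {a<..<b}"
      then have "((\<lambda>x. - (- g x)) has_real_derivative - f x) (at x)" using elim by (intro DERIV_minus) auto
      then show "deriv g x = - f x" by (simp add: DERIV_imp_deriv)
    qed
  qed
  \<comment> \<open>Measurability of the derivative was shown for functions continuous on the whole
    line; on the open interval, \<open>deriv g\<close> and \<open>deriv G\<close> agree.\<close>
  define G where "G x = g (max a (min b x))" for x
  have "continuous_on UNIV (\<lambda>x. g (max a (min b x)))"
    by (intro continuous_on_compose2[OF abs_cont_on_imp_continuous_on[OF ac]] continuous_intros) (use ab in auto)
  then have [measurable]: "deriv G \<in> borel_measurable borel"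
    by (intro deriv_borel_measurable) (simp add: G_def[abs_def])
  have dG: "deriv g x = deriv G x" if "x \<in> {a<..<b}" for x
    by (rule deriv_cong_open[of "{a<..<b}"]) (use that in \<open>auto simp: G_def\<close>)
  have m[measurable]: "(\<lambda>x. indicator {a<..<b} x *\<^sub>R deriv g x) \<in> borel_measurable borel"
  proof -
    have "(\<lambda>x. indicator {a<..<b} x *\<^sub>R deriv g x) = (\<lambda>x. indicator {a<..<b} x *\<^sub>R deriv G x)"
      using dG by (auto simp: indicator_def)
    then show ?thesis by simp
  qed
  have AE': "AE x in lborel. indicator {a<..<b} x *\<^sub>R deriv g x = indicator {a<..<b} x *\<^sub>R (- f x)"
    using AEd by eventually_elim (auto simp: indicator_def)
  have i: "integrable lborel (\<lambda>x. indicator {a<..<b} x *\<^sub>R (- f x))"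
    by (intro integrable_mult_indicator Bochner_Integration.integrable_minus f) simp
  show "set_integrable lborel {a<..<b} (deriv g)"
    unfolding set_integrable_def by (rule integrable_cong_AE[THEN iffD2, OF _ _ AE' i]) (use m in simp_all)
  have "(LINT x:{a<..<b}|lborel. deriv g x) = (LINT x|lborel. indicator {a<..<b} x *\<^sub>R (- f x))"
    unfolding set_lebesgue_integral_def by (rule integral_cong_AE) (use m AE' in simp_all)
  also have "\<dots> = (LINT x|lborel. - (indicator {a..b} x *\<^sub>R f x))"
  proof (rule integral_cong_AE)
    have "AE x in lborel. x \<noteq> a" "AE x in lborel. x \<noteq> b" by (rule AE_lborel_singleton)+
    then show "AE x in lborel. indicator {a<..<b} x *\<^sub>R (- f x) = - (indicator {a..b} x *\<^sub>R f x)"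
      by eventually_elim (auto simp: indicator_def)
  qed auto
  also have "\<dots> = g b - g a" using f(4)[of a b] ab by (simp add: set_lebesgue_integral_def)
  finally show "(LINT x:{a<..<b}|lborel. deriv g x) = g b - g a" .
  show "AE x in lborel. x \<in> {a<..<b} \<longrightarrow> deriv g x \<le> 0" using AEd by eventually_elim (use f(3) in auto)
qed

section \<open>Test functions\<close>
text \<open>With the extra parameters p and k the family is closed under differentiation, which
  gives smoothness by induction. With p = 1, k = 0 and \<epsilon> tending to 0 the bumps converge to
  the indicator of the open interval.\<close>

definition bump :: "real \<Rightarrow> real \<Rightarrow> real \<Rightarrow> real poly \<Rightarrow> nat \<Rightarrow> real \<Rightarrow> real" where
  "bump a b \<epsilon> p k x = (if a < x \<and> x < b
     then poly p x / ((x - a) * (b - x)) ^ k * exp (- \<epsilon> / ((x - a) * (b - x))) else 0)"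

text \<open>The n-th power of x \<le> exp x at x = \<epsilon> t / n.\<close>

lemma power_exp_bound:
  fixes t \<epsilon> :: real
  assumes "t > 0" "\<epsilon> > 0" "n > 0"
  shows "t ^ n * exp (- \<epsilon> * t) \<le> (real n / \<epsilon>) ^ n"
proof -
  have "\<epsilon> * t / real n \<le> exp (\<epsilon> * t / real n)"
    using exp_ge_add_one_self[of "\<epsilon> * t / real n"] by linarith
  then have "(\<epsilon> * t / real n) ^ n \<le> exp (\<epsilon> * t / real n) ^ n"
    by (rule power_mono) (use assms in auto)
  also have "\<dots> = exp (\<epsilon> * t)" using assms by (simp add: exp_of_nat_mult[symmetric])
  finally have "(t * (\<epsilon> / real n)) ^ n \<le> exp (\<epsilon> * t)" by (simp add: mult.commute)
  then have "t ^ n * (\<epsilon> / real n) ^ n * exp (- \<epsilon> * t) \<le> exp (\<epsilon> * t) * exp (- \<epsilon> * t)"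
    by (simp only: power_mult_distrib) (rule mult_right_mono, simp_all)
  also have "exp (\<epsilon> * t) * exp (- \<epsilon> * t) = 1" by (simp add: exp_add[symmetric])
  finally have "t ^ n * exp (- \<epsilon> * t) * (\<epsilon> / real n) ^ n \<le> 1" by (simp add: mult_ac)
  then show ?thesis using assms by (simp add: power_divide field_simps)
qed

lemma continuous_on_Icc_bounded:
  fixes f :: "real \<Rightarrow> 'b::real_normed_vector"
  assumes "continuous_on {a..b} f"
  shows "\<exists>C\<ge>0. \<forall>x\<in>{a..b}. norm (f x) \<le> C"
proof -
  have "bounded (f ` {a..b})" by (intro compact_imp_bounded compact_continuous_image assms) simp
  then obtain C where "\<forall>y\<in>f ` {a..b}. norm y \<le> C" unfolding bounded_iff by blast
  then have C: "\<And>x. x \<in> {a..b} \<Longrightarrow> norm (f x) \<le> C" by blast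
  have "norm (f x) \<le> \<bar>C\<bar>" if "x \<in> {a..b}" for x using C[OF that] by simp
  then show ?thesis by (intro exI[of _ "\<bar>C\<bar>"]) auto
qed

text \<open>Put q = (y - a)(b - y). The exponential absorbs q^-(k+2) and leaves q^2, while q \<le>
  (b - a)|y - x|, since one end point separates y from x. The bound makes the derivative vanish at
  every x outside the open interval, end points included.\<close>

lemma bump_quadratic_bound:
  assumes ab: "a < b" and e: "\<epsilon> > 0"
  shows "\<exists>C. \<forall>x y. \<not> (a < x \<and> x < b) \<longrightarrow> \<bar>bump a b \<epsilon> p k y\<bar> \<le> C * (y - x)\<^sup>2"
proof -
  have "continuous_on {a..b} (poly p)" by (intro continuous_intros)
  then obtain D where D: "\<And>y. y \<in> {a..b} \<Longrightarrow> \<bar>poly p y\<bar> \<le> D"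
    using continuous_on_Icc_bounded by fastforce
  have D0: "D \<ge> 0" using D[of a] ab by auto
  define E where "E = (real (k + 2) / \<epsilon>) ^ (k + 2)"
  have E0: "E \<ge> 0" using e by (simp add: E_def)
  have "\<bar>bump a b \<epsilon> p k y\<bar> \<le> (D * E * (b - a)\<^sup>2) * (y - x)\<^sup>2" if x: "\<not> (a < x \<and> x < b)" for x y
  proof (cases "a < y \<and> y < b")
    case True
    define q where "q = (y - a) * (b - y)"
    have q: "q > 0" using True by (simp add: q_def)
    have qle: "q \<le> (b - a) * \<bar>y - x\<bar>"
    proof -
      have "y - a \<le> \<bar>y - x\<bar> \<or> b - y \<le> \<bar>y - x\<bar>" using x True by auto
      then show ?thesis
      proof
        assume "y - a \<le> \<bar>y - x\<bar>"
        then have "(y - a) * (b - y) \<le> \<bar>y - x\<bar> * (b - a)" by (intro mult_mono) (use True in auto)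
        then show ?thesis by (simp add: q_def mult.commute)
      next
        assume "b - y \<le> \<bar>y - x\<bar>"
        then have "(y - a) * (b - y) \<le> (b - a) * \<bar>y - x\<bar>" by (intro mult_mono) (use True in auto)
        then show ?thesis by (simp add: q_def)
      qed
    qed
    have "(1 / q) ^ (k + 2) * exp (- \<epsilon> * (1 / q)) \<le> E"
      unfolding E_def by (rule power_exp_bound) (use q e in auto)
    then have "1 / q ^ k * exp (- \<epsilon> / q) * (1 / q\<^sup>2) \<le> E" by (simp add: power_divide power_add power2_eq_square mult_ac)
    then have ex: "1 / q ^ k * exp (- \<epsilon> / q) \<le> E * q\<^sup>2" using q by (simp add: divide_le_eq mult_ac)
    have "\<bar>bump a b \<epsilon> p k y\<bar> = \<bar>poly p y\<bar> * (1 / q ^ k * exp (- \<epsilon> / q))"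
      using True q by (simp add: bump_def q_def abs_mult abs_divide)
    also have "\<dots> \<le> D * (E * q\<^sup>2)"
      by (intro mult_mono ex D) (use True q D0 in auto)
    also have "\<dots> \<le> D * (E * ((b - a) * \<bar>y - x\<bar>)\<^sup>2)"
      by (intro mult_left_mono power_mono qle) (use D0 E0 q in auto)
    finally show ?thesis by (simp add: power_mult_distrib mult_ac)
  next
    case False then show ?thesis using D0 E0 by (auto simp: bump_def)
  qed
  then show ?thesis by blast
qed

lemma DERIV_zero_if_quadratic:
  fixes f :: "real \<Rightarrow> real"
  assumes "\<And>y. \<bar>f y\<bar> \<le> C * (y - x)\<^sup>2"
  shows "(f has_real_derivative 0) (at x)"
proof -
  have fx: "f x = 0" using assms[of x] by simp
  have "((\<lambda>y. (f y - f x) / (y - x)) \<longlongrightarrow> 0) (at x)"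
  proof (rule Lim_null_comparison)
    show "\<forall>\<^sub>F y in at x. norm ((f y - f x) / (y - x)) \<le> C * \<bar>y - x\<bar>"
    proof (rule always_eventually, rule allI)
      fix y show "norm ((f y - f x) / (y - x)) \<le> C * \<bar>y - x\<bar>"
      proof (cases "y = x")
        case False
        have "\<bar>f y\<bar> \<le> C * \<bar>y - x\<bar> * \<bar>y - x\<bar>" using assms[of y] by (simp add: power2_eq_square mult.assoc)
        then show ?thesis using False fx by (simp add: abs_divide divide_le_eq)
      qed simp
    qed
    have "((\<lambda>y. C * \<bar>y - x\<bar>) \<longlongrightarrow> C * \<bar>x - x\<bar>) (at x)" by (intro tendsto_intros)
    then show "((\<lambda>y. C * \<bar>y - x\<bar>) \<longlongrightarrow> 0) (at x)" by simp
  qed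
  then show ?thesis by (simp add: has_field_derivative_iff)
qed

lemma bump_derivative_identity:
  fixes q :: real
  assumes q: "q \<noteq> 0"
  shows "(p1 * q ^ k - p0 * (K * (q1 * (q ^ k / q)))) / (q ^ k * q ^ k) * X
       + X * ((0 * q - - e * q1) / (q * q)) * (p0 / q ^ k)
     = (p1 * q\<^sup>2 - K * p0 * q1 * q + e * (p0 * q1)) / q ^ (k + 2) * X"
proof -
  define W where "W = q ^ k"
  have "W \<noteq> 0" using q by (simp add: W_def)
  then show ?thesis using q by (simp add: W_def[symmetric] power_add field_simps power2_eq_square)
qed

lemma bump_has_derivative:
  assumes ab: "a < b" and e: "\<epsilon> > 0"
  shows "\<exists>p'. \<forall>x. (bump a b \<epsilon> p k has_real_derivative bump a b \<epsilon> p' (k + 2) x) (at x)"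
proof -
  define Q where "Q = [:-a, 1:] * [:b, -1:]"
  \<comment> \<open>Quotient rule for p/Q^k plus the derivative \<epsilon> Q'/Q^2 of the exponent,
    over the common denominator Q^(k+2).\<close>
  define p' where "p' = pderiv p * Q ^ 2 - of_nat k * p * pderiv Q * Q + smult \<epsilon> (p * pderiv Q)"
  have Qx: "poly Q x = (x - a) * (b - x)" for x by (simp add: Q_def algebra_simps)
  have "(bump a b \<epsilon> p k has_real_derivative bump a b \<epsilon> p' (k + 2) x) (at x)" for x
  proof (cases "a < x \<and> x < b")
    case True
    have q: "poly Q x \<noteq> 0" using True by (simp add: Qx)
    note D3 = DERIV_divide[OF poly_DERIV DERIV_power[OF poly_DERIV], of Q x k p]
    note D5 = DERIV_fun_exp[OF DERIV_divide[OF DERIV_const poly_DERIV, of Q x "-\<epsilon>"]]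
    have k1: "real k * (y * poly Q x ^ (k - Suc 0)) = real k * (y * (poly Q x ^ k / poly Q x))" for y
      using q by (cases k) auto
    have 2: "((\<lambda>x. poly p x / poly Q x ^ k * exp (- \<epsilon> / poly Q x)) has_real_derivative bump a b \<epsilon> p' (k + 2) x) (at x)"
    proof (rule DERIV_cong[OF DERIV_mult[OF D3 D5]])
      show "(poly (pderiv p) x * poly Q x ^ k - poly p x * (real k * (poly (pderiv Q) x * poly Q x ^ (k - Suc 0)))) / (poly Q x ^ k * poly Q x ^ k) * exp (- \<epsilon> / poly Q x)
       + exp (- \<epsilon> / poly Q x) * ((0 * poly Q x - - \<epsilon> * poly (pderiv Q) x) / (poly Q x * poly Q x)) * (poly p x / poly Q x ^ k)
       = bump a b \<epsilon> p' (k + 2) x"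
        unfolding k1 using q True bump_derivative_identity[OF q, of "poly (pderiv p) x" k]
        by (simp add: bump_def Qx[symmetric] p'_def)
    qed (use q in simp_all)
    show ?thesis
      by (rule has_field_derivative_transform_within_open[OF 2, of "{a<..<b}"]) (use True in \<open>auto simp: bump_def Qx\<close>)
  next
    case False
    obtain C where "\<And>x y. \<not> (a < x \<and> x < b) \<Longrightarrow> \<bar>bump a b \<epsilon> p k y\<bar> \<le> C * (y - x)\<^sup>2"
      using bump_quadratic_bound[OF ab e, of p k] by blast
    then have "(bump a b \<epsilon> p k has_real_derivative 0) (at x)" using False by (intro DERIV_zero_if_quadratic) blast
    moreover have "bump a b \<epsilon> p' (k + 2) x = 0" using False by (auto simp: bump_def)
    ultimately show ?thesis by simp
  qed
  then show ?thesis by blast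
qed

lemma test_fun_bump:
  assumes ab: "a < b" and e: "\<epsilon> > 0" and U: "{a..b} \<subseteq> U"
  shows "test_fun U (bump a b \<epsilon> p k)"
  unfolding test_fun_def
proof (intro conjI allI)
  fix n x
  have "\<exists>p' k'. (deriv ^^ n) (bump a b \<epsilon> p k) = bump a b \<epsilon> p' k'"
  proof (induction n)
    case 0 show ?case by auto
  next
    case (Suc n)
    then obtain p1 k1 where 1: "(deriv ^^ n) (bump a b \<epsilon> p k) = bump a b \<epsilon> p1 k1" by blast
    obtain p2 where "\<And>x. (bump a b \<epsilon> p1 k1 has_real_derivative bump a b \<epsilon> p2 (k1 + 2) x) (at x)"
      using bump_has_derivative[OF ab e] by blast
    then have "deriv (bump a b \<epsilon> p1 k1) = bump a b \<epsilon> p2 (k1 + 2)" by (auto intro: DERIV_imp_deriv)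
    then show ?case using 1 by auto
  qed
  then obtain p' k' where eq: "(deriv ^^ n) (bump a b \<epsilon> p k) = bump a b \<epsilon> p' k'" by blast
  show "(deriv ^^ n) (bump a b \<epsilon> p k) differentiable at x"
    unfolding eq real_differentiable_def using bump_has_derivative[OF ab e, of p' k'] by blast
next
  show "\<exists>K. compact K \<and> K \<subseteq> U \<and> (\<forall>x. x \<notin> K \<longrightarrow> bump a b \<epsilon> p k x = 0)"
    by (intro exI[of _ "{a..b}"]) (use U in \<open>auto simp: bump_def\<close>)
qed

lemma test_fun_DERIV: "test_fun U \<phi> \<Longrightarrow> (\<phi> has_real_derivative deriv \<phi> x) (at x)"
  unfolding test_fun_def by (metis DERIV_deriv_iff_real_differentiable funpow_0)

lemma test_fun_deriv:
  assumes "test_fun U \<phi>" shows "test_fun U (deriv \<phi>)"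
proof -
  obtain K where K: "compact K" "K \<subseteq> U" "\<And>x. x \<notin> K \<Longrightarrow> \<phi> x = 0" using assms unfolding test_fun_def by blast
  have "deriv \<phi> x = 0" if "x \<notin> K" for x
    using deriv_cong_open[of "- K" x \<phi> "\<lambda>_. 0"] that K by (auto simp: compact_imp_closed open_Compl)
  moreover have "(deriv ^^ n) (deriv \<phi>) differentiable at x" for n x
    using assms unfolding test_fun_def by (metis funpow_Suc_right o_apply)
  ultimately show ?thesis unfolding test_fun_def using K by blast
qed

lemma test_fun_continuous_on: "test_fun U \<phi> \<Longrightarrow> continuous_on A \<phi>"
  using test_fun_DERIV DERIV_isCont continuous_at_imp_continuous_on by blast

lemma test_fun_measurable: "test_fun U \<phi> \<Longrightarrow> \<phi> \<in> borel_measurable borel"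
  using test_fun_continuous_on borel_measurable_continuous_onI by blast

lemma test_fun_support:
  assumes "test_fun U \<phi>"
  obtains p q where "p < q" "\<And>x. x \<notin> {p..q} \<Longrightarrow> \<phi> x = 0"
proof -
  obtain K where K: "compact K" "\<And>x. x \<notin> K \<Longrightarrow> \<phi> x = 0" using assms unfolding test_fun_def by blast
  obtain B where B: "\<And>x. x \<in> K \<Longrightarrow> \<bar>x\<bar> \<le> B" using compact_imp_bounded[OF K(1)] by (auto simp: bounded_iff)
  show thesis by (rule that[of "- \<bar>B\<bar> - 1" "\<bar>B\<bar> + 1"]) (use K B in fastforce)+
qed

lemma test_fun_bounded:
  assumes "test_fun U \<phi>" obtains C where "C \<ge> 0" "\<And>x. \<bar>\<phi> x\<bar> \<le> C"
proof -
  obtain p q where pq: "p < q" "\<And>x. x \<notin> {p..q} \<Longrightarrow> \<phi> x = 0" using test_fun_support[OF assms] by blast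
  obtain C where C: "\<And>x. x \<in> {p..q} \<Longrightarrow> \<bar>\<phi> x\<bar> \<le> C"
    using continuous_on_Icc_bounded[OF test_fun_continuous_on[OF assms]] by (metis real_norm_def)
  have "\<bar>\<phi> x\<bar> \<le> \<bar>C\<bar>" for x using C[of x] pq(2)[of x] by (cases "x \<in> {p..q}") auto
  then show thesis using that[of "\<bar>C\<bar>"] by simp
qed

lemma test_fun_minus_scaled:
  assumes "test_fun U \<phi>" "test_fun U \<psi>"
  shows "test_fun U (\<lambda>x. \<phi> x - c * \<psi> x)"
proof -
  have d: "(deriv ^^ n) (\<lambda>x. \<phi> x - c * \<psi> x) = (\<lambda>x. (deriv ^^ n) \<phi> x - c * (deriv ^^ n) \<psi> x)" for n
  proof (induction n)
    case (Suc n)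
    have "((\<lambda>x. (deriv ^^ n) \<phi> x - c * (deriv ^^ n) \<psi> x) has_real_derivative
        (deriv ((deriv ^^ n) \<phi>) x - c * deriv ((deriv ^^ n) \<psi>) x)) (at x)" for x
      by (intro DERIV_diff DERIV_cmult) (use assms in \<open>auto simp: test_fun_def DERIV_deriv_iff_real_differentiable\<close>)
    then show ?case using Suc by (auto intro!: DERIV_imp_deriv)
  qed simp
  obtain K L where "compact K" "K \<subseteq> U" "\<And>x. x \<notin> K \<Longrightarrow> \<phi> x = 0" "compact L" "L \<subseteq> U" "\<And>x. x \<notin> L \<Longrightarrow> \<psi> x = 0"
    using assms unfolding test_fun_def by metis
  then have "compact (K \<union> L) \<and> K \<union> L \<subseteq> U \<and> (\<forall>x. x \<notin> K \<union> L \<longrightarrow> \<phi> x - c * \<psi> x = 0)" by auto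
  moreover have "(deriv ^^ n) (\<lambda>x. \<phi> x - c * \<psi> x) differentiable at x" for n x
    unfolding d by (intro differentiable_diff differentiable_mult) (use assms in \<open>auto simp: test_fun_def\<close>)
  ultimately show ?thesis unfolding test_fun_def by blast
qed

lemma set_integral_lebesgue_on:
  fixes f :: "real \<Rightarrow> 'b::{banach, second_countable_topology}"
  assumes "U \<in> sets lebesgue"
  shows "integrable (lebesgue_on U) f \<longleftrightarrow> integrable lebesgue (\<lambda>x. indicator U x *\<^sub>R f x)"
    "integral\<^sup>L (lebesgue_on U) f = integral\<^sup>L lebesgue (\<lambda>x. indicator U x *\<^sub>R f x)"
  using assms by (auto simp: integrable_restrict_space integral_restrict_space)

lemma AE_lebesgue_on_iff:
  assumes "U \<in> sets lebesgue"
  shows "(AE x in lebesgue_on U. P x) \<longleftrightarrow> (AE x in lborel. x \<in> U \<longrightarrow> P x)"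
  using assms by (simp add: AE_restrict_space_iff AE_completion_iff)

section \<open>The operator square root and the memory kernel\<close>
locale operator_sqrt =
  fixes A B :: "'h::{real_inner,banach,second_countable_topology} \<Rightarrow> 'h"
    and DA DB :: "'h set"
  assumes A: "selfadjoint_op A DA" "strictly_positive_op A DA" "has_compact_inverse A DA"
    and B: "is_op_sqrt B DB A DA"
begin

text \<open>This is A^(-1/2). Elements of V are handled through their images under B in H and
  recovered by R.\<close>

definition R :: "'h \<Rightarrow> 'h" where "R = inv_into DB B"

lemma selfadjoint_B: "selfadjoint_op B DB" using B by (simp add: is_op_sqrt_def)

lemma DA_iff: "u \<in> DA \<longleftrightarrow> u \<in> DB \<and> B u \<in> DB" using B unfolding is_op_sqrt_def by blast

lemma A_eq: "u \<in> DA \<Longrightarrow> A u = B (B u)" using B unfolding is_op_sqrt_def by blast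

lemma subspace_DB: "subspace DB" using selfadjoint_B by (simp add: selfadjoint_op_def lin_on_def)

lemma DB_add: "x \<in> DB \<Longrightarrow> y \<in> DB \<Longrightarrow> x + y \<in> DB" using subspace_DB by (rule subspace_add)
lemma DB_diff: "x \<in> DB \<Longrightarrow> y \<in> DB \<Longrightarrow> x - y \<in> DB" using subspace_DB by (rule subspace_diff)
lemma DB_scale: "x \<in> DB \<Longrightarrow> c *\<^sub>R x \<in> DB" using subspace_DB by (rule subspace_scale)
lemma DB_0: "0 \<in> DB" using subspace_DB by (rule subspace_0)

lemma B_add: "x \<in> DB \<Longrightarrow> y \<in> DB \<Longrightarrow> B (x + y) = B x + B y"
  using selfadjoint_B unfolding selfadjoint_op_def lin_on_def by blast

lemma B_scale: "x \<in> DB \<Longrightarrow> B (c *\<^sub>R x) = c *\<^sub>R B x"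
  using selfadjoint_B unfolding selfadjoint_op_def lin_on_def by blast

lemma B_0: "B 0 = 0" using B_scale[OF DB_0, of 0] by simp

lemma B_diff: assumes "x \<in> DB" "y \<in> DB" shows "B (x - y) = B x - B y"
  using B_add[OF assms(1) DB_scale[OF assms(2), of "-1"]] B_scale[OF assms(2), of "-1"] by simp

lemma B_sym: "x \<in> DB \<Longrightarrow> y \<in> DB \<Longrightarrow> inner (B x) y = inner x (B y)"
  using selfadjoint_B unfolding selfadjoint_op_def by blast

lemma DB_dense: "closure DB = UNIV" using selfadjoint_B unfolding selfadjoint_op_def by blast

lemma A_surj: "\<exists>x\<in>DA. A x = y"
proof -
  have "y \<in> A ` DA" using A(3) by (simp add: has_compact_inverse_def)
  then show ?thesis by blast
qed

lemma B_surj: "B ` DB = UNIV"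
proof -
  have "y \<in> B ` DB" for y
  proof -
    obtain x where "x \<in> DA" "A x = y" using A_surj by blast
    then have "B (B x) = y" "B x \<in> DB" using A_eq DA_iff by auto
    then show ?thesis by blast
  qed
  then show ?thesis by blast
qed

lemma B_eq_0D: assumes "u \<in> DB" "B u = 0" shows "u = 0"
proof -
  have d: "u \<in> DA" using assms DB_0 by (simp add: DA_iff)
  then have "A u = 0" using assms by (simp add: A_eq B_0)
  moreover have "u \<noteq> 0 \<longrightarrow> inner (A u) u > 0" using A(2) d unfolding strictly_positive_op_def by blast
  ultimately show ?thesis by auto
qed

lemma inj_on_B: "inj_on B DB"
proof (rule inj_onI)
  fix x y assume "x \<in> DB" "y \<in> DB" "B x = B y"
  then have "x - y = 0" by - (rule B_eq_0D, simp_all add: B_diff DB_diff)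
  then show "x = y" by simp
qed

lemma R_DB [simp]: "R y \<in> DB" unfolding R_def by (rule inv_into_into) (simp add: B_surj)
lemma B_R [simp]: "B (R y) = y" unfolding R_def by (rule f_inv_into_f) (simp add: B_surj)
lemma R_B [simp]: "u \<in> DB \<Longrightarrow> R (B u) = u" unfolding R_def by (rule inv_into_f_f[OF inj_on_B])
lemma R_eq_iff: "u \<in> DB \<Longrightarrow> R y = u \<longleftrightarrow> y = B u" by auto

lemma R_add: "R (x + y) = R x + R y" by (simp add: R_eq_iff DB_add B_add)
lemma R_scale: "R (c *\<^sub>R x) = c *\<^sub>R R x" by (simp add: R_eq_iff DB_scale B_scale)

lemma R_sym: "inner (R x) y = inner x (R y)"
  using B_sym[OF R_DB R_DB, of x y] by simp

lemma RR_DA: "w \<in> DB \<Longrightarrow> R w \<in> DA" by (simp add: DA_iff)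
lemma A_R: "w \<in> DB \<Longrightarrow> A (R w) = B w" by (simp add: A_eq RR_DA)

text \<open>The compact inverse K of A is bounded and equals R R, and the symmetry of R gives |R
  y|^2 = <K y, y>; so the square root of a bound for K bounds R.\<close>

lemma R_bounded_linear: "bounded_linear R"
proof -
  define K where "K = inv_into DA A"
  have inj: "inj_on A DA" and co: "compact_op K" using A(3) by (auto simp: has_compact_inverse_def K_def)
  have K: "K y = R (R y)" for y
    unfolding K_def by (rule inv_into_f_eq[OF inj]) (simp_all add: RR_DA A_R)
  have "bounded (closure (K ` cball 0 1))"
    using co unfolding compact_op_def by (intro compact_imp_bounded) auto
  then have "bounded (K ` cball 0 1)" using bounded_subset closure_subset by blast
  then obtain C where "\<forall>z\<in>K ` cball 0 1. norm z \<le> C" unfolding bounded_iff by blast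
  then have C: "norm (K y) \<le> C" if "norm y \<le> 1" for y using that by auto
  have "norm (K 0) \<le> C" by (rule C) simp
  then have C0: "C \<ge> 0" using norm_ge_zero[of "K 0"] by linarith
  have Kb: "norm (K y) \<le> C * norm y" for y
  proof (cases "y = 0")
    case True then show ?thesis using R_scale[of 0 0] by (simp add: K)
  next
    case False
    have e: "K y = norm y *\<^sub>R K (y /\<^sub>R norm y)" using False by (simp add: K R_scale[symmetric])
    have "norm (K (y /\<^sub>R norm y)) \<le> C" by (rule C) (use False in simp)
    then have "norm (norm y *\<^sub>R K (y /\<^sub>R norm y)) \<le> norm y * C" by (simp only: norm_scaleR abs_norm_cancel mult_left_mono norm_ge_zero)
    then show ?thesis unfolding e[symmetric] by (simp add: mult.commute)
  qed
  show ?thesis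
  proof (rule bounded_linear_intro[where K="sqrt C"])
    fix y
    have "(norm (R y))\<^sup>2 = inner (K y) y" by (simp add: power2_norm_eq_inner K R_sym)
    also have "\<dots> \<le> norm (K y) * norm y" by (rule norm_cauchy_schwarz)
    also have "\<dots> \<le> C * norm y * norm y" by (intro mult_right_mono Kb) simp
    finally have "(norm (R y))\<^sup>2 \<le> (sqrt C * norm y)\<^sup>2" using C0 by (simp add: power_mult_distrib) (simp add: power2_eq_square mult.assoc)
    then have "norm (R y) \<le> sqrt C * norm y" by (rule power2_le_imp_le) (use C0 in simp)
    then show "norm (R y) \<le> norm y * sqrt C" by (simp only: mult.commute)
  qed (rule R_add R_scale)+
qed

sublocale R: bounded_linear R by (rule R_bounded_linear)

lemma R_measurable [measurable]: "R \<in> borel_measurable borel"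
  by (rule borel_measurable_continuous_onI) (rule R.continuous_on[OF continuous_on_id])

lemma inner_B_eq_0D:
  assumes "\<And>w. w \<in> DB \<Longrightarrow> inner x (B w) = 0" shows "x = 0"
  using assms[of "R x"] by simp

end

section \<open>The memory kernel and its derivative on the half-line\<close>

locale memory_kernel_locale =
  fixes l :: ereal and \<mu> :: "real \<Rightarrow> real"
  assumes l: "l > 0" and mu: "memory_kernel l \<mu>"
begin

lemma Omega_pos: "\<tau> \<in> Omega l \<Longrightarrow> \<tau> > 0" by (simp add: Omega_def)
lemma Omega_down: "\<tau> \<in> Omega l \<Longrightarrow> 0 < \<sigma> \<Longrightarrow> \<sigma> \<le> \<tau> \<Longrightarrow> \<sigma> \<in> Omega l"
  unfolding Omega_def using order.strict_trans1[of "ereal \<sigma>" "ereal \<tau>" l] by auto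

lemma Omega_open: "open (Omega l)"
proof -
  have "Omega l = {0<..} \<inter> ereal -` {..<l}" by (auto simp: Omega_def)
  moreover have "open (ereal -` {..<l})" by (rule open_vimage) (auto intro: continuous_on_ereal continuous_on_id)
  ultimately show ?thesis by auto
qed

lemma Omega_borel [measurable]: "Omega l \<in> sets borel" using Omega_open by simp
lemma Omega_lebesgue: "Omega l \<in> sets lebesgue" using Omega_open by simp

lemma mu_pos: "\<tau> \<in> Omega l \<Longrightarrow> \<mu> \<tau> > 0" using mu by (auto simp: memory_kernel_def)
lemma mu_zero: "\<tau> \<notin> Omega l \<Longrightarrow> \<mu> \<tau> = 0" using mu by (auto simp: memory_kernel_def)
lemma mu_nonneg [simp]: "\<mu> \<tau> \<ge> 0" using mu_pos[of \<tau>] mu_zero[of \<tau>] by (cases "\<tau> \<in> Omega l") auto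

lemma mu_antimono: "0 < x \<Longrightarrow> x \<le> y \<Longrightarrow> \<mu> y \<le> \<mu> x"
proof (cases "y \<in> Omega l")
  case True
  assume "0 < x" "x \<le> y"
  then have "x \<in> Omega l" using True Omega_down by blast
  then show ?thesis using mu True \<open>x \<le> y\<close> unfolding memory_kernel_def monotone_on_def by blast
qed (simp add: mu_zero)

lemma mu_ac: "a \<le> b \<Longrightarrow> {a..b} \<subseteq> Omega l \<Longrightarrow> abs_cont_on a b \<mu>" using mu by (simp add: memory_kernel_def)

lemma mu_continuous_Omega: "continuous_on (Omega l) \<mu>"
proof (rule continuous_at_imp_continuous_on, rule ballI)
  fix x assume "x \<in> Omega l"
  then obtain e where e: "e > 0" "cball x e \<subseteq> Omega l" using Omega_open open_contains_cball by blast
  then have "{x - e..x + e} \<subseteq> Omega l" by (simp add: cball_eq_atLeastAtMost)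
  then have "continuous_on {x - e..x + e} \<mu>" using e by (intro abs_cont_on_imp_continuous_on mu_ac) auto
  then show "isCont \<mu> x" by (rule continuous_on_interior) (use e in \<open>auto simp: interior_atLeastAtMost_real\<close>)
qed

lemma mu_measurable [measurable]: "\<mu> \<in> borel_measurable borel"
proof -
  have "(\<lambda>x. indicator (Omega l) x *\<^sub>R \<mu> x) \<in> borel_measurable borel"
    by (rule borel_measurable_continuous_on_indicator) (auto intro: mu_continuous_Omega)
  moreover have "(\<lambda>x. indicator (Omega l) x *\<^sub>R \<mu> x) = \<mu>" using mu_zero by (auto simp: fun_eq_iff indicator_def)
  ultimately show ?thesis by simp
qed

lemma mu_integrable: "integrable lborel \<mu>"
proof -
  have "integrable (lebesgue_on (Omega l)) \<mu>" using mu by (simp add: memory_kernel_def)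
  then have "integrable lebesgue (\<lambda>x. indicator (Omega l) x *\<^sub>R \<mu> x)"
    using Omega_lebesgue by (simp add: integrable_restrict_space)
  moreover have "(\<lambda>x. indicator (Omega l) x *\<^sub>R \<mu> x) = \<mu>" using mu_zero by (auto simp: fun_eq_iff indicator_def)
  ultimately have "integrable lebesgue \<mu>" by simp
  then show ?thesis by (subst (asm) integrable_completion) auto
qed

lemma mu_shift_integrable: "integrable lborel (\<lambda>s. \<mu> (c + s))"
  using lborel_integrable_real_affine[OF mu_integrable, of 1 c] by simp

lemma mu_continuous: "x > 0 \<Longrightarrow> isCont \<mu> x"
proof -
  assume x: "x > 0"
  show ?thesis
  proof (cases "x \<in> Omega l")
    case True then show ?thesis using mu_continuous_Omega Omega_open by (simp add: continuous_on_eq_continuous_at)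
  next
    case False
    then have "l \<le> ereal x" using x by (simp add: Omega_def)
    then obtain L where L: "l = ereal L" using l by (cases l) auto
    show ?thesis
    proof (cases "x = L")
      case True then show ?thesis using mu L by (simp add: memory_kernel_def)
    next
      case False
      then have "x > L" using \<open>l \<le> ereal x\<close> L by simp
      then have "\<forall>\<^sub>F y in nhds x. \<mu> y = 0"
        using mu_zero L by (intro eventually_nhds[THEN iffD2] exI[of _ "{L<..}"]) (auto simp: Omega_def)
      then have "isCont \<mu> x \<longleftrightarrow> isCont (\<lambda>_. 0 :: real) x" by (rule isCont_cong)
      then show ?thesis by simp
    qed
  qed
qed

lemma mu_FTC_Omega:
  assumes "0 < x" "x \<le> y" "y \<in> Omega l"
  shows "set_integrable lborel {x<..<y} (deriv \<mu>)" "(LINT r:{x<..<y}|lborel. deriv \<mu> r) = \<mu> y - \<mu> x"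
    "AE r in lborel. r \<in> {x<..<y} \<longrightarrow> deriv \<mu> r \<le> 0"
proof -
  have "{x..y} \<subseteq> Omega l" using assms Omega_down by auto
  then have ac: "abs_cont_on x y \<mu>" using assms by (intro mu_ac)
  have an: "\<And>a b. x \<le> a \<Longrightarrow> a \<le> b \<Longrightarrow> b \<le> y \<Longrightarrow> \<mu> b \<le> \<mu> a" using assms by (intro mu_antimono) auto
  show "set_integrable lborel {x<..<y} (deriv \<mu>)" "(LINT r:{x<..<y}|lborel. deriv \<mu> r) = \<mu> y - \<mu> x"
    "AE r in lborel. r \<in> {x<..<y} \<longrightarrow> deriv \<mu> r \<le> 0"
    using antimono_abs_cont_FTC[OF assms(2) an ac] by auto
qed

text \<open>Absolute continuity is available only on closed subintervals of Omega. The end point L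
  is reached by monotone convergence along points increasing to L, using the sign of
  \<open>deriv \<mu>\<close> and the continuity of \<mu> at L.\<close>

lemma mu_FTC_end:
  assumes L: "l = ereal L" and x: "0 < x" "x < L"
  shows "set_integrable lborel {x<..<L} (deriv \<mu>)" "(LINT r:{x<..<L}|lborel. deriv \<mu> r) = - \<mu> x"
    "AE r in lborel. r \<in> {x<..<L} \<longrightarrow> deriv \<mu> r \<le> 0"
proof -
  define y where "y n = L - (L - x) / real (Suc (Suc n))" for n
  have y: "x < y n" "y n < L" for n
  proof -
    have "(L - x) * 1 < (L - x) * real (Suc (Suc n))" using x by (intro mult_strict_left_mono) auto
    then have "(L - x) / real (Suc (Suc n)) < L - x" by (simp add: divide_less_eq)
    moreover have "(L - x) / real (Suc (Suc n)) > 0" using x by simp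
    ultimately show "x < y n" "y n < L" by (simp_all add: y_def)
  qed
  have yO: "y n \<in> Omega l" for n using y[of n] x L by (simp add: Omega_def)
  have ymono: "y m \<le> y n" if "m \<le> n" for m n using that x by (simp add: y_def frac_le)
  have ylim: "y \<longlonglongrightarrow> L"
  proof -
    have "(\<lambda>n. L - (L - x) * (1 / real (Suc (Suc n)))) \<longlonglongrightarrow> L - (L - x) * 0"
      by (rule tendsto_diff[OF tendsto_const tendsto_mult[OF tendsto_const LIMSEQ_Suc[OF LIMSEQ_Suc[OF lim_1_over_n]]]])
    then show ?thesis by (simp add: y_def[abs_def])
  qed
  note F = mu_FTC_Omega[OF x(1) less_imp_le[OF y(1)] yO]
  define f where "f n r = indicator {x<..<y n} r *\<^sub>R (- deriv \<mu> r)" for n r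
  have fint: "integrable lborel (f n)" for n
    using F(1)[of n] by (simp add: f_def[abs_def] set_integrable_def)
  have AEneg: "AE r in lborel. \<forall>n. r \<in> {x<..<y n} \<longrightarrow> deriv \<mu> r \<le> 0" by (subst AE_all_countable) (use F(3) in blast)
  have limf: "(\<lambda>n. f n r) \<longlonglongrightarrow> indicator {x<..<L} r *\<^sub>R (- deriv \<mu> r)" for r
  proof (cases "r < L")
    case True
    then have "\<forall>\<^sub>F n in sequentially. r < y n" using ylim by (intro order_tendstoD(1)) auto
    then have "\<forall>\<^sub>F n in sequentially. f n r = indicator {x<..<L} r *\<^sub>R (- deriv \<mu> r)"
      by eventually_elim (use True in \<open>auto simp: f_def indicator_def\<close>)
    then show ?thesis by (rule tendsto_eventually)
  next
    case False then have "f n r = 0" for n using y[of n] by (auto simp: f_def indicator_def)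
    then show ?thesis using False by simp
  qed
  have mL: "\<mu> L = 0" using L by (intro mu_zero) (simp add: Omega_def)
  have "(\<lambda>n. \<mu> (y n)) \<longlonglongrightarrow> \<mu> L" using isCont_tendsto_compose[OF mu_continuous ylim] x by simp
  then have "(\<lambda>n. \<mu> x - \<mu> (y n)) \<longlonglongrightarrow> \<mu> x - 0" unfolding mL by (intro tendsto_intros)
  moreover have "integral\<^sup>L lborel (f n) = \<mu> x - \<mu> (y n)" for n
    using F(2)[of n] by (simp add: f_def[abs_def] set_lebesgue_integral_def)
  ultimately have limI: "(\<lambda>n. integral\<^sup>L lborel (f n)) \<longlonglongrightarrow> \<mu> x" by simp
  have meas: "(\<lambda>r. indicator {x<..<L} r *\<^sub>R (- deriv \<mu> r)) \<in> borel_measurable lborel"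
    by (rule borel_measurable_LIMSEQ_real[OF limf]) (use fint in auto)
  have monof: "AE r in lborel. mono (\<lambda>n. f n r)"
    using AEneg
  proof eventually_elim
    case (elim r)
    show ?case
    proof (rule monoI)
      fix m n :: nat assume "m \<le> n"
      then show "f m r \<le> f n r" using ymono[of m n] elim by (auto simp: f_def indicator_def)
    qed
  qed
  have i: "integrable lborel (\<lambda>r. indicator {x<..<L} r *\<^sub>R (- deriv \<mu> r))"
    by (rule integrable_monotone_convergence[OF fint monof _ limI meas]) (use limf in auto)
  have e: "(LINT r|lborel. indicator {x<..<L} r *\<^sub>R (- deriv \<mu> r)) = \<mu> x"
    by (rule integral_monotone_convergence[OF fint monof _ limI meas]) (use limf in auto)
  show "set_integrable lborel {x<..<L} (deriv \<mu>)" using i by (simp add: set_integrable_def)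
  show "(LINT r:{x<..<L}|lborel. deriv \<mu> r) = - \<mu> x" using e by (simp add: set_lebesgue_integral_def)
  show "AE r in lborel. r \<in> {x<..<L} \<longrightarrow> deriv \<mu> r \<le> 0" using AEneg
  proof eventually_elim
    case (elim r)
    show ?case
    proof
      assume r: "r \<in> {x<..<L}"
      then have "\<forall>\<^sub>F n in sequentially. r < y n" using ylim by (intro order_tendstoD(1)) auto
      then obtain n where "r < y n" by (auto simp: eventually_sequentially)
      then show "deriv \<mu> r \<le> 0" using elim r by auto
    qed
  qed
qed

text \<open>Beyond l both the kernel and its derivative vanish, so the formula continues past l. The
  lower limit stays positive because \<mu> may be unbounded near 0.\<close>

lemma mu_FTC:
  assumes "0 < x" "x \<le> y"
  shows "set_integrable lborel {x<..<y} (deriv \<mu>)" "(LINT r:{x<..<y}|lborel. deriv \<mu> r) = \<mu> y - \<mu> x"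
    "AE r in lborel. r \<in> {x<..<y} \<longrightarrow> deriv \<mu> r \<le> 0"
proof -
  have "set_integrable lborel {x<..<y} (deriv \<mu>) \<and> (LINT r:{x<..<y}|lborel. deriv \<mu> r) = \<mu> y - \<mu> x \<and>
    (AE r in lborel. r \<in> {x<..<y} \<longrightarrow> deriv \<mu> r \<le> 0)"
  proof (cases "y \<in> Omega l")
    case True then show ?thesis using mu_FTC_Omega assms by blast
  next
    case False
    then have "l \<le> ereal y" using assms by (simp add: Omega_def)
    then obtain L where L: "l = ereal L" using l by (cases l) auto
    have Ly: "L \<le> y" using \<open>l \<le> ereal y\<close> L by simp
    have L0: "0 < L" using l L by simp
    have d0: "deriv \<mu> r = 0" if "r > L" for r
    proof -
      have "deriv \<mu> r = deriv (\<lambda>_. 0) r"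
        by (rule deriv_cong_open[of "{L<..}"]) (use that L mu_zero in \<open>auto simp: Omega_def\<close>)
      then show ?thesis by simp
    qed
    have my: "\<mu> y = 0" using False mu_zero by simp
    have AEL: "AE r in lborel. r \<noteq> L" by (rule AE_lborel_singleton)
    show ?thesis
    proof (cases "x < L")
      case True
      note E = mu_FTC_end[OF L assms(1) True]
      \<comment> \<open>At L the kernel may have a corner and \<open>deriv \<mu> L\<close> an
        arbitrary value; the singleton is split off as a null contribution.\<close>
      have eq: "(\<lambda>r. indicator {x<..<y} r *\<^sub>R deriv \<mu> r) = (\<lambda>r. indicator {x<..<L} r *\<^sub>R deriv \<mu> r + indicator ({L} \<inter> {x<..<y}) r *\<^sub>R deriv \<mu> L)"
        using d0 Ly True by (auto simp: fun_eq_iff indicator_def)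
      have null: "integrable lborel (\<lambda>r. indicator ({L} \<inter> {x<..<y}) r *\<^sub>R deriv \<mu> L)"
        "(LINT r|lborel. indicator ({L} \<inter> {x<..<y}) r *\<^sub>R deriv \<mu> L) = 0"
      proof -
        have ae: "AE r in lborel. indicator ({L} \<inter> {x<..<y}) r *\<^sub>R deriv \<mu> L = 0" using AEL by eventually_elim simp
        show "integrable lborel (\<lambda>r. indicator ({L} \<inter> {x<..<y}) r *\<^sub>R deriv \<mu> L)"
          by (rule integrable_cong_AE[THEN iffD2, OF _ _ ae]) auto
        show "(LINT r|lborel. indicator ({L} \<inter> {x<..<y}) r *\<^sub>R deriv \<mu> L) = 0"
          using integral_eq_zero_AE[OF ae] by simp
      qed
      have "set_integrable lborel {x<..<y} (deriv \<mu>)"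
        unfolding set_integrable_def eq by (rule Bochner_Integration.integrable_add) (use E(1) null in \<open>auto simp: set_integrable_def\<close>)
      moreover have "(LINT r:{x<..<y}|lborel. deriv \<mu> r) = \<mu> y - \<mu> x"
        unfolding set_lebesgue_integral_def eq
        by (subst Bochner_Integration.integral_add) (use E(1,2) null my in \<open>auto simp: set_integrable_def set_lebesgue_integral_def\<close>)
      moreover have "AE r in lborel. r \<in> {x<..<y} \<longrightarrow> deriv \<mu> r \<le> 0"
        using E(3) AEL
      proof eventually_elim
        case (elim r) then show ?case using d0[of r] by (cases "r < L") auto
      qed
      ultimately show ?thesis by blast
    next
      case False
      then have "x \<notin> Omega l" using L by (simp add: Omega_def)
      then have mx: "\<mu> x = 0" by (rule mu_zero)
      have z: "indicator {x<..<y} r *\<^sub>R deriv \<mu> r = 0" for r using d0[of r] False by (auto simp: indicator_def)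
      have "AE r in lborel. r \<in> {x<..<y} \<longrightarrow> deriv \<mu> r \<le> 0" using d0 False by auto
      then show ?thesis unfolding set_integrable_def set_lebesgue_integral_def z using mx my by simp
    qed
  qed
  then show "set_integrable lborel {x<..<y} (deriv \<mu>)" "(LINT r:{x<..<y}|lborel. deriv \<mu> r) = \<mu> y - \<mu> x"
    "AE r in lborel. r \<in> {x<..<y} \<longrightarrow> deriv \<mu> r \<le> 0" by auto
qed

end

locale visco = operator_sqrt A B DA DB + memory_kernel_locale l \<mu>
  for A B :: "'h::{real_inner,banach,second_countable_topology} \<Rightarrow> 'h"
    and DA DB :: "'h set" and l \<mu>

section \<open>The fundamental lemma of the calculus of variations\<close>

text \<open>Local argument on intervals {a..b} compactly inside U: bumps approximate indicators, so
  f integrates to 0 over every subinterval and vanishes a.e. on {a..b}. Countably many rational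
  intervals exhaust U.\<close>

theorem fundamental_lemma_test_fun:
  fixes f :: "real \<Rightarrow> 'b::{banach, second_countable_topology}"
  assumes U: "open U"
    and int: "\<And>\<phi>. test_fun U \<phi> \<Longrightarrow> integrable (lebesgue_on U) (\<lambda>x. \<phi> x *\<^sub>R f x)"
    and zero: "\<And>\<phi>. test_fun U \<phi> \<Longrightarrow> integral\<^sup>L (lebesgue_on U) (\<lambda>x. \<phi> x *\<^sub>R f x) = 0"
  shows "AE x in lborel. x \<in> U \<longrightarrow> f x = 0"
proof -
  have Ul: "U \<in> sets lebesgue" using U by simp
  have loc: "AE x in lborel. x \<in> {a..b} \<longrightarrow> f x = 0" if abU: "{a'..b'} \<subseteq> U" and lt: "a' < a" "a < b" "b < b'" for a b a' b'
  proof -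
    \<comment> \<open>This test function is bounded below by some m > 0 on {a..b}, which turns the
      hypothesis on products into integrability of f over {a..b}.\<close>
    define \<phi>0 where "\<phi>0 = bump a' b' 1 1 0"
    have t0: "test_fun U \<phi>0" unfolding \<phi>0_def by (rule test_fun_bump) (use abU lt in auto)
    have pos0: "\<phi>0 x > 0" if "x \<in> {a..b}" for x using that lt by (simp add: \<phi>0_def bump_def)
    obtain m where m: "m > 0" "\<And>x. x \<in> {a..b} \<Longrightarrow> m \<le> \<phi>0 x"
    proof -
      obtain z where "z \<in> {a..b}" "\<forall>y\<in>{a..b}. \<phi>0 z \<le> \<phi>0 y"
        using continuous_attains_inf[of "{a..b}" \<phi>0] lt test_fun_continuous_on[OF t0] by auto
      then show thesis using that[of "\<phi>0 z"] pos0 by auto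
    qed
    define g where "g x = indicator {a..b} x *\<^sub>R f x" for x
    have i0: "integrable lebesgue (\<lambda>x. indicator U x *\<^sub>R (\<phi>0 x *\<^sub>R f x))"
      using set_integral_lebesgue_on(1)[OF Ul, of "\<lambda>x. \<phi>0 x *\<^sub>R f x"] int[OF t0] by blast
    have \<phi>0m: "\<phi>0 \<in> borel_measurable lebesgue"
      using test_fun_measurable[OF t0] by (intro measurable_completion) simp
    have gi: "integrable lebesgue g"
    proof (rule Bochner_Integration.integrable_bound)
      show "integrable lebesgue (\<lambda>x. (1/m) *\<^sub>R (indicator U x *\<^sub>R (\<phi>0 x *\<^sub>R f x)))" by (rule integrable_scaleR_right) (rule i0)
      have "(\<lambda>x. (indicator {a..b} x / \<phi>0 x) *\<^sub>R (indicator U x *\<^sub>R (\<phi>0 x *\<^sub>R f x))) \<in> borel_measurable lebesgue"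
        by (rule borel_measurable_scaleR[OF borel_measurable_divide[OF borel_measurable_indicator \<phi>0m] borel_measurable_integrable[OF i0]]) simp
      moreover have "(\<lambda>x. (indicator {a..b} x / \<phi>0 x) *\<^sub>R (indicator U x *\<^sub>R (\<phi>0 x *\<^sub>R f x))) = g"
        using pos0 abU lt by (fastforce simp: g_def indicator_def fun_eq_iff)
      ultimately show "g \<in> borel_measurable lebesgue" by simp
      show "AE x in lebesgue. norm (g x) \<le> norm ((1/m) *\<^sub>R (indicator U x *\<^sub>R (\<phi>0 x *\<^sub>R f x)))"
      proof (rule AE_I2)
        fix x show "norm (g x) \<le> norm ((1/m) *\<^sub>R (indicator U x *\<^sub>R (\<phi>0 x *\<^sub>R f x)))"
        proof (cases "x \<in> {a..b}")
          case True
          then have "x \<in> U" using abU lt by auto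
          moreover have "m * norm (f x) \<le> \<phi>0 x * norm (f x)" using m(2)[OF True] by (simp add: mult_right_mono)
          ultimately show ?thesis using True m(1) pos0[OF True] by (simp add: g_def field_simps)
        qed (simp add: g_def)
      qed
    qed
    obtain h where h[measurable]: "h \<in> borel_measurable borel" and hg: "AE x in lborel. g x = h x"
      using completion_ex_borel_measurable_banach[of g lborel] gi by auto
    have hgl: "AE x in lebesgue. g x = h x" using hg by (rule AE_completion)
    have hl: "h \<in> borel_measurable lebesgue" using h by (intro measurable_completion) simp
    have "integrable lebesgue h" using gi by (rule integrable_cong_AE_imp) (use hl hgl in \<open>auto simp: eq_commute\<close>)
    then have hi: "integrable lborel h" using integrable_completion[of h lborel] by simp
    have Ioo: "(LINT x|lebesgue. indicator {c<..<d} x *\<^sub>R f x) = 0" if cd: "a \<le> c" "c < d" "d \<le> b" for c d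
    proof -
      \<comment> \<open>As \<epsilon> = 1/(n+1) tends to 0 these bumps converge pointwise to the
        indicator of the open interval and stay between 0 and 1, so dominated convergence
        applies.\<close>
      define \<phi> where "\<phi> n = bump c d (1 / real (Suc n)) 1 0" for n
      have tn: "test_fun U (\<phi> n)" for n unfolding \<phi>_def by (rule test_fun_bump) (use abU lt cd in auto)
      have lim: "(\<lambda>n. \<phi> n x) \<longlonglongrightarrow> indicator {c<..<d} x" for x
      proof (cases "c < x \<and> x < d")
        case True
        have "(\<lambda>n. 1 / real (Suc n)) \<longlonglongrightarrow> 0" by (rule LIMSEQ_Suc[OF lim_1_over_n])
        then have "(\<lambda>n. exp (- (1 / real (Suc n)) / ((x - c) * (d - x)))) \<longlonglongrightarrow> exp (- 0 / ((x - c) * (d - x)))"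
          by (intro tendsto_exp tendsto_divide tendsto_minus tendsto_const) (use True in auto)
        then show ?thesis using True by (simp add: \<phi>_def bump_def)
      next
        case False
        then have "\<phi> n x = 0" for n by (auto simp: \<phi>_def bump_def)
        then show ?thesis using False by auto
      qed
      have bd: "\<bar>\<phi> n x\<bar> \<le> indicator {a..b} x" for n x
        using cd by (auto simp: \<phi>_def bump_def indicator_def)
      have mn: "(\<lambda>x. \<phi> n x *\<^sub>R g x) \<in> borel_measurable lebesgue" for n
        by (rule borel_measurable_scaleR[OF measurable_completion borel_measurable_integrable[OF gi]])
           (use test_fun_measurable[OF tn[of n]] in simp)
      have eq: "\<phi> n x *\<^sub>R g x = indicator U x *\<^sub>R (\<phi> n x *\<^sub>R f x)" for n x
      proof (cases "x \<in> {a..b}")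
        case True
        then have "x \<in> U" using abU lt by auto
        then show ?thesis using True by (simp add: g_def)
      next
        case False then have "\<phi> n x = 0" using bd[of n x] by simp
        then show ?thesis by simp
      qed
      have "(\<lambda>n. LINT x|lebesgue. \<phi> n x *\<^sub>R g x) \<longlonglongrightarrow> (LINT x|lebesgue. indicator {c<..<d} x *\<^sub>R g x)"
      proof (rule integral_dominated_convergence[where w="\<lambda>x. norm (g x)"])
        show "(\<lambda>x. indicator {c<..<d} x *\<^sub>R g x) \<in> borel_measurable lebesgue"
          by (rule borel_measurable_scaleR[OF borel_measurable_indicator borel_measurable_integrable[OF gi]]) simp
        show "AE x in lebesgue. (\<lambda>n. \<phi> n x *\<^sub>R g x) \<longlonglongrightarrow> indicator {c<..<d} x *\<^sub>R g x"
          by (intro AE_I2 tendsto_scaleR lim tendsto_const)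
        show "AE x in lebesgue. norm (\<phi> n x *\<^sub>R g x) \<le> norm (g x)" for n
        proof (rule AE_I2)
          fix x
          have "\<bar>\<phi> n x\<bar> \<le> 1" by (rule order_trans[OF bd]) (simp add: indicator_def)
          then show "norm (\<phi> n x *\<^sub>R g x) \<le> norm (g x)" by (simp add: mult_left_le_one_le)
        qed
      qed (use gi mn in auto)
      moreover have "(LINT x|lebesgue. \<phi> n x *\<^sub>R g x) = 0" for n
        using zero[OF tn[of n]] set_integral_lebesgue_on(2)[OF Ul, of "\<lambda>x. \<phi> n x *\<^sub>R f x"] by (simp add: eq)
      moreover have "(\<lambda>x. indicator {c<..<d} x *\<^sub>R g x) = (\<lambda>x. indicator {c<..<d} x *\<^sub>R f x)"
        using cd by (auto simp: g_def indicator_def fun_eq_iff)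
      ultimately show ?thesis by (simp add: LIMSEQ_const_iff)
    qed
    have "AE x in lborel. h x = 0"
    proof (rule AE_zero_if_Ioc_integrals_zero[OF hi])
      fix c d :: real assume "c \<le> d"
      define c' d' where "c' = max c a" and "d' = min d b"
      have "(LINT x:{c<..d}|lborel. h x) = (LINT x|lebesgue. indicator {c<..d} x *\<^sub>R h x)"
        unfolding set_lebesgue_integral_def by (rule integral_completion[symmetric]) auto
      also have "\<dots> = (LINT x|lebesgue. indicator {c'<..<d'} x *\<^sub>R f x)"
      proof (rule integral_cong_AE)
        show "(\<lambda>x. indicator {c<..d} x *\<^sub>R h x) \<in> borel_measurable lebesgue" by (rule borel_measurable_scaleR[OF borel_measurable_indicator hl]) simp
        have "(\<lambda>x. indicator {c'<..<d'} x *\<^sub>R f x) = (\<lambda>x. indicator {c'<..<d'} x *\<^sub>R g x)"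
          by (auto simp: g_def indicator_def fun_eq_iff c'_def d'_def)
        then show "(\<lambda>x. indicator {c'<..<d'} x *\<^sub>R f x) \<in> borel_measurable lebesgue"
          by (simp only:) (rule borel_measurable_scaleR[OF borel_measurable_indicator borel_measurable_integrable[OF gi]], simp)
        have "AE x in lebesgue. x \<noteq> a" "AE x in lebesgue. x \<noteq> b" "AE x in lebesgue. x \<noteq> d"
          by (rule AE_completion, rule AE_lborel_singleton)+
        with hgl show "AE x in lebesgue. indicator {c<..d} x *\<^sub>R h x = indicator {c'<..<d'} x *\<^sub>R f x"
        proof eventually_elim
          case (elim x)
          then show ?case by (auto simp: g_def indicator_def c'_def d'_def min_def max_def split: if_splits)
        qed
      qed
      also have "\<dots> = 0"
      proof (cases "c' < d'")
        case True then show ?thesis by (intro Ioo) (auto simp: c'_def d'_def)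
      next
        case False then have "{c'<..<d'} = {}" by auto
        then show ?thesis by simp
      qed
      finally show "(LINT x:{c<..d}|lborel. h x) = 0" .
    qed
    with hg show ?thesis by eventually_elim (auto simp: g_def)
  qed
  define R :: "(rat \<times> rat \<times> rat \<times> rat) set" where "R = {(a', a, b, b'). {real_of_rat a'..of_rat b'} \<subseteq> U \<and> a' < a \<and> a < b \<and> b < b'}"
  have "AE x in lborel. \<forall>r\<in>R. x \<in> {real_of_rat (fst (snd r))..of_rat (fst (snd (snd r)))} \<longrightarrow> f x = 0"
  proof (rule AE_ball_countable[THEN iffD2])
    show "countable R" by (rule countableI_type)
    show "\<forall>r\<in>R. AE x in lborel. x \<in> {real_of_rat (fst (snd r))..of_rat (fst (snd (snd r)))} \<longrightarrow> f x = 0"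
    proof
      fix r assume "r \<in> R"
      then show "AE x in lborel. x \<in> {real_of_rat (fst (snd r))..of_rat (fst (snd (snd r)))} \<longrightarrow> f x = 0"
        by (intro loc[of "of_rat (fst r)" "of_rat (snd (snd (snd r)))"]) (auto simp: R_def of_rat_less split: prod.splits)
    qed
  qed
  then show ?thesis
  proof eventually_elim
    case (elim x)
    show ?case
    proof
      assume "x \<in> U"
      then obtain e where e: "e > 0" "ball x e \<subseteq> U" using U open_contains_ball by blast
      obtain a' where a': "x - e < of_rat a'" "of_rat a' < x" using of_rat_dense[of "x - e" x] e by auto
      obtain a where a: "of_rat a' < (of_rat a :: real)" "of_rat a < x" using of_rat_dense a' by blast
      obtain b' where b': "x < of_rat b'" "of_rat b' < x + e" using of_rat_dense[of x "x + e"] e by auto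
      obtain b where b: "x < of_rat b" "of_rat b < (of_rat b' :: real)" using of_rat_dense b' by blast
      have "{real_of_rat a'..of_rat b'} \<subseteq> ball x e" using a' b' by (auto simp: dist_real_def)
      moreover have "(of_rat a :: real) < of_rat b" using a b by linarith
      ultimately have "(a', a, b, b') \<in> R" using e a b by (auto simp: R_def of_rat_less)
      then show "f x = 0" using elim a b by fastforce
    qed
  qed
qed

text \<open>The primitive that vanishes to the left of the support also vanishes to the right
  because the mean is zero. Between the extreme points of the support it need not vanish, hence the
  convexity of U.\<close>

lemma test_fun_primitive:
  assumes t: "test_fun U \<psi>" and conv: "\<And>p q. p \<in> U \<Longrightarrow> q \<in> U \<Longrightarrow> {p..q} \<subseteq> U" and z: "(LINT x|lborel. \<psi> x) = 0"
  obtains \<Psi> where "test_fun U \<Psi>" "deriv \<Psi> = \<psi>"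
proof -
  obtain K where K: "compact K" "K \<subseteq> U" "\<And>x. x \<notin> K \<Longrightarrow> \<psi> x = 0" using t unfolding test_fun_def by blast
  consider p q where "{p..q} \<subseteq> U" "p \<le> q" "\<And>x. x \<notin> {p..q} \<Longrightarrow> \<psi> x = 0" | "\<And>x. \<psi> x = 0"
  proof (cases "K = {}")
    case True then show thesis using that(2) K by blast
  next
    case False
    obtain p where p: "p \<in> K" "\<And>x. x \<in> K \<Longrightarrow> p \<le> x" using compact_attains_inf[OF K(1) False] by blast
    obtain q where q: "q \<in> K" "\<And>x. x \<in> K \<Longrightarrow> x \<le> q" using compact_attains_sup[OF K(1) False] by blast
    show thesis by (rule that(1)[of p q], rule conv) (use p q K in \<open>auto intro: K(3)\<close>)
  qed
  then show thesis
  proof cases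
    case 2
    have "(deriv ^^ n) (\<lambda>x. 0 :: real) = (\<lambda>x. 0)" for n by (induction n) auto
    then have "test_fun U (\<lambda>x. 0)" unfolding test_fun_def by (auto intro!: exI[of _ "{}"])
    moreover have "deriv (\<lambda>x. 0 :: real) = \<psi>" using 2 by auto
    ultimately show thesis using that by blast
  next
    case 1
    have c: "continuous_on A \<psi>" for A using t by (rule test_fun_continuous_on)
    define \<Psi> where "\<Psi> x = integral {p - 1..x} \<psi>" for x
    have low: "\<Psi> x = 0" if "x < p" for x
    proof -
      have "integral {p - 1..x} \<psi> = integral {p - 1..x} (\<lambda>x. 0)" by (rule integral_cong) (use that 1 in auto)
      then show ?thesis by (simp add: \<Psi>_def)
    qed
    have D: "(\<Psi> has_real_derivative \<psi> x) (at x)" for x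
    proof (cases "x < p")
      case True
      have "(\<Psi> has_real_derivative 0) (at x)"
        by (rule has_field_derivative_transform_within_open[where f="\<lambda>_. 0" and S="{..<p}"]) (use True low in auto)
      then show ?thesis using True 1(3) by auto
    next
      case False
      have "(\<Psi> has_real_derivative \<psi> x) (at x within {p - 1..x + 1})"
        unfolding \<Psi>_def by (rule integral_has_real_derivative[OF c]) (use False in auto)
      moreover have "at x within {p - 1..x + 1} = at x" using False by (intro at_within_interior) auto
      ultimately show ?thesis by simp
    qed
    have dP: "deriv \<Psi> = \<psi>" using D by (auto intro: DERIV_imp_deriv)
    have high: "\<Psi> x = 0" if "x > q" for x
    proof -
      have iS: "set_integrable lborel {p - 1..x} \<psi>" by (rule borel_integrable_atLeastAtMost') (rule c)
      have "\<Psi> x = (LINT y:{p - 1..x}|lborel. \<psi> y)"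
        unfolding \<Psi>_def using set_borel_integral_eq_integral(2)[OF iS] by simp
      also have "\<dots> = (LINT y|lborel. \<psi> y)"
        unfolding set_lebesgue_integral_def
      proof (intro Bochner_Integration.integral_cong refl)
        fix y show "indicator {p - 1..x} y *\<^sub>R \<psi> y = \<psi> y"
          using 1(3)[of y] that by (cases "y \<in> {p..q}") (auto simp: indicator_def)
      qed
      finally show ?thesis using z by simp
    qed
    have "(deriv ^^ n) \<Psi> differentiable at x" for n x
    proof (cases n)
      case 0 then show ?thesis using D by (auto simp: real_differentiable_def)
    next
      case (Suc m)
      then have "(deriv ^^ n) \<Psi> = (deriv ^^ m) \<psi>" by (simp add: funpow_swap1 dP del: funpow.simps(2)) (metis dP funpow_Suc_right o_apply)
      then show ?thesis using t by (simp add: test_fun_def)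
    qed
    moreover have "\<Psi> x = 0" if "x \<notin> {p..q}" for x using that low high by force
    ultimately have "test_fun U \<Psi>" unfolding test_fun_def using 1 by (auto intro!: exI[of _ "{p..q}"])
    then show thesis using dP that by blast
  qed
qed

section \<open>Weighted histories\<close>
text \<open>Lebesgue measure is complete: every subset of a Borel null set is measurable.\<close>

lemma lebesgue_measurable_cong_AE:
  fixes f g :: "real \<Rightarrow> 'b::{second_countable_topology, banach}"
  assumes g: "g \<in> borel_measurable lebesgue" and ae: "AE x in lborel. f x = g x"
  shows "f \<in> borel_measurable lebesgue"
proof (rule measurableI)
  obtain N where N: "N \<in> null_sets lborel" "\<And>x. x \<notin> N \<Longrightarrow> f x = g x"
    using ae by (elim AE_E3) auto
  have sub: "Z \<in> sets lebesgue" if "Z \<subseteq> N" for Z :: "real set"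
    using null_sets_completion_subset[OF that] N(1) null_sets_completionI by blast
  fix S :: "'b set" assume "S \<in> sets borel"
  then have 1: "g -` S \<in> sets lebesgue" using measurable_sets[OF g] by simp
  have "f -` S = (g -` S - N) \<union> (f -` S \<inter> N)" using N(2) by auto
  also have "\<dots> \<in> sets lebesgue" using 1 sub by (intro sets.Un sets.Diff) auto
  finally show "f -` S \<inter> space lebesgue \<in> sets lebesgue" by simp
qed simp

section \<open>Primitives that vanish at infinity\<close>

text \<open>The sign makes d the derivative. The limit condition at l in the domain of P singles out
  exactly this primitive.\<close>

definition tail_prim :: "(real \<Rightarrow> 'b::{banach, second_countable_topology}) \<Rightarrow> real \<Rightarrow> 'b" where
  "tail_prim d \<tau> = - (LINT \<sigma>:{\<tau>..}|lborel. d \<sigma>)"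

lemma tail_prim_norm:
  fixes d :: "real \<Rightarrow> 'b::{banach, second_countable_topology}"
  assumes "integrable lborel d" shows "norm (tail_prim d \<tau>) \<le> (LINT \<sigma>|lborel. norm (d \<sigma>))"
proof -
  have "norm (tail_prim d \<tau>) \<le> (LINT \<sigma>|lborel. norm (indicator {\<tau>..} \<sigma> *\<^sub>R d \<sigma>))"
    unfolding tail_prim_def set_lebesgue_integral_def norm_minus_cancel by (rule integral_norm_bound)
  also have "\<dots> \<le> (LINT \<sigma>|lborel. norm (d \<sigma>))"
  proof (rule integral_mono)
    show "integrable lborel (\<lambda>\<sigma>. norm (indicator {\<tau>..} \<sigma> *\<^sub>R d \<sigma>))"
      by (intro integrable_norm integrable_mult_indicator assms) simp
    show "norm (indicator {\<tau>..} \<sigma> *\<^sub>R d \<sigma>) \<le> norm (d \<sigma>)" for \<sigma> by (simp add: indicator_def)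
  qed (intro integrable_norm assms)
  finally show ?thesis .
qed

lemma tail_prim_tendsto_seq:
  fixes d :: "real \<Rightarrow> 'b::{banach, second_countable_topology}"
  assumes d: "integrable lborel d" and X: "X \<longlonglongrightarrow> x"
  shows "(\<lambda>n. tail_prim d (X n)) \<longlonglongrightarrow> tail_prim d x"
proof -
  have "(\<lambda>n. LINT \<sigma>|lborel. indicator {X n..} \<sigma> *\<^sub>R d \<sigma>) \<longlonglongrightarrow> (LINT \<sigma>|lborel. indicator {x..} \<sigma> *\<^sub>R d \<sigma>)"
  proof (rule integral_dominated_convergence[where w="\<lambda>x. norm (d x)"])
    have "AE \<sigma> in lborel. \<sigma> \<noteq> x" by (rule AE_lborel_singleton)
    then show "AE \<sigma> in lborel. (\<lambda>n. indicator {X n..} \<sigma> *\<^sub>R d \<sigma>) \<longlonglongrightarrow> indicator {x..} \<sigma> *\<^sub>R d \<sigma>"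
    proof eventually_elim
      case (elim \<sigma>)
      show ?case
      proof (cases "\<sigma> < x")
        case True
        then have "\<forall>\<^sub>F n in sequentially. \<sigma> < X n" using X by (intro order_tendstoD(1)) auto
        then have "\<forall>\<^sub>F n in sequentially. indicator {X n..} \<sigma> *\<^sub>R d \<sigma> = indicator {x..} \<sigma> *\<^sub>R d \<sigma>"
          by eventually_elim (use True in auto)
        then show ?thesis by (rule tendsto_eventually)
      next
        case False
        then have "x < \<sigma>" using elim by simp
        then have "\<forall>\<^sub>F n in sequentially. X n < \<sigma>" using X by (intro order_tendstoD(2)) auto
        then have "\<forall>\<^sub>F n in sequentially. indicator {X n..} \<sigma> *\<^sub>R d \<sigma> = indicator {x..} \<sigma> *\<^sub>R d \<sigma>"
          by eventually_elim (use \<open>x < \<sigma>\<close> in auto)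
        then show ?thesis by (rule tendsto_eventually)
      qed
    qed
    show "AE \<sigma> in lborel. norm (indicator {X n..} \<sigma> *\<^sub>R d \<sigma>) \<le> norm (d \<sigma>)" for n by (auto simp: indicator_def)
  qed (use d in \<open>auto intro: borel_measurable_scaleR borel_measurable_integrable\<close>)
  then show ?thesis unfolding tail_prim_def set_lebesgue_integral_def by (rule tendsto_minus)
qed

lemma tail_prim_continuous:
  fixes d :: "real \<Rightarrow> 'b::{banach, second_countable_topology}"
  assumes d: "integrable lborel d" shows "continuous_on A (tail_prim d)"
  by (rule continuous_at_imp_continuous_on)
     (auto simp: continuous_at_sequentially o_def intro: tail_prim_tendsto_seq[OF d])

lemma tail_prim_at_top:
  fixes d :: "real \<Rightarrow> 'b::{banach, second_countable_topology}"
  assumes d: "integrable lborel d" shows "(tail_prim d \<longlongrightarrow> 0) at_top"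
proof -
  have "((\<lambda>x. LINT \<sigma>|lborel. indicator {x..} \<sigma> *\<^sub>R d \<sigma>) \<longlongrightarrow> 0) at_top"
  proof (rule tendsto_at_topI_sequentially)
    fix X :: "nat \<Rightarrow> real" assume X: "filterlim X at_top sequentially"
    have "(\<lambda>n. LINT \<sigma>|lborel. indicator {X n..} \<sigma> *\<^sub>R d \<sigma>) \<longlonglongrightarrow> integral\<^sup>L (lborel :: real measure) (\<lambda>\<sigma>. 0 :: 'b)"
    proof (rule integral_dominated_convergence[where w="\<lambda>x. norm (d x)"])
      show "AE \<sigma> in lborel. (\<lambda>n. indicator {X n..} \<sigma> *\<^sub>R d \<sigma>) \<longlonglongrightarrow> 0"
      proof (rule AE_I2, rule tendsto_eventually)
        fix \<sigma> :: real
        have "\<forall>\<^sub>F n in sequentially. \<sigma> < X n" using X by (simp add: filterlim_at_top_dense)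
        then show "\<forall>\<^sub>F n in sequentially. indicator {X n..} \<sigma> *\<^sub>R d \<sigma> = 0" by eventually_elim auto
      qed
      show "AE \<sigma> in lborel. norm (indicator {X n..} \<sigma> *\<^sub>R d \<sigma>) \<le> norm (d \<sigma>)" for n
        by (auto simp: indicator_def)
    qed (use d in \<open>auto intro: borel_measurable_scaleR borel_measurable_integrable\<close>)
    then show "(\<lambda>n. LINT \<sigma>|lborel. indicator {X n..} \<sigma> *\<^sub>R d \<sigma>) \<longlonglongrightarrow> 0" by simp
  qed
  then show ?thesis unfolding tail_prim_def[abs_def] set_lebesgue_integral_def using tendsto_minus by fastforce
qed

lemma ennreal_lin:
  "0 \<le> u \<Longrightarrow> 0 \<le> v \<Longrightarrow> 0 \<le> x \<Longrightarrow> 0 \<le> y \<Longrightarrow> ennreal (u * x + v * y) = ennreal u * ennreal x + ennreal v * ennreal y"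
  by (simp add: ennreal_mult ennreal_plus)

section \<open>The weighted L2 space of histories\<close>

context memory_kernel_locale begin

definition N2 :: "(real \<Rightarrow> 'b::real_normed_vector) \<Rightarrow> ennreal" where
  "N2 b = (\<integral>\<^sup>+ \<tau>. ennreal ((norm (b \<tau>))\<^sup>2 / \<mu> \<tau>) \<partial>lborel)"

text \<open>Outside Omega the weight 1/\<mu> is 1/0 = 0, so \<open>N2\<close> does not see b there;
  the vanishing is therefore demanded separately and lets all integrals run over the whole
  line.\<close>

definition wL2 :: "(real \<Rightarrow> 'b::{banach, second_countable_topology}) \<Rightarrow> bool" where
  "wL2 b \<longleftrightarrow> b \<in> borel_measurable borel \<and> (\<forall>\<tau>. \<tau> \<notin> Omega l \<longrightarrow> b \<tau> = 0) \<and> N2 b < \<infinity>"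

lemma wL2_meas: "wL2 b \<Longrightarrow> b \<in> borel_measurable borel" by (simp add: wL2_def)
lemma wL2_zero: "wL2 b \<Longrightarrow> \<tau> \<notin> Omega l \<Longrightarrow> b \<tau> = 0" by (simp add: wL2_def)

lemma N2_lin:
  fixes a b :: "real \<Rightarrow> 'b::{banach, second_countable_topology}"
  assumes [measurable]: "a \<in> borel_measurable borel" "b \<in> borel_measurable borel"
  shows "N2 (\<lambda>\<tau>. p *\<^sub>R a \<tau> + q *\<^sub>R b \<tau>) \<le> ennreal (2 * p\<^sup>2) * N2 a + ennreal (2 * q\<^sup>2) * N2 b"
proof -
  have pt: "ennreal ((norm (p *\<^sub>R a \<tau> + q *\<^sub>R b \<tau>))\<^sup>2 / \<mu> \<tau>)
      \<le> ennreal (2 * p\<^sup>2) * ennreal ((norm (a \<tau>))\<^sup>2 / \<mu> \<tau>) + ennreal (2 * q\<^sup>2) * ennreal ((norm (b \<tau>))\<^sup>2 / \<mu> \<tau>)" for \<tau>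
  proof -
    have sq: "(x + y)\<^sup>2 \<le> 2 * x\<^sup>2 + 2 * y\<^sup>2" for x y :: real
      using sum_squares_bound[of x y] by (simp add: power2_sum)
    have "(norm (p *\<^sub>R a \<tau> + q *\<^sub>R b \<tau>))\<^sup>2 \<le> (norm (p *\<^sub>R a \<tau>) + norm (q *\<^sub>R b \<tau>))\<^sup>2"
      by (intro power_mono norm_triangle_ineq) simp
    also have "\<dots> \<le> 2 * (norm (p *\<^sub>R a \<tau>))\<^sup>2 + 2 * (norm (q *\<^sub>R b \<tau>))\<^sup>2" by (rule sq)
    also have "\<dots> = 2 * p\<^sup>2 * (norm (a \<tau>))\<^sup>2 + 2 * q\<^sup>2 * (norm (b \<tau>))\<^sup>2" by (simp add: power_mult_distrib)
    finally have "(norm (p *\<^sub>R a \<tau> + q *\<^sub>R b \<tau>))\<^sup>2 / \<mu> \<tau> \<le> (2 * p\<^sup>2 * (norm (a \<tau>))\<^sup>2 + 2 * q\<^sup>2 * (norm (b \<tau>))\<^sup>2) / \<mu> \<tau>"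
      by (rule divide_right_mono) simp
    then have "ennreal ((norm (p *\<^sub>R a \<tau> + q *\<^sub>R b \<tau>))\<^sup>2 / \<mu> \<tau>) \<le> ennreal (2 * p\<^sup>2 * ((norm (a \<tau>))\<^sup>2 / \<mu> \<tau>) + 2 * q\<^sup>2 * ((norm (b \<tau>))\<^sup>2 / \<mu> \<tau>))"
      by (intro ennreal_leI) (simp add: add_divide_distrib)
    then show ?thesis by (subst (asm) ennreal_lin) simp_all
  qed
  have "N2 (\<lambda>\<tau>. p *\<^sub>R a \<tau> + q *\<^sub>R b \<tau>) \<le> (\<integral>\<^sup>+ \<tau>. ennreal (2 * p\<^sup>2) * ennreal ((norm (a \<tau>))\<^sup>2 / \<mu> \<tau>) + ennreal (2 * q\<^sup>2) * ennreal ((norm (b \<tau>))\<^sup>2 / \<mu> \<tau>) \<partial>lborel)"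
    unfolding N2_def by (rule nn_integral_mono) (rule pt)
  also have "\<dots> = ennreal (2 * p\<^sup>2) * N2 a + ennreal (2 * q\<^sup>2) * N2 b"
    unfolding N2_def by (subst nn_integral_add) (simp_all add: nn_integral_cmult)
  finally show ?thesis .
qed

lemma wL2_lin:
  fixes a b :: "real \<Rightarrow> 'b::{banach, second_countable_topology}"
  assumes "wL2 a" "wL2 b" shows "wL2 (\<lambda>\<tau>. p *\<^sub>R a \<tau> + q *\<^sub>R b \<tau>)"
proof -
  have "N2 (\<lambda>\<tau>. p *\<^sub>R a \<tau> + q *\<^sub>R b \<tau>) \<le> ennreal (2 * p\<^sup>2) * N2 a + ennreal (2 * q\<^sup>2) * N2 b"
    by (rule N2_lin) (use assms in \<open>auto simp: wL2_def\<close>)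
  also have "\<dots> < \<infinity>" using assms by (auto simp: wL2_def ennreal_mult_less_top less_top)
  finally have "N2 (\<lambda>\<tau>. p *\<^sub>R a \<tau> + q *\<^sub>R b \<tau>) < \<infinity>" .
  moreover have [measurable]: "a \<in> borel_measurable borel" "b \<in> borel_measurable borel"
    using assms by (auto simp: wL2_def)
  ultimately show ?thesis using assms unfolding wL2_def by auto
qed

lemma wL2_diff:
  fixes a b :: "real \<Rightarrow> 'b::{banach, second_countable_topology}"
  assumes "wL2 a" "wL2 b" shows "wL2 (\<lambda>\<tau>. a \<tau> - b \<tau>)"
  using wL2_lin[OF assms, of 1 "-1"] by simp

lemma wL2_add:
  fixes a b :: "real \<Rightarrow> 'b::{banach, second_countable_topology}"
  assumes "wL2 a" "wL2 b" shows "wL2 (\<lambda>\<tau>. a \<tau> + b \<tau>)"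
  using wL2_lin[OF assms, of 1 1] by simp

lemma wL2_mu: "wL2 (\<lambda>\<tau>. \<mu> \<tau> *\<^sub>R (h :: 'b::{banach, second_countable_topology}))"
proof -
  have "N2 (\<lambda>\<tau>. \<mu> \<tau> *\<^sub>R h) = (\<integral>\<^sup>+ \<tau>. ennreal ((norm h)\<^sup>2 * \<mu> \<tau>) \<partial>lborel)"
    unfolding N2_def by (rule nn_integral_cong) (simp add: power_mult_distrib power2_eq_square)
  also have "\<dots> < \<infinity>"
    using integrableD(2)[of lborel "\<lambda>\<tau>. (norm h)\<^sup>2 * \<mu> \<tau>"] mu_integrable by (simp add: abs_mult less_top)
  finally show ?thesis by (simp add: wL2_def mu_zero)
qed

text \<open>This is M(0), so that \<alpha> = 1 + mass.\<close>

definition mass :: real where "mass = (LINT r|lborel. \<mu> r)"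

lemma mass_nonneg: "mass \<ge> 0" by (simp add: mass_def)

text \<open>Young's inequality |b| \<le> |b|^2/(\<mu> e) + \<mu> e integrates to e^2/e + mass e. The
  parameter e plays the role of the norm, which avoids roots of extended reals.\<close>

lemma wL2_integral_norm:
  fixes b :: "real \<Rightarrow> 'b::{banach, second_countable_topology}"
  assumes b: "wL2 b" and le: "N2 b \<le> ennreal (e\<^sup>2)" and e: "e > 0"
  shows "integrable lborel b" "(LINT \<tau>|lborel. norm (b \<tau>)) \<le> (1 + mass) * e"
proof -
  have [measurable]: "b \<in> borel_measurable borel" using b by (rule wL2_meas)
  have pt: "norm (b \<tau>) \<le> (norm (b \<tau>))\<^sup>2 / \<mu> \<tau> / e + \<mu> \<tau> * e" for \<tau>
  proof (cases "\<tau> \<in> Omega l")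
    case True
    have m: "\<mu> \<tau> > 0" using mu_pos[OF True] .
    define z where "z = norm (b \<tau>)"
    have "2 * (z * (\<mu> \<tau> * e)) \<le> z\<^sup>2 + (\<mu> \<tau> * e)\<^sup>2" using sum_squares_bound[of z "\<mu> \<tau> * e"] by (simp add: mult.assoc)
    moreover have "z * (\<mu> \<tau> * e) \<ge> 0" using m e by (simp add: z_def)
    ultimately have "z * (\<mu> \<tau> * e) \<le> z\<^sup>2 + (\<mu> \<tau> * e)\<^sup>2" by linarith
    then have "z \<le> (z\<^sup>2 + (\<mu> \<tau> * e)\<^sup>2) / (\<mu> \<tau> * e)" using m e by (subst pos_le_divide_eq) auto
    also have "\<dots> = z\<^sup>2 / \<mu> \<tau> / e + \<mu> \<tau> * e" using m e by (simp add: add_divide_distrib power2_eq_square)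
    finally show ?thesis by (simp add: z_def)
  qed (use wL2_zero[OF b] in \<open>simp add: mu_zero\<close>)
  have i2: "integrable lborel (\<lambda>\<tau>. (norm (b \<tau>))\<^sup>2 / \<mu> \<tau>)"
    by (rule integrableI_nonneg) (use b in \<open>auto simp: wL2_def N2_def\<close>)
  have ii: "integrable lborel (\<lambda>\<tau>. (norm (b \<tau>))\<^sup>2 / \<mu> \<tau> / e + \<mu> \<tau> * e)"
    by (intro Bochner_Integration.integrable_add integrable_divide integrable_mult_left i2 mu_integrable)
  show ib: "integrable lborel b"
    by (rule Bochner_Integration.integrable_bound[OF ii]) (simp, intro AE_I2, rule order_trans[OF pt], simp)
  have "(LINT \<tau>|lborel. norm (b \<tau>)) \<le> (LINT \<tau>|lborel. (norm (b \<tau>))\<^sup>2 / \<mu> \<tau> / e + \<mu> \<tau> * e)"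
    by (rule integral_mono) (use ib ii pt in auto)
  also have "\<dots> = (LINT \<tau>|lborel. (norm (b \<tau>))\<^sup>2 / \<mu> \<tau>) / e + mass * e"
    by (subst Bochner_Integration.integral_add[OF integrable_divide[OF i2] integrable_mult_left[OF mu_integrable]])
       (simp_all only: mass_def integral_divide_zero integral_mult_left_zero)
  also have "(LINT \<tau>|lborel. (norm (b \<tau>))\<^sup>2 / \<mu> \<tau>) \<le> e\<^sup>2"
  proof -
    have "ennreal (LINT \<tau>|lborel. (norm (b \<tau>))\<^sup>2 / \<mu> \<tau>) = N2 b"
      unfolding N2_def by (rule nn_integral_eq_integral[symmetric]) (use i2 in auto)
    then have "ennreal (LINT \<tau>|lborel. (norm (b \<tau>))\<^sup>2 / \<mu> \<tau>) \<le> ennreal (e\<^sup>2)" using le by simp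
    then show ?thesis by (subst (asm) ennreal_le_iff) simp_all
  qed
  then have "(LINT \<tau>|lborel. (norm (b \<tau>))\<^sup>2 / \<mu> \<tau>) / e \<le> e" using e by (simp add: divide_le_eq power2_eq_square)
  finally show "(LINT \<tau>|lborel. norm (b \<tau>)) \<le> (1 + mass) * e" by (simp add: algebra_simps)
qed

lemma wL2_integrable:
  fixes b :: "real \<Rightarrow> 'b::{banach, second_countable_topology}"
  assumes "wL2 b" shows "integrable lborel b"
proof -
  have f: "N2 b < \<infinity>" using assms by (simp add: wL2_def)
  define e where "e = sqrt (enn2real (N2 b)) + 1"
  have "enn2real (N2 b) \<le> e\<^sup>2" by (simp add: e_def power2_sum)
  then have "N2 b \<le> ennreal (e\<^sup>2)" using f by (metis ennreal_enn2real ennreal_leI infinity_ennreal_def)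
  moreover have "e > 0" by (simp add: e_def add_nonneg_pos)
  ultimately show ?thesis using wL2_integral_norm(1)[OF assms] by blast
qed

text \<open>As \<mu> is nonincreasing, the weight on {p..q} is at most
  \<open>1 / \<mu> q\<close>.\<close>

lemma wL2_bounded_support:
  fixes b :: "real \<Rightarrow> 'b::{banach, second_countable_topology}"
  assumes [measurable]: "b \<in> borel_measurable borel" and bd: "\<And>x. norm (b x) \<le> C"
    and supp: "\<And>x. x \<notin> {p..q} \<Longrightarrow> b x = 0" and pq: "0 < p" "p \<le> q" "q \<in> Omega l"
  shows "wL2 b" "N2 b \<le> ennreal (C\<^sup>2 * ((q - p) / \<mu> q))"
proof -
  have mq: "\<mu> q > 0" using mu_pos pq by blast
  have C0: "C \<ge> 0" using bd[of 0] norm_ge_zero[of "b 0"] by linarith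
  have pt: "(norm (b \<tau>))\<^sup>2 / \<mu> \<tau> \<le> C\<^sup>2 / \<mu> q * indicator {p..q} \<tau>" for \<tau>
  proof (cases "\<tau> \<in> {p..q}")
    case True
    then have "\<mu> q \<le> \<mu> \<tau>" using pq by (intro mu_antimono) auto
    then have "(norm (b \<tau>))\<^sup>2 / \<mu> \<tau> \<le> C\<^sup>2 / \<mu> q" using mq bd by (intro frac_le power_mono) auto
    then show ?thesis using True by simp
  next
    case False then show ?thesis using supp[OF False] by simp
  qed
  have "N2 b \<le> (\<integral>\<^sup>+ \<tau>. ennreal (C\<^sup>2 / \<mu> q) * indicator {p..q} \<tau> \<partial>lborel)"
    unfolding N2_def
  proof (rule nn_integral_mono)
    fix \<tau>
    show "ennreal ((norm (b \<tau>))\<^sup>2 / \<mu> \<tau>) \<le> ennreal (C\<^sup>2 / \<mu> q) * indicator {p..q} \<tau>"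
    proof (cases "\<tau> \<in> {p..q}")
      case True then show ?thesis using ennreal_leI[OF pt[of \<tau>]] by simp
    next
      case False then show ?thesis using supp[OF False] by simp
    qed
  qed
  also have "\<dots> = ennreal (C\<^sup>2 / \<mu> q) * ennreal (q - p)" using pq by (simp add: nn_integral_cmult_indicator)
  also have "\<dots> = ennreal (C\<^sup>2 * ((q - p) / \<mu> q))" using mq pq by (simp add: ennreal_mult'[symmetric])
  finally show le: "N2 b \<le> ennreal (C\<^sup>2 * ((q - p) / \<mu> q))" .
  have "b \<tau> = 0" if "\<tau> \<notin> Omega l" for \<tau>
    using that Omega_down[OF pq(3)] pq(1) supp by (metis atLeastAtMost_iff order_less_le_trans)
  then show "wL2 b" using le by (auto simp: wL2_def intro: le_less_trans)
qed

section \<open>Density of the domain of P in the history space\<close>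

text \<open>Membership in the closure of the domain of P, expressed for the profile B xi. It is
  established for continuous functions, then indicators, then simple functions, then
  everything.\<close>

definition approximable :: "(real \<Rightarrow> 'b::{banach, second_countable_topology}) \<Rightarrow> bool" where
  "approximable b \<longleftrightarrow> wL2 b \<and> (\<forall>\<epsilon>>0. \<exists>d. wL2 d \<and> wL2 (\<lambda>\<tau>. indicator (Omega l) \<tau> *\<^sub>R tail_prim d \<tau>) \<and>
     N2 (\<lambda>\<tau>. b \<tau> - indicator (Omega l) \<tau> *\<^sub>R tail_prim d \<tau>) \<le> ennreal \<epsilon>)"

text \<open>\<open>N2\<close> is a squared norm: the norm of a sum obeys (x + y)^2 \<le> 2 x^2 + 2
  y^2, which explains the quarters.\<close>

lemma N2_add_le:
  fixes a b :: "real \<Rightarrow> 'b::{banach, second_countable_topology}"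
  assumes "a \<in> borel_measurable borel" "b \<in> borel_measurable borel"
    "N2 a \<le> ennreal (\<epsilon> / 4)" "N2 b \<le> ennreal (\<epsilon> / 4)" "\<epsilon> > 0"
  shows "N2 (\<lambda>\<tau>. a \<tau> + b \<tau>) \<le> ennreal \<epsilon>"
proof -
  have "N2 (\<lambda>\<tau>. 1 *\<^sub>R a \<tau> + 1 *\<^sub>R b \<tau>) \<le> ennreal (2 * 1\<^sup>2) * N2 a + ennreal (2 * 1\<^sup>2) * N2 b"
    by (rule N2_lin) fact+
  also have "\<dots> \<le> ennreal 2 * ennreal (\<epsilon> / 4) + ennreal 2 * ennreal (\<epsilon> / 4)"
    using assms by (intro add_mono mult_mono) auto
  also have "\<dots> = ennreal \<epsilon>"
    by (subst ennreal_lin[symmetric]) (use assms(5) in simp_all)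
  finally show ?thesis by simp
qed

lemma approximable_closed:
  fixes b :: "real \<Rightarrow> 'b::{banach, second_countable_topology}"
  assumes b: "wL2 b" and ap: "\<And>\<epsilon>. \<epsilon> > 0 \<Longrightarrow> \<exists>a. approximable a \<and> N2 (\<lambda>\<tau>. b \<tau> - a \<tau>) \<le> ennreal \<epsilon>"
  shows "approximable b"
  unfolding approximable_def
proof (intro conjI allI impI b)
  fix \<epsilon> :: real assume e: "\<epsilon> > 0"
  obtain a where a: "approximable a" "N2 (\<lambda>\<tau>. b \<tau> - a \<tau>) \<le> ennreal (\<epsilon> / 4)" using ap[of "\<epsilon> / 4"] e by auto
  have "\<epsilon> / 4 > 0" using e by simp
  then obtain d where d: "wL2 d" "wL2 (\<lambda>\<tau>. indicator (Omega l) \<tau> *\<^sub>R tail_prim d \<tau>)"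
     "N2 (\<lambda>\<tau>. a \<tau> - indicator (Omega l) \<tau> *\<^sub>R tail_prim d \<tau>) \<le> ennreal (\<epsilon> / 4)" using a(1) unfolding approximable_def by blast
  have wa: "wL2 a" using a(1) by (simp add: approximable_def)
  have "N2 (\<lambda>\<tau>. (b \<tau> - a \<tau>) + (a \<tau> - indicator (Omega l) \<tau> *\<^sub>R tail_prim d \<tau>)) \<le> ennreal \<epsilon>"
    by (rule N2_add_le[OF _ _ a(2) d(3) e]) (rule wL2_meas[OF wL2_diff[OF b wa]] wL2_meas[OF wL2_diff[OF wa d(2)]])+
  then show "\<exists>d. wL2 d \<and> wL2 (\<lambda>\<tau>. indicator (Omega l) \<tau> *\<^sub>R tail_prim d \<tau>) \<and>
     N2 (\<lambda>\<tau>. b \<tau> - indicator (Omega l) \<tau> *\<^sub>R tail_prim d \<tau>) \<le> ennreal \<epsilon>" using d by auto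
qed

lemma tail_prim_add:
  fixes d :: "real \<Rightarrow> 'b::{banach, second_countable_topology}"
  assumes "integrable lborel d" "integrable lborel d'"
  shows "tail_prim (\<lambda>\<tau>. d \<tau> + d' \<tau>) \<tau> = tail_prim d \<tau> + tail_prim d' \<tau>"
  unfolding tail_prim_def
  by (subst set_integral_add) (use assms in \<open>auto simp: set_integrable_def intro!: integrable_mult_indicator\<close>)

lemma approximable_add:
  fixes a b :: "real \<Rightarrow> 'b::{banach, second_countable_topology}"
  assumes "approximable a" "approximable b" shows "approximable (\<lambda>\<tau>. a \<tau> + b \<tau>)"
  unfolding approximable_def
proof (intro conjI allI impI)
  have w: "wL2 a" "wL2 b" using assms by (auto simp: approximable_def)
  then show "wL2 (\<lambda>\<tau>. a \<tau> + b \<tau>)" by (rule wL2_add)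
  fix \<epsilon> :: real assume e: "\<epsilon> > 0"
  then have e4: "\<epsilon> / 4 > 0" by simp
  obtain d where d: "wL2 d" "wL2 (\<lambda>\<tau>. indicator (Omega l) \<tau> *\<^sub>R tail_prim d \<tau>)"
     "N2 (\<lambda>\<tau>. a \<tau> - indicator (Omega l) \<tau> *\<^sub>R tail_prim d \<tau>) \<le> ennreal (\<epsilon> / 4)" using assms(1) e4 unfolding approximable_def by blast
  obtain d' where d': "wL2 d'" "wL2 (\<lambda>\<tau>. indicator (Omega l) \<tau> *\<^sub>R tail_prim d' \<tau>)"
     "N2 (\<lambda>\<tau>. b \<tau> - indicator (Omega l) \<tau> *\<^sub>R tail_prim d' \<tau>) \<le> ennreal (\<epsilon> / 4)" using assms(2) e4 unfolding approximable_def by blast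
  have t: "tail_prim (\<lambda>\<tau>. d \<tau> + d' \<tau>) \<tau> = tail_prim d \<tau> + tail_prim d' \<tau>" for \<tau>
    by (intro tail_prim_add wL2_integrable d d')
  have "N2 (\<lambda>\<tau>. (a \<tau> - indicator (Omega l) \<tau> *\<^sub>R tail_prim d \<tau>) + (b \<tau> - indicator (Omega l) \<tau> *\<^sub>R tail_prim d' \<tau>)) \<le> ennreal \<epsilon>"
    by (rule N2_add_le[OF _ _ d(3) d'(3) e]) (rule wL2_meas[OF wL2_diff[OF w(1) d(2)]] wL2_meas[OF wL2_diff[OF w(2) d'(2)]])+
  moreover have "wL2 (\<lambda>\<tau>. indicator (Omega l) \<tau> *\<^sub>R tail_prim (\<lambda>\<tau>. d \<tau> + d' \<tau>) \<tau>)"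
    using wL2_add[OF d(2) d'(2)] by (simp add: t scaleR_add_right)
  moreover have "(\<lambda>\<tau>. (a \<tau> - indicator (Omega l) \<tau> *\<^sub>R tail_prim d \<tau>) + (b \<tau> - indicator (Omega l) \<tau> *\<^sub>R tail_prim d' \<tau>))
     = (\<lambda>\<tau>. a \<tau> + b \<tau> - indicator (Omega l) \<tau> *\<^sub>R tail_prim (\<lambda>\<tau>. d \<tau> + d' \<tau>) \<tau>)" by (simp add: t scaleR_add_right fun_eq_iff)
  ultimately show "\<exists>d. wL2 d \<and> wL2 (\<lambda>\<tau>. indicator (Omega l) \<tau> *\<^sub>R tail_prim d \<tau>) \<and>
     N2 (\<lambda>\<tau>. a \<tau> + b \<tau> - indicator (Omega l) \<tau> *\<^sub>R tail_prim d \<tau>) \<le> ennreal \<epsilon>"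
    using wL2_add[OF d(1) d'(1)] by metis
qed

lemma approximable_scaled_vector:
  fixes k :: "real \<Rightarrow> real" and h :: "'b::{banach, second_countable_topology}"
  assumes k: "approximable k" shows "approximable (\<lambda>\<tau>. k \<tau> *\<^sub>R h)"
  unfolding approximable_def
proof (intro conjI allI impI)
  have N: "N2 (\<lambda>\<tau>. j \<tau> *\<^sub>R h) = ennreal ((norm h)\<^sup>2) * N2 j" if [measurable]: "j \<in> borel_measurable borel" for j :: "real \<Rightarrow> real"
  proof -
    have "N2 (\<lambda>\<tau>. j \<tau> *\<^sub>R h) = (\<integral>\<^sup>+ \<tau>. ennreal ((norm h)\<^sup>2) * ennreal ((norm (j \<tau>))\<^sup>2 / \<mu> \<tau>) \<partial>lborel)"
      unfolding N2_def by (rule nn_integral_cong) (simp add: power_mult_distrib ennreal_mult'[symmetric] mult.commute)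
    then show ?thesis unfolding N2_def by (simp add: nn_integral_cmult)
  qed
  have W: "wL2 (\<lambda>\<tau>. j \<tau> *\<^sub>R h)" if "wL2 j" for j :: "real \<Rightarrow> real"
  proof -
    have "N2 (\<lambda>\<tau>. j \<tau> *\<^sub>R h) < \<infinity>" using that N[of j] by (auto simp: wL2_def ennreal_mult_less_top)
    moreover have [measurable]: "j \<in> borel_measurable borel" using that by (rule wL2_meas)
    ultimately show ?thesis using that unfolding wL2_def by auto
  qed
  have wk: "wL2 k" using k by (simp add: approximable_def)
  then show "wL2 (\<lambda>\<tau>. k \<tau> *\<^sub>R h)" by (rule W)
  fix \<epsilon> :: real assume e: "\<epsilon> > 0"
  define \<epsilon>' where "\<epsilon>' = \<epsilon> / ((norm h)\<^sup>2 + 1)"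
  have "\<epsilon>' > 0" using e by (simp add: \<epsilon>'_def add_nonneg_pos)
  then obtain d where d: "wL2 d" "wL2 (\<lambda>\<tau>. indicator (Omega l) \<tau> *\<^sub>R tail_prim d \<tau>)"
     "N2 (\<lambda>\<tau>. k \<tau> - indicator (Omega l) \<tau> *\<^sub>R tail_prim d \<tau>) \<le> ennreal \<epsilon>'" using k unfolding approximable_def by blast
  have t: "tail_prim (\<lambda>\<tau>. d \<tau> *\<^sub>R h) \<tau> = tail_prim d \<tau> *\<^sub>R h" for \<tau>
    using wL2_integrable[OF d(1)] unfolding tail_prim_def set_lebesgue_integral_def
    by (subst scaleR_minus_left, subst integral_scaleR_left[symmetric]) (auto intro!: integrable_mult_indicator[of _ _ d, simplified])
  have "N2 (\<lambda>\<tau>. (k \<tau> - indicator (Omega l) \<tau> *\<^sub>R tail_prim d \<tau>) *\<^sub>R h) \<le> ennreal ((norm h)\<^sup>2) * ennreal \<epsilon>'"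
    by (subst N) (use wL2_meas[OF wL2_diff[OF wk d(2)]] d(3) in \<open>auto intro: mult_left_mono\<close>)
  also have "\<dots> = ennreal ((norm h)\<^sup>2 * \<epsilon>')" by (simp add: ennreal_mult')
  also have "(norm h)\<^sup>2 * \<epsilon>' \<le> \<epsilon>"
  proof -
    have "(norm h)\<^sup>2 + 1 > 0" by (simp add: add_nonneg_pos)
    then show ?thesis using e by (simp add: \<epsilon>'_def pos_divide_le_eq algebra_simps)
  qed
  finally have "N2 (\<lambda>\<tau>. (k \<tau> - indicator (Omega l) \<tau> *\<^sub>R tail_prim d \<tau>) *\<^sub>R h) \<le> ennreal \<epsilon>" by (simp add: ennreal_leI)
  moreover have "(\<lambda>\<tau>. (k \<tau> - indicator (Omega l) \<tau> *\<^sub>R tail_prim d \<tau>) *\<^sub>R h) = (\<lambda>\<tau>. k \<tau> *\<^sub>R h - indicator (Omega l) \<tau> *\<^sub>R tail_prim (\<lambda>\<tau>. d \<tau> *\<^sub>R h) \<tau>)"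
    by (simp add: t fun_eq_iff scaleR_diff_left)
  moreover have "wL2 (\<lambda>\<tau>. indicator (Omega l) \<tau> *\<^sub>R tail_prim (\<lambda>\<tau>. d \<tau> *\<^sub>R h) \<tau>)" using W[OF d(2)] by (simp add: t)
  ultimately show "\<exists>d. wL2 d \<and> wL2 (\<lambda>\<tau>. indicator (Omega l) \<tau> *\<^sub>R tail_prim d \<tau>) \<and>
     N2 (\<lambda>\<tau>. k \<tau> *\<^sub>R h - indicator (Omega l) \<tau> *\<^sub>R tail_prim d \<tau>) \<le> ennreal \<epsilon>" using W[OF d(1)] by metis
qed

text \<open>The two tail integrals cancel except over a window of length h: the tail primitive of a
  forward difference quotient is the Steklov average, which approximates k and has a bounded
  derivative.\<close>

lemma tail_prim_difference_quotient:
  fixes k :: "real \<Rightarrow> real"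
  assumes k: "continuous_on UNIV k" and supp: "\<And>x. x \<notin> {p..q} \<Longrightarrow> k x = 0" and h: "h > 0"
  shows "tail_prim (\<lambda>s. (k (s + h) - k s) / h) \<tau> = (LINT s:{\<tau>..<\<tau> + h}|lborel. k s) / h"
proof -
  have ki: "integrable lborel k"
  proof -
    have "set_integrable lborel {p..q} k" by (rule borel_integrable_atLeastAtMost') (rule continuous_on_subset[OF k], simp)
    moreover have "(\<lambda>x. indicator {p..q} x *\<^sub>R k x) = k" using supp by (auto simp: indicator_def fun_eq_iff)
    ultimately show ?thesis by (simp add: set_integrable_def)
  qed
  have kih: "integrable lborel (\<lambda>s. k (h + s))" using lborel_integrable_real_affine[OF ki, of 1 h] by simp
  have "(LINT s:{\<tau>..}|lborel. (k (s + h) - k s) / h) = ((LINT s:{\<tau>..}|lborel. k (h + s)) - (LINT s:{\<tau>..}|lborel. k s)) / h"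
  proof -
    have "(LINT s:{\<tau>..}|lborel. (k (s + h) - k s) / h) = (LINT s:{\<tau>..}|lborel. k (h + s) - k s) / h"
      by (simp add: add.commute)
    also have "(LINT s:{\<tau>..}|lborel. k (h + s) - k s) = (LINT s:{\<tau>..}|lborel. k (h + s)) - (LINT s:{\<tau>..}|lborel. k s)"
      by (rule set_integral_diff) (use ki kih in \<open>auto simp: set_integrable_def intro!: integrable_mult_indicator[where 'b=real, simplified]\<close>)
    finally show ?thesis .
  qed
  also have "(LINT s:{\<tau>..}|lborel. k (h + s)) = (LINT s:{\<tau> + h..}|lborel. k s)"
  proof -
    have "(LINT s:{\<tau> + h..}|lborel. k s) = (LINT s|lborel. indicator {\<tau> + h..} (h + 1 * s) *\<^sub>R k (h + 1 * s))"
      unfolding set_lebesgue_integral_def using lborel_integral_real_affine[of 1 "\<lambda>s. indicator {\<tau> + h..} s *\<^sub>R k s" h] by simp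
    also have "\<dots> = (LINT s:{\<tau>..}|lborel. k (h + s))"
      unfolding set_lebesgue_integral_def by (intro Bochner_Integration.integral_cong) (auto simp: indicator_def)
    finally show ?thesis by simp
  qed
  also have "(LINT s:{\<tau>..}|lborel. k s) = (LINT s:{\<tau>..<\<tau> + h}|lborel. k s) + (LINT s:{\<tau> + h..}|lborel. k s)"
  proof -
    have "{\<tau>..} = {\<tau>..<\<tau> + h} \<union> {\<tau> + h..}" using h by auto
    then show ?thesis by (simp only:) (rule set_integral_Un, use ki in \<open>auto simp: set_integrable_def intro!: integrable_mult_indicator[where 'b=real, simplified]\<close>)
  qed
  also have "(x - (y + x)) / h = - (y / h)" for x y :: real by (simp add: diff_divide_distrib add_divide_distrib)
  finally show ?thesis by (simp only: tail_prim_def minus_minus)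
qed

lemma approximable_continuous:
  fixes k :: "real \<Rightarrow> real"
  assumes k: "continuous_on UNIV k" and supp: "\<And>x. x \<notin> {p..q} \<Longrightarrow> k x = 0"
    and pq: "0 < p" "p \<le> q" "q \<in> Omega l"
  shows "approximable k"
  unfolding approximable_def
proof (intro conjI allI impI)
  have km[measurable]: "k \<in> borel_measurable borel" using k by (rule borel_measurable_continuous_onI)
  obtain C where C: "C \<ge> 0" "\<And>x. x \<in> {p..q} \<Longrightarrow> norm (k x) \<le> C"
    using continuous_on_Icc_bounded[OF continuous_on_subset[OF k]] by (metis subset_UNIV)
  have Ck: "norm (k x) \<le> C" for x using C supp[of x] by (cases "x \<in> {p..q}") auto
  show "wL2 k" by (rule wL2_bounded_support[OF km Ck supp pq])
  fix \<epsilon> :: real assume e: "\<epsilon> > 0"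
  have mq: "\<mu> q > 0" using mu_pos pq by blast
  \<comment> \<open>An error of size \<delta> supported in {p/2..q} has squared norm at most
    \<delta>^2 (q - p/2)/(\<mu> q) \<le> \<delta>^2 c, so \<delta> is chosen with \<delta>^2 c =
    \<epsilon>.\<close>
  define c where "c = q / \<mu> q"
  have c: "c > 0" using mq pq by (simp add: c_def)
  define \<delta> where "\<delta> = sqrt (\<epsilon> / c)"
  have \<delta>: "\<delta> > 0" "\<delta>\<^sup>2 * c = \<epsilon>" using e c by (auto simp: \<delta>_def)
  have "uniformly_continuous_on {p/2..q + 1} k"
    by (rule compact_uniformly_continuous) (use k in \<open>auto intro: continuous_on_subset\<close>)
  then obtain r where r: "r > 0" "\<And>x y. x \<in> {p/2..q + 1} \<Longrightarrow> y \<in> {p/2..q + 1} \<Longrightarrow> dist y x < r \<Longrightarrow> dist (k y) (k x) < \<delta>"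
    using \<delta>(1) unfolding uniformly_continuous_on_def by metis
  \<comment> \<open>h < r serves uniform continuity, h \<le> p/2 keeps the average supported in
    {p/2..q} and thus away from 0, and h \<le> 1 keeps the window inside {p/2..q + 1}.\<close>
  define h where "h = min (min (r / 2) (p / 2)) 1"
  have h: "h > 0" "h < r" "h \<le> p / 2" "h \<le> 1" using r pq by (auto simp: h_def)
  define d where "d s = (k (s + h) - k s) / h" for s
  have dm[measurable]: "d \<in> borel_measurable borel" by (simp add: d_def[abs_def])
  have dsupp: "d x = 0" if "x \<notin> {p/2..q}" for x
    using supp[of x] supp[of "x + h"] that h pq by (auto simp: d_def)
  have dbd: "norm (d x) \<le> 2 * C / h" for x
  proof -
    have "norm (k (x + h) - k x) \<le> 2 * C" using norm_triangle_ineq4[of "k (x + h)" "k x"] Ck[of x] Ck[of "x + h"] by linarith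
    then show ?thesis using h(1) by (simp add: d_def divide_right_mono)
  qed
  have p2: "0 < p/2" "p/2 \<le> q" using pq by auto
  have wd: "wL2 d" by (rule wL2_bounded_support(1)[OF dm dbd dsupp p2 pq(3)])
  have di: "integrable lborel d" by (rule wL2_integrable[OF wd])
  have tp: "tail_prim d \<tau> = (LINT s:{\<tau>..<\<tau> + h}|lborel. k s) / h" for \<tau>
    unfolding d_def[abs_def] by (rule tail_prim_difference_quotient[OF k supp h(1)])
  have tsupp: "tail_prim d \<tau> = 0" if "\<tau> \<notin> {p/2..q}" for \<tau>
  proof -
    have "(LINT s:{\<tau>..<\<tau> + h}|lborel. k s) = (LINT s:{\<tau>..<\<tau> + h}|lborel. 0)"
      by (rule set_lebesgue_integral_cong) (use that h pq supp in \<open>auto intro!: supp\<close>)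
    then show ?thesis unfolding tp by (simp add: set_lebesgue_integral_def)
  qed
  have ind: "indicator (Omega l) \<tau> *\<^sub>R tail_prim d \<tau> = tail_prim d \<tau>" for \<tau>
    using tsupp[of \<tau>] Omega_down[OF pq(3), of \<tau>] p2 by (cases "\<tau> \<in> {p/2..q}") auto
  have tm[measurable]: "tail_prim d \<in> borel_measurable borel"
    using tail_prim_continuous[OF di] by (rule borel_measurable_continuous_onI)
  have wt: "wL2 (tail_prim d)"
    by (rule wL2_bounded_support(1)[OF tm tail_prim_norm[OF di] tsupp p2 pq(3)])
  have diff: "norm (k \<tau> - tail_prim d \<tau>) \<le> \<delta>" for \<tau>
  proof (cases "\<tau> \<in> {p/2..q}")
    case True
    have si: "set_integrable lborel {\<tau>..<\<tau> + h} k"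
      by (rule set_integrable_subset[OF borel_integrable_atLeastAtMost'[of \<tau> "\<tau> + h" k]]) (use k in \<open>auto intro: continuous_on_subset\<close>)
    have ci: "set_integrable lborel {\<tau>..<\<tau> + h} (\<lambda>_. k \<tau>)" using h by (simp add: set_integrable_def)
    have ci2: "set_integrable lborel {\<tau>..<\<tau> + h} (\<lambda>_. \<delta>)" using h by (simp add: set_integrable_def)
    have "k \<tau> - tail_prim d \<tau> = (LINT s:{\<tau>..<\<tau> + h}|lborel. k \<tau> - k s) / h"
      unfolding tp by (subst set_integral_diff(2)[OF ci si]) (use h in \<open>simp add: set_lebesgue_integral_def field_simps\<close>)
    moreover have "norm (LINT s:{\<tau>..<\<tau> + h}|lborel. k \<tau> - k s) \<le> (LINT s:{\<tau>..<\<tau> + h}|lborel. \<delta>)"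
    proof -
      have "norm (LINT s:{\<tau>..<\<tau> + h}|lborel. k \<tau> - k s) \<le> (LINT s:{\<tau>..<\<tau> + h}|lborel. norm (k \<tau> - k s))"
        by (rule set_integral_norm_bound) (rule set_integral_diff(1)[OF ci si])
      also have "\<dots> \<le> (LINT s:{\<tau>..<\<tau> + h}|lborel. \<delta>)"
      proof (rule set_integral_mono)
        show "set_integrable lborel {\<tau>..<\<tau> + h} (\<lambda>s. norm (k \<tau> - k s))"
          by (rule set_integrable_norm) (rule set_integral_diff(1)[OF ci si])
        fix s assume s: "s \<in> {\<tau>..<\<tau> + h}"
        have "dist (k \<tau>) (k s) < \<delta>" by (rule r(2)) (use s True h in \<open>auto simp: dist_real_def\<close>)
        then show "norm (k \<tau> - k s) \<le> \<delta>" by (simp add: dist_norm)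
      qed (rule ci2)
      finally show ?thesis .
    qed
    moreover have "(LINT s:{\<tau>..<\<tau> + h}|lborel. \<delta>) = h * \<delta>" using h by (simp add: set_lebesgue_integral_def)
    ultimately show ?thesis using h(1) by (simp add: divide_le_eq mult.commute)
  next
    case False
    then have "k \<tau> = 0" using supp[of \<tau>] p2 pq by auto
    then show ?thesis using tsupp[OF False] \<delta> by simp
  qed
  have "N2 (\<lambda>\<tau>. k \<tau> - tail_prim d \<tau>) \<le> ennreal (\<delta>\<^sup>2 * ((q - p/2) / \<mu> q))"
  proof (rule wL2_bounded_support(2)[OF _ diff _ p2 pq(3)])
    show "k x - tail_prim d x = 0" if "x \<notin> {p/2..q}" for x using tsupp[OF that] supp[of x] that pq by auto
  qed simp
  also have "\<delta>\<^sup>2 * ((q - p/2) / \<mu> q) \<le> \<delta>\<^sup>2 * c"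
    unfolding c_def by (intro mult_left_mono divide_right_mono) (use pq mq in auto)
  finally have "N2 (\<lambda>\<tau>. k \<tau> - tail_prim d \<tau>) \<le> ennreal \<epsilon>" using \<delta> by (simp add: ennreal_leI)
  then show "\<exists>d. wL2 d \<and> wL2 (\<lambda>\<tau>. indicator (Omega l) \<tau> *\<^sub>R tail_prim d \<tau>) \<and>
     N2 (\<lambda>\<tau>. k \<tau> - indicator (Omega l) \<tau> *\<^sub>R tail_prim d \<tau>) \<le> ennreal \<epsilon>"
    using wd wt by (intro exI[of _ d]) (simp only: ind simp_thms)
qed

lemma N2_tendsto_zero:
  fixes b :: "nat \<Rightarrow> real \<Rightarrow> 'b::{banach, second_countable_topology}" and w :: "real \<Rightarrow> real"
  assumes m[measurable]: "\<And>n. b n \<in> borel_measurable borel" and w: "wL2 w"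
    and bd: "\<And>n x. norm (b n x) \<le> norm (w x)" and lim: "AE x in lborel. (\<lambda>n. b n x) \<longlonglongrightarrow> 0"
  shows "(\<lambda>n. N2 (b n)) \<longlonglongrightarrow> 0"
proof -
  have [measurable]: "w \<in> borel_measurable borel" using w by (rule wL2_meas)
  have "(\<lambda>n. N2 (b n)) \<longlonglongrightarrow> (\<integral>\<^sup>+ x. 0 \<partial>(lborel :: real measure))"
    unfolding N2_def
  proof (rule nn_integral_dominated_convergence[where w="\<lambda>x. ennreal ((norm (w x))\<^sup>2 / \<mu> x)"])
    show "(\<integral>\<^sup>+ x. ennreal ((norm (w x))\<^sup>2 / \<mu> x) \<partial>lborel) < \<infinity>" using w by (simp add: wL2_def N2_def)
    show "AE x in lborel. ennreal ((norm (b n x))\<^sup>2 / \<mu> x) \<le> ennreal ((norm (w x))\<^sup>2 / \<mu> x)" for n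
      by (intro AE_I2 ennreal_leI divide_right_mono power_mono bd) auto
    show "AE x in lborel. (\<lambda>n. ennreal ((norm (b n x))\<^sup>2 / \<mu> x)) \<longlonglongrightarrow> 0"
      using lim
    proof eventually_elim
      case (elim x)
      have "(\<lambda>n. (norm (b n x))\<^sup>2 / \<mu> x) \<longlonglongrightarrow> (norm (0::'b))\<^sup>2 / \<mu> x"
      proof (cases "\<mu> x = 0")
        case False show ?thesis by (intro tendsto_intros elim False)
      qed simp
      then have "(\<lambda>n. ennreal ((norm (b n x))\<^sup>2 / \<mu> x)) \<longlonglongrightarrow> ennreal ((norm (0::'b))\<^sup>2 / \<mu> x)" by (rule tendsto_ennrealI)
      then show ?case by simp
    qed
  qed auto
  then show ?thesis by simp
qed

lemma N2_eventually_le: "(\<lambda>n. N2 (b n)) \<longlonglongrightarrow> 0 \<Longrightarrow> \<epsilon> > 0 \<Longrightarrow> \<exists>n. N2 (b n) \<le> ennreal \<epsilon>"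
proof -
  assume "(\<lambda>n. N2 (b n)) \<longlonglongrightarrow> 0" "\<epsilon> > 0"
  then have "\<forall>\<^sub>F n in sequentially. N2 (b n) < ennreal \<epsilon>" by (intro order_tendstoD(2)) auto
  then obtain n where "N2 (b n) < ennreal \<epsilon>" by (auto simp: eventually_sequentially)
  then show ?thesis by (intro exI[of _ n]) simp
qed

text \<open>Measurability provides continuous functions converging a.e. to the indicator. They are
  truncated to [0,1] and cut off to a common compact part of Omega, where the weight is bounded;
  dominated convergence does the rest.\<close>

lemma approximable_indicator:
  assumes E[measurable]: "E \<in> sets borel" and Epq: "E \<subseteq> {p..q}" and pq: "0 < p" "p \<le> q" "q \<in> Omega l"
  shows "approximable (indicator E :: real \<Rightarrow> real)"
proof -
  obtain q' where q': "q < q'" "q' \<in> Omega l"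
  proof -
    obtain e where e: "e > 0" "ball q e \<subseteq> Omega l" using Omega_open pq(3) open_contains_ball by blast
    then have "q + e/2 \<in> Omega l" by (auto simp: dist_real_def subset_iff)
    then show thesis using that[of "q + e/2"] e by simp
  qed
  define p' where "p' = p / 2"
  have p': "0 < p'" "p' < p" "p' \<le> q'" using pq q' by (auto simp: p'_def)
  have "(indicator E :: real \<Rightarrow> real) measurable_on UNIV"
    by (rule lebesgue_measurable_imp_measurable_on[OF borel_measurable_indicator]) auto
  then obtain N g where N: "negligible N" "\<And>n. continuous_on UNIV (g n)"
     "\<And>x. x \<notin> N \<Longrightarrow> (\<lambda>n. g n x) \<longlonglongrightarrow> (indicator E x :: real)" unfolding measurable_on_def by auto
  \<comment> \<open>Piecewise linear cut-off: 1 on {p..q}, 0 outside {p'..q'}.\<close>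
  define \<theta> where "\<theta> x = max 0 (min 1 (min ((x - p') / (p - p')) ((q' - x) / (q' - q))))" for x
  have \<theta>c: "continuous_on UNIV \<theta>" unfolding \<theta>_def by (intro continuous_intros) (use p' q' in auto)
  have \<theta>1: "\<theta> x = 1" if "x \<in> {p..q}" for x using that p' q' by (auto simp: \<theta>_def min_def max_def field_simps)
  have \<theta>0: "\<theta> x = 0" if "x \<notin> {p'..q'}" for x
  proof -
    have "(x - p') / (p - p') < 0 \<or> (q' - x) / (q' - q) < 0" using that p' q' by (auto simp: divide_less_0_iff)
    then show ?thesis by (auto simp: \<theta>_def)
  qed
  have \<theta>b: "0 \<le> \<theta> x" "\<theta> x \<le> 1" for x by (auto simp: \<theta>_def)
  define k where "k n x = max 0 (min 1 (g n x)) * \<theta> x" for n x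
  have kc: "continuous_on UNIV (k n)" for n unfolding k_def by (intro continuous_intros N \<theta>c)
  have k0: "k n x = 0" if "x \<notin> {p'..q'}" for n x using \<theta>0[OF that] by (simp add: k_def)
  have kb: "0 \<le> k n x" "k n x \<le> 1" for n x using \<theta>b[of x] by (auto simp: k_def intro!: mult_le_one)
  have klim: "(\<lambda>n. k n x) \<longlonglongrightarrow> indicator E x" if "x \<notin> N" for x
  proof -
    have "(\<lambda>n. max 0 (min 1 (g n x)) * \<theta> x) \<longlonglongrightarrow> max 0 (min 1 (indicator E x)) * \<theta> x"
      by (intro tendsto_intros N that)
    moreover have "max 0 (min 1 (indicator E x)) * \<theta> x = indicator E x" using \<theta>1[of x] Epq by (auto simp: indicator_def)
    ultimately show ?thesis unfolding k_def by (simp only:)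
  qed
  have [measurable]: "k n \<in> borel_measurable borel" for n using kc by (rule borel_measurable_continuous_onI)
  have wI: "wL2 (indicator {p'..q'} :: real \<Rightarrow> real)"
    by (rule wL2_bounded_support(1)[where C=1 and p=p' and q=q']) (use p' q' in \<open>auto simp: indicator_def\<close>)
  have wE: "wL2 (indicator E :: real \<Rightarrow> real)"
    by (rule wL2_bounded_support(1)[where C=1 and p=p and q=q]) (use pq Epq in \<open>auto simp: indicator_def\<close>)
  have "(\<lambda>n. N2 (\<lambda>x. indicator E x - k n x)) \<longlonglongrightarrow> 0"
  proof (rule N2_tendsto_zero[OF _ wI])
    show "norm (indicator E x - k n x) \<le> norm (indicator {p'..q'} x :: real)" for n x
      using kb[of n x] k0[of x n] Epq p' q' by (cases "x \<in> {p'..q'}") (auto simp: indicator_def)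
    have "AE x in lborel. x \<notin> N"
      using N(1) by (subst AE_completion_iff[symmetric]) (auto simp: negligible_iff_null_sets dest: AE_not_in)
    then show "AE x in lborel. (\<lambda>n. indicator E x - k n x) \<longlonglongrightarrow> 0"
    proof eventually_elim
      case (elim x) show ?case using tendsto_diff[OF tendsto_const klim[OF elim], of "indicator E x"] by simp
    qed
  qed simp
  then have "\<exists>n. N2 (\<lambda>x. indicator E x - k n x) \<le> ennreal \<epsilon>" if "\<epsilon> > 0" for \<epsilon>
    using N2_eventually_le[of "\<lambda>n x. indicator E x - k n x"] that by simp
  moreover have "approximable (k n)" for n
    by (rule approximable_continuous[OF kc k0 p'(1,3) q'(2)])
  ultimately show ?thesis by (intro approximable_closed wE) blast
qed

lemma approximable_sum:
  fixes f :: "'c \<Rightarrow> real \<Rightarrow> 'b::{banach, second_countable_topology}"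
  assumes "finite I" "\<And>i. i \<in> I \<Longrightarrow> approximable (f i)" shows "approximable (\<lambda>x. \<Sum>i\<in>I. f i x)"
  using assms
proof (induction I rule: finite_induct)
  case empty
  have "approximable (\<lambda>\<tau>. indicator {} \<tau> *\<^sub>R (0::'b))"
  proof (rule approximable_scaled_vector)
    obtain q where "q \<in> Omega l"
    proof -
      obtain q where "0 < q" "ereal q < l" using l ereal_dense2[of 0 l] by (auto simp: zero_ereal_def)
      then show thesis using that by (auto simp: Omega_def)
    qed
    then show "approximable (indicator {} :: real \<Rightarrow> real)" by (intro approximable_indicator[where p=q and q=q]) (auto dest: Omega_pos)
  qed
  then show ?case by simp
next
  case (insert i I) then show ?case using approximable_add[of "f i" "\<lambda>x. \<Sum>i\<in>I. f i x"] by simp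
qed

theorem approximable_wL2:
  fixes b :: "real \<Rightarrow> 'b::{banach, second_countable_topology}"
  assumes b: "wL2 b" shows "approximable b"
proof (rule approximable_closed[OF b])
  fix \<epsilon> :: real assume \<epsilon>: "\<epsilon> > 0"
  have bm[measurable]: "b \<in> borel_measurable borel" using b by (rule wL2_meas)
  obtain s where s: "\<And>i. simple_function borel (s i)" "\<And>x. (\<lambda>i. s i x) \<longlonglongrightarrow> b x" "\<And>i x. dist (s i x) 0 \<le> 2 * dist (b x) 0"
    using borel_measurable_implies_sequence_metric[OF bm, of 0] by auto
  \<comment> \<open>Exhaustion of Omega by sets that keep distance 1/(n+1) from 0 and from l and are
    bounded by n+1; one formula serves finite and infinite l.\<close>
  define J where "J n = {x \<in> Omega l. 1 / real (Suc n) \<le> x \<and> x \<le> real (Suc n) \<and> ereal (x + 1 / real (Suc n)) \<le> l}" for n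
  have Jm[measurable]: "J n \<in> sets borel" for n
  proof -
    have "J n = Omega l \<inter> {1 / real (Suc n)..real (Suc n)} \<inter> {x. ereal (x + 1 / real (Suc n)) \<le> l}" by (auto simp: J_def)
    moreover have "{x. ereal (x + 1 / real (Suc n)) \<le> l} \<in> sets borel" by measurable
    ultimately show ?thesis by simp
  qed
  have Jpq: "\<exists>p q. J n \<subseteq> {p..q} \<and> 0 < p \<and> p \<le> q \<and> q \<in> Omega l" for n
  proof (cases "J n = {}")
    case True
    obtain q where "0 < q" "ereal q < l" using l ereal_dense2[of 0 l] by (auto simp: zero_ereal_def)
    then show ?thesis using True by (intro exI[of _ q]) (auto simp: Omega_def)
  next
    case False
    define q where "q = (case l of ereal L \<Rightarrow> min (real (Suc n)) (L - 1 / real (Suc n)) | _ \<Rightarrow> real (Suc n))"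
    have up: "x \<le> q" if "x \<in> J n" for x using that by (cases l) (auto simp: J_def q_def)
    obtain x where x: "x \<in> J n" using False by blast
    have "1 / real (Suc n) \<le> q" using up[OF x] x by (auto simp: J_def)
    moreover have "0 < 1 / real (Suc n)" by simp
    moreover have "q \<in> Omega l"
    proof -
      have "q > 0" using \<open>1 / real (Suc n) \<le> q\<close> \<open>0 < 1 / real (Suc n)\<close> by linarith
      moreover have "ereal q < l" using l
      proof (cases l)
        case (real L)
        have "q \<le> L - 1 / real (Suc n)" by (simp add: q_def real)
        also have "\<dots> < L" by simp
        finally show ?thesis by (simp add: real)
      qed auto
      ultimately show ?thesis by (simp add: Omega_def)
    qed
    ultimately show ?thesis using up by (intro exI[of _ "1 / real (Suc n)"] exI[of _ q]) (auto simp: J_def)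
  qed
  have Jlim: "\<forall>\<^sub>F n in sequentially. x \<in> J n" if x: "x \<in> Omega l" for x
  proof -
    have x0: "x > 0" using Omega_pos[OF x] .
    obtain e where e: "e > 0" "ereal (x + e) \<le> l"
    proof -
      obtain z where "x < z" "ereal z < l" using x ereal_dense2[of "ereal x" l] by (auto simp: Omega_def)
      then show thesis using that[of "z - x"] by auto
    qed
    obtain m where m: "1 / real (Suc m) < min e x" using nat_approx_posE[of "min e x"] e x0 by auto
    obtain m' where m': "x < real m'" using reals_Archimedean2 by blast
    have "x \<in> J n" if n: "n \<ge> max m m'" for n
    proof -
      have "1 / real (Suc n) \<le> 1 / real (Suc m)" using n by (simp add: frac_le)
      then have "1 / real (Suc n) \<le> e" "1 / real (Suc n) \<le> x" using m by linarith+
      moreover have "ereal (x + 1 / real (Suc n)) \<le> l"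
        by (rule order_trans[OF _ e(2)]) (use \<open>1 / real (Suc n) \<le> e\<close> in \<open>simp del: of_nat_Suc\<close>)
      moreover have "x \<le> real (Suc n)" using m' n by simp
      ultimately show ?thesis using x by (simp add: J_def del: of_nat_Suc)
    qed
    then show ?thesis unfolding eventually_sequentially by blast
  qed
  define t where "t n x = indicator (J n) x *\<^sub>R s n x" for n x
  have [measurable]: "s n \<in> borel_measurable borel" for n by (rule borel_measurable_simple_function[OF s(1)])
  \<comment> \<open>The simple functions satisfy |s| \<le> 2|b|, so 3|b| dominates the
    differences.\<close>
  have wb3: "wL2 (\<lambda>x. 3 * norm (b x))"
  proof -
    have "N2 (\<lambda>x. 3 * norm (b x)) = (\<integral>\<^sup>+ x. ennreal 9 * ennreal ((norm (b x))\<^sup>2 / \<mu> x) \<partial>lborel)"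
      unfolding N2_def by (rule nn_integral_cong) (simp add: power_mult_distrib ennreal_mult'[symmetric] flip: ennreal_numeral)
    also have "\<dots> = ennreal 9 * N2 b" unfolding N2_def by (rule nn_integral_cmult) measurable
    also have "\<dots> < \<infinity>" using b by (simp add: wL2_def ennreal_mult_less_top)
    finally show ?thesis using b by (simp add: wL2_def)
  qed
  have "(\<lambda>n. N2 (\<lambda>x. b x - t n x)) \<longlonglongrightarrow> 0"
  proof (rule N2_tendsto_zero[OF _ wb3])
    show "norm (b x - t n x) \<le> norm (3 * norm (b x))" for n x
    proof -
      have "norm (b x - t n x) \<le> norm (b x) + norm (t n x)" by (rule norm_triangle_ineq4)
      moreover have "norm (t n x) \<le> norm (s n x)" by (simp add: t_def indicator_def)
      moreover have "norm (s n x) \<le> 2 * norm (b x)" using s(3)[of n x] by simp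
      ultimately show ?thesis by simp
    qed
    have "(\<lambda>n. b x - t n x) \<longlonglongrightarrow> 0" for x
    proof (cases "x \<in> Omega l")
      case True
      have "\<forall>\<^sub>F n in sequentially. b x - s n x = b x - t n x" using Jlim[OF True] by eventually_elim (simp add: t_def)
      moreover have "(\<lambda>n. b x - s n x) \<longlonglongrightarrow> 0" using tendsto_diff[OF tendsto_const s(2), of "b x" x] by simp
      ultimately show ?thesis by (rule Lim_transform_eventually[rotated])
    next
      case False
      then have "t n x = 0" for n by (simp add: t_def J_def)
      then show ?thesis using wL2_zero[OF b False] by simp
    qed
    then show "AE x in lborel. (\<lambda>n. b x - t n x) \<longlonglongrightarrow> 0" by simp
  qed (simp add: t_def[abs_def])
  then obtain n where n: "N2 (\<lambda>x. b x - t n x) \<le> ennreal \<epsilon>"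
    using N2_eventually_le[of "\<lambda>n x. b x - t n x"] \<epsilon> by blast
  obtain p q where pq: "J n \<subseteq> {p..q}" "0 < p" "p \<le> q" "q \<in> Omega l" using Jpq by blast
  have fin: "finite (range (s n))" using s(1)[of n] by (simp add: simple_function_def)
  have "t n = (\<lambda>x. \<Sum>y\<in>range (s n). indicator (J n \<inter> s n -` {y}) x *\<^sub>R y)"
  proof
    fix x
    have "(\<Sum>y\<in>range (s n). indicator (J n \<inter> s n -` {y}) x *\<^sub>R y) = (\<Sum>y\<in>range (s n). if s n x = y then indicator (J n) x *\<^sub>R y else 0)"
      by (rule sum.cong) (auto simp: indicator_def)
    also have "\<dots> = t n x" using fin by (simp add: t_def sum.delta)
    finally show "t n x = (\<Sum>y\<in>range (s n). indicator (J n \<inter> s n -` {y}) x *\<^sub>R y)" by simp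
  qed
  moreover have "approximable (\<lambda>x. \<Sum>y\<in>range (s n). indicator (J n \<inter> s n -` {y}) x *\<^sub>R y)"
  proof (rule approximable_sum[OF fin], rule approximable_scaled_vector, rule approximable_indicator[OF _ _ pq(2-4)])
    fix y
    have "s n -` {y} \<inter> space borel \<in> sets borel" by (rule measurable_sets[of _ _ borel]) auto
    then show "J n \<inter> s n -` {y} \<in> sets borel" by simp
    show "J n \<inter> s n -` {y} \<subseteq> {p..q}" using pq(1) by blast
  qed
  ultimately show "\<exists>a. approximable a \<and> N2 (\<lambda>\<tau>. b \<tau> - a \<tau>) \<le> ennreal \<epsilon>" using n by auto
qed

end

section \<open>Distributional derivatives\<close>
lemma test_fun_zero_outside: "test_fun U \<phi> \<Longrightarrow> x \<notin> U \<Longrightarrow> \<phi> x = 0"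
  unfolding test_fun_def by blast

text \<open>Integration by parts against a tail integral, as an instance of Fubini's theorem.\<close>
lemma integral_deriv_tail_prim:
  fixes d :: "real \<Rightarrow> 'b::{banach, second_countable_topology}"
  assumes d: "integrable lborel d" and dm[measurable]: "d \<in> borel_measurable borel"
    and D: "\<And>x. (\<phi> has_real_derivative \<phi>' x) (at x)" and c: "continuous_on UNIV \<phi>'"
    and supp: "\<And>x. x \<notin> {p..q} \<Longrightarrow> \<phi> x = 0" and supp': "\<And>x. x \<notin> {p..q} \<Longrightarrow> \<phi>' x = 0"
  shows "(LINT \<tau>|lborel. \<phi>' \<tau> *\<^sub>R tail_prim d \<tau>) = - (LINT \<sigma>|lborel. \<phi> \<sigma> *\<^sub>R d \<sigma>)"
proof -
  have [measurable]: "\<phi>' \<in> borel_measurable borel" using c by (rule borel_measurable_continuous_onI)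
  have i': "integrable lborel \<phi>'"
  proof -
    have "set_integrable lborel {p..q} \<phi>'" by (rule borel_integrable_atLeastAtMost') (rule continuous_on_subset[OF c], simp)
    moreover have "(\<lambda>x. indicator {p..q} x *\<^sub>R \<phi>' x) = \<phi>'" using supp' by (auto simp: indicator_def fun_eq_iff)
    ultimately show ?thesis by (simp add: set_integrable_def)
  qed
  have inner: "(LINT \<tau>|lborel. indicator {..\<sigma>} \<tau> *\<^sub>R \<phi>' \<tau>) = \<phi> \<sigma>" for \<sigma>
  proof -
    define a where "a = min p \<sigma> - 1"
    have "(LINT \<tau>|lborel. indicator {..\<sigma>} \<tau> *\<^sub>R \<phi>' \<tau>) = (LINT \<tau>|lborel. indicator {a..\<sigma>} \<tau> *\<^sub>R \<phi>' \<tau>)"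
      by (intro Bochner_Integration.integral_cong) (auto simp: a_def indicator_def min_def supp' split: if_splits)
    also have "\<dots> = \<phi> \<sigma> - \<phi> a"
    proof (rule integral_FTC_atLeastAtMost)
      show "a \<le> \<sigma>" by (simp add: a_def)
      show "(\<phi> has_vector_derivative \<phi>' x) (at x within {a..\<sigma>})" if "a \<le> x" "x \<le> \<sigma>" for x
        using D[of x] by (simp add: has_real_derivative_iff_has_vector_derivative has_vector_derivative_at_within)
      show "continuous_on {a..\<sigma>} \<phi>'" using c by (rule continuous_on_subset) simp
    qed
    also have "\<phi> a = 0" by (rule supp) (auto simp: a_def)
    finally show ?thesis by simp
  qed
  let ?f = "\<lambda>(\<tau>, \<sigma>). (indicator {\<tau>..} \<sigma> * \<phi>' \<tau>) *\<^sub>R d \<sigma>"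
  have ind: "indicator {\<tau>..} \<sigma> = (indicator {..\<sigma>} \<tau> :: real)" for \<tau> \<sigma> :: real by (simp add: indicator_def)
  have meas: "?f \<in> borel_measurable (lborel \<Otimes>\<^sub>M lborel)"
  proof -
    have "(\<lambda>x::real \<times> real. indicator {x. fst x \<le> snd x} x * \<phi>' (fst x)) \<in> borel_measurable (lborel \<Otimes>\<^sub>M lborel)"
      by measurable
    then have "(\<lambda>x::real \<times> real. (indicator {x. fst x \<le> snd x} x * \<phi>' (fst x)) *\<^sub>R d (snd x)) \<in> borel_measurable (lborel \<Otimes>\<^sub>M lborel)"
      by (intro borel_measurable_scaleR) simp_all
    moreover have "(\<lambda>x::real \<times> real. (indicator {x. fst x \<le> snd x} x * \<phi>' (fst x)) *\<^sub>R d (snd x)) = ?f"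
      by (auto simp: indicator_def fun_eq_iff)
    ultimately show ?thesis by simp
  qed
  have prod: "integrable (lborel \<Otimes>\<^sub>M lborel) ?f"
  proof (rule lborel_pair.Fubini_integrable[OF meas])
    have n: "norm (?f (\<tau>, \<sigma>)) = \<bar>\<phi>' \<tau>\<bar> * (indicator {\<tau>..} \<sigma> * norm (d \<sigma>))" for \<tau> \<sigma> by (simp add: abs_mult)
    have il: "integrable lborel (\<lambda>\<sigma>. indicator {\<tau>..} \<sigma> * norm (d \<sigma>))" for \<tau>
      using integrable_mult_indicator[OF _ integrable_norm[OF d], of "{\<tau>..}"] by simp
    show "integrable lborel (\<lambda>\<tau>. LINT \<sigma>|lborel. norm (?f (\<tau>, \<sigma>)))"
    proof (rule Bochner_Integration.integrable_bound)
      show "integrable lborel (\<lambda>\<tau>. \<phi>' \<tau> * (LINT \<sigma>|lborel. norm (d \<sigma>)))" using i' by simp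
      show "(\<lambda>\<tau>. LINT \<sigma>|lborel. norm (?f (\<tau>, \<sigma>))) \<in> borel_measurable lborel"
        by (rule lborel.borel_measurable_lebesgue_integral) (use measurable_compose[OF meas borel_measurable_norm] in \<open>simp add: split_beta'\<close>)
      show "AE \<tau> in lborel. norm (LINT \<sigma>|lborel. norm (?f (\<tau>, \<sigma>))) \<le> norm (\<phi>' \<tau> * (LINT \<sigma>|lborel. norm (d \<sigma>)))"
      proof (rule AE_I2)
        fix \<tau>
        have "(LINT \<sigma>|lborel. indicator {\<tau>..} \<sigma> * norm (d \<sigma>)) \<le> (LINT \<sigma>|lborel. norm (d \<sigma>))"
          by (rule integral_mono[OF il integrable_norm[OF d]]) (simp add: indicator_def)
        then have "\<bar>\<phi>' \<tau>\<bar> * (LINT \<sigma>|lborel. indicator {\<tau>..} \<sigma> * norm (d \<sigma>)) \<le> \<bar>\<phi>' \<tau>\<bar> * (LINT \<sigma>|lborel. norm (d \<sigma>))"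
          by (rule mult_left_mono) simp
        moreover have "0 \<le> (LINT \<sigma>|lborel. indicator {\<tau>..} \<sigma> * norm (d \<sigma>))" by simp
        moreover have "0 \<le> (LINT \<sigma>|lborel. norm (d \<sigma>))" by simp
        ultimately show "norm (LINT \<sigma>|lborel. norm (?f (\<tau>, \<sigma>))) \<le> norm (\<phi>' \<tau> * (LINT \<sigma>|lborel. norm (d \<sigma>)))"
          unfolding n by (simp add: abs_mult)
      qed
    qed
    show "AE \<tau> in lborel. integrable lborel (\<lambda>\<sigma>. ?f (\<tau>, \<sigma>))"
    proof (rule AE_I2)
      fix \<tau>
      have "integrable lborel (\<lambda>\<sigma>. \<phi>' \<tau> *\<^sub>R (indicator {\<tau>..} \<sigma> *\<^sub>R d \<sigma>))"
        by (intro integrable_scaleR_right integrable_mult_indicator d) simp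
      then show "integrable lborel (\<lambda>\<sigma>. ?f (\<tau>, \<sigma>))" by (simp add: mult.commute)
    qed
  qed
  have "(LINT \<tau>|lborel. \<phi>' \<tau> *\<^sub>R tail_prim d \<tau>) = - (LINT \<tau>|lborel. LINT \<sigma>|lborel. ?f (\<tau>, \<sigma>))"
  proof -
    have "\<phi>' \<tau> *\<^sub>R tail_prim d \<tau> = - (LINT \<sigma>|lborel. ?f (\<tau>, \<sigma>))" for \<tau>
    proof -
      have "(LINT \<sigma>|lborel. ?f (\<tau>, \<sigma>)) = (LINT \<sigma>|lborel. \<phi>' \<tau> *\<^sub>R (indicator {\<tau>..} \<sigma> *\<^sub>R d \<sigma>))"
        by (intro Bochner_Integration.integral_cong) (simp_all add: mult.commute)
      also have "\<dots> = \<phi>' \<tau> *\<^sub>R (LINT \<sigma>|lborel. indicator {\<tau>..} \<sigma> *\<^sub>R d \<sigma>)"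
        by (rule integral_scaleR_right)
      finally show ?thesis by (simp add: tail_prim_def set_lebesgue_integral_def)
    qed
    then show ?thesis by simp
  qed
  also have "(LINT \<tau>|lborel. LINT \<sigma>|lborel. ?f (\<tau>, \<sigma>)) = (LINT \<sigma>|lborel. LINT \<tau>|lborel. ?f (\<tau>, \<sigma>))"
    using lborel_pair.Fubini_integral[of "\<lambda>\<tau> \<sigma>. ?f (\<tau>, \<sigma>)"] prod by simp
  also have "\<dots> = (LINT \<sigma>|lborel. \<phi> \<sigma> *\<^sub>R d \<sigma>)"
  proof (intro Bochner_Integration.integral_cong refl)
    fix \<sigma>
    have "(LINT \<tau>|lborel. ?f (\<tau>, \<sigma>)) = (LINT \<tau>|lborel. (indicator {..\<sigma>} \<tau> *\<^sub>R \<phi>' \<tau>) *\<^sub>R d \<sigma>)"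
      by (intro Bochner_Integration.integral_cong) (simp_all add: ind)
    also have "\<dots> = (LINT \<tau>|lborel. indicator {..\<sigma>} \<tau> *\<^sub>R \<phi>' \<tau>) *\<^sub>R d \<sigma>"
      by (rule integral_scaleR_left) (intro integrable_mult_indicator i', simp)
    finally show "(LINT \<tau>|lborel. ?f (\<tau>, \<sigma>)) = \<phi> \<sigma> *\<^sub>R d \<sigma>" by (simp only: inner)
  qed
  finally show ?thesis .
qed

lemma integral_deriv_test_fun_tail_prim:
  fixes d :: "real \<Rightarrow> 'b::{banach, second_countable_topology}"
  assumes d: "integrable lborel d" "d \<in> borel_measurable borel" and t: "test_fun U \<phi>"
  shows "(LINT \<tau>|lborel. deriv \<phi> \<tau> *\<^sub>R tail_prim d \<tau>) = - (LINT \<sigma>|lborel. \<phi> \<sigma> *\<^sub>R d \<sigma>)"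
proof -
  obtain K where K: "compact K" "K \<subseteq> U" "\<And>x. x \<notin> K \<Longrightarrow> \<phi> x = 0" using t unfolding test_fun_def by blast
  obtain C where C: "\<And>x. x \<in> K \<Longrightarrow> \<bar>x\<bar> \<le> C" using compact_imp_bounded[OF K(1)] by (auto simp: bounded_iff)
  have z: "\<phi> x = 0" if "x \<notin> {-C..C}" for x using that C[of x] K(3)[of x] by fastforce
  have z': "deriv \<phi> x = 0" if "x \<notin> {-C..C}" for x
  proof -
    have "deriv \<phi> x = deriv (\<lambda>_. 0) x"
      by (rule deriv_cong_open[of "- {-C..C}"]) (use that z in \<open>auto intro: open_Compl\<close>)
    then show ?thesis by simp
  qed
  show ?thesis
    by (rule integral_deriv_tail_prim[OF d _ _ z z'])
       (use test_fun_DERIV[OF t] test_fun_continuous_on[OF test_fun_deriv[OF t]] in auto)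
qed

text \<open>The lemma of du Bois-Reymond.\<close>
theorem dist_deriv_zero_imp_const:
  fixes g :: "real \<Rightarrow> 'b::{banach, second_countable_topology}"
  assumes U: "open U" "U \<noteq> {}" and conv: "\<And>p q. p \<in> U \<Longrightarrow> q \<in> U \<Longrightarrow> {p..q} \<subseteq> U"
    and int: "\<And>\<phi>. test_fun U \<phi> \<Longrightarrow> integrable (lebesgue_on U) (\<lambda>x. \<phi> x *\<^sub>R g x)"
    and zero: "\<And>\<phi>. test_fun U \<phi> \<Longrightarrow> integral\<^sup>L (lebesgue_on U) (\<lambda>x. deriv \<phi> x *\<^sub>R g x) = 0"
  shows "\<exists>c. AE x in lborel. x \<in> U \<longrightarrow> g x = c"
proof -
  have Ul: "U \<in> sets lebesgue" using U by simp
  obtain p q where pq: "p < q" "{p..q} \<subseteq> U"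
  proof -
    obtain x where "x \<in> U" using U(2) by blast
    then obtain r where r: "r > 0" "cball x r \<subseteq> U" using U(1) open_contains_cball by blast
    then show thesis using that[of "x - r" "x + r"] by (simp add: cball_eq_atLeastAtMost)
  qed
  define \<phi>0 where "\<phi>0 = bump p q 1 1 0"
  have t0: "test_fun U \<phi>0" unfolding \<phi>0_def by (rule test_fun_bump) (use pq in auto)
  have ti: "integrable lborel \<phi>" if t: "test_fun U \<phi>" for \<phi>
  proof -
    obtain a b where ab: "a < b" "\<And>x. x \<notin> {a..b} \<Longrightarrow> \<phi> x = 0" using test_fun_support[OF t] by blast
    have "set_integrable lborel {a..b} \<phi>" by (rule borel_integrable_atLeastAtMost') (rule test_fun_continuous_on[OF t])
    moreover have "(\<lambda>x. indicator {a..b} x *\<^sub>R \<phi> x) = \<phi>" using ab by (auto simp: indicator_def fun_eq_iff)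
    ultimately show ?thesis by (simp add: set_integrable_def)
  qed
  have nn0: "\<phi>0 x \<ge> 0" for x by (simp add: \<phi>0_def bump_def)
  define Z where "Z = (LINT x|lborel. \<phi>0 x)"
  have Z: "Z \<noteq> 0"
  proof
    assume "Z = 0"
    then have "AE x in lborel. \<phi>0 x = 0"
      using integral_nonneg_eq_0_iff_AE[OF ti[OF t0]] nn0 by (simp add: Z_def)
    then have "AE x in lborel. x \<notin> {p<..<q}" by eventually_elim (auto simp: \<phi>0_def bump_def)
    then have "{p<..<q} \<in> null_sets lborel" by (subst AE_iff_null_sets) auto
    then show False using pq by (simp add: null_sets_def)
  qed
  \<comment> \<open>The candidate constant is the mean of g against the normalised bump.\<close>
  define c where "c = (1 / Z) *\<^sub>R integral\<^sup>L (lebesgue_on U) (\<lambda>x. \<phi>0 x *\<^sub>R g x)"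
  have bU: "integrable (lebesgue_on U) \<phi> \<and> integral\<^sup>L (lebesgue_on U) \<phi> = integral\<^sup>L lborel \<phi>" if t: "test_fun U \<phi>" for \<phi>
  proof -
    have eq: "(\<lambda>x. indicator U x *\<^sub>R \<phi> x) = \<phi>" using test_fun_zero_outside[OF t] by (auto simp: indicator_def fun_eq_iff)
    show ?thesis unfolding set_integral_lebesgue_on[OF Ul] eq
      using ti[OF t] test_fun_measurable[OF t] by (simp add: integrable_completion integral_completion)
  qed
  have "AE x in lborel. x \<in> U \<longrightarrow> g x - c = 0"
  proof (rule fundamental_lemma_test_fun)
    fix \<phi> assume t: "test_fun U \<phi>"
    have ic: "integrable (lebesgue_on U) (\<lambda>x. \<phi> x *\<^sub>R c)" using bU[OF t] by simp
    have "integrable (lebesgue_on U) (\<lambda>x. \<phi> x *\<^sub>R g x - \<phi> x *\<^sub>R c)"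
      by (rule Bochner_Integration.integrable_diff[OF int[OF t] ic])
    then show "integrable (lebesgue_on U) (\<lambda>x. \<phi> x *\<^sub>R (g x - c))" by (simp add: scaleR_diff_right)
    define I where "I = (LINT x|lborel. \<phi> x)"
    \<comment> \<open>Subtracting this multiple of the bump gives mean zero, so \<psi> is the
      derivative of a test function and the hypothesis applies to it.\<close>
    define \<psi> where "\<psi> x = \<phi> x - (I / Z) * \<phi>0 x" for x
    have t\<psi>: "test_fun U \<psi>" unfolding \<psi>_def by (rule test_fun_minus_scaled[OF t t0])
    have "(LINT x|lborel. \<psi> x) = 0"
      unfolding \<psi>_def using ti[OF t] ti[OF t0] Z by (simp add: I_def Z_def)
    then obtain \<Psi> where \<Psi>: "test_fun U \<Psi>" "deriv \<Psi> = \<psi>" using test_fun_primitive[OF t\<psi> conv] by blast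
    have "0 = integral\<^sup>L (lebesgue_on U) (\<lambda>x. \<psi> x *\<^sub>R g x)" using zero[OF \<Psi>(1)] \<Psi>(2) by simp
    also have "\<dots> = integral\<^sup>L (lebesgue_on U) (\<lambda>x. \<phi> x *\<^sub>R g x - (I / Z) *\<^sub>R (\<phi>0 x *\<^sub>R g x))"
      by (simp add: \<psi>_def scaleR_diff_left)
    also have "\<dots> = integral\<^sup>L (lebesgue_on U) (\<lambda>x. \<phi> x *\<^sub>R g x) - (I / Z) *\<^sub>R integral\<^sup>L (lebesgue_on U) (\<lambda>x. \<phi>0 x *\<^sub>R g x)"
      using int[OF t] int[OF t0] by (subst Bochner_Integration.integral_diff) (simp_all del: scaleR_scaleR)
    also have "(I / Z) *\<^sub>R integral\<^sup>L (lebesgue_on U) (\<lambda>x. \<phi>0 x *\<^sub>R g x) = integral\<^sup>L (lebesgue_on U) (\<lambda>x. \<phi> x *\<^sub>R c)"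
      using bU[OF t] by (simp add: c_def I_def)
    finally have "integral\<^sup>L (lebesgue_on U) (\<lambda>x. \<phi> x *\<^sub>R g x) - integral\<^sup>L (lebesgue_on U) (\<lambda>x. \<phi> x *\<^sub>R c) = 0" by simp
    then show "integral\<^sup>L (lebesgue_on U) (\<lambda>x. \<phi> x *\<^sub>R (g x - c)) = 0"
      using Bochner_Integration.integral_diff[OF int[OF t] ic] by (simp add: scaleR_diff_right)
  qed (rule U)
  then show ?thesis by (intro exI[of _ c]) simp
qed

section \<open>The generator\<close>
text \<open>Bridge from the completed measure of the definitions to Borel representatives, on which
  product measurability and Fubini's theorem are available.\<close>

lemma integral_lebesgue_eq_lborel:
  fixes f g :: "real \<Rightarrow> 'b::{banach, second_countable_topology}"
  assumes g: "g \<in> borel_measurable borel" and gi: "integrable lborel g" and ae: "AE x in lborel. f x = g x"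
  shows "integrable lebesgue f" "integral\<^sup>L lebesgue f = integral\<^sup>L lborel g"
proof -
  have gl: "g \<in> borel_measurable lebesgue" using g by (intro measurable_completion) simp
  have fl: "f \<in> borel_measurable lebesgue" by (rule lebesgue_measurable_cong_AE[OF gl ae])
  have ael: "AE x in lebesgue. f x = g x" using ae by (rule AE_completion)
  have g': "g \<in> borel_measurable lborel" using g by simp
  have gil: "integrable lebesgue g" using integrable_completion[OF g'] gi by simp
  show "integrable lebesgue f" using integrable_cong_AE[OF fl gl ael] gil by simp
  show "integral\<^sup>L lebesgue f = integral\<^sup>L lborel g"
    using integral_cong_AE[OF fl gl ael] integral_completion[OF g'] by simp
qed

context visco begin

lemma R_0: "R 0 = 0" using R_scale[of 0 0] by simp
lemma R_minus: "R (- x) = - R x" using R_scale[of "-1" x] by simp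

text \<open>b is a Borel representative of B xi, extended by 0. The history itself is fixed only
  a.e. on Omega, while b can be shifted, integrated over the line and used in product
  spaces.\<close>

definition prof :: "(real \<Rightarrow> 'h) \<Rightarrow> (real \<Rightarrow> 'h) \<Rightarrow> bool" where
  "prof \<xi> b \<longleftrightarrow> wL2 b \<and> (AE \<tau> in lborel. \<tau> \<in> Omega l \<longrightarrow> \<xi> \<tau> \<in> DB \<and> B (\<xi> \<tau>) = b \<tau>)"

lemma prof_wL2: "prof \<xi> b \<Longrightarrow> wL2 b" by (simp add: prof_def)
lemma prof_AE: "prof \<xi> b \<Longrightarrow> AE \<tau> in lborel. \<tau> \<in> Omega l \<longrightarrow> \<xi> \<tau> \<in> DB \<and> B (\<xi> \<tau>) = b \<tau>" by (simp add: prof_def)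
lemma prof_AE_R: "prof \<xi> b \<Longrightarrow> AE \<tau> in lborel. \<tau> \<in> Omega l \<longrightarrow> \<xi> \<tau> = R (b \<tau>)"
proof -
  assume "prof \<xi> b"
  then have "AE \<tau> in lborel. \<tau> \<in> Omega l \<longrightarrow> \<xi> \<tau> \<in> DB \<and> B (\<xi> \<tau>) = b \<tau>" by (rule prof_AE)
  then show ?thesis
  proof eventually_elim
    case (elim \<tau>) then show ?case by (metis R_B)
  qed
qed

lemma normV2_eq_N2:
  assumes ae: "AE \<tau> in lborel. \<tau> \<in> Omega l \<longrightarrow> norm (B (\<xi> \<tau>)) = norm (b \<tau>)" and b: "b \<in> borel_measurable borel"
    and z: "\<And>\<tau>. \<tau> \<notin> Omega l \<Longrightarrow> b \<tau> = 0"
  shows "normV2 l \<mu> B \<xi> = N2 b"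
proof -
  have "normV2 l \<mu> B \<xi> = (\<integral>\<^sup>+ \<tau>. ennreal ((norm (b \<tau>))\<^sup>2 / \<mu> \<tau>) \<partial>lebesgue)"
    unfolding normV2_def
  proof (rule nn_integral_cong_AE)
    have "AE \<tau> in lborel. indicator (Omega l) \<tau> * ennreal ((norm (B (\<xi> \<tau>)))\<^sup>2 / \<mu> \<tau>) = ennreal ((norm (b \<tau>))\<^sup>2 / \<mu> \<tau>)"
      using ae
    proof eventually_elim
      case (elim \<tau>) then show ?case using z[of \<tau>] by (cases "\<tau> \<in> Omega l") auto
    qed
    then show "AE \<tau> in lebesgue. indicator (Omega l) \<tau> * ennreal ((norm (B (\<xi> \<tau>)))\<^sup>2 / \<mu> \<tau>) = ennreal ((norm (b \<tau>))\<^sup>2 / \<mu> \<tau>)"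
      by (rule AE_completion)
  qed
  then show ?thesis by (simp add: N2_def nn_integral_completion)
qed

lemma prof_norm: "prof \<xi> b \<Longrightarrow> normV2 l \<mu> B \<xi> = N2 b"
proof (rule normV2_eq_N2)
  assume p: "prof \<xi> b"
  show "AE \<tau> in lborel. \<tau> \<in> Omega l \<longrightarrow> norm (B (\<xi> \<tau>)) = norm (b \<tau>)" using prof_AE[OF p] by eventually_elim auto
qed (auto simp: prof_def wL2_def)

lemma prof_ex: assumes "in_calV l \<mu> B DB \<xi>" shows "\<exists>b. prof \<xi> b"
proof -
  have "(\<lambda>\<tau>. B (\<xi> \<tau>)) \<in> borel_measurable (lebesgue_on (Omega l))" using assms by (simp add: in_calV_def)
  then have m: "(\<lambda>\<tau>. indicator (Omega l) \<tau> *\<^sub>R B (\<xi> \<tau>)) \<in> borel_measurable lebesgue"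
    using Omega_lebesgue by (subst (asm) borel_measurable_restrict_space_iff) auto
  obtain b0 where b0[measurable]: "b0 \<in> borel_measurable borel" and ae0: "AE \<tau> in lborel. indicator (Omega l) \<tau> *\<^sub>R B (\<xi> \<tau>) = b0 \<tau>"
    using completion_ex_borel_measurable_banach[OF m] by auto
  define b where "b \<tau> = indicator (Omega l) \<tau> *\<^sub>R b0 \<tau>" for \<tau>
  have bm: "b \<in> borel_measurable borel" by (simp add: b_def[abs_def])
  have ae: "AE \<tau> in lborel. \<tau> \<in> Omega l \<longrightarrow> B (\<xi> \<tau>) = b \<tau>" using ae0 by eventually_elim (auto simp: b_def)
  have DB: "AE \<tau> in lborel. \<tau> \<in> Omega l \<longrightarrow> \<xi> \<tau> \<in> DB"
    using assms AE_lebesgue_on_iff[OF Omega_lebesgue] by (simp add: in_calV_def)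
  have z: "b \<tau> = 0" if "\<tau> \<notin> Omega l" for \<tau> using that by (simp add: b_def)
  have "normV2 l \<mu> B \<xi> = N2 b" by (rule normV2_eq_N2[OF _ bm z]) (use ae in \<open>eventually_elim, auto\<close>)
  then have "wL2 b" using assms bm z by (simp add: wL2_def in_calV_def)
  moreover have "AE \<tau> in lborel. \<tau> \<in> Omega l \<longrightarrow> \<xi> \<tau> \<in> DB \<and> B (\<xi> \<tau>) = b \<tau>" using ae DB by eventually_elim auto
  ultimately show ?thesis unfolding prof_def by blast
qed

lemma borel_measurable_lebesgue_on_Omega:
  fixes f g :: "real \<Rightarrow> 'h"
  assumes g: "g \<in> borel_measurable borel" and ae: "AE \<tau> in lborel. \<tau> \<in> Omega l \<longrightarrow> f \<tau> = g \<tau>"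
  shows "f \<in> borel_measurable (lebesgue_on (Omega l))"
proof -
  have "(\<lambda>\<tau>. indicator (Omega l) \<tau> *\<^sub>R g \<tau>) \<in> borel_measurable borel" using g by simp
  then have "(\<lambda>\<tau>. indicator (Omega l) \<tau> *\<^sub>R g \<tau>) \<in> borel_measurable lebesgue" by (intro measurable_completion) simp
  moreover have "AE \<tau> in lborel. indicator (Omega l) \<tau> *\<^sub>R f \<tau> = indicator (Omega l) \<tau> *\<^sub>R g \<tau>"
    using ae by eventually_elim (auto simp: indicator_def)
  ultimately have "(\<lambda>\<tau>. indicator (Omega l) \<tau> *\<^sub>R f \<tau>) \<in> borel_measurable lebesgue" by (rule lebesgue_measurable_cong_AE)
  then show ?thesis using Omega_lebesgue by (subst borel_measurable_restrict_space_iff) auto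
qed

lemma prof_calV: assumes p: "prof \<xi> b" shows "in_calV l \<mu> B DB \<xi>"
proof -
  have w: "wL2 b" using p by (rule prof_wL2)
  have [measurable]: "b \<in> borel_measurable borel" using w by (rule wL2_meas)
  have "AE \<tau> in lborel. \<tau> \<in> Omega l \<longrightarrow> \<xi> \<tau> \<in> DB" using prof_AE[OF p] by eventually_elim auto
  moreover have "\<xi> \<in> borel_measurable (lebesgue_on (Omega l))"
    by (rule borel_measurable_lebesgue_on_Omega[OF _ prof_AE_R[OF p]]) measurable
  moreover have "(\<lambda>\<tau>. B (\<xi> \<tau>)) \<in> borel_measurable (lebesgue_on (Omega l))"
    by (rule borel_measurable_lebesgue_on_Omega[of b]) (use prof_AE[OF p] in \<open>measurable, eventually_elim, auto\<close>)
  moreover have "normV2 l \<mu> B \<xi> < \<infinity>" using prof_norm[OF p] w by (simp add: wL2_def)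
  ultimately show ?thesis by (simp add: in_calV_def AE_lebesgue_on_iff[OF Omega_lebesgue])
qed

lemma prof_lin: assumes "prof \<xi> b" "prof \<eta> d" shows "prof (\<lambda>\<tau>. p *\<^sub>R \<xi> \<tau> + q *\<^sub>R \<eta> \<tau>) (\<lambda>\<tau>. p *\<^sub>R b \<tau> + q *\<^sub>R d \<tau>)"
  unfolding prof_def
proof
  show "wL2 (\<lambda>\<tau>. p *\<^sub>R b \<tau> + q *\<^sub>R d \<tau>)" using assms by (intro wL2_lin prof_wL2)
  show "AE \<tau> in lborel. \<tau> \<in> Omega l \<longrightarrow> p *\<^sub>R \<xi> \<tau> + q *\<^sub>R \<eta> \<tau> \<in> DB \<and> B (p *\<^sub>R \<xi> \<tau> + q *\<^sub>R \<eta> \<tau>) = p *\<^sub>R b \<tau> + q *\<^sub>R d \<tau>"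
    using prof_AE[OF assms(1)] prof_AE[OF assms(2)]
    by eventually_elim (auto simp: B_add B_scale DB_add DB_scale)
qed

lemma prof_diff: "prof \<xi> b \<Longrightarrow> prof \<eta> d \<Longrightarrow> prof (\<lambda>\<tau>. \<xi> \<tau> - \<eta> \<tau>) (\<lambda>\<tau>. b \<tau> - d \<tau>)"
  using prof_lin[of \<xi> b \<eta> d 1 "-1"] by simp

lemma prof_add: "prof \<xi> b \<Longrightarrow> prof \<eta> d \<Longrightarrow> prof (\<lambda>\<tau>. \<xi> \<tau> + \<eta> \<tau>) (\<lambda>\<tau>. b \<tau> + d \<tau>)"
  using prof_lin[of \<xi> b \<eta> d 1 1] by simp

lemma prof_cong: "prof \<xi> b \<Longrightarrow> AE \<tau> in lborel. \<tau> \<in> Omega l \<longrightarrow> \<eta> \<tau> = \<xi> \<tau> \<Longrightarrow> prof \<eta> b"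
  unfolding prof_def by (auto elim: eventually_elim2)

lemma prof_R: "wL2 b \<Longrightarrow> prof (\<lambda>\<tau>. R (b \<tau>)) b" by (simp add: prof_def)

lemma prof_mu: "u \<in> DB \<Longrightarrow> prof (\<lambda>\<tau>. \<mu> \<tau> *\<^sub>R u) (\<lambda>\<tau>. \<mu> \<tau> *\<^sub>R B u)"
  using wL2_mu by (simp add: prof_def B_scale DB_scale)

lemma prof_0: "prof (\<lambda>\<tau>. 0) (\<lambda>\<tau>. 0)" using prof_mu[OF DB_0] by (simp add: B_0)

text \<open>B is unbounded and cannot be pulled out of an integral; instead xi = R b a.e., and the
  bounded R commutes with integration.\<close>

lemma prof_integral:
  assumes p: "prof \<xi> b" and W[measurable]: "W \<in> sets borel" "W \<subseteq> Omega l"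
    and \<phi>[measurable]: "\<phi> \<in> borel_measurable borel" and i: "integrable lborel (\<lambda>\<tau>. indicator W \<tau> *\<^sub>R (\<phi> \<tau> *\<^sub>R b \<tau>))"
  shows "integrable (lebesgue_on W) (\<lambda>\<tau>. \<phi> \<tau> *\<^sub>R \<xi> \<tau>)"
    "integral\<^sup>L (lebesgue_on W) (\<lambda>\<tau>. \<phi> \<tau> *\<^sub>R \<xi> \<tau>) = R (LINT \<tau>|lborel. indicator W \<tau> *\<^sub>R (\<phi> \<tau> *\<^sub>R b \<tau>))"
    "integrable (lebesgue_on W) (\<lambda>\<tau>. \<phi> \<tau> *\<^sub>R B (\<xi> \<tau>))"
    "integral\<^sup>L (lebesgue_on W) (\<lambda>\<tau>. \<phi> \<tau> *\<^sub>R B (\<xi> \<tau>)) = (LINT \<tau>|lborel. indicator W \<tau> *\<^sub>R (\<phi> \<tau> *\<^sub>R b \<tau>))"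
proof -
  have [measurable]: "b \<in> borel_measurable borel" using wL2_meas[OF prof_wL2[OF p]] .
  have Wl: "W \<in> sets lebesgue" by simp
  have Ri: "integrable lborel (\<lambda>\<tau>. R (indicator W \<tau> *\<^sub>R (\<phi> \<tau> *\<^sub>R b \<tau>)))" by (rule integrable_bounded_linear[OF R_bounded_linear i])
  have RI: "(LINT \<tau>|lborel. R (indicator W \<tau> *\<^sub>R (\<phi> \<tau> *\<^sub>R b \<tau>))) = R (LINT \<tau>|lborel. indicator W \<tau> *\<^sub>R (\<phi> \<tau> *\<^sub>R b \<tau>))"
    by (rule integral_bounded_linear[OF R_bounded_linear i])
  have ae: "AE \<tau> in lborel. indicator W \<tau> *\<^sub>R (\<phi> \<tau> *\<^sub>R \<xi> \<tau>) = R (indicator W \<tau> *\<^sub>R (\<phi> \<tau> *\<^sub>R b \<tau>))"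
    using prof_AE_R[OF p] by eventually_elim (use W(2) in \<open>auto simp: R_scale indicator_def R_0\<close>)
  have ae2: "AE \<tau> in lborel. indicator W \<tau> *\<^sub>R (\<phi> \<tau> *\<^sub>R B (\<xi> \<tau>)) = indicator W \<tau> *\<^sub>R (\<phi> \<tau> *\<^sub>R b \<tau>)"
    using prof_AE[OF p] by eventually_elim (use W(2) in \<open>auto simp: indicator_def\<close>)
  have m1: "(\<lambda>\<tau>. R (indicator W \<tau> *\<^sub>R (\<phi> \<tau> *\<^sub>R b \<tau>))) \<in> borel_measurable borel"
    and m2: "(\<lambda>\<tau>. indicator W \<tau> *\<^sub>R (\<phi> \<tau> *\<^sub>R b \<tau>)) \<in> borel_measurable borel" by measurable
  show "integrable (lebesgue_on W) (\<lambda>\<tau>. \<phi> \<tau> *\<^sub>R \<xi> \<tau>)"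
    unfolding set_integral_lebesgue_on(1)[OF Wl] by (rule integral_lebesgue_eq_lborel(1)[OF m1 Ri ae])
  show "integral\<^sup>L (lebesgue_on W) (\<lambda>\<tau>. \<phi> \<tau> *\<^sub>R \<xi> \<tau>) = R (LINT \<tau>|lborel. indicator W \<tau> *\<^sub>R (\<phi> \<tau> *\<^sub>R b \<tau>))"
    unfolding set_integral_lebesgue_on(2)[OF Wl] RI[symmetric] by (rule integral_lebesgue_eq_lborel(2)[OF m1 Ri ae])
  show "integrable (lebesgue_on W) (\<lambda>\<tau>. \<phi> \<tau> *\<^sub>R B (\<xi> \<tau>))"
    unfolding set_integral_lebesgue_on(1)[OF Wl] by (rule integral_lebesgue_eq_lborel(1)[OF m2 i ae2])
  show "integral\<^sup>L (lebesgue_on W) (\<lambda>\<tau>. \<phi> \<tau> *\<^sub>R B (\<xi> \<tau>)) = (LINT \<tau>|lborel. indicator W \<tau> *\<^sub>R (\<phi> \<tau> *\<^sub>R b \<tau>))"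
    unfolding set_integral_lebesgue_on(2)[OF Wl] by (rule integral_lebesgue_eq_lborel(2)[OF m2 i ae2])
qed

lemma prof_integral_bounded:
  assumes p: "prof \<xi> b" and \<phi>[measurable]: "\<phi> \<in> borel_measurable borel" and C: "\<And>x. \<bar>\<phi> x\<bar> \<le> C"
  shows "integrable lborel (\<lambda>\<tau>. \<phi> \<tau> *\<^sub>R b \<tau>)" "integrable (lebesgue_on (Omega l)) (\<lambda>\<tau>. \<phi> \<tau> *\<^sub>R \<xi> \<tau>)"
    "integral\<^sup>L (lebesgue_on (Omega l)) (\<lambda>\<tau>. \<phi> \<tau> *\<^sub>R \<xi> \<tau>) = R (LINT \<tau>|lborel. \<phi> \<tau> *\<^sub>R b \<tau>)"
proof -
  have w: "wL2 b" using p by (rule prof_wL2)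
  have [measurable]: "b \<in> borel_measurable borel" using wL2_meas[OF w] .
  have "integrable lborel (\<lambda>\<tau>. C *\<^sub>R b \<tau>)" using wL2_integrable[OF w] by simp
  then show i: "integrable lborel (\<lambda>\<tau>. \<phi> \<tau> *\<^sub>R b \<tau>)"
  proof (rule Bochner_Integration.integrable_bound)
    have "\<bar>\<phi> x\<bar> \<le> \<bar>C\<bar>" for x using C[of x] by linarith
    then show "AE x in lborel. norm (\<phi> x *\<^sub>R b x) \<le> norm (C *\<^sub>R b x)" by (auto intro!: mult_right_mono)
  qed measurable
  have e: "indicator (Omega l) \<tau> *\<^sub>R (\<phi> \<tau> *\<^sub>R b \<tau>) = \<phi> \<tau> *\<^sub>R b \<tau>" for \<tau>
    using wL2_zero[OF w, of \<tau>] by (cases "\<tau> \<in> Omega l") auto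
  show "integrable (lebesgue_on (Omega l)) (\<lambda>\<tau>. \<phi> \<tau> *\<^sub>R \<xi> \<tau>)"
    "integral\<^sup>L (lebesgue_on (Omega l)) (\<lambda>\<tau>. \<phi> \<tau> *\<^sub>R \<xi> \<tau>) = R (LINT \<tau>|lborel. \<phi> \<tau> *\<^sub>R b \<tau>)"
    using prof_integral(1,2)[OF p Omega_borel order_refl \<phi>] i unfolding e by auto
qed

lemma Omega_conv: "p \<in> Omega l \<Longrightarrow> q \<in> Omega l \<Longrightarrow> {p..q} \<subseteq> Omega l"
  using Omega_down Omega_pos by (meson atLeastAtMost_iff order_less_le_trans subsetI)

lemma Omega_ne: "Omega l \<noteq> {}"
proof -
  obtain q where "0 < q" "ereal q < l" using l ereal_dense2[of 0 l] by (auto simp: zero_ereal_def)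
  then show ?thesis by (auto simp: Omega_def)
qed

lemma eventually_to_l_iff:
  assumes "\<forall>\<^sub>F \<tau> in to_l l. P \<tau>"
  shows "\<exists>T\<in>Omega l. \<forall>\<tau>\<in>Omega l. T < \<tau> \<longrightarrow> P \<tau>"
proof (cases l)
  case (real L)
  then have "\<forall>\<^sub>F \<tau> in at_left L. P \<tau>" using assms by (simp add: to_l_def)
  then obtain b where b: "b < L" "\<forall>y>b. y < L \<longrightarrow> P y" by (auto simp: eventually_at_left_field)
  have "max b (L/2) \<in> Omega l" using b l real by (auto simp: Omega_def)
  then show ?thesis using b real by (intro bexI[of _ "max b (L/2)"]) (auto simp: Omega_def)
next
  case PInf
  then have "\<forall>\<^sub>F \<tau> in at_top. P \<tau>" using assms by (simp add: to_l_def)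
  then obtain N where "\<forall>n\<ge>N. P n" by (auto simp: eventually_at_top_linorder)
  then show ?thesis using PInf by (intro bexI[of _ "max N 1"]) (auto simp: Omega_def)
qed (use l in auto)

lemma tail_prim_to_l:
  fixes d :: "real \<Rightarrow> 'h"
  assumes "wL2 d" shows "(tail_prim d \<longlongrightarrow> 0) (to_l l)"
proof (cases l)
  case (real L)
  have "(LINT \<sigma>:{L..}|lborel. d \<sigma>) = (LINT \<sigma>:{L..}|lborel. 0)"
    by (rule set_lebesgue_integral_cong) (use wL2_zero[OF assms] real in \<open>auto simp: Omega_def\<close>)
  then have z: "tail_prim d L = 0" by (simp add: tail_prim_def set_lebesgue_integral_def)
  have "isCont (tail_prim d) L"
    using tail_prim_continuous[OF wL2_integrable[OF assms], of UNIV] by (simp add: continuous_on_eq_continuous_at)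
  then have "(tail_prim d \<longlongrightarrow> tail_prim d L) (at L)" by (simp add: isCont_def)
  then have "(tail_prim d \<longlongrightarrow> 0) (at_left L)" unfolding z by (simp add: filterlim_at_split)
  then show ?thesis using real by (simp add: to_l_def)
next
  case PInf
  then show ?thesis using tail_prim_at_top[OF wL2_integrable[OF assms]] by (simp add: to_l_def)
qed (use l in auto)

lemma distA2_le:
  assumes "distA2 l \<mu> B x y \<le> ennreal (e\<^sup>2)" "e \<ge> 0"
  shows "norm (B (fst x - fst y)) \<le> e" "norm (fst (snd x) - fst (snd y)) \<le> e"
    "normV2 l \<mu> B (\<lambda>\<tau>. snd (snd x) \<tau> - snd (snd y) \<tau>) \<le> ennreal (e\<^sup>2)"
proof -
  have "ennreal ((norm (B (fst x - fst y)))\<^sup>2) \<le> ennreal (e\<^sup>2)"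
    by (rule order_trans[OF _ assms(1)]) (simp add: distA2_def add.assoc)
  then show "norm (B (fst x - fst y)) \<le> e" using assms(2) by (subst (asm) ennreal_le_iff) (auto intro: power2_le_imp_le)
  have "ennreal ((norm (fst (snd x) - fst (snd y)))\<^sup>2) \<le> ennreal (e\<^sup>2)"
    by (rule order_trans[OF _ assms(1)]) (simp add: distA2_def add.assoc add.left_commute)
  then show "norm (fst (snd x) - fst (snd y)) \<le> e" using assms(2) by (subst (asm) ennreal_le_iff) (auto intro: power2_le_imp_le)
  show "normV2 l \<mu> B (\<lambda>\<tau>. snd (snd x) \<tau> - snd (snd y) \<tau>) \<le> ennreal (e\<^sup>2)"
    by (rule order_trans[OF _ assms(1)]) (simp add: distA2_def)
qed

lemma N2_eq_0_AE:
  fixes b :: "real \<Rightarrow> 'h"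
  assumes "wL2 b" "N2 b = 0" shows "AE \<tau> in lborel. b \<tau> = 0"
proof -
  have [measurable]: "b \<in> borel_measurable borel" using assms(1) by (rule wL2_meas)
  have "AE \<tau> in lborel. ennreal ((norm (b \<tau>))\<^sup>2 / \<mu> \<tau>) = 0"
    using assms(2) unfolding N2_def by (subst (asm) nn_integral_0_iff_AE) auto
  then show ?thesis
  proof eventually_elim
    case (elim \<tau>)
    show ?case
    proof (cases "\<tau> \<in> Omega l")
      case True
      have "(norm (b \<tau>))\<^sup>2 / \<mu> \<tau> \<le> 0" using elim by (simp add: ennreal_eq_0_iff)
      then show ?thesis using mu_pos[OF True] by (simp add: divide_le_0_iff)
    qed (rule wL2_zero[OF assms(1)])
  qed
qed

lemma distA2_zero_imp:
  assumes "distA2 l \<mu> B x y = 0" "in_frakA l \<mu> B DB x" "in_frakA l \<mu> B DB y"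
  shows "fst x = fst y" "fst (snd x) = fst (snd y)" "prof (snd (snd y)) b \<Longrightarrow> prof (snd (snd x)) b"
    "AE \<tau> in lborel. \<tau> \<in> Omega l \<longrightarrow> snd (snd x) \<tau> = snd (snd y) \<tau>"
proof -
  have le: "distA2 l \<mu> B x y \<le> ennreal (0\<^sup>2)" using assms(1) by simp
  have DB: "fst x \<in> DB" "fst y \<in> DB" using assms by (auto simp: in_frakA_def)
  have "B (fst x - fst y) = 0" using distA2_le(1)[OF le] by simp
  then have "fst x - fst y = 0" by - (rule B_eq_0D[OF DB_diff[OF DB]])
  then show "fst x = fst y" by simp
  show "fst (snd x) = fst (snd y)" using distA2_le(2)[OF le] by simp
  obtain bx where bx: "prof (snd (snd x)) bx" using assms(2) prof_ex by (auto simp: in_frakA_def)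
  obtain bY where bY: "prof (snd (snd y)) bY" using assms(3) prof_ex by (auto simp: in_frakA_def)
  note pd = prof_diff[OF bx bY]
  have "N2 (\<lambda>\<tau>. bx \<tau> - bY \<tau>) = 0" using distA2_le(3)[OF le] prof_norm[OF pd] by simp
  then have "AE \<tau> in lborel. bx \<tau> - bY \<tau> = 0" by (rule N2_eq_0_AE[OF prof_wL2[OF pd]])
  with prof_AE_R[OF bx] prof_AE_R[OF bY]
  show ae: "AE \<tau> in lborel. \<tau> \<in> Omega l \<longrightarrow> snd (snd x) \<tau> = snd (snd y) \<tau>" by eventually_elim auto
  show "prof (snd (snd y)) b \<Longrightarrow> prof (snd (snd x)) b" using prof_cong ae by blast
qed

section \<open>The domain of the generator\<close>

text \<open>The distributional derivative d and the limit at l determine the history: xi is R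
  applied to the tail primitive of d. This gives concrete formulas for all components of the image
  under the generator.\<close>

lemma gen_rel_profile:
  assumes g: "gen_rel l \<mu> A DA B DB (u, v, \<xi>) y" and y: "in_frakA l \<mu> B DB y"
  shows "\<exists>b d. prof \<xi> b \<and> wL2 d \<and> b = (\<lambda>\<tau>. indicator (Omega l) \<tau> *\<^sub>R tail_prim d \<tau>) \<and> u \<in> DB \<and> v \<in> DB \<and>
     u + R (LINT \<tau>|lborel. b \<tau>) \<in> DA \<and> fst y = v \<and> fst (snd y) = - A (u + R (LINT \<tau>|lborel. b \<tau>)) \<and>
     prof (snd (snd y)) (\<lambda>\<tau>. d \<tau> + \<mu> \<tau> *\<^sub>R B v)"
proof -
  obtain \<eta> \<zeta> where G: "u \<in> DB" "in_calV l \<mu> B DB \<xi>" "v \<in> DB"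
     "u + integral\<^sup>L (lebesgue_on (Omega l)) \<xi> \<in> DA" "dist_deriv (Omega l) \<xi> \<eta>" "in_calV l \<mu> B DB \<eta>"
     "AE \<tau> in lebesgue_on (Omega l). \<zeta> \<tau> = \<xi> \<tau>" "\<forall>\<^sub>F \<tau> in to_l l. \<zeta> \<tau> \<in> DB" "((\<lambda>\<tau>. B (\<zeta> \<tau>)) \<longlongrightarrow> 0) (to_l l)"
     "distA2 l \<mu> B y (v, - A (u + integral\<^sup>L (lebesgue_on (Omega l)) \<xi>), \<lambda>\<tau>. \<eta> \<tau> + \<mu> \<tau> *\<^sub>R v) = 0"
    using g unfolding gen_rel_def in_frakA_def by auto
  obtain b0 where b0: "prof \<xi> b0" using prof_ex[OF G(2)] by blast
  obtain d where d: "prof \<eta> d" using prof_ex[OF G(6)] by blast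
  have wd: "wL2 d" using d by (rule prof_wL2)
  have di: "integrable lborel d" by (rule wL2_integrable[OF wd])
  have tm[measurable]: "tail_prim d \<in> borel_measurable borel"
    using tail_prim_continuous[OF di] by (rule borel_measurable_continuous_onI)
  \<comment> \<open>h has zero distributional derivative, so it is a.e. a constant.\<close>
  define h where "h \<tau> = \<xi> \<tau> - R (tail_prim d \<tau>)" for \<tau>
  have tl: "integrable (lebesgue_on (Omega l)) (\<lambda>\<tau>. \<phi> \<tau> *\<^sub>R R (tail_prim d \<tau>)) \<and>
      integral\<^sup>L (lebesgue_on (Omega l)) (\<lambda>\<tau>. \<phi> \<tau> *\<^sub>R R (tail_prim d \<tau>)) = R (LINT \<tau>|lborel. \<phi> \<tau> *\<^sub>R tail_prim d \<tau>)"
    if t: "test_fun (Omega l) \<phi>" for \<phi>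
  proof -
    have [measurable]: "\<phi> \<in> borel_measurable borel" by (rule test_fun_measurable[OF t])
    obtain p q where pq: "p < q" "\<And>x. x \<notin> {p..q} \<Longrightarrow> \<phi> x = 0" using test_fun_support[OF t] by blast
    have "set_integrable lborel {p..q} (\<lambda>\<tau>. \<phi> \<tau> *\<^sub>R tail_prim d \<tau>)"
      by (rule borel_integrable_atLeastAtMost') (intro continuous_on_scaleR test_fun_continuous_on[OF t] tail_prim_continuous[OF di])
    moreover have "(\<lambda>\<tau>. indicator {p..q} \<tau> *\<^sub>R (\<phi> \<tau> *\<^sub>R tail_prim d \<tau>)) = (\<lambda>\<tau>. \<phi> \<tau> *\<^sub>R tail_prim d \<tau>)"
      using pq(2) by (auto simp: indicator_def fun_eq_iff)
    ultimately have i: "integrable lborel (\<lambda>\<tau>. \<phi> \<tau> *\<^sub>R tail_prim d \<tau>)" by (simp add: set_integrable_def)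
    have Ri: "integrable lborel (\<lambda>\<tau>. R (\<phi> \<tau> *\<^sub>R tail_prim d \<tau>))" by (rule integrable_bounded_linear[OF R_bounded_linear i])
    have RI: "(LINT \<tau>|lborel. R (\<phi> \<tau> *\<^sub>R tail_prim d \<tau>)) = R (LINT \<tau>|lborel. \<phi> \<tau> *\<^sub>R tail_prim d \<tau>)"
      by (rule integral_bounded_linear[OF R_bounded_linear i])
    have ae: "AE \<tau> in lborel. indicator (Omega l) \<tau> *\<^sub>R (\<phi> \<tau> *\<^sub>R R (tail_prim d \<tau>)) = R (\<phi> \<tau> *\<^sub>R tail_prim d \<tau>)"
      using test_fun_zero_outside[OF t] by (intro AE_I2) (auto simp: R_scale indicator_def R_0)
    have m: "(\<lambda>\<tau>. R (\<phi> \<tau> *\<^sub>R tail_prim d \<tau>)) \<in> borel_measurable borel" by measurable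
    show ?thesis unfolding set_integral_lebesgue_on[OF Omega_lebesgue] RI[symmetric]
      using integral_lebesgue_eq_lborel[OF m Ri ae] by blast
  qed
  have txi: "integrable (lebesgue_on (Omega l)) (\<lambda>\<tau>. \<phi> \<tau> *\<^sub>R \<xi> \<tau>)" if t: "test_fun (Omega l) \<phi>" for \<phi>
  proof -
    obtain C where "\<And>x. \<bar>\<phi> x\<bar> \<le> C" using test_fun_bounded[OF t] by blast
    then show ?thesis by (rule prof_integral_bounded(2)[OF b0 test_fun_measurable[OF t]])
  qed
  have "\<exists>c. AE x in lborel. x \<in> Omega l \<longrightarrow> h x = c"
  proof (rule dist_deriv_zero_imp_const[OF Omega_open Omega_ne Omega_conv])
    fix \<phi> assume t: "test_fun (Omega l) \<phi>"
    show "integrable (lebesgue_on (Omega l)) (\<lambda>x. \<phi> x *\<^sub>R h x)"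
      unfolding h_def scaleR_diff_right using tl[OF t] txi[OF t] by (intro Bochner_Integration.integrable_diff) auto
    have t': "test_fun (Omega l) (deriv \<phi>)" by (rule test_fun_deriv[OF t])
    obtain C where C: "\<And>x. \<bar>\<phi> x\<bar> \<le> C" using test_fun_bounded[OF t] by blast
    have "integral\<^sup>L (lebesgue_on (Omega l)) (\<lambda>x. deriv \<phi> x *\<^sub>R h x)
       = integral\<^sup>L (lebesgue_on (Omega l)) (\<lambda>x. deriv \<phi> x *\<^sub>R \<xi> x) - R (LINT \<tau>|lborel. deriv \<phi> \<tau> *\<^sub>R tail_prim d \<tau>)"
      unfolding h_def scaleR_diff_right using tl[OF t'] txi[OF t'] by (subst Bochner_Integration.integral_diff) auto
    also have "(LINT \<tau>|lborel. deriv \<phi> \<tau> *\<^sub>R tail_prim d \<tau>) = - (LINT \<tau>|lborel. \<phi> \<tau> *\<^sub>R d \<tau>)"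
      by (rule integral_deriv_test_fun_tail_prim[OF di wL2_meas[OF wd] t])
    also have "integral\<^sup>L (lebesgue_on (Omega l)) (\<lambda>x. deriv \<phi> x *\<^sub>R \<xi> x) = - integral\<^sup>L (lebesgue_on (Omega l)) (\<lambda>x. \<phi> x *\<^sub>R \<eta> x)"
      using G(5) t unfolding dist_deriv_def by blast
    also have "integral\<^sup>L (lebesgue_on (Omega l)) (\<lambda>x. \<phi> x *\<^sub>R \<eta> x) = R (LINT \<tau>|lborel. \<phi> \<tau> *\<^sub>R d \<tau>)"
      by (rule prof_integral_bounded(3)[OF d test_fun_measurable[OF t] C])
    finally show "integral\<^sup>L (lebesgue_on (Omega l)) (\<lambda>x. deriv \<phi> x *\<^sub>R h x) = 0" by (simp add: R_minus)
  qed
  then obtain c where c: "AE x in lborel. x \<in> Omega l \<longrightarrow> h x = c" by blast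
  \<comment> \<open>Both \<open>\<zeta>\<close> and the tail primitive tend to 0 at l, so a nonzero
    constant would contradict the limit on an interval near l, a set of positive measure.\<close>
  have c0: "c = 0"
  proof (rule ccontr)
    assume "c \<noteq> 0"
    have "((\<lambda>\<tau>. R (B (\<zeta> \<tau>)) - R (tail_prim d \<tau>)) \<longlongrightarrow> R 0 - R 0) (to_l l)"
      by (intro tendsto_diff R.tendsto G(9) tail_prim_to_l[OF wd])
    then have "\<forall>\<^sub>F \<tau> in to_l l. norm (R (B (\<zeta> \<tau>)) - R (tail_prim d \<tau>)) < norm c"
      using \<open>c \<noteq> 0\<close> by (intro order_tendstoD(2)[OF tendsto_norm]) (auto simp: R_0)
    then have "\<forall>\<^sub>F \<tau> in to_l l. norm (\<zeta> \<tau> - R (tail_prim d \<tau>)) < norm c" using G(8) by eventually_elim simp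
    then obtain T where T: "T \<in> Omega l" "\<And>\<tau>. \<tau> \<in> Omega l \<Longrightarrow> T < \<tau> \<Longrightarrow> norm (\<zeta> \<tau> - R (tail_prim d \<tau>)) < norm c"
      using eventually_to_l_iff by blast
    obtain T' where T': "T < T'" "T' \<in> Omega l"
    proof -
      obtain e where e: "e > 0" "ball T e \<subseteq> Omega l" using Omega_open T(1) open_contains_ball by blast
      then have "T + e/2 \<in> Omega l" by (auto simp: dist_real_def subset_iff)
      then show thesis using that[of "T + e/2"] e by simp
    qed
    have "AE \<tau> in lborel. \<tau> \<in> Omega l \<longrightarrow> \<zeta> \<tau> = \<xi> \<tau>" using G(7) by (simp add: AE_lebesgue_on_iff[OF Omega_lebesgue])
    with c have "AE \<tau> in lborel. \<tau> \<notin> {T<..<T'}"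
    proof eventually_elim
      case (elim \<tau>)
      show ?case
      proof
        assume \<tau>: "\<tau> \<in> {T<..<T'}"
        then have "\<tau> \<in> Omega l" using Omega_down[OF T'(2)] Omega_pos[OF T(1)] by auto
        then show False using elim T(2)[of \<tau>] \<tau> by (auto simp: h_def)
      qed
    qed
    then have "{T<..<T'} \<in> null_sets lborel" by (subst AE_iff_null_sets) auto
    then show False using T' by (simp add: null_sets_def)
  qed
  define b where "b = (\<lambda>\<tau>. indicator (Omega l) \<tau> *\<^sub>R tail_prim d \<tau>)"
  have xiR: "AE \<tau> in lborel. \<tau> \<in> Omega l \<longrightarrow> \<xi> \<tau> = R (b \<tau>)"
    using c unfolding c0 by eventually_elim (auto simp: h_def b_def)
  have "AE \<tau> in lborel. \<tau> \<in> Omega l \<longrightarrow> b \<tau> = b0 \<tau>"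
    using xiR prof_AE[OF b0] by eventually_elim auto
  then have aeb: "AE \<tau> in lborel. \<tau> \<in> Omega l \<longrightarrow> \<xi> \<tau> \<in> DB \<and> B (\<xi> \<tau>) = b \<tau>"
    using prof_AE[OF b0] by eventually_elim auto
  have bm: "b \<in> borel_measurable borel" by (simp add: b_def)
  have bz: "\<And>\<tau>. \<tau> \<notin> Omega l \<Longrightarrow> b \<tau> = 0" by (simp add: b_def)
  have "normV2 l \<mu> B \<xi> = N2 b" by (rule normV2_eq_N2[OF _ bm bz]) (use aeb in \<open>eventually_elim, auto\<close>)
  then have "wL2 b" using bm bz G(2) by (simp add: wL2_def in_calV_def)
  then have pb: "prof \<xi> b" using aeb by (simp add: prof_def)
  have I: "integral\<^sup>L (lebesgue_on (Omega l)) \<xi> = R (LINT \<tau>|lborel. b \<tau>)"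
    using prof_integral_bounded(3)[OF pb, of "\<lambda>_. 1" 1] by simp
  have py: "prof (\<lambda>\<tau>. \<eta> \<tau> + \<mu> \<tau> *\<^sub>R v) (\<lambda>\<tau>. d \<tau> + \<mu> \<tau> *\<^sub>R B v)" by (rule prof_add[OF d prof_mu[OF G(3)]])
  have F: "in_frakA l \<mu> B DB (v, - A (u + integral\<^sup>L (lebesgue_on (Omega l)) \<xi>), \<lambda>\<tau>. \<eta> \<tau> + \<mu> \<tau> *\<^sub>R v)"
    using G(3) prof_calV[OF py] by (simp add: in_frakA_def)
  show ?thesis
    using distA2_zero_imp(1,2)[OF G(10) y F] distA2_zero_imp(3)[OF G(10) y F, of "\<lambda>\<tau>. d \<tau> + \<mu> \<tau> *\<^sub>R B v"] py pb wd G(1,3,4) I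
    by (intro exI[of _ b] exI[of _ d]) (simp add: b_def)
qed

lemma gen_rel_intro:
  assumes d: "wL2 d" and b: "wL2 (\<lambda>\<tau>. indicator (Omega l) \<tau> *\<^sub>R tail_prim d \<tau>)" and u: "u \<in> DB" and v: "v \<in> DB"
    and DA: "u + R (LINT \<tau>|lborel. indicator (Omega l) \<tau> *\<^sub>R tail_prim d \<tau>) \<in> DA"
  defines "\<xi> \<equiv> \<lambda>\<tau>. R (indicator (Omega l) \<tau> *\<^sub>R tail_prim d \<tau>)"
  shows "\<exists>y. in_frakA l \<mu> B DB y \<and> gen_rel l \<mu> A DA B DB (u, v, \<xi>) y"
proof -
  define bb where "bb = (\<lambda>\<tau>. indicator (Omega l) \<tau> *\<^sub>R tail_prim d \<tau>)"
  have pb: "prof \<xi> bb" unfolding \<xi>_def bb_def by (rule prof_R[OF b])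
  define \<eta> where "\<eta> \<tau> = R (d \<tau>)" for \<tau>
  have pd: "prof \<eta> d" unfolding \<eta>_def by (rule prof_R[OF d])
  have xi1: "integrable (lebesgue_on (Omega l)) \<xi>" and xiI: "integral\<^sup>L (lebesgue_on (Omega l)) \<xi> = R (LINT \<tau>|lborel. bb \<tau>)"
    using prof_integral_bounded(2,3)[OF pb, of "\<lambda>_. 1" 1] by auto
  have di: "integrable lborel d" by (rule wL2_integrable[OF d])
  have dd: "dist_deriv (Omega l) \<xi> \<eta>"
    unfolding dist_deriv_def
  proof (intro allI impI)
    fix \<phi> assume t: "test_fun (Omega l) \<phi>"
    have t': "test_fun (Omega l) (deriv \<phi>)" by (rule test_fun_deriv[OF t])
    obtain C where C: "\<And>x. \<bar>\<phi> x\<bar> \<le> C" using test_fun_bounded[OF t] by blast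
    obtain C' where C': "\<And>x. \<bar>deriv \<phi> x\<bar> \<le> C'" using test_fun_bounded[OF t'] by blast
    note P = prof_integral_bounded[OF pb test_fun_measurable[OF t'] C']
    note Q = prof_integral_bounded[OF pd test_fun_measurable[OF t] C]
    have "(\<lambda>\<tau>. deriv \<phi> \<tau> *\<^sub>R bb \<tau>) = (\<lambda>\<tau>. deriv \<phi> \<tau> *\<^sub>R tail_prim d \<tau>)"
      using test_fun_zero_outside[OF t'] by (auto simp: bb_def indicator_def fun_eq_iff)
    then have "(LINT \<tau>|lborel. deriv \<phi> \<tau> *\<^sub>R bb \<tau>) = - (LINT \<tau>|lborel. \<phi> \<tau> *\<^sub>R d \<tau>)"
      using integral_deriv_test_fun_tail_prim[OF di wL2_meas[OF d] t] by simp
    then show "integrable (lebesgue_on (Omega l)) (\<lambda>x. deriv \<phi> x *\<^sub>R \<xi> x) \<and>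
       integrable (lebesgue_on (Omega l)) (\<lambda>x. \<phi> x *\<^sub>R \<eta> x) \<and>
       integral\<^sup>L (lebesgue_on (Omega l)) (\<lambda>x. deriv \<phi> x *\<^sub>R \<xi> x) = - integral\<^sup>L (lebesgue_on (Omega l)) (\<lambda>x. \<phi> x *\<^sub>R \<eta> x)"
      using P(2,3) Q(2,3) by (simp add: R_minus)
  qed
  define \<zeta> where "\<zeta> \<tau> = R (tail_prim d \<tau>)" for \<tau>
  have z: "(AE \<tau> in lebesgue_on (Omega l). \<zeta> \<tau> = \<xi> \<tau>) \<and> (\<forall>\<^sub>F \<tau> in to_l l. \<zeta> \<tau> \<in> DB) \<and> ((\<lambda>\<tau>. B (\<zeta> \<tau>)) \<longlongrightarrow> 0) (to_l l)"
    using tail_prim_to_l[OF d] by (auto simp: \<zeta>_def \<xi>_def AE_lebesgue_on_iff[OF Omega_lebesgue])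
  define y where "y = (v, - A (u + integral\<^sup>L (lebesgue_on (Omega l)) \<xi>), \<lambda>\<tau>. \<eta> \<tau> + \<mu> \<tau> *\<^sub>R v)"
  have py: "prof (\<lambda>\<tau>. \<eta> \<tau> + \<mu> \<tau> *\<^sub>R v) (\<lambda>\<tau>. d \<tau> + \<mu> \<tau> *\<^sub>R B v)" by (rule prof_add[OF pd prof_mu[OF v]])
  have Fy: "in_frakA l \<mu> B DB y" using v prof_calV[OF py] by (simp add: in_frakA_def y_def)
  have "normV2 l \<mu> B (\<lambda>\<tau>. 0) = 0" using prof_norm[OF prof_0] by (simp add: N2_def)
  then have d0: "distA2 l \<mu> B y y = 0" by (simp add: distA2_def B_0)
  have DA': "u + integral\<^sup>L (lebesgue_on (Omega l)) \<xi> \<in> DA" using DA by (simp add: xiI bb_def)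
  have Fx: "in_frakA l \<mu> B DB (u, v, \<xi>)" using u prof_calV[OF pb] by (simp add: in_frakA_def)
  have "gen_rel l \<mu> A DA B DB (u, v, \<xi>) y"
    unfolding gen_rel_def prod.case
    using Fx v xi1 DA' dd prof_calV[OF pd] z d0[unfolded y_def] unfolding y_def by blast
  then show ?thesis using Fy by blast
qed

theorem gen_rel_dense:
  assumes x: "in_frakA l \<mu> B DB x" and e: "e > 0"
  shows "\<exists>x' y'. in_frakA l \<mu> B DB x' \<and> in_frakA l \<mu> B DB y' \<and> gen_rel l \<mu> A DA B DB x' y' \<and> distA2 l \<mu> B x x' \<le> ennreal (e\<^sup>2)"
proof -
  obtain u v \<xi> where xe: "x = (u, v, \<xi>)" by (cases x)
  have u: "u \<in> DB" and xi: "in_calV l \<mu> B DB \<xi>" using x by (auto simp: in_frakA_def xe)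
  obtain b where b: "prof \<xi> b" using prof_ex[OF xi] by blast
  have "approximable b" by (rule approximable_wL2[OF prof_wL2[OF b]])
  moreover have e3: "e\<^sup>2 / 3 > 0" using e by simp
  ultimately obtain d where d: "wL2 d" "wL2 (\<lambda>\<tau>. indicator (Omega l) \<tau> *\<^sub>R tail_prim d \<tau>)"
     "N2 (\<lambda>\<tau>. b \<tau> - indicator (Omega l) \<tau> *\<^sub>R tail_prim d \<tau>) \<le> ennreal (e\<^sup>2 / 3)" unfolding approximable_def by blast
  define \<delta> where "\<delta> = sqrt (e\<^sup>2 / 3)"
  have \<delta>: "\<delta> > 0" "\<delta>\<^sup>2 = e\<^sup>2 / 3" using e by (auto simp: \<delta>_def)
  have dn: "\<exists>w\<in>DB. norm (z - w) < \<delta>" for z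
    using DB_dense closure_approachable[of z DB] \<delta>(1) by (auto simp: dist_norm norm_minus_commute)
  obtain v' where v': "v' \<in> DB" "norm (v - v') < \<delta>" using dn by blast
  define I where "I = (LINT \<tau>|lborel. indicator (Omega l) \<tau> *\<^sub>R tail_prim d \<tau>)"
  obtain w where w: "w \<in> DB" "norm ((B u + I) - w) < \<delta>" using dn by blast
  \<comment> \<open>The domain condition couples u' with the history: u' plus the integral of xi'
    must lie in DA, which contains R(DB). So w in DB is chosen near B u + I and u' is solved for;
    the error B(u - u') is then exactly B u + I - w.\<close>
  define u' where "u' = R (w - I)"
  define \<xi>' where "\<xi>' = (\<lambda>\<tau>. R (indicator (Omega l) \<tau> *\<^sub>R tail_prim d \<tau>))"
  have "u' + R I = R w" by (simp add: u'_def R_add[symmetric])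
  then have "u' + R I \<in> DA" using RR_DA[OF w(1)] by simp
  then obtain y where y: "in_frakA l \<mu> B DB y" "gen_rel l \<mu> A DA B DB (u', v', \<xi>') y"
    using gen_rel_intro[OF d(1,2), of u' v'] v'(1) unfolding \<xi>'_def I_def by (auto simp: u'_def)
  have p': "prof \<xi>' (\<lambda>\<tau>. indicator (Omega l) \<tau> *\<^sub>R tail_prim d \<tau>)" unfolding \<xi>'_def by (rule prof_R[OF d(2)])
  have F': "in_frakA l \<mu> B DB (u', v', \<xi>')" using prof_calV[OF p'] by (simp add: in_frakA_def u'_def)
  have Bu: "B (u - u') = (B u + I) - w" using u by (simp add: B_diff u'_def)
  have "distA2 l \<mu> B x (u', v', \<xi>') = ennreal ((norm ((B u + I) - w))\<^sup>2) + ennreal ((norm (v - v'))\<^sup>2)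
     + N2 (\<lambda>\<tau>. b \<tau> - indicator (Omega l) \<tau> *\<^sub>R tail_prim d \<tau>)"
    using prof_norm[OF prof_diff[OF b p']] by (simp add: distA2_def xe Bu)
  also have "\<dots> \<le> ennreal (e\<^sup>2 / 3) + ennreal (e\<^sup>2 / 3) + ennreal (e\<^sup>2 / 3)"
  proof (intro add_mono ennreal_leI d(3))
    have sq: "(norm z)\<^sup>2 \<le> e\<^sup>2 / 3" if "norm z < \<delta>" for z :: 'h
      unfolding \<delta>(2)[symmetric] by (rule power_mono) (use that in auto)
    show "(norm ((B u + I) - w))\<^sup>2 \<le> e\<^sup>2 / 3" by (rule sq[OF w(2)])
    show "(norm (v - v'))\<^sup>2 \<le> e\<^sup>2 / 3" by (rule sq[OF v'(2)])
  qed
  also have "\<dots> = ennreal (e\<^sup>2)"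
  proof -
    have "ennreal a + ennreal a + ennreal a = ennreal (3 * a)" if "a \<ge> 0" for a
      using that ennreal_plus[of "a + a" a] ennreal_plus[of a a] by simp
    from this[of "e\<^sup>2 / 3"] show ?thesis by simp
  qed
  finally show ?thesis using y F' by blast
qed

end

section \<open>The semigroup\<close>
locale visco_semigroup = visco A B DA DB l \<mu>
  for A B :: "'h::{real_inner,banach,second_countable_topology} \<Rightarrow> 'h"
    and DA DB :: "'h set" and l \<mu> +
  fixes S :: "real \<Rightarrow> 'h st \<Rightarrow> 'h st"
  assumes S: "is_generated_semigroup l \<mu> A DA B DB S"
begin

abbreviation FA :: "'h st \<Rightarrow> bool" where "FA \<equiv> in_frakA l \<mu> B DB"
abbreviation d2 :: "'h st \<Rightarrow> 'h st \<Rightarrow> ennreal" where "d2 \<equiv> distA2 l \<mu> B"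
abbreviation GR :: "'h st \<Rightarrow> 'h st \<Rightarrow> bool" where "GR \<equiv> gen_rel l \<mu> A DA B DB"

lemmas S_unf = S[unfolded is_generated_semigroup_def]

lemma S_FA: "t \<ge> 0 \<Longrightarrow> FA x \<Longrightarrow> FA (S t x)" using S_unf[THEN conjunct1] by blast
lemma S_lin: "t \<ge> 0 \<Longrightarrow> FA x \<Longrightarrow> FA y \<Longrightarrow> d2 (S t (st_lin a x b y)) (st_lin a (S t x) b (S t y)) = 0"
  using S_unf[THEN conjunct2, THEN conjunct1] by blast
lemma S_contr: "t \<ge> 0 \<Longrightarrow> FA x \<Longrightarrow> d2 (S t x) st_zero \<le> d2 x st_zero"
  using S_unf[THEN conjunct2, THEN conjunct2, THEN conjunct1] by blast
lemma S_0: "FA x \<Longrightarrow> d2 (S 0 x) x = 0" using S_unf[THEN conjunct2, THEN conjunct2, THEN conjunct2, THEN conjunct1] by blast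
lemma S_add: "t \<ge> 0 \<Longrightarrow> s \<ge> 0 \<Longrightarrow> FA x \<Longrightarrow> d2 (S (t + s) x) (S t (S s x)) = 0"
  using S_unf[THEN conjunct2, THEN conjunct2, THEN conjunct2, THEN conjunct2, THEN conjunct1] by blast
lemma S_cont: "FA x \<Longrightarrow> t0 \<ge> 0 \<Longrightarrow> ((\<lambda>t. d2 (S t x) (S t0 x)) \<longlongrightarrow> 0) (at t0 within {0..})"
  using S_unf[THEN conjunct2, THEN conjunct2, THEN conjunct2, THEN conjunct2, THEN conjunct2, THEN conjunct1] by blast
lemma S_gen: "FA x \<Longrightarrow> FA y \<Longrightarrow> GR x y \<longleftrightarrow> ((\<lambda>h. d2 (st_lin (1/h) (S h x) (-1/h) x) y) \<longlongrightarrow> 0) (at_right 0)"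
  using S_unf[THEN conjunct2, THEN conjunct2, THEN conjunct2, THEN conjunct2, THEN conjunct2, THEN conjunct2] by blast

lemma FA_prof: "FA x \<Longrightarrow> \<exists>b. prof (snd (snd x)) b"
  unfolding in_frakA_def using prof_ex by blast

lemma FA_lin: assumes "FA x" "FA y" shows "FA (st_lin a x b y)"
proof -
  obtain c d where "prof (snd (snd x)) c" "prof (snd (snd y)) d" using FA_prof[OF assms(1)] FA_prof[OF assms(2)] by blast
  then show ?thesis using assms prof_calV[OF prof_lin] by (auto simp: in_frakA_def st_lin_def DB_add DB_scale)
qed

lemma FA_0: "FA st_zero" using prof_calV[OF prof_0] by (simp add: in_frakA_def st_zero_def DB_0)

lemma d2_st_lin: "d2 x y = d2 (st_lin 1 x (-1) y) st_zero"
  by (simp add: distA2_def st_lin_def st_zero_def)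

lemma sum_sq_le: fixes a b :: "'h" shows "ennreal ((norm (a + b))\<^sup>2) \<le> 2 * ennreal ((norm a)\<^sup>2) + 2 * ennreal ((norm b)\<^sup>2)"
proof -
  have "(norm (a + b))\<^sup>2 \<le> (norm a + norm b)\<^sup>2" by (intro power_mono norm_triangle_ineq) simp
  also have "\<dots> \<le> 2 * (norm a)\<^sup>2 + 2 * (norm b)\<^sup>2" using sum_squares_bound[of "norm a" "norm b"] by (simp add: power2_sum)
  finally have "ennreal ((norm (a + b))\<^sup>2) \<le> ennreal (2 * (norm a)\<^sup>2 + 2 * (norm b)\<^sup>2)" by (rule ennreal_leI)
  also have "\<dots> = ennreal 2 * ennreal ((norm a)\<^sup>2) + ennreal 2 * ennreal ((norm b)\<^sup>2)" by (rule ennreal_lin) auto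
  finally show ?thesis by simp
qed

lemma d2_triangle: assumes "FA x" "FA y" "FA z" shows "d2 x z \<le> 2 * d2 x y + 2 * d2 y z"
proof -
  have DB: "fst x \<in> DB" "fst y \<in> DB" "fst z \<in> DB" using assms by (auto simp: in_frakA_def)
  obtain bx bY bz where p: "prof (snd (snd x)) bx" "prof (snd (snd y)) bY" "prof (snd (snd z)) bz"
    using FA_prof[OF assms(1)] FA_prof[OF assms(2)] FA_prof[OF assms(3)] by blast
  have [measurable]: "bx \<in> borel_measurable borel" "bY \<in> borel_measurable borel" "bz \<in> borel_measurable borel"
    using p wL2_meas prof_wL2 by blast+
  have "B (fst x - fst z) = B (fst x - fst y) + B (fst y - fst z)" using DB by (simp add: B_diff)
  then have 1: "ennreal ((norm (B (fst x - fst z)))\<^sup>2) \<le> 2 * ennreal ((norm (B (fst x - fst y)))\<^sup>2) + 2 * ennreal ((norm (B (fst y - fst z)))\<^sup>2)"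
    using sum_sq_le by simp
  have "fst (snd x) - fst (snd z) = (fst (snd x) - fst (snd y)) + (fst (snd y) - fst (snd z))" by simp
  then have 2: "ennreal ((norm (fst (snd x) - fst (snd z)))\<^sup>2) \<le> 2 * ennreal ((norm (fst (snd x) - fst (snd y)))\<^sup>2) + 2 * ennreal ((norm (fst (snd y) - fst (snd z)))\<^sup>2)"
    using sum_sq_le by metis
  have "N2 (\<lambda>\<tau>. 1 *\<^sub>R (bx \<tau> - bY \<tau>) + 1 *\<^sub>R (bY \<tau> - bz \<tau>)) \<le> ennreal (2 * 1\<^sup>2) * N2 (\<lambda>\<tau>. bx \<tau> - bY \<tau>) + ennreal (2 * 1\<^sup>2) * N2 (\<lambda>\<tau>. bY \<tau> - bz \<tau>)"
    by (rule N2_lin) measurable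
  then have 3: "N2 (\<lambda>\<tau>. bx \<tau> - bz \<tau>) \<le> 2 * N2 (\<lambda>\<tau>. bx \<tau> - bY \<tau>) + 2 * N2 (\<lambda>\<tau>. bY \<tau> - bz \<tau>)" by simp
  note n = prof_norm[OF prof_diff[OF p(1,3)]] prof_norm[OF prof_diff[OF p(1,2)]] prof_norm[OF prof_diff[OF p(2,3)]]
  have "d2 x z \<le> (2 * ennreal ((norm (B (fst x - fst y)))\<^sup>2) + 2 * ennreal ((norm (B (fst y - fst z)))\<^sup>2))
     + (2 * ennreal ((norm (fst (snd x) - fst (snd y)))\<^sup>2) + 2 * ennreal ((norm (fst (snd y) - fst (snd z)))\<^sup>2))
     + (2 * N2 (\<lambda>\<tau>. bx \<tau> - bY \<tau>) + 2 * N2 (\<lambda>\<tau>. bY \<tau> - bz \<tau>))"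
    unfolding distA2_def n by (intro add_mono 1 2 3)
  also have "\<dots> = 2 * d2 x y + 2 * d2 y z" unfolding distA2_def n by (simp add: distrib_left add_ac)
  finally show ?thesis .
qed

lemma d2_zero_trans: "FA x \<Longrightarrow> FA y \<Longrightarrow> FA z \<Longrightarrow> d2 x y = 0 \<Longrightarrow> d2 y z = 0 \<Longrightarrow> d2 x z = 0"
  using d2_triangle[of x y z] by simp

lemma d2_sym: "FA x \<Longrightarrow> FA y \<Longrightarrow> d2 x y = d2 y x"
proof -
  assume F: "FA x" "FA y"
  obtain bx bY where p: "prof (snd (snd x)) bx" "prof (snd (snd y)) bY" using FA_prof[OF F(1)] FA_prof[OF F(2)] by blast
  show ?thesis using F unfolding distA2_def prof_norm[OF prof_diff[OF p(1,2)]] prof_norm[OF prof_diff[OF p(2,1)]]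
    by (simp add: B_diff in_frakA_def norm_minus_commute N2_def)
qed

text \<open>Contractivity applied to x - y. The factor 2 comes from the relaxed triangle inequality
  for squared distances, which enters because S is linear only up to distance zero.\<close>

lemma S_lipschitz: assumes t: "t \<ge> 0" and "FA x" "FA y" shows "d2 (S t x) (S t y) \<le> 2 * d2 x y"
proof -
  have F: "FA (st_lin 1 x (-1) y)" using assms by (intro FA_lin)
  have "d2 (S t x) (S t y) = d2 (st_lin 1 (S t x) (-1) (S t y)) st_zero" by (rule d2_st_lin)
  also have "\<dots> \<le> 2 * d2 (st_lin 1 (S t x) (-1) (S t y)) (S t (st_lin 1 x (-1) y)) + 2 * d2 (S t (st_lin 1 x (-1) y)) st_zero"
    by (intro d2_triangle FA_lin S_FA F FA_0 assms)
  also have "d2 (st_lin 1 (S t x) (-1) (S t y)) (S t (st_lin 1 x (-1) y)) = 0"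
    using S_lin[OF t assms(2,3), of 1 "-1"] d2_sym[of "st_lin 1 (S t x) (-1) (S t y)" "S t (st_lin 1 x (-1) y)"] assms F
    by (simp add: FA_lin S_FA)
  also have "d2 (S t (st_lin 1 x (-1) y)) st_zero \<le> d2 (st_lin 1 x (-1) y) st_zero" by (rule S_contr[OF t F])
  also have "d2 (st_lin 1 x (-1) y) st_zero = d2 x y" by (rule d2_st_lin[symmetric])
  finally show ?thesis by (simp add: mult_left_mono)
qed

section \<open>Bounded functionals along orbits\<close>

text \<open>Bounded linear maps from the state space to H, through which orbits are observed.
  Boundedness is phrased with a real upper bound e of the norm, since squared norms are extended
  reals.\<close>

definition blf :: "('h st \<Rightarrow> 'h) \<Rightarrow> bool" where
  "blf f \<longleftrightarrow> (\<forall>x y a b. FA x \<longrightarrow> FA y \<longrightarrow> f (st_lin a x b y) = a *\<^sub>R f x + b *\<^sub>R f y) \<and>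
     (\<exists>C>0. \<forall>x e. FA x \<longrightarrow> e > 0 \<longrightarrow> d2 x st_zero \<le> ennreal (e\<^sup>2) \<longrightarrow> norm (f x) \<le> C * e)"

lemma blf_lin: "blf f \<Longrightarrow> FA x \<Longrightarrow> FA y \<Longrightarrow> f (st_lin a x b y) = a *\<^sub>R f x + b *\<^sub>R f y" unfolding blf_def by blast

lemma blf_bound: assumes "blf f"
  obtains C where "C > 0" "\<And>x y e. FA x \<Longrightarrow> FA y \<Longrightarrow> e > 0 \<Longrightarrow> d2 x y \<le> ennreal (e\<^sup>2) \<Longrightarrow> norm (f x - f y) \<le> C * e"
proof -
  obtain C where C: "C > 0" "\<And>x e. FA x \<Longrightarrow> e > 0 \<Longrightarrow> d2 x st_zero \<le> ennreal (e\<^sup>2) \<Longrightarrow> norm (f x) \<le> C * e"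
    using assms unfolding blf_def by metis
  have "norm (f x - f y) \<le> C * e" if h: "FA x" "FA y" "e > 0" "d2 x y \<le> ennreal (e\<^sup>2)" for x y e
  proof -
    have "norm (f (st_lin 1 x (-1) y)) \<le> C * e"
      by (rule C(2)) (use h d2_st_lin[of x y] in \<open>auto intro: FA_lin\<close>)
    then show ?thesis using blf_lin[OF assms h(1,2), of 1 "-1"] by simp
  qed
  then show thesis using that C(1) by blast
qed

text \<open>Lets a bounded functional be evaluated on any representative of a state.\<close>

lemma blf_cong: assumes f: "blf f" and F: "FA x" "FA y" and z: "d2 x y = 0" shows "f x = f y"
proof -
  obtain C where C: "C > 0" "\<And>x y e. FA x \<Longrightarrow> FA y \<Longrightarrow> e > 0 \<Longrightarrow> d2 x y \<le> ennreal (e\<^sup>2) \<Longrightarrow> norm (f x - f y) \<le> C * e"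
    using blf_bound[OF f] by metis
  have "norm (f x - f y) \<le> 0 + e" if "e > 0" for e
  proof -
    have "norm (f x - f y) \<le> C * (e / C)" by (rule C(2)) (use that C(1) F z in auto)
    then show ?thesis using C(1) by simp
  qed
  then have "norm (f x - f y) \<le> 0" by (rule field_le_epsilon)
  then show ?thesis by simp
qed

lemma blf_continuous: assumes f: "blf f" and x: "FA x" shows "continuous_on {0..} (\<lambda>t. f (S t x))"
  unfolding continuous_on_def
proof (intro ballI tendstoI)
  fix t0 e :: real assume t0: "t0 \<in> {0..}" and e: "e > 0"
  obtain C where C: "C > 0" "\<And>x y e. FA x \<Longrightarrow> FA y \<Longrightarrow> e > 0 \<Longrightarrow> d2 x y \<le> ennreal (e\<^sup>2) \<Longrightarrow> norm (f x - f y) \<le> C * e"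
    using blf_bound[OF f] by metis
  define \<delta> where "\<delta> = e / (2 * C)"
  have \<delta>: "\<delta> > 0" using e C by (simp add: \<delta>_def)
  have "\<forall>\<^sub>F t in at t0 within {0..}. d2 (S t x) (S t0 x) < ennreal (\<delta>\<^sup>2)"
    using S_cont[OF x, of t0] t0 \<delta> by (intro order_tendstoD(2)) auto
  moreover have "\<forall>\<^sub>F t in at t0 within {0..}. t \<in> {0..}" by (auto simp: eventually_at_filter)
  ultimately show "\<forall>\<^sub>F t in at t0 within {0..}. dist (f (S t x)) (f (S t0 x)) < e"
  proof eventually_elim
    case (elim t)
    have "norm (f (S t x) - f (S t0 x)) \<le> C * \<delta>" by (rule C(2)) (use elim t0 \<delta> x S_FA in auto)
    also have "\<dots> < e" using C(1) e by (simp add: \<delta>_def)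
    finally show ?case by (simp add: dist_norm)
  qed
qed

lemma S_commute: assumes "t \<ge> 0" "s \<ge> 0" "FA x" shows "d2 (S t (S s x)) (S s (S t x)) = 0"
proof -
  have F: "FA (S t (S s x))" "FA (S s (S t x))" "FA (S (t + s) x)" using assms by (auto intro!: S_FA)
  have 1: "d2 (S t (S s x)) (S (t + s) x) = 0" using S_add[OF assms] d2_sym F by simp
  have 2: "d2 (S (t + s) x) (S s (S t x)) = 0" using S_add[OF assms(2,1,3)] by (simp add: add.commute)
  show ?thesis by (rule d2_zero_trans[OF F(1,3,2) 1 2])
qed

lemma d2_zero_lin: assumes F: "FA x" "FA x'" "FA y" and z: "d2 x x' = 0"
  shows "d2 (st_lin a x b y) (st_lin a x' b y) = 0"
proof -
  have ae: "AE \<tau> in lborel. \<tau> \<in> Omega l \<longrightarrow> snd (snd x) \<tau> = snd (snd x') \<tau>"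
    and e: "fst x = fst x'" "fst (snd x) = fst (snd x')" using distA2_zero_imp[OF z F(1,2)] by auto
  have "normV2 l \<mu> B (\<lambda>\<tau>. snd (snd (st_lin a x b y)) \<tau> - snd (snd (st_lin a x' b y)) \<tau>) = N2 (\<lambda>\<tau>. 0 :: 'h)"
    by (rule prof_norm, rule prof_cong[OF prof_0], use ae in eventually_elim) (auto simp: st_lin_def)
  then show ?thesis using e by (simp add: distA2_def st_lin_def N2_def B_0)
qed

text \<open>S t commutes with the difference quotients at 0 up to distance zero. The constant 4 is
  the triangle factor 2 times the Lipschitz factor 2.\<close>

lemma S_GR: assumes t: "t \<ge> 0" and F: "FA x" "FA y" and g: "GR x y" shows "GR (S t x) (S t y)"
proof -
  have SF: "FA (S t x)" "FA (S t y)" using F t by (auto intro: S_FA)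
  define q where "q h = st_lin (1/h) (S h x) (-1/h) x" for h
  have lim: "((\<lambda>h. d2 (q h) y) \<longlongrightarrow> 0) (at_right 0)" using g S_gen[OF F] by (simp add: q_def)
  have "((\<lambda>h. d2 (st_lin (1/h) (S h (S t x)) (-1/h) (S t x)) (S t y)) \<longlongrightarrow> 0) (at_right 0)"
  proof (rule tendsto_sandwich[OF _ _ tendsto_const])
    have "((\<lambda>h. 4 * d2 (q h) y) \<longlongrightarrow> 4 * 0) (at_right 0)" by (intro ennreal_tendsto_cmult lim) (simp add: less_top[symmetric])
    then show "((\<lambda>h. 4 * d2 (q h) y) \<longlongrightarrow> 0) (at_right 0)" by simp
    show "\<forall>\<^sub>F h in at_right 0. d2 (st_lin (1/h) (S h (S t x)) (-1/h) (S t x)) (S t y) \<le> 4 * d2 (q h) y"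
      using eventually_at_right_less[of 0]
    proof eventually_elim
      case (elim h)
      then have h: "h \<ge> 0" by simp
      have Fq: "FA (q h)" unfolding q_def by (intro FA_lin S_FA F h)
      let ?w = "st_lin (1/h) (S h (S t x)) (-1/h) (S t x)" and ?w' = "st_lin (1/h) (S t (S h x)) (-1/h) (S t x)"
      have FF: "FA (S h (S t x))" "FA (S t (S h x))" "FA (S h x)" by (intro S_FA F h t)+
      have Fw: "FA ?w" "FA ?w'" by (intro FA_lin S_FA F h t)+
      have 1: "d2 ?w ?w' = 0" by (rule d2_zero_lin[OF FF(1,2) SF(1) S_commute[OF h t F(1)]])
      have "d2 (S t (q h)) ?w' = 0" unfolding q_def by (rule S_lin[OF t FF(3) F(1)])
      then have 2: "d2 ?w' (S t (q h)) = 0" using d2_sym[OF Fw(2) S_FA[OF t Fq]] by simp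
      have 3: "d2 ?w (S t (q h)) = 0" by (rule d2_zero_trans[OF Fw(1,2) S_FA[OF t Fq] 1 2])
      have "d2 ?w (S t y) \<le> 2 * d2 ?w (S t (q h)) + 2 * d2 (S t (q h)) (S t y)" by (intro d2_triangle Fw S_FA Fq F t)
      also have "\<dots> = 2 * d2 (S t (q h)) (S t y)" using 3 by simp
      also have "\<dots> \<le> 2 * (2 * d2 (q h) y)" by (intro mult_left_mono S_lipschitz t Fq F) simp
      also have "\<dots> = 4 * d2 (q h) y" by (simp add: mult.assoc[symmetric])
      finally show ?case .
    qed
  qed simp
  then show ?thesis using S_gen[OF SF] by simp
qed

text \<open>The quotient error is controlled at time 0 and transported by the Lipschitz map S s, so
  \<delta> does not depend on s. This uniformity is what yields derivatives from the left.\<close>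

lemma blf_S_increment:
  assumes f: "blf f" and F: "FA x" "FA y" and g: "GR x y" and e: "\<epsilon> > 0"
  shows "\<exists>\<delta>>0. \<forall>s h. 0 \<le> s \<longrightarrow> 0 < h \<longrightarrow> h < \<delta> \<longrightarrow> norm (f (S (s + h) x) - f (S s x) - h *\<^sub>R f (S s y)) \<le> \<epsilon> * h"
proof -
  obtain C where C: "C > 0" "\<And>x y e. FA x \<Longrightarrow> FA y \<Longrightarrow> e > 0 \<Longrightarrow> d2 x y \<le> ennreal (e\<^sup>2) \<Longrightarrow> norm (f x - f y) \<le> C * e"
    using blf_bound[OF f] by metis
  define \<eta> where "\<eta> = \<epsilon> / C"
  have \<eta>: "\<eta> > 0" using e C by (simp add: \<eta>_def)
  define q where "q h = st_lin (1/h) (S h x) (-1/h) x" for h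
  have "((\<lambda>h. d2 (q h) y) \<longlongrightarrow> 0) (at_right 0)" using g S_gen[OF F] by (simp add: q_def)
  then have "\<forall>\<^sub>F h in at_right 0. d2 (q h) y < ennreal (\<eta>\<^sup>2 / 2)" using \<eta> by (intro order_tendstoD(2)) auto
  then obtain \<delta> where \<delta>: "\<delta> > 0" "\<And>h. 0 < h \<Longrightarrow> h < \<delta> \<Longrightarrow> d2 (q h) y < ennreal (\<eta>\<^sup>2 / 2)"
    by (auto simp: eventually_at_right_field)
  show ?thesis
  proof (intro exI[of _ \<delta>] conjI allI impI \<delta>(1))
    fix s h :: real assume s: "0 \<le> s" and h: "0 < h" "h < \<delta>"
    have h0: "h \<ge> 0" using h by simp
    have Fq: "FA (q h)" and Fh: "FA (S h x)" unfolding q_def by (intro FA_lin S_FA F h0)+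
    have "d2 (S s (q h)) (S s y) \<le> 2 * d2 (q h) y" by (rule S_lipschitz[OF s Fq F(2)])
    also have "\<dots> \<le> 2 * ennreal (\<eta>\<^sup>2 / 2)" using \<delta>(2)[OF h] by (intro mult_left_mono) auto
    also have "\<dots> = ennreal 2 * ennreal (\<eta>\<^sup>2 / 2)" by simp
    also have "\<dots> = ennreal (\<eta>\<^sup>2)" by (subst ennreal_mult[symmetric]) auto
    finally have "norm (f (S s (q h)) - f (S s y)) \<le> C * \<eta>" by (intro C(2) S_FA s Fq F \<eta>)
    then have le: "norm (f (S s (q h)) - f (S s y)) \<le> \<epsilon>" using C(1) by (simp add: \<eta>_def)
    have "f (S s (q h)) = f (st_lin (1/h) (S s (S h x)) (-1/h) (S s x))"
      unfolding q_def by (rule blf_cong[OF f _ _ S_lin[OF s Fh F(1)]]) (intro FA_lin S_FA s Fh F)+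
    also have "\<dots> = (1/h) *\<^sub>R f (S s (S h x)) + (-1/h) *\<^sub>R f (S s x)" by (intro blf_lin f S_FA s Fh F)
    also have "f (S s (S h x)) = f (S (s + h) x)"
      by (rule blf_cong[OF f, symmetric]) (intro S_add S_FA s h0 F add_nonneg_nonneg)+
    finally have "h *\<^sub>R f (S s (q h)) = f (S (s + h) x) - f (S s x)" using h by (simp add: scaleR_add_right scaleR_diff_right)
    then have "f (S (s + h) x) - f (S s x) - h *\<^sub>R f (S s y) = h *\<^sub>R (f (S s (q h)) - f (S s y))"
      by (simp add: scaleR_diff_right)
    then show "norm (f (S (s + h) x) - f (S s x) - h *\<^sub>R f (S s y)) \<le> \<epsilon> * h"
      using le h by (simp add: mult.commute mult_left_mono)
  qed
qed

lemma blf_S_derivative_classical: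
  assumes f: "blf f" and F: "FA x" "FA y" and g: "GR x y" and t: "t \<ge> 0"
  shows "((\<lambda>t. f (S t x)) has_vector_derivative f (S t y)) (at t within {0..})"
  unfolding has_vector_derivative_def has_derivative_within_alt
proof (intro conjI allI impI bounded_linear_scaleR_left)
  fix e :: real assume e: "0 < e"
  then have e2: "e / 2 > 0" by simp
  obtain \<delta>1 where \<delta>1: "\<delta>1 > 0" "\<And>s h. 0 \<le> s \<Longrightarrow> 0 < h \<Longrightarrow> h < \<delta>1 \<Longrightarrow> norm (f (S (s + h) x) - f (S s x) - h *\<^sub>R f (S s y)) \<le> e / 2 * h"
    using blf_S_increment[OF f F g e2] by blast
  obtain \<delta>2 where \<delta>2: "\<delta>2 > 0" "\<And>s. s \<ge> 0 \<Longrightarrow> dist s t < \<delta>2 \<Longrightarrow> dist (f (S s y)) (f (S t y)) < e / 2"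
    using blf_continuous[OF f F(2)] t e2 unfolding continuous_on_iff by (metis atLeast_iff)
  show "\<exists>d>0. \<forall>ya\<in>{0..}. norm (ya - t) < d \<longrightarrow> norm (f (S ya x) - f (S t x) - (ya - t) *\<^sub>R f (S t y)) \<le> e * norm (ya - t)"
  proof (intro exI[of _ "min \<delta>1 \<delta>2"] conjI ballI impI)
    show "0 < min \<delta>1 \<delta>2" using \<delta>1 \<delta>2 by simp
    fix r assume r: "r \<in> {0..}" and rt: "norm (r - t) < min \<delta>1 \<delta>2"
    consider "r = t" | "r > t" | "r < t" by linarith
    then show "norm (f (S r x) - f (S t x) - (r - t) *\<^sub>R f (S t y)) \<le> e * norm (r - t)"
    proof cases
      case 1 then show ?thesis by simp
    next
      case 2
      have "norm (f (S (t + (r - t)) x) - f (S t x) - (r - t) *\<^sub>R f (S t y)) \<le> e / 2 * (r - t)"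
        by (rule \<delta>1(2)) (use 2 rt t in auto)
      also have "\<dots> \<le> e * (r - t)" using 2 e by simp
      finally show ?thesis using 2 by simp
    next
      case 3
      \<comment> \<open>A left increment at t is a right increment at r; the estimate is uniform in
        r, and continuity of the functional along the orbit of y replaces r by t in the
        derivative.\<close>
      define h where "h = t - r"
      have h: "h > 0" "h < \<delta>1" "dist r t < \<delta>2" using 3 rt by (auto simp: h_def dist_real_def)
      have "norm (f (S (r + h) x) - f (S r x) - h *\<^sub>R f (S r y)) \<le> e / 2 * h"
        by (rule \<delta>1(2)) (use h r in auto)
      then have a: "norm (f (S t x) - f (S r x) - h *\<^sub>R f (S r y)) \<le> e / 2 * h" by (simp add: h_def)
      have "norm (h *\<^sub>R (f (S r y) - f (S t y))) \<le> h * (e / 2)"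
        using \<delta>2(2)[of r] r h by (simp add: dist_norm less_imp_le)
      moreover have "f (S r x) - f (S t x) - (r - t) *\<^sub>R f (S t y)
         = - (f (S t x) - f (S r x) - h *\<^sub>R f (S r y)) - h *\<^sub>R (f (S r y) - f (S t y))"
        by (simp add: h_def algebra_simps)
      ultimately have "norm (f (S r x) - f (S t x) - (r - t) *\<^sub>R f (S t y)) \<le> e / 2 * h + h * (e / 2)"
        using a norm_triangle_ineq4[of "- (f (S t x) - f (S r x) - h *\<^sub>R f (S r y))" "h *\<^sub>R (f (S r y) - f (S t y))"]
        by (simp only: norm_minus_cancel)
      then show ?thesis using 3 by (simp add: h_def algebra_simps)
    qed
  qed
qed

lemma has_integral_continuous_Icc:
  fixes g :: "real \<Rightarrow> 'h" assumes "continuous_on {0..} g" "t \<ge> 0" shows "(g has_integral integral {0..t} g) {0..t}"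
  by (rule integrable_integral) (rule integrable_continuous_real, rule continuous_on_subset[OF assms(1)], auto)

text \<open>The hypothesis says that g is a bounded extension of f composed with the generator. Both
  sides then depend continuously on the initial state, so the identity passes from the dense domain
  to every orbit.\<close>

theorem blf_S_integral:
  assumes f: "blf f" and g: "blf g" and fg: "\<And>x y. FA x \<Longrightarrow> FA y \<Longrightarrow> GR x y \<Longrightarrow> f y = g x"
    and x: "FA x" and t: "t \<ge> 0"
  shows "f (S t x) - f x = integral {0..t} (\<lambda>s. g (S s x))"
proof -
  have cl: "f (S t z) - f z = integral {0..t} (\<lambda>s. g (S s z))" if z: "FA z" "FA y" "GR z y" for z y
  proof -
    have "((\<lambda>s. g (S s z)) has_integral f (S t z) - f (S 0 z)) {0..t}"
    proof (rule fundamental_theorem_of_calculus[OF t])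
      fix s assume s: "s \<in> {0..t}"
      then have "((\<lambda>t. f (S t z)) has_vector_derivative f (S s y)) (at s within {0..})"
        by (intro blf_S_derivative_classical f z) auto
      moreover have "f (S s y) = g (S s z)" by (rule fg) (use z s in \<open>auto intro!: S_FA S_GR\<close>)
      ultimately show "((\<lambda>t. f (S t z)) has_vector_derivative g (S s z)) (at s within {0..t})"
        by (auto intro: has_vector_derivative_within_subset)
    qed
    moreover have "f (S 0 z) = f z" by (rule blf_cong[OF f _ _ S_0]) (use z S_FA in auto)
    ultimately show ?thesis by (simp add: integral_unique)
  qed
  obtain C where C: "C > 0" "\<And>x y e. FA x \<Longrightarrow> FA y \<Longrightarrow> e > 0 \<Longrightarrow> d2 x y \<le> ennreal (e\<^sup>2) \<Longrightarrow> norm (f x - f y) \<le> C * e"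
    using blf_bound[OF f] by metis
  obtain C' where C': "C' > 0" "\<And>x y e. FA x \<Longrightarrow> FA y \<Longrightarrow> e > 0 \<Longrightarrow> d2 x y \<le> ennreal (e\<^sup>2) \<Longrightarrow> norm (g x - g y) \<le> C' * e"
    using blf_bound[OF g] by metis
  \<comment> \<open>Orbits of states at distance e stay within 2e. The terms come from f at time t,
    from f at time 0, and from the integral of g.\<close>
  define K where "K = 2 * C + C + C' * 2 * t"
  have K: "K > 0" using C C' t by (simp add: K_def add_pos_nonneg)
  have "norm (f (S t x) - f x - integral {0..t} (\<lambda>s. g (S s x))) \<le> 0 + \<epsilon>" if \<epsilon>: "\<epsilon> > 0" for \<epsilon>
  proof -
    define e where "e = \<epsilon> / K"
    have e: "e > 0" using \<epsilon> K by (simp add: e_def)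
    obtain z y where z: "FA z" "FA y" "GR z y" "d2 x z \<le> ennreal (e\<^sup>2)" using gen_rel_dense[OF x e] by blast
    have Sd: "d2 (S s x) (S s z) \<le> ennreal ((2 * e)\<^sup>2)" if "s \<ge> 0" for s
    proof -
      have "d2 (S s x) (S s z) \<le> 2 * d2 x z" by (rule S_lipschitz[OF that x z(1)])
      also have "\<dots> \<le> ennreal 2 * ennreal (e\<^sup>2)" using z(4) by (intro mult_mono) auto
      also have "\<dots> = ennreal (2 * e\<^sup>2)" by (subst ennreal_mult) auto
      also have "\<dots> \<le> ennreal ((2 * e)\<^sup>2)" by (intro ennreal_leI) (simp add: power_mult_distrib)
      finally show ?thesis .
    qed
    have 1: "norm (f (S t x) - f (S t z)) \<le> C * (2 * e)" by (rule C(2)[OF _ _ _ Sd]) (use t x z e S_FA in auto)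
    have 2: "norm (f x - f z) \<le> C * e" by (rule C(2)) (use x z e in auto)
    have cont: "continuous_on {0..} (\<lambda>s. g (S s x))" "continuous_on {0..} (\<lambda>s. g (S s z))"
      by (intro blf_continuous g x z)+
    have i: "(\<lambda>s. g (S s x)) integrable_on {0..t}" "(\<lambda>s. g (S s z)) integrable_on {0..t}"
      using has_integral_continuous_Icc[OF cont(1) t] has_integral_continuous_Icc[OF cont(2) t] by blast+
    have 3: "norm (integral {0..t} (\<lambda>s. g (S s x)) - integral {0..t} (\<lambda>s. g (S s z))) \<le> C' * (2 * e) * t"
    proof -
      have "norm (integral {0..t} (\<lambda>s. g (S s x) - g (S s z))) \<le> (C' * (2 * e)) * (t - 0)"
      proof (rule integral_bound[OF t])
        show "continuous_on {0..t} (\<lambda>s. g (S s x) - g (S s z))"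
          by (intro continuous_on_diff continuous_on_subset[OF cont(1)] continuous_on_subset[OF cont(2)]) auto
        show "norm (g (S s x) - g (S s z)) \<le> C' * (2 * e)" if "s \<in> {0..t}" for s
          by (rule C'(2)[OF _ _ _ Sd]) (use that x z e S_FA in auto)
      qed
      then show ?thesis using integral_diff[OF i] by simp
    qed
    have eq: "f (S t x) - f x - integral {0..t} (\<lambda>s. g (S s x)) = (f (S t x) - f (S t z)) - (f x - f z)
       - (integral {0..t} (\<lambda>s. g (S s x)) - integral {0..t} (\<lambda>s. g (S s z)))"
      using cl[OF z(1,2,3)] by (simp add: algebra_simps)
    have "norm (f (S t x) - f x - integral {0..t} (\<lambda>s. g (S s x))) \<le> C * (2 * e) + C * e + C' * (2 * e) * t"
      unfolding eq using 1 2 3 norm_triangle_ineq4[of "(f (S t x) - f (S t z)) - (f x - f z)" "integral {0..t} (\<lambda>s. g (S s x)) - integral {0..t} (\<lambda>s. g (S s z))"]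
        norm_triangle_ineq4[of "f (S t x) - f (S t z)" "f x - f z"] by linarith
    also have "\<dots> = K * e" by (simp add: K_def algebra_simps)
    also have "\<dots> = \<epsilon>" using K by (simp add: e_def)
    finally show ?thesis by simp
  qed
  then have "norm (f (S t x) - f x - integral {0..t} (\<lambda>s. g (S s x))) \<le> 0" by (rule field_le_epsilon)
  then show ?thesis by simp
qed

lemma integral_has_vector_derivative_Ici:
  fixes g :: "real \<Rightarrow> 'h"
  assumes c: "continuous_on {0..} g" and t: "t \<ge> 0"
  shows "((\<lambda>t. integral {0..t} g) has_vector_derivative g t) (at t within {0..})"
proof -
  have "((\<lambda>t. integral {0..t} g) has_vector_derivative g t) (at t within {0..t + 1})"
    by (rule integral_has_vector_derivative[OF continuous_on_subset[OF c]]) (use t in auto)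
  moreover have "at t within {0..t + 1} = at t within {0..}"
    by (rule at_within_nhd[of t "{..<t + 1}"]) auto
  ultimately show ?thesis by simp
qed

text \<open>The integrand of the integral identity is continuous, so even orbits outside the domain
  are differentiable when observed through such an f.\<close>

theorem blf_S_derivative:
  assumes f: "blf f" and g: "blf g" and fg: "\<And>x y. FA x \<Longrightarrow> FA y \<Longrightarrow> GR x y \<Longrightarrow> f y = g x"
    and x: "FA x" and t: "t \<ge> 0"
  shows "((\<lambda>t. f (S t x)) has_vector_derivative g (S t x)) (at t within {0..})"
proof -
  have "((\<lambda>t. f x + integral {0..t} (\<lambda>s. g (S s x))) has_vector_derivative (0 + g (S t x))) (at t within {0..})"
    by (intro has_vector_derivative_add has_vector_derivative_const integral_has_vector_derivative_Ici blf_continuous g x t)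
  then have "((\<lambda>t. f x + integral {0..t} (\<lambda>s. g (S s x))) has_vector_derivative g (S t x)) (at t within {0..})" by simp
  then show ?thesis
  proof (rule has_vector_derivative_transform[rotated 2])
    show "f (S s x) = f x + integral {0..s} (\<lambda>s. g (S s x))" if "s \<in> {0..}" for s
    proof -
      have "f (S s x) - f x = integral {0..s} (\<lambda>s. g (S s x))"
        by (rule blf_S_integral[OF f g fg x]) (use that in auto)
      then show ?thesis by (simp add: algebra_simps)
    qed
  qed (use t in auto)
qed

section \<open>The functionals observed\<close>

lemma d2_zeroD:
  assumes "d2 x st_zero \<le> ennreal (e\<^sup>2)" "e > 0"
  shows "norm (B (fst x)) \<le> e" "norm (fst (snd x)) \<le> e" "normV2 l \<mu> B (snd (snd x)) \<le> ennreal (e\<^sup>2)"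
  using distA2_le[OF assms(1)] assms(2) by (auto simp: st_zero_def)

lemma R_bound: obtains C where "C > 0" "\<And>x. norm (R x) \<le> C * norm x"
  using R.pos_bounded by (metis mult.commute)

lemma blf_fst: "blf fst"
proof -
  obtain C where C: "C > 0" "\<And>x. norm (R x) \<le> C * norm x" using R_bound by blast
  have "norm (fst x) \<le> C * e" if h: "FA x" "e > 0" "d2 x st_zero \<le> ennreal (e\<^sup>2)" for x e
  proof -
    have "norm (fst x) = norm (R (B (fst x)))" using h(1) by (simp add: in_frakA_def)
    also have "\<dots> \<le> C * norm (B (fst x))" by (rule C(2))
    also have "\<dots> \<le> C * e" using d2_zeroD(1)[OF h(3,2)] C(1) by simp
    finally show ?thesis .
  qed
  then show ?thesis using C(1) unfolding blf_def by (auto simp: st_lin_def)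
qed

lemma blf_B_fst: "blf (\<lambda>x. B (fst x))"
proof -
  have "\<exists>C>0. \<forall>x e. FA x \<longrightarrow> e > 0 \<longrightarrow> d2 x st_zero \<le> ennreal (e\<^sup>2) \<longrightarrow> norm (B (fst x)) \<le> C * e"
    using d2_zeroD(1) by (intro exI[of _ 1]) auto
  then show ?thesis unfolding blf_def by (simp add: st_lin_def in_frakA_def B_add B_scale DB_scale)
qed

lemma blf_snd: "blf (\<lambda>x. fst (snd x))"
proof -
  have "\<exists>C>0. \<forall>x e. FA x \<longrightarrow> e > 0 \<longrightarrow> d2 x st_zero \<le> ennreal (e\<^sup>2) \<longrightarrow> norm (fst (snd x)) \<le> C * e"
    using d2_zeroD(2) by (intro exI[of _ 1]) auto
  then show ?thesis unfolding blf_def by (simp add: st_lin_def)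
qed

lemma blf_R_comp: assumes f: "blf f" shows "blf (\<lambda>x. R (f x))"
proof -
  obtain C where C: "C > 0" "\<And>x. norm (R x) \<le> C * norm x" using R_bound by blast
  obtain D where D: "D > 0" "\<And>x e. FA x \<Longrightarrow> e > 0 \<Longrightarrow> d2 x st_zero \<le> ennreal (e\<^sup>2) \<Longrightarrow> norm (f x) \<le> D * e"
    using f unfolding blf_def by metis
  have "norm (R (f x)) \<le> (C * D) * e" if h: "FA x" "e > 0" "d2 x st_zero \<le> ennreal (e\<^sup>2)" for x e
  proof -
    have "norm (R (f x)) \<le> C * norm (f x)" by (rule C(2))
    also have "\<dots> \<le> C * (D * e)" using D(2)[OF h] C(1) by simp
    finally show ?thesis by simp
  qed
  moreover have "C * D > 0" using C D by simp
  ultimately have "\<exists>C>0. \<forall>x e. FA x \<longrightarrow> e > 0 \<longrightarrow> d2 x st_zero \<le> ennreal (e\<^sup>2) \<longrightarrow> norm (R (f x)) \<le> C * e" by blast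
  then show ?thesis using f unfolding blf_def by (simp add: R_add R_scale)
qed

lemma blf_combine: assumes f: "blf f" and g: "blf g" shows "blf (\<lambda>x. p *\<^sub>R f x + q *\<^sub>R g x)"
proof -
  obtain C where C: "C > 0" "\<And>x e. FA x \<Longrightarrow> e > 0 \<Longrightarrow> d2 x st_zero \<le> ennreal (e\<^sup>2) \<Longrightarrow> norm (f x) \<le> C * e"
    using f unfolding blf_def by metis
  obtain D where D: "D > 0" "\<And>x e. FA x \<Longrightarrow> e > 0 \<Longrightarrow> d2 x st_zero \<le> ennreal (e\<^sup>2) \<Longrightarrow> norm (g x) \<le> D * e"
    using g unfolding blf_def by metis
  define K where "K = \<bar>p\<bar> * C + \<bar>q\<bar> * D + 1"
  have K: "K > 0" using C D by (simp add: K_def add_nonneg_pos)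
  have "norm (p *\<^sub>R f x + q *\<^sub>R g x) \<le> K * e" if h: "FA x" "e > 0" "d2 x st_zero \<le> ennreal (e\<^sup>2)" for x e
  proof -
    have "norm (p *\<^sub>R f x + q *\<^sub>R g x) \<le> \<bar>p\<bar> * norm (f x) + \<bar>q\<bar> * norm (g x)"
      by (rule order_trans[OF norm_triangle_ineq]) simp
    also have "\<dots> \<le> \<bar>p\<bar> * (C * e) + \<bar>q\<bar> * (D * e)" by (intro add_mono mult_left_mono C(2) D(2) h) auto
    also have "\<dots> \<le> K * e" using h(2) by (simp add: K_def algebra_simps)
    finally show ?thesis .
  qed
  then have "\<exists>C>0. \<forall>x e. FA x \<longrightarrow> e > 0 \<longrightarrow> d2 x st_zero \<le> ennreal (e\<^sup>2) \<longrightarrow> norm (p *\<^sub>R f x + q *\<^sub>R g x) \<le> C * e" using K by blast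
  then show ?thesis using f g unfolding blf_def by (simp add: algebra_simps)
qed

text \<open>Moments of the history profile. \<open>G (\<lambda>_. 1)\<close> is the contribution of
  the history to the restoring force; test functions \<phi> give the weak transport
  equation.\<close>

definition G :: "(real \<Rightarrow> real) \<Rightarrow> 'h st \<Rightarrow> 'h" where
  "G \<phi> x = integral\<^sup>L (lebesgue_on (Omega l)) (\<lambda>\<tau>. \<phi> \<tau> *\<^sub>R B (snd (snd x) \<tau>))"

lemma G_prof:
  assumes p: "prof (snd (snd x)) b" and \<phi>: "\<phi> \<in> borel_measurable borel" and C: "\<And>x. \<bar>\<phi> x\<bar> \<le> C"
  shows "G \<phi> x = (LINT \<tau>|lborel. \<phi> \<tau> *\<^sub>R b \<tau>)" "integrable lborel (\<lambda>\<tau>. \<phi> \<tau> *\<^sub>R b \<tau>)"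
proof -
  show i: "integrable lborel (\<lambda>\<tau>. \<phi> \<tau> *\<^sub>R b \<tau>)" by (rule prof_integral_bounded(1)[OF p \<phi> C])
  have e: "indicator (Omega l) \<tau> *\<^sub>R (\<phi> \<tau> *\<^sub>R b \<tau>) = \<phi> \<tau> *\<^sub>R b \<tau>" for \<tau>
    using wL2_zero[OF prof_wL2[OF p], of \<tau>] by (cases "\<tau> \<in> Omega l") auto
  show "G \<phi> x = (LINT \<tau>|lborel. \<phi> \<tau> *\<^sub>R b \<tau>)"
    unfolding G_def using prof_integral(4)[OF p Omega_borel order_refl \<phi>] i unfolding e by simp
qed

lemma blf_G: assumes \<phi>: "\<phi> \<in> borel_measurable borel" and C: "\<And>x. \<bar>\<phi> x\<bar> \<le> C" shows "blf (G \<phi>)"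
  unfolding blf_def
proof (intro conjI allI impI)
  fix x y a b assume F: "FA x" "FA y"
  obtain bx bY where p: "prof (snd (snd x)) bx" "prof (snd (snd y)) bY" using FA_prof[OF F(1)] FA_prof[OF F(2)] by blast
  have pl: "prof (snd (snd (st_lin a x b y))) (\<lambda>\<tau>. a *\<^sub>R bx \<tau> + b *\<^sub>R bY \<tau>)" using prof_lin[OF p] by (simp add: st_lin_def)
  have "G \<phi> (st_lin a x b y) = (LINT \<tau>|lborel. a *\<^sub>R (\<phi> \<tau> *\<^sub>R bx \<tau>) + b *\<^sub>R (\<phi> \<tau> *\<^sub>R bY \<tau>))"
    by (simp add: G_prof(1)[OF pl \<phi> C] scaleR_add_right mult.commute)
  also have "\<dots> = a *\<^sub>R (LINT \<tau>|lborel. \<phi> \<tau> *\<^sub>R bx \<tau>) + b *\<^sub>R (LINT \<tau>|lborel. \<phi> \<tau> *\<^sub>R bY \<tau>)"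
    by (simp only: Bochner_Integration.integral_add[OF integrable_scaleR_right[OF G_prof(2)[OF p(1) \<phi> C]]
          integrable_scaleR_right[OF G_prof(2)[OF p(2) \<phi> C]]] integral_scaleR_right)
  finally show "G \<phi> (st_lin a x b y) = a *\<^sub>R G \<phi> x + b *\<^sub>R G \<phi> y"
    by (simp add: G_prof(1)[OF p(1) \<phi> C] G_prof(1)[OF p(2) \<phi> C])
next
  define K where "K = (\<bar>C\<bar> + 1) * (1 + mass)"
  have "K > 0" using mass_nonneg by (simp add: K_def add_nonneg_pos add_pos_nonneg)
  moreover have "norm (G \<phi> x) \<le> K * e" if h: "FA x" "e > 0" "d2 x st_zero \<le> ennreal (e\<^sup>2)" for x e
  proof -
    obtain b where p: "prof (snd (snd x)) b" using FA_prof[OF h(1)] by blast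
    have w: "wL2 b" using p by (rule prof_wL2)
    have le: "N2 b \<le> ennreal (e\<^sup>2)" using d2_zeroD(3)[OF h(3,2)] prof_norm[OF p] by simp
    note b = wL2_integral_norm[OF w le h(2)]
    have "norm (G \<phi> x) \<le> (LINT \<tau>|lborel. norm (\<phi> \<tau> *\<^sub>R b \<tau>))"
      unfolding G_prof(1)[OF p \<phi> C] by (rule integral_norm_bound)
    also have "\<dots> \<le> (LINT \<tau>|lborel. (\<bar>C\<bar> + 1) * norm (b \<tau>))"
    proof (rule integral_mono)
      have "\<bar>\<phi> x\<bar> \<le> \<bar>C\<bar> + 1" for x using C[of x] by linarith
      then show "norm (\<phi> \<tau> *\<^sub>R b \<tau>) \<le> (\<bar>C\<bar> + 1) * norm (b \<tau>)" for \<tau> by (simp add: mult_right_mono)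
      show "integrable lborel (\<lambda>\<tau>. norm (\<phi> \<tau> *\<^sub>R b \<tau>))" by (rule integrable_norm[OF G_prof(2)[OF p \<phi> C]])
      show "integrable lborel (\<lambda>\<tau>. (\<bar>C\<bar> + 1) * norm (b \<tau>))" by (intro integrable_mult_right integrable_norm b(1))
    qed
    also have "\<dots> = (\<bar>C\<bar> + 1) * (LINT \<tau>|lborel. norm (b \<tau>))" by simp
    also have "\<dots> \<le> (\<bar>C\<bar> + 1) * ((1 + mass) * e)" by (rule mult_left_mono[OF b(2)]) simp
    finally show ?thesis by (simp add: K_def mult.assoc)
  qed
  ultimately show "\<exists>C>0. \<forall>x e. FA x \<longrightarrow> e > 0 \<longrightarrow> d2 x st_zero \<le> ennreal (e\<^sup>2) \<longrightarrow> norm (G \<phi> x) \<le> C * e" by blast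
qed

end

section \<open>Convolution with the memory kernel\<close>
text \<open>Absorbs end points, where a closed interval of integration meets values of
  \<open>deriv \<mu>\<close> that the open one omits.\<close>

lemma integral_modify_two_points:
  fixes h :: "real \<Rightarrow> 'b::{banach, second_countable_topology}"
  assumes [measurable]: "h \<in> borel_measurable borel"
  shows "(LINT s|lborel. h s + (indicator {a} s *\<^sub>R c + (indicator {b} s * q) *\<^sub>R d)) = (LINT s|lborel. h s)"
proof (rule integral_cong_AE)
  have "AE s in lborel. s \<noteq> a" "AE s in lborel. s \<noteq> b" by (rule AE_lborel_singleton)+
  then show "AE s in lborel. h s + (indicator {a} s *\<^sub>R c + (indicator {b} s * q) *\<^sub>R d) = h s"
    by eventually_elim simp
qed measurable

lemma triangle_fubini:
  fixes m :: "real \<Rightarrow> real" and v :: "real \<Rightarrow> 'b::{banach, second_countable_topology}"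
  assumes m: "integrable lborel m" and mm[measurable]: "m \<in> borel_measurable borel"
    and v: "integrable lborel v" and vm[measurable]: "v \<in> borel_measurable borel"
  shows "(LINT s|lborel. (LINT r|lborel. indicator {..<s} r * m r) *\<^sub>R v s)
       = (LINT r|lborel. m r *\<^sub>R (LINT s|lborel. indicator {r<..} s *\<^sub>R v s))"
proof -
  let ?f = "\<lambda>(s, r). (indicator {..<s} r * m r) *\<^sub>R v s"
  have meas: "?f \<in> borel_measurable (lborel \<Otimes>\<^sub>M lborel)"
  proof -
    have "(\<lambda>x::real \<times> real. indicator {x. snd x < fst x} x * m (snd x)) \<in> borel_measurable (lborel \<Otimes>\<^sub>M lborel)"
      by measurable
    then have "(\<lambda>x::real \<times> real. (indicator {x. snd x < fst x} x * m (snd x)) *\<^sub>R v (fst x)) \<in> borel_measurable (lborel \<Otimes>\<^sub>M lborel)"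
      by (intro borel_measurable_scaleR) simp_all
    moreover have "(\<lambda>x::real \<times> real. (indicator {x. snd x < fst x} x * m (snd x)) *\<^sub>R v (fst x)) = ?f"
      by (auto simp: indicator_def fun_eq_iff)
    ultimately show ?thesis by simp
  qed
  have im: "integrable lborel (\<lambda>r. indicator {..<s} r * m r)" for s
    using integrable_mult_indicator[OF _ m, of "{..<s}"] by simp
  have prod: "integrable (lborel \<Otimes>\<^sub>M lborel) ?f"
  proof (rule lborel_pair.Fubini_integrable[OF meas])
    show "integrable lborel (\<lambda>s. LINT r|lborel. norm (?f (s, r)))"
    proof (rule Bochner_Integration.integrable_bound)
      show "integrable lborel (\<lambda>s. (LINT r|lborel. \<bar>m r\<bar>) *\<^sub>R norm (v s))" using v by (intro integrable_scaleR_right integrable_norm)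
      show "(\<lambda>s. LINT r|lborel. norm (?f (s, r))) \<in> borel_measurable lborel"
        by (rule lborel.borel_measurable_lebesgue_integral) (use measurable_compose[OF meas borel_measurable_norm] in \<open>simp add: split_beta'\<close>)
      show "AE s in lborel. norm (LINT r|lborel. norm (?f (s, r))) \<le> norm ((LINT r|lborel. \<bar>m r\<bar>) *\<^sub>R norm (v s))"
      proof (rule AE_I2)
        fix s
        have n: "norm (?f (s, r)) = \<bar>indicator {..<s} r * m r\<bar> * norm (v s)" for r by simp
        have "(LINT r|lborel. norm (?f (s, r))) = (LINT r|lborel. \<bar>indicator {..<s} r * m r\<bar>) * norm (v s)"
          unfolding n by (rule integral_mult_left_zero)
        moreover have "(LINT r|lborel. \<bar>indicator {..<s} r * m r\<bar>) \<le> (LINT r|lborel. \<bar>m r\<bar>)"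
          by (rule integral_mono[OF integrable_abs[OF im] integrable_abs[OF m]]) (simp add: indicator_def)
        moreover have "0 \<le> (LINT r|lborel. \<bar>indicator {..<s} r * m r\<bar>)" "0 \<le> (LINT r|lborel. \<bar>m r\<bar>)" by simp_all
        ultimately show "norm (LINT r|lborel. norm (?f (s, r))) \<le> norm ((LINT r|lborel. \<bar>m r\<bar>) *\<^sub>R norm (v s))"
          by (simp add: abs_mult mult_right_mono)
      qed
    qed
    show "AE s in lborel. integrable lborel (\<lambda>r. ?f (s, r))"
      by (rule AE_I2) (use im in \<open>auto intro!: integrable_scaleR_left\<close>)
  qed
  have "(LINT s|lborel. (LINT r|lborel. indicator {..<s} r * m r) *\<^sub>R v s) = (LINT s|lborel. LINT r|lborel. ?f (s, r))"
    by (intro Bochner_Integration.integral_cong refl) (simp add: integral_scaleR_left[OF im])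
  also have "\<dots> = (LINT r|lborel. LINT s|lborel. ?f (s, r))"
    using lborel_pair.Fubini_integral[of "\<lambda>s r. ?f (s, r)"] prod by simp
  also have "\<dots> = (LINT r|lborel. m r *\<^sub>R (LINT s|lborel. indicator {r<..} s *\<^sub>R v s))"
  proof (intro Bochner_Integration.integral_cong refl)
    fix r
    have "(LINT s|lborel. ?f (s, r)) = (LINT s|lborel. m r *\<^sub>R (indicator {r<..} s *\<^sub>R v s))"
      by (intro Bochner_Integration.integral_cong) (auto simp: indicator_def)
    also have "\<dots> = m r *\<^sub>R (LINT s|lborel. indicator {r<..} s *\<^sub>R v s)" by (rule integral_scaleR_right)
    finally show "(LINT s|lborel. ?f (s, r)) = m r *\<^sub>R (LINT s|lborel. indicator {r<..} s *\<^sub>R v s)" .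
  qed
  finally show ?thesis .
qed

lemma lborel_integral_reflect:
  fixes f :: "real \<Rightarrow> 'b::{banach, second_countable_topology}"
  shows "(LINT x|lborel. f (c - x)) = (LINT x|lborel. f x)"
  using lborel_integral_real_affine[of "-1" f c] by simp

lemma lborel_integrable_reflect:
  fixes f :: "real \<Rightarrow> 'b::{banach, second_countable_topology}"
  shows "integrable lborel f \<Longrightarrow> integrable lborel (\<lambda>x. f (c - x))"
  using lborel_integrable_real_affine[of f "-1" c] by simp

lemma lborel_integral_shift:
  fixes f :: "real \<Rightarrow> 'b::{banach, second_countable_topology}"
  shows "(LINT x|lborel. f (c + x)) = (LINT x|lborel. f x)"
  using lborel_integral_real_affine[of 1 f c] by simp

lemma lborel_integrable_shift:
  fixes f :: "real \<Rightarrow> 'b::{banach, second_countable_topology}"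
  shows "integrable lborel f \<Longrightarrow> integrable lborel (\<lambda>x. f (c + x))"
  using lborel_integrable_real_affine[of f 1 c] by simp

definition cut :: "real \<Rightarrow> (real \<Rightarrow> 'b::real_vector) \<Rightarrow> real \<Rightarrow> 'b" where
  "cut T v s = indicator {0..T} s *\<^sub>R v s"

lemma cut_integrable:
  fixes v :: "real \<Rightarrow> 'b::{banach, second_countable_topology}"
  assumes v: "continuous_on {0..} v"
  shows "integrable lborel (cut T v)" "cut T v \<in> borel_measurable borel"
proof -
  have "set_integrable lborel {0..T} v" by (rule borel_integrable_atLeastAtMost') (rule continuous_on_subset[OF v], auto)
  then show "integrable lborel (cut T v)" by (simp add: set_integrable_def cut_def[abs_def])
  then show "cut T v \<in> borel_measurable borel" by (auto dest: borel_measurable_integrable)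
qed

lemma continuous_Ici_max:
  fixes v :: "real \<Rightarrow> 'b::topological_space"
  assumes "continuous_on {0..} v" shows "continuous_on UNIV (\<lambda>t. v (max 0 t))"
  by (rule continuous_on_compose2[OF assms]) (auto intro!: continuous_intros)

text \<open>Reduced to the real-valued theorem by pairing with every vector of the space.\<close>

lemma FTC_Icc:
  fixes u v :: "real \<Rightarrow> 'b::{real_inner, banach, second_countable_topology}"
  assumes v: "continuous_on {a..b} v" and d: "\<And>t. t \<in> {a..b} \<Longrightarrow> (u has_vector_derivative v t) (at t within {a..b})"
    and ab: "a \<le> b"
  shows "(LINT s:{a..b}|lborel. v s) = u b - u a"
proof -
  have vi: "set_integrable lborel {a..b} v"
    by (rule borel_integrable_atLeastAtMost') (rule v)
  have "inner h (LINT s:{a..b}|lborel. v s) = inner h (u b - u a)" for h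
  proof -
    have "inner h (LINT s:{a..b}|lborel. v s) = (LINT s|lborel. inner h (indicator {a..b} s *\<^sub>R v s))"
      unfolding set_lebesgue_integral_def
      by (rule integral_inner_right[symmetric]) (use vi in \<open>simp add: set_integrable_def\<close>)
    also have "\<dots> = (LINT s|lborel. indicator {a..b} s *\<^sub>R inner h (v s))" by simp
    also have "\<dots> = inner h (u b) - inner h (u a)"
    proof (rule integral_FTC_atLeastAtMost[OF ab])
      show "((\<lambda>x. inner h (u x)) has_vector_derivative inner h (v x)) (at x within {a..b})" if "a \<le> x" "x \<le> b" for x
      proof -
        have "(u has_vector_derivative v x) (at x within {a..b})"
          by (rule d) (use that in auto)
        then show ?thesis by (rule bounded_linear.has_vector_derivative[OF bounded_linear_inner_right])
      qed
      show "continuous_on {a..b} (\<lambda>x. inner h (v x))"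
        by (intro continuous_on_inner continuous_on_const v)
    qed
    finally show ?thesis by (simp add: inner_diff_right)
  qed
  then show ?thesis by (metis vector_eq_ldot)
qed

lemma FTC_Ici:
  fixes u v :: "real \<Rightarrow> 'b::{real_inner, banach, second_countable_topology}"
  assumes v: "continuous_on {0..} v" and d: "\<And>t. t \<ge> 0 \<Longrightarrow> (u has_vector_derivative v t) (at t within {0..})"
    and ab: "0 \<le> a" "a \<le> b"
  shows "(LINT s:{a..b}|lborel. v s) = u b - u a"
proof (rule FTC_Icc[OF _ _ ab(2)])
  show "continuous_on {a..b} v" by (rule continuous_on_subset[OF v]) (use ab in auto)
  show "(u has_vector_derivative v t) (at t within {a..b})" if "t \<in> {a..b}" for t
    by (rule has_vector_derivative_within_subset[OF d]) (use ab that in auto)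
qed

lemma cut_tail_integral:
  fixes u v :: "real \<Rightarrow> 'b::{real_inner, banach, second_countable_topology}"
  assumes v: "continuous_on {0..} v" and d: "\<And>t. t \<ge> 0 \<Longrightarrow> (u has_vector_derivative v t) (at t within {0..})"
    and r: "r \<le> T" "0 \<le> T"
  shows "(LINT s|lborel. indicator {r<..} s *\<^sub>R cut T v s) = u T - u (max 0 r)"
proof -
  have "(LINT s|lborel. indicator {r<..} s *\<^sub>R cut T v s) = (LINT s|lborel. indicator {max 0 r..T} s *\<^sub>R v s)"
  proof (rule integral_cong_AE)
    show "(\<lambda>s. indicator {r<..} s *\<^sub>R cut T v s) \<in> borel_measurable lborel" using cut_integrable(2)[OF v] by simp
    have "set_integrable lborel {max 0 r..T} v"
      by (rule borel_integrable_atLeastAtMost') (rule continuous_on_subset[OF v], auto)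
    then show "(\<lambda>s. indicator {max 0 r..T} s *\<^sub>R v s) \<in> borel_measurable lborel" unfolding set_integrable_def by (rule borel_measurable_integrable)
    have "AE s in lborel. s \<noteq> r" by (rule AE_lborel_singleton)
    then show "AE s in lborel. indicator {r<..} s *\<^sub>R cut T v s = indicator {max 0 r..T} s *\<^sub>R v s"
      by eventually_elim (auto simp: cut_def indicator_def)
  qed
  also have "\<dots> = u T - u (max 0 r)"
    using FTC_Ici[OF v d, of "max 0 r" T] r by (simp add: set_lebesgue_integral_def)
  finally show ?thesis .
qed

section \<open>Integration by parts and Fubini for the memory term\<close>

context memory_kernel_locale begin

text \<open>Integration by parts for an absolutely continuous kernel, obtained from Fubini:
  \<open>\<mu> (\<sigma> + T - s)\<close> is \<open>\<mu> (\<sigma> + T)\<close> minus an integral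
  of the derivative of \<mu>, and exchanging the order integrates v to u. Positivity of \<sigma>
  keeps the kernel away from its possible singularity.\<close>

lemma memory_by_parts:
  fixes u v :: "real \<Rightarrow> 'b::{real_inner, banach, second_countable_topology}"
  assumes v: "continuous_on {0..} v" and d: "\<And>t. t \<ge> 0 \<Longrightarrow> (u has_vector_derivative v t) (at t within {0..})"
    and \<sigma>: "\<sigma> > 0" and T: "T \<ge> 0"
  shows "(LINT s|lborel. \<mu> (\<sigma> + T - s) *\<^sub>R cut T v s)
     = \<mu> \<sigma> *\<^sub>R u T - \<mu> (\<sigma> + T) *\<^sub>R u 0 + (LINT s:{0..T}|lborel. deriv \<mu> (\<sigma> + s) *\<^sub>R u (T - s))"
proof -
  have uc: "continuous_on {0..} u"
    using d by (auto intro!: continuous_on_vector_derivative)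
  define um where "um t = u (max 0 t)" for t
  have umc: "continuous_on UNIV um" unfolding um_def by (rule continuous_Ici_max[OF uc])
  have [measurable]: "um \<in> borel_measurable borel" using umc by (rule borel_measurable_continuous_onI)
  have sT: "\<sigma> \<le> \<sigma> + T" using T by simp
  define m0 where "m0 x = indicator {\<sigma><..<\<sigma> + T} x *\<^sub>R deriv \<mu> x" for x
  have m0i: "integrable lborel m0" using mu_FTC(1)[OF \<sigma> sT] by (simp add: m0_def[abs_def] set_integrable_def)
  have m0m[measurable]: "m0 \<in> borel_measurable borel" using borel_measurable_integrable[OF m0i] by simp
  \<comment> \<open>The reflected derivative of the kernel, supported in 0 < r < T; its integral up
    to s is the increment of \<mu> from \<sigma> + T - s to \<sigma> + T.\<close>
  define m where "m r = m0 (\<sigma> + T - r)" for r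
  have mi: "integrable lborel m" unfolding m_def[abs_def] by (rule lborel_integrable_reflect[OF m0i])
  have mm[measurable]: "m \<in> borel_measurable borel" unfolding m_def[abs_def] by measurable
  have inner: "(LINT r|lborel. indicator {..<s} r * m r) = \<mu> (\<sigma> + T) - \<mu> (\<sigma> + T - s)" if s: "0 \<le> s" "s \<le> T" for s
  proof -
    have "(LINT r|lborel. indicator {..<s} r * m r) = (LINT r|lborel. (\<lambda>x. indicator {\<sigma> + T - s<..} x * m0 x) (\<sigma> + T - r))"
      by (intro Bochner_Integration.integral_cong) (auto simp: m_def indicator_def)
    also have "\<dots> = (LINT x|lborel. indicator {\<sigma> + T - s<..} x * m0 x)" by (rule lborel_integral_reflect)
    also have "\<dots> = (LINT x:{\<sigma> + T - s<..<\<sigma> + T}|lborel. deriv \<mu> x)"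
      unfolding set_lebesgue_integral_def by (intro Bochner_Integration.integral_cong) (use s in \<open>auto simp: m0_def indicator_def\<close>)
    also have "\<dots> = \<mu> (\<sigma> + T) - \<mu> (\<sigma> + T - s)" by (rule mu_FTC(2)) (use s \<sigma> in auto)
    finally show ?thesis .
  qed
  have msupp: "m r = 0" if "\<not> (0 < r \<and> r < T)" for r using that by (auto simp: m_def m0_def indicator_def)
  note cv = cut_integrable[OF v, of T]
  have mubd: "\<mu> (\<sigma> + T - s) *\<^sub>R cut T v s = \<mu> (\<sigma> + T) *\<^sub>R cut T v s - (LINT r|lborel. indicator {..<s} r * m r) *\<^sub>R cut T v s" for s
    using inner[of s] by (cases "s \<in> {0..T}") (auto simp: cut_def scaleR_diff_left)
  have i2: "integrable lborel (\<lambda>s. (LINT r|lborel. indicator {..<s} r * m r) *\<^sub>R cut T v s)"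
  proof (rule Bochner_Integration.integrable_bound)
    show "integrable lborel (\<lambda>s. (\<mu> (\<sigma> + T) + \<mu> \<sigma>) *\<^sub>R cut T v s)" using cv by simp
    have "(\<lambda>s. (\<mu> (\<sigma> + T) - \<mu> (\<sigma> + T - s)) *\<^sub>R cut T v s) \<in> borel_measurable lborel" using cv by measurable
    moreover have "(\<lambda>s. (\<mu> (\<sigma> + T) - \<mu> (\<sigma> + T - s)) *\<^sub>R cut T v s) = (\<lambda>s. (LINT r|lborel. indicator {..<s} r * m r) *\<^sub>R cut T v s)"
    proof
      fix s show "(\<mu> (\<sigma> + T) - \<mu> (\<sigma> + T - s)) *\<^sub>R cut T v s = (LINT r|lborel. indicator {..<s} r * m r) *\<^sub>R cut T v s"
        using inner[of s] by (cases "s \<in> {0..T}") (auto simp: cut_def)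
    qed
    ultimately show "(\<lambda>s. (LINT r|lborel. indicator {..<s} r * m r) *\<^sub>R cut T v s) \<in> borel_measurable lborel" by simp
    show "AE s in lborel. norm ((LINT r|lborel. indicator {..<s} r * m r) *\<^sub>R cut T v s) \<le> norm ((\<mu> (\<sigma> + T) + \<mu> \<sigma>) *\<^sub>R cut T v s)"
    proof (rule AE_I2)
      fix s
      show "norm ((LINT r|lborel. indicator {..<s} r * m r) *\<^sub>R cut T v s) \<le> norm ((\<mu> (\<sigma> + T) + \<mu> \<sigma>) *\<^sub>R cut T v s)"
      proof (cases "s \<in> {0..T}")
        case True
        have "\<mu> (\<sigma> + T - s) \<le> \<mu> \<sigma>" using True \<sigma> by (intro mu_antimono) auto
        then have "\<bar>\<mu> (\<sigma> + T) - \<mu> (\<sigma> + T - s)\<bar> \<le> \<bar>\<mu> (\<sigma> + T) + \<mu> \<sigma>\<bar>"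
          using mu_nonneg[of "\<sigma> + T"] mu_nonneg[of "\<sigma> + T - s"] by linarith
        then show ?thesis using inner[of s] True by (simp add: mult_right_mono)
      qed (simp add: cut_def)
    qed
  qed
  have i1: "integrable lborel (\<lambda>s. \<mu> (\<sigma> + T) *\<^sub>R cut T v s)" using cv by simp
  have "(LINT s|lborel. \<mu> (\<sigma> + T - s) *\<^sub>R cut T v s)
     = (LINT s|lborel. \<mu> (\<sigma> + T) *\<^sub>R cut T v s) - (LINT s|lborel. (LINT r|lborel. indicator {..<s} r * m r) *\<^sub>R cut T v s)"
    unfolding mubd by (rule Bochner_Integration.integral_diff[OF i1 i2])
  also have "(LINT s|lborel. \<mu> (\<sigma> + T) *\<^sub>R cut T v s) = \<mu> (\<sigma> + T) *\<^sub>R (u T - u 0)"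
  proof -
    have "(LINT s|lborel. cut T v s) = u T - u 0"
      using FTC_Ici[OF v d order_refl T] by (simp add: cut_def set_lebesgue_integral_def)
    then show ?thesis by (simp only: integral_scaleR_right)
  qed
  also have "(LINT s|lborel. (LINT r|lborel. indicator {..<s} r * m r) *\<^sub>R cut T v s)
     = (LINT r|lborel. m r *\<^sub>R (LINT s|lborel. indicator {r<..} s *\<^sub>R cut T v s))"
    by (rule triangle_fubini[OF mi mm cv])
  also have "\<dots> = (LINT r|lborel. m r *\<^sub>R u T - m r *\<^sub>R um r)"
  proof (intro Bochner_Integration.integral_cong refl)
    fix r show "m r *\<^sub>R (LINT s|lborel. indicator {r<..} s *\<^sub>R cut T v s) = m r *\<^sub>R u T - m r *\<^sub>R um r"
      using msupp[of r] cut_tail_integral[OF v d, of r T] T by (cases "0 < r \<and> r < T") (auto simp: um_def scaleR_diff_right)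
  qed
  also have "\<dots> = (LINT r|lborel. m r *\<^sub>R u T) - (LINT r|lborel. m r *\<^sub>R um r)"
  proof (rule Bochner_Integration.integral_diff)
    show "integrable lborel (\<lambda>r. m r *\<^sub>R u T)" using mi by (intro integrable_scaleR_left)
    obtain C where C: "C \<ge> 0" "\<And>x. x \<in> {0..T} \<Longrightarrow> norm (um x) \<le> C"
      using continuous_on_Icc_bounded[OF continuous_on_subset[OF umc], of 0 T] by blast
    show "integrable lborel (\<lambda>r. m r *\<^sub>R um r)"
    proof (rule Bochner_Integration.integrable_bound)
      show "integrable lborel (\<lambda>r. C *\<^sub>R m r)" using mi by simp
      show "AE r in lborel. norm (m r *\<^sub>R um r) \<le> norm (C *\<^sub>R m r)"
      proof (rule AE_I2)
        fix r show "norm (m r *\<^sub>R um r) \<le> norm (C *\<^sub>R m r)"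
        proof (cases "0 < r \<and> r < T")
          case True
          then have "norm (um r) \<le> C" by (intro C(2)) auto
          then show ?thesis using C(1) mult_left_mono[of "norm (um r)" C "\<bar>m r\<bar>"] by (simp add: abs_mult mult.commute)
        qed (use msupp[of r] in simp)
      qed
    qed measurable
  qed
  also have "(LINT r|lborel. m r *\<^sub>R u T) = (\<mu> (\<sigma> + T) - \<mu> \<sigma>) *\<^sub>R u T"
  proof -
    have "(LINT r|lborel. m r) = (LINT r|lborel. m0 r)" unfolding m_def[abs_def] by (rule lborel_integral_reflect)
    also have "\<dots> = \<mu> (\<sigma> + T) - \<mu> \<sigma>" using mu_FTC(2)[OF \<sigma> sT] by (simp add: m0_def[abs_def] set_lebesgue_integral_def)
    finally show ?thesis using integral_scaleR_left[OF mi, of "u T"] by simp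
  qed
  also have "(LINT r|lborel. m r *\<^sub>R um r) = (LINT s:{0..T}|lborel. deriv \<mu> (\<sigma> + s) *\<^sub>R u (T - s))"
  proof -
    have "(LINT r|lborel. m r *\<^sub>R um r) = (LINT r|lborel. (\<lambda>s. m0 (\<sigma> + s) *\<^sub>R um (T - s)) (T - r))"
      by (simp add: m_def algebra_simps)
    also have "\<dots> = (LINT s|lborel. m0 (\<sigma> + s) *\<^sub>R um (T - s))" by (rule lborel_integral_reflect)
    also have "\<dots> = (LINT s|lborel. indicator {0..T} s *\<^sub>R (deriv \<mu> (\<sigma> + s) *\<^sub>R u (T - s)))"
    proof -
      \<comment> \<open>\<open>m0\<close> lives on an open interval, the statement on a closed one.
        The conditional prevents the end point from being counted twice when T = 0.\<close>
      have eq: "(\<lambda>s. indicator {0..T} s *\<^sub>R (deriv \<mu> (\<sigma> + s) *\<^sub>R u (T - s)))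
         = (\<lambda>s. m0 (\<sigma> + s) *\<^sub>R um (T - s) + (indicator {0} s *\<^sub>R (deriv \<mu> \<sigma> *\<^sub>R u T) + (indicator {T} s * (if T = 0 then 0 else 1)) *\<^sub>R (deriv \<mu> (\<sigma> + T) *\<^sub>R u 0)))"
        using T by (auto simp: fun_eq_iff m0_def um_def indicator_def)
      show ?thesis unfolding eq by (rule integral_modify_two_points[symmetric]) measurable
    qed
    finally show ?thesis by (simp add: set_lebesgue_integral_def)
  qed
  finally show ?thesis by (simp add: algebra_simps)
qed

text \<open>Fubini in (s, \<sigma>), with the absolute value of the coefficient dominated by C times
  a translate of \<mu>, whose integral is C mass for every s. The indicator restricts to \<sigma> >
  0, where the history formula lives.\<close>

lemma memory_product:
  fixes v :: "real \<Rightarrow> 'b::{banach, second_countable_topology}" and \<phi> :: "real \<Rightarrow> real"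
  assumes v: "integrable lborel v" and vm[measurable]: "v \<in> borel_measurable borel"
    and \<phi>[measurable]: "\<phi> \<in> borel_measurable borel" and C: "\<And>x. \<bar>\<phi> x\<bar> \<le> C"
  shows "(LINT s|lborel. (LINT \<sigma>|lborel. \<phi> \<sigma> * (indicator {0<..} \<sigma> * \<mu> (\<sigma> + T - s))) *\<^sub>R v s)
       = (LINT \<sigma>|lborel. \<phi> \<sigma> *\<^sub>R (indicator {0<..} \<sigma> *\<^sub>R (LINT s|lborel. \<mu> (\<sigma> + T - s) *\<^sub>R v s)))"
    "integrable lborel (\<lambda>\<sigma>. \<phi> \<sigma> *\<^sub>R (indicator {0<..} \<sigma> *\<^sub>R (LINT s|lborel. \<mu> (\<sigma> + T - s) *\<^sub>R v s)))"
    "integrable lborel (\<lambda>\<sigma>. \<phi> \<sigma> * (indicator {0<..} \<sigma> * \<mu> (\<sigma> + T - s)))"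
proof -
  have C0: "C \<ge> 0" using C[of 0] by linarith
  let ?k = "\<lambda>s \<sigma>. \<phi> \<sigma> * (indicator {0<..} \<sigma> * \<mu> (\<sigma> + T - s))"
  let ?f = "\<lambda>(s, \<sigma>). ?k s \<sigma> *\<^sub>R v s"
  have kb: "\<bar>?k s \<sigma>\<bar> \<le> C * \<mu> (T - s + \<sigma>)" for s \<sigma>
    using C[of \<sigma>] C0 by (auto simp: indicator_def abs_mult add.commute add_diff_eq intro!: mult_right_mono)
  have msi: "integrable lborel (\<lambda>\<sigma>. C * \<mu> (T - s + \<sigma>))" for s by (intro integrable_mult_right mu_shift_integrable)
  have ki: "integrable lborel (?k s)" for s
    by (rule Bochner_Integration.integrable_bound[OF msi[of s]]) (use kb C0 in \<open>auto simp: abs_mult\<close>)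
  then show "integrable lborel (\<lambda>\<sigma>. \<phi> \<sigma> * (indicator {0<..} \<sigma> * \<mu> (\<sigma> + T - s)))" .
  have meas: "?f \<in> borel_measurable (lborel \<Otimes>\<^sub>M lborel)"
  proof -
    have "(\<lambda>x::real \<times> real. \<phi> (snd x) * (indicator {0<..} (snd x) * \<mu> (snd x + T - fst x))) \<in> borel_measurable (lborel \<Otimes>\<^sub>M lborel)"
      by measurable
    then have "(\<lambda>x::real \<times> real. (\<phi> (snd x) * (indicator {0<..} (snd x) * \<mu> (snd x + T - fst x))) *\<^sub>R v (fst x)) \<in> borel_measurable (lborel \<Otimes>\<^sub>M lborel)"
      by (intro borel_measurable_scaleR) simp_all
    then show ?thesis by (simp add: split_beta')
  qed
  have prod: "integrable (lborel \<Otimes>\<^sub>M lborel) ?f"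
  proof (rule lborel_pair.Fubini_integrable[OF meas])
    show "integrable lborel (\<lambda>s. LINT \<sigma>|lborel. norm (?f (s, \<sigma>)))"
    proof (rule Bochner_Integration.integrable_bound)
      show "integrable lborel (\<lambda>s. (C * mass) *\<^sub>R norm (v s))" using v by (intro integrable_scaleR_right integrable_norm)
      show "(\<lambda>s. LINT \<sigma>|lborel. norm (?f (s, \<sigma>))) \<in> borel_measurable lborel"
        by (rule lborel.borel_measurable_lebesgue_integral) (use measurable_compose[OF meas borel_measurable_norm] in \<open>simp add: split_beta'\<close>)
      show "AE s in lborel. norm (LINT \<sigma>|lborel. norm (?f (s, \<sigma>))) \<le> norm ((C * mass) *\<^sub>R norm (v s))"
      proof (rule AE_I2)
        fix s
        have n: "norm (?f (s, \<sigma>)) = \<bar>?k s \<sigma>\<bar> * norm (v s)" for \<sigma> by simp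
        have e: "(LINT \<sigma>|lborel. norm (?f (s, \<sigma>))) = (LINT \<sigma>|lborel. \<bar>?k s \<sigma>\<bar>) * norm (v s)"
          unfolding n by (rule integral_mult_left_zero)
        have "(LINT \<sigma>|lborel. \<bar>?k s \<sigma>\<bar>) \<le> (LINT \<sigma>|lborel. C * \<mu> (T - s + \<sigma>))"
          by (rule integral_mono[OF integrable_abs[OF ki] msi kb])
        also have "\<dots> = C * mass" using lborel_integral_shift[of \<mu> "T - s"] by (simp add: mass_def)
        finally have le: "(LINT \<sigma>|lborel. \<bar>?k s \<sigma>\<bar>) \<le> C * mass" .
        have nn: "0 \<le> (LINT \<sigma>|lborel. \<bar>?k s \<sigma>\<bar>)" by simp
        show "norm (LINT \<sigma>|lborel. norm (?f (s, \<sigma>))) \<le> norm ((C * mass) *\<^sub>R norm (v s))"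
          unfolding e using mult_right_mono[OF le norm_ge_zero[of "v s"]] mult_nonneg_nonneg[OF nn norm_ge_zero[of "v s"]] by simp
      qed
    qed
    show "AE s in lborel. integrable lborel (\<lambda>\<sigma>. ?f (s, \<sigma>))"
      by (rule AE_I2) (use ki in \<open>auto intro!: integrable_scaleR_left\<close>)
  qed
  have swap: "(LINT s|lborel. ?f (s, \<sigma>)) = \<phi> \<sigma> *\<^sub>R (indicator {0<..} \<sigma> *\<^sub>R (LINT s|lborel. \<mu> (\<sigma> + T - s) *\<^sub>R v s))" for \<sigma>
  proof -
    have "(LINT s|lborel. ?f (s, \<sigma>)) = (LINT s|lborel. (\<phi> \<sigma> * indicator {0<..} \<sigma>) *\<^sub>R (\<mu> (\<sigma> + T - s) *\<^sub>R v s))"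
      by (intro Bochner_Integration.integral_cong) (simp_all add: mult.assoc)
    also have "\<dots> = (\<phi> \<sigma> * indicator {0<..} \<sigma>) *\<^sub>R (LINT s|lborel. \<mu> (\<sigma> + T - s) *\<^sub>R v s)" by (rule integral_scaleR_right)
    finally show ?thesis by simp
  qed
  have "(LINT s|lborel. (LINT \<sigma>|lborel. ?k s \<sigma>) *\<^sub>R v s) = (LINT s|lborel. LINT \<sigma>|lborel. ?f (s, \<sigma>))"
    by (intro Bochner_Integration.integral_cong refl) (simp add: integral_scaleR_left[OF ki])
  also have "\<dots> = (LINT \<sigma>|lborel. LINT s|lborel. ?f (s, \<sigma>))"
    using lborel_pair.Fubini_integral[of "\<lambda>s \<sigma>. ?f (s, \<sigma>)"] prod by simp
  finally show "(LINT s|lborel. (LINT \<sigma>|lborel. ?k s \<sigma>) *\<^sub>R v s) = (LINT \<sigma>|lborel. \<phi> \<sigma> *\<^sub>R (indicator {0<..} \<sigma> *\<^sub>R (LINT s|lborel. \<mu> (\<sigma> + T - s) *\<^sub>R v s)))"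
    unfolding swap .
  have "integrable lborel (\<lambda>\<sigma>. LINT s|lborel. ?f (s, \<sigma>))"
    using lborel_pair.integrable_snd[of "\<lambda>s \<sigma>. ?f (s, \<sigma>)"] prod by simp
  then show "integrable lborel (\<lambda>\<sigma>. \<phi> \<sigma> *\<^sub>R (indicator {0<..} \<sigma> *\<^sub>R (LINT s|lborel. \<mu> (\<sigma> + T - s) *\<^sub>R v s)))"
    unfolding swap .
qed

section \<open>Convolution with the kernel\<close>

definition memconv :: "(real \<Rightarrow> 'b::{banach, second_countable_topology}) \<Rightarrow> real \<Rightarrow> 'b" where
  "memconv \<beta> T = (LINT r:{0..T}|lborel. \<mu> r *\<^sub>R \<beta> (T - r))"

text \<open>M(T) for T \<ge> 0, written over the whole half-line because \<mu> vanishes from l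
  on.\<close>

definition tail_mass :: "real \<Rightarrow> real" where "tail_mass T = (LINT r:{T<..}|lborel. \<mu> r)"

lemma mu_times_bounded_integrable:
  fixes f :: "real \<Rightarrow> 'b::{banach, second_countable_topology}"
  assumes f: "f \<in> borel_measurable borel" and C: "\<And>x. norm (f x) \<le> C"
  shows "integrable lborel (\<lambda>r. \<mu> r *\<^sub>R f r)"
proof (rule Bochner_Integration.integrable_bound)
  show "integrable lborel (\<lambda>r. C * \<mu> r)" by (intro integrable_mult_right mu_integrable)
  have "C \<ge> 0" using C[of 0] norm_ge_zero[of "f 0"] by linarith
  then show "AE r in lborel. norm (\<mu> r *\<^sub>R f r) \<le> norm (C * \<mu> r)"
    using C mult_left_mono[OF C, of "\<mu> r" for r] by (intro AE_I2) (simp add: abs_mult mult.commute)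
qed (use f in measurable)

lemma shifted_cut:
  fixes \<beta> :: "real \<Rightarrow> 'b::{banach, second_countable_topology}"
  assumes \<beta>: "continuous_on {0..} \<beta>"
  shows "(\<lambda>r. indicator {0..T} r *\<^sub>R \<beta> (T - r)) \<in> borel_measurable borel"
    "\<exists>C. \<forall>r. norm (indicator {0..T} r *\<^sub>R \<beta> (T - r)) \<le> C"
proof -
  have eq: "indicator {0..T} r *\<^sub>R \<beta> (T - r) = cut T \<beta> (T - r)" for r by (auto simp: cut_def indicator_def)
  have [measurable]: "cut T \<beta> \<in> borel_measurable borel" by (rule cut_integrable(2)[OF \<beta>])
  show "(\<lambda>r. indicator {0..T} r *\<^sub>R \<beta> (T - r)) \<in> borel_measurable borel" unfolding eq by measurable
  obtain C where C: "C \<ge> 0" "\<And>x. x \<in> {0..T} \<Longrightarrow> norm (\<beta> x) \<le> C"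
    using continuous_on_Icc_bounded[OF continuous_on_subset[OF \<beta>], of 0 T] by fastforce
  have "norm (indicator {0..T} r *\<^sub>R \<beta> (T - r)) \<le> C" for r
    using C(1) C(2)[of "T - r"] by (auto simp: indicator_def)
  then show "\<exists>C. \<forall>r. norm (indicator {0..T} r *\<^sub>R \<beta> (T - r)) \<le> C" by blast
qed

lemma memconv_integrable:
  fixes \<beta> :: "real \<Rightarrow> 'b::{banach, second_countable_topology}"
  assumes \<beta>: "continuous_on {0..} \<beta>"
  shows "set_integrable lborel {0..T} (\<lambda>r. \<mu> r *\<^sub>R \<beta> (T - r))"
proof -
  obtain C where "\<And>r. norm (indicator {0..T} r *\<^sub>R \<beta> (T - r)) \<le> C" using shifted_cut(2)[OF \<beta>] by blast
  then have "integrable lborel (\<lambda>r. \<mu> r *\<^sub>R (indicator {0..T} r *\<^sub>R \<beta> (T - r)))"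
    by (rule mu_times_bounded_integrable[OF shifted_cut(1)[OF \<beta>]])
  then show ?thesis by (simp add: set_integrable_def mult.commute)
qed

lemma memconv_bounded_linear:
  fixes \<beta> :: "real \<Rightarrow> 'b::{banach, second_countable_topology}" and L :: "'b \<Rightarrow> 'c::{banach, second_countable_topology}"
  assumes L: "bounded_linear L" and \<beta>: "continuous_on {0..} \<beta>"
  shows "memconv (\<lambda>t. L (\<beta> t)) T = L (memconv \<beta> T)"
proof -
  interpret L: bounded_linear L by (rule L)
  have "memconv (\<lambda>t. L (\<beta> t)) T = (LINT r|lborel. L (indicator {0..T} r *\<^sub>R (\<mu> r *\<^sub>R \<beta> (T - r))))"
    unfolding memconv_def set_lebesgue_integral_def by (intro Bochner_Integration.integral_cong) (simp_all add: L.scaleR)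
  also have "\<dots> = L (memconv \<beta> T)"
    unfolding memconv_def set_lebesgue_integral_def
    by (rule integral_bounded_linear[OF L]) (use memconv_integrable[OF \<beta>] in \<open>simp add: set_integrable_def\<close>)
  finally show ?thesis .
qed

text \<open>The \<sigma>-integral of the kernel equals that of \<open>\<mu> (T - r)\<close> over r <
  s, so exchanging the order turns v into u T - u (max 0 r). The three terms come from u T, from 0
  \<le> r \<le> T, and from r < 0, where u (max 0 r) is u 0.\<close>

lemma memory_total:
  fixes u v :: "real \<Rightarrow> 'b::{real_inner, banach, second_countable_topology}"
  assumes v: "continuous_on {0..} v" and d: "\<And>t. t \<ge> 0 \<Longrightarrow> (u has_vector_derivative v t) (at t within {0..})"
    and T: "T \<ge> 0"
  shows "(LINT \<sigma>|lborel. indicator {0<..} \<sigma> *\<^sub>R (LINT s|lborel. \<mu> (\<sigma> + T - s) *\<^sub>R cut T v s))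
     = mass *\<^sub>R u T - memconv u T - tail_mass T *\<^sub>R u 0"
proof -
  have uc: "continuous_on {0..} u" using d by (auto intro!: continuous_on_vector_derivative)
  define um where "um t = u (max 0 t)" for t
  have umc: "continuous_on UNIV um" unfolding um_def by (rule continuous_Ici_max[OF uc])
  have umm[measurable]: "um \<in> borel_measurable borel" using umc by (rule borel_measurable_continuous_onI)
  note cv = cut_integrable[OF v, of T]
  define m where "m r = \<mu> (T - r)" for r
  have mi: "integrable lborel m" unfolding m_def[abs_def] by (rule lborel_integrable_reflect[OF mu_integrable])
  have mm[measurable]: "m \<in> borel_measurable borel" unfolding m_def[abs_def] by measurable
  have "(LINT \<sigma>|lborel. indicator {0<..} \<sigma> *\<^sub>R (LINT s|lborel. \<mu> (\<sigma> + T - s) *\<^sub>R cut T v s))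
     = (LINT s|lborel. (LINT \<sigma>|lborel. indicator {0<..} \<sigma> * \<mu> (\<sigma> + T - s)) *\<^sub>R cut T v s)"
    using memory_product(1)[OF cv, of "\<lambda>_. 1" 1 T] by simp
  also have "\<dots> = (LINT s|lborel. (LINT r|lborel. indicator {..<s} r * m r) *\<^sub>R cut T v s)"
  proof (intro Bochner_Integration.integral_cong refl)
    fix s
    have "(LINT r|lborel. indicator {..<s} r * m r) = (LINT r|lborel. (\<lambda>\<sigma>. indicator {0<..} \<sigma> * \<mu> (\<sigma> + T - s)) (s - r))"
      by (intro Bochner_Integration.integral_cong) (auto simp: m_def indicator_def)
    also have "\<dots> = (LINT \<sigma>|lborel. indicator {0<..} \<sigma> * \<mu> (\<sigma> + T - s))" by (rule lborel_integral_reflect)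
    finally show "(LINT \<sigma>|lborel. indicator {0<..} \<sigma> * \<mu> (\<sigma> + T - s)) *\<^sub>R cut T v s = (LINT r|lborel. indicator {..<s} r * m r) *\<^sub>R cut T v s" by simp
  qed
  also have "\<dots> = (LINT r|lborel. m r *\<^sub>R (LINT s|lborel. indicator {r<..} s *\<^sub>R cut T v s))"
    by (rule triangle_fubini[OF mi mm cv])
  also have "\<dots> = (LINT r|lborel. (\<lambda>r. \<mu> r *\<^sub>R (u T - um (T - r))) (T - r))"
  proof (intro Bochner_Integration.integral_cong refl)
    fix r
    show "m r *\<^sub>R (LINT s|lborel. indicator {r<..} s *\<^sub>R cut T v s) = \<mu> (T - r) *\<^sub>R (u T - um (T - (T - r)))"
    proof (cases "r \<le> T")
      case True then show ?thesis using cut_tail_integral[OF v d True T] by (simp add: m_def um_def)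
    next
      case False
      then have "\<mu> (T - r) = 0" by (intro mu_zero) (auto dest: Omega_pos)
      then show ?thesis by (simp add: m_def)
    qed
  qed
  also have "\<dots> = (LINT r|lborel. \<mu> r *\<^sub>R (u T - um (T - r)))" by (rule lborel_integral_reflect)
  also have "\<dots> = (LINT r|lborel. \<mu> r *\<^sub>R u T - (indicator {0..T} r *\<^sub>R (\<mu> r *\<^sub>R u (T - r)) + (indicator {T<..} r *\<^sub>R \<mu> r) *\<^sub>R u 0))"
  proof (intro Bochner_Integration.integral_cong refl)
    fix r
    consider "r < 0" | "0 \<le> r" "r \<le> T" | "T < r" by linarith
    then show "\<mu> r *\<^sub>R (u T - um (T - r)) = \<mu> r *\<^sub>R u T - (indicator {0..T} r *\<^sub>R (\<mu> r *\<^sub>R u (T - r)) + (indicator {T<..} r *\<^sub>R \<mu> r) *\<^sub>R u 0)"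
    proof cases
      case 1
      then have "\<mu> r = 0" by (intro mu_zero) (auto dest: Omega_pos)
      then show ?thesis by simp
    qed (use T in \<open>auto simp: um_def scaleR_diff_right\<close>)
  qed
  also have "\<dots> = mass *\<^sub>R u T - (memconv u T + tail_mass T *\<^sub>R u 0)"
  proof -
    have i1: "integrable lborel (\<lambda>r. \<mu> r *\<^sub>R u T)" using mu_integrable by (intro integrable_scaleR_left)
    have i2: "integrable lborel (\<lambda>r. indicator {0..T} r *\<^sub>R (\<mu> r *\<^sub>R u (T - r)))"
      using memconv_integrable[OF uc, of T] unfolding set_integrable_def .
    have i3': "integrable lborel (\<lambda>r. indicator {T<..} r *\<^sub>R \<mu> r)" by (intro integrable_mult_indicator mu_integrable) simp
    have i3: "integrable lborel (\<lambda>r. (indicator {T<..} r *\<^sub>R \<mu> r) *\<^sub>R u 0)" using i3' by (intro integrable_scaleR_left)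
    show ?thesis
      unfolding Bochner_Integration.integral_diff[OF i1 Bochner_Integration.integrable_add[OF i2 i3]] Bochner_Integration.integral_add[OF i2 i3]
        integral_scaleR_left[OF i3'] integral_scaleR_left[OF mu_integrable]
      by (simp only: mass_def memconv_def tail_mass_def set_lebesgue_integral_def)
  qed
  finally show ?thesis by simp
qed

text \<open>With \<beta> 0 = 0 the extension of \<beta> by 0 is continuous on the line. The limits
  of integration then disappear and dominated convergence applies.\<close>

lemma memconv_continuous:
  fixes \<beta> :: "real \<Rightarrow> 'b::{banach, second_countable_topology}"
  assumes \<beta>: "continuous_on {0..} \<beta>" and z: "\<beta> 0 = 0"
  shows "continuous_on {0..} (memconv \<beta>)"
proof -
  define \<gamma> where "\<gamma> t = \<beta> (max 0 t)" for t
  have \<gamma>c: "continuous_on UNIV \<gamma>" unfolding \<gamma>_def by (rule continuous_Ici_max[OF \<beta>])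
  have [measurable]: "\<gamma> \<in> borel_measurable borel" using \<gamma>c by (rule borel_measurable_continuous_onI)
  have \<gamma>0: "\<gamma> t = 0" if "t \<le> 0" for t using that z by (simp add: \<gamma>_def max_def)
  have eq: "memconv \<beta> T = (LINT r|lborel. \<mu> r *\<^sub>R \<gamma> (T - r))" for T
    unfolding memconv_def set_lebesgue_integral_def
  proof (intro Bochner_Integration.integral_cong refl)
    fix r
    consider "r < 0" | "0 \<le> r" "r \<le> T" | "T < r" by linarith
    then show "indicator {0..T} r *\<^sub>R (\<mu> r *\<^sub>R \<beta> (T - r)) = \<mu> r *\<^sub>R \<gamma> (T - r)"
    proof cases
      case 1
      then have "\<mu> r = 0" by (intro mu_zero) (auto dest: Omega_pos)
      then show ?thesis by simp
    next
      case 2 then show ?thesis by (simp add: \<gamma>_def)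
    next
      case 3 then show ?thesis using \<gamma>0[of "T - r"] by simp
    qed
  qed
  show ?thesis unfolding continuous_on_sequentially
  proof (intro allI ballI impI)
    fix X :: "nat \<Rightarrow> real" and T assume T: "T \<in> {0..}" and X: "(\<forall>n. X n \<in> {0..}) \<and> X \<longlonglongrightarrow> T"
    have "bounded (range X)" using X by (intro convergent_imp_bounded[of X]) (auto simp: convergent_def)
    then obtain K where K: "\<And>n. \<bar>X n\<bar> \<le> K" unfolding bounded_iff by auto
    obtain C where C: "C \<ge> 0" "\<And>x. x \<in> {0..K} \<Longrightarrow> norm (\<gamma> x) \<le> C"
      using continuous_on_Icc_bounded[OF continuous_on_subset[OF \<gamma>c], of 0 K] by blast
    have bd: "norm (\<mu> r *\<^sub>R \<gamma> (X n - r)) \<le> C * \<mu> r" for n r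
    proof (cases "0 < r \<and> r \<le> X n")
      case True
      then have "norm (\<gamma> (X n - r)) \<le> C" using K[of n] by (intro C(2)) auto
      then show ?thesis using mult_left_mono[of "norm (\<gamma> (X n - r))" C "\<mu> r"] by (simp add: mult.commute)
    next
      case False
      then consider "r \<le> 0" | "X n < r" by linarith
      then show ?thesis
      proof cases
        case 1
        then have "\<mu> r = 0" by (intro mu_zero) (auto dest: Omega_pos)
        then show ?thesis by simp
      next
        case 2 then show ?thesis using \<gamma>0[of "X n - r"] C(1) by simp
      qed
    qed
    have "(\<lambda>n. LINT r|lborel. \<mu> r *\<^sub>R \<gamma> (X n - r)) \<longlonglongrightarrow> (LINT r|lborel. \<mu> r *\<^sub>R \<gamma> (T - r))"
    proof (rule integral_dominated_convergence[where w="\<lambda>r. C * \<mu> r"])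
      show "AE r in lborel. (\<lambda>n. \<mu> r *\<^sub>R \<gamma> (X n - r)) \<longlonglongrightarrow> \<mu> r *\<^sub>R \<gamma> (T - r)"
      proof (intro AE_I2 tendsto_scaleR tendsto_const)
        fix r
        have "isCont \<gamma> (T - r)" using \<gamma>c by (simp add: continuous_on_eq_continuous_at)
        moreover have "(\<lambda>n. X n - r) \<longlonglongrightarrow> T - r" using X by (intro tendsto_diff tendsto_const) simp
        ultimately show "(\<lambda>n. \<gamma> (X n - r)) \<longlonglongrightarrow> \<gamma> (T - r)" by (rule isCont_tendsto_compose)
      qed
      show "AE r in lborel. norm (\<mu> r *\<^sub>R \<gamma> (X n - r)) \<le> C * \<mu> r" for n using bd by simp
      show "integrable lborel (\<lambda>r. C * \<mu> r)" by (intro integrable_mult_right mu_integrable)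
    qed measurable
    then show "(memconv \<beta> \<circ> X) \<longlonglongrightarrow> memconv \<beta> T" by (simp add: eq o_def)
  qed
qed

text \<open>Both sides are the integral of \<open>\<mu> r * inner (\<beta> (t - r - s)) (\<gamma> s)\<close> over the simplex \<open>r + s \<le> t\<close>.\<close>
lemma memconv_symmetric:
  fixes \<beta> \<gamma> :: "real \<Rightarrow> 'b::{real_inner, banach, second_countable_topology}"
  assumes \<beta>: "continuous_on {0..} \<beta>" and \<gamma>: "continuous_on {0..} \<gamma>" and t: "t \<ge> 0"
  shows "(LINT s:{0..t}|lborel. inner (memconv \<beta> (t - s)) (\<gamma> s)) = (LINT s:{0..t}|lborel. inner (\<beta> (t - s)) (memconv \<gamma> s))"
proof -
  define b where "b x = \<beta> (max 0 x)" for x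
  define g where "g x = \<gamma> (max 0 x)" for x
  have bc: "continuous_on UNIV b" and gc: "continuous_on UNIV g"
    unfolding b_def g_def by (rule continuous_Ici_max[OF \<beta>], rule continuous_Ici_max[OF \<gamma>])
  have [measurable]: "b \<in> borel_measurable borel" "g \<in> borel_measurable borel"
    using bc gc by (auto intro: borel_measurable_continuous_onI)
  obtain C where C: "C \<ge> 0" "\<And>x. x \<in> {0..t} \<Longrightarrow> norm (b x) \<le> C"
    using continuous_on_Icc_bounded[OF continuous_on_subset[OF bc], of 0 t] by blast
  obtain D where D: "D \<ge> 0" "\<And>x. x \<in> {0..t} \<Longrightarrow> norm (g x) \<le> D"
    using continuous_on_Icc_bounded[OF continuous_on_subset[OF gc], of 0 t] by blast
  define k where "k s r = indicator {x. 0 \<le> fst x \<and> 0 \<le> snd x \<and> fst x + snd x \<le> t} (s, r) * (\<mu> r * inner (b (t - s - r)) (g s))" for s r :: real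
  have km: "(\<lambda>(s, r). k s r) \<in> borel_measurable (lborel \<Otimes>\<^sub>M lborel)"
  proof -
    have "(\<lambda>x::real \<times> real. indicator {x. 0 \<le> fst x \<and> 0 \<le> snd x \<and> fst x + snd x \<le> t} x * (\<mu> (snd x) * inner (b (t - fst x - snd x)) (g (fst x)))) \<in> borel_measurable (lborel \<Otimes>\<^sub>M lborel)"
      by measurable
    then show ?thesis by (simp add: k_def split_beta')
  qed
  have kb: "\<bar>k s r\<bar> \<le> (indicator {0..t} s * (C * D)) * \<mu> r" for s r
  proof (cases "0 \<le> s \<and> 0 \<le> r \<and> s + r \<le> t")
    case True
    have "\<bar>inner (b (t - s - r)) (g s)\<bar> \<le> norm (b (t - s - r)) * norm (g s)" by (rule Cauchy_Schwarz_ineq2)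
    also have "\<dots> \<le> C * D" by (intro mult_mono C D) (use True C D in auto)
    finally have "\<mu> r * \<bar>inner (b (t - s - r)) (g s)\<bar> \<le> \<mu> r * (C * D)" by (rule mult_left_mono) simp
    then show ?thesis using True by (simp add: k_def abs_mult mult.commute)
  next
    case False then show ?thesis using C(1) D(1) by (auto simp: k_def)
  qed
  have prod: "integrable (lborel \<Otimes>\<^sub>M lborel) (\<lambda>(s, r). k s r)"
  proof (rule lborel_pair.Fubini_integrable[OF km])
    have i: "integrable lborel (\<lambda>r. k s r)" for s
    proof (rule Bochner_Integration.integrable_bound)
      show "integrable lborel (\<lambda>r. (indicator {0..t} s * (C * D)) * \<mu> r)" by (intro integrable_mult_right mu_integrable)
      show "(\<lambda>r. k s r) \<in> borel_measurable lborel" using measurable_Pair2[OF km, of s] by simp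
      show "AE r in lborel. norm (k s r) \<le> norm ((indicator {0..t} s * (C * D)) * \<mu> r)"
        using kb C(1) D(1) by (auto intro!: order_trans[OF kb] simp: abs_mult)
    qed
    then show "AE s in lborel. integrable lborel (\<lambda>r. case (s, r) of (s, r) \<Rightarrow> k s r)" by simp
    show "integrable lborel (\<lambda>s. LINT r|lborel. norm (case (s, r) of (s, r) \<Rightarrow> k s r))"
    proof (rule Bochner_Integration.integrable_bound)
      show "integrable lborel (\<lambda>s. indicator {0..t} s * (C * D * mass))" by (intro integrable_mult_left) (use t in \<open>simp add: integrable_indicator_iff\<close>)
      show "(\<lambda>s. LINT r|lborel. norm (case (s, r) of (s, r) \<Rightarrow> k s r)) \<in> borel_measurable lborel"
        by (rule lborel.borel_measurable_lebesgue_integral) (use measurable_compose[OF km borel_measurable_norm] in \<open>simp add: split_beta'\<close>)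
      show "AE s in lborel. norm (LINT r|lborel. norm (case (s, r) of (s, r) \<Rightarrow> k s r)) \<le> norm (indicator {0..t} s * (C * D * mass))"
      proof (rule AE_I2)
        fix s
        have "(LINT r|lborel. \<bar>k s r\<bar>) \<le> (LINT r|lborel. (indicator {0..t} s * (C * D)) * \<mu> r)"
          by (rule integral_mono[OF integrable_abs[OF i] _ kb]) (intro integrable_mult_right mu_integrable)
        also have "\<dots> = indicator {0..t} s * (C * D * mass)" by (simp add: mass_def)
        finally show "norm (LINT r|lborel. norm (case (s, r) of (s, r) \<Rightarrow> k s r)) \<le> norm (indicator {0..t} s * (C * D * mass))"
          using C(1) D(1) mass_nonneg by (simp add: abs_mult)
      qed
    qed
  qed
    have m': "(\<lambda>(s, r). k (s - r) r) \<in> borel_measurable (lborel \<Otimes>\<^sub>M lborel)"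
    proof -
      have "(\<lambda>x::real \<times> real. indicator {x. 0 \<le> fst x - snd x \<and> 0 \<le> snd x \<and> fst x \<le> t} x * (\<mu> (snd x) * inner (b (t - fst x)) (g (fst x - snd x)))) \<in> borel_measurable (lborel \<Otimes>\<^sub>M lborel)"
        by measurable
      moreover have "(\<lambda>x::real \<times> real. indicator {x. 0 \<le> fst x - snd x \<and> 0 \<le> snd x \<and> fst x \<le> t} x * (\<mu> (snd x) * inner (b (t - fst x)) (g (fst x - snd x)))) = (\<lambda>(s, r). k (s - r) r)"
        by (auto simp: k_def fun_eq_iff indicator_def)
      ultimately show ?thesis by (simp only:)
    qed
    have kb': "\<bar>k (s - r) r\<bar> \<le> (indicator {0..t} s * (C * D)) * \<mu> r" for s r
    proof (cases "0 \<le> s - r \<and> 0 \<le> r \<and> s - r + r \<le> t")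
      case True
      then have "indicator {0..t} (s - r) = (1::real)" "indicator {0..t} s = (1::real)" by auto
      then show ?thesis using kb[of "s - r" r] by simp
    next
      case False then show ?thesis using C(1) D(1) by (auto simp: k_def)
    qed
    have prod': "integrable (lborel \<Otimes>\<^sub>M lborel) (\<lambda>(s, r). k (s - r) r)"
    proof (rule lborel_pair.Fubini_integrable[OF m'])
      have i: "integrable lborel (\<lambda>r. k (s - r) r)" for s
      proof (rule Bochner_Integration.integrable_bound)
        show "integrable lborel (\<lambda>r. (indicator {0..t} s * (C * D)) * \<mu> r)" by (intro integrable_mult_right mu_integrable)
        show "(\<lambda>r. k (s - r) r) \<in> borel_measurable lborel" using measurable_Pair2[OF m', of s] by simp
        show "AE r in lborel. norm (k (s - r) r) \<le> norm ((indicator {0..t} s * (C * D)) * \<mu> r)"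
          using C(1) D(1) by (auto intro!: order_trans[OF kb'] simp: abs_mult)
      qed
      then show "AE s in lborel. integrable lborel (\<lambda>r. case (s, r) of (s, r) \<Rightarrow> k (s - r) r)" by simp
      show "integrable lborel (\<lambda>s. LINT r|lborel. norm (case (s, r) of (s, r) \<Rightarrow> k (s - r) r))"
      proof (rule Bochner_Integration.integrable_bound)
        show "integrable lborel (\<lambda>s. indicator {0..t} s * (C * D * mass))" by (intro integrable_mult_left) (use t in \<open>simp add: integrable_indicator_iff\<close>)
        show "(\<lambda>s. LINT r|lborel. norm (case (s, r) of (s, r) \<Rightarrow> k (s - r) r)) \<in> borel_measurable lborel"
          by (rule lborel.borel_measurable_lebesgue_integral) (use measurable_compose[OF m' borel_measurable_norm] in \<open>simp add: split_beta'\<close>)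
        show "AE s in lborel. norm (LINT r|lborel. norm (case (s, r) of (s, r) \<Rightarrow> k (s - r) r)) \<le> norm (indicator {0..t} s * (C * D * mass))"
        proof (rule AE_I2)
          fix s
          have "(LINT r|lborel. \<bar>k (s - r) r\<bar>) \<le> (LINT r|lborel. (indicator {0..t} s * (C * D)) * \<mu> r)"
            by (rule integral_mono[OF integrable_abs[OF i] _ kb']) (intro integrable_mult_right mu_integrable)
          also have "\<dots> = indicator {0..t} s * (C * D * mass)" by (simp add: mass_def)
          finally show "norm (LINT r|lborel. norm (case (s, r) of (s, r) \<Rightarrow> k (s - r) r)) \<le> norm (indicator {0..t} s * (C * D * mass))"
            using C(1) D(1) mass_nonneg by (simp add: abs_mult)
        qed
      qed
    qed
  have "(LINT s:{0..t}|lborel. inner (memconv \<beta> (t - s)) (\<gamma> s)) = (LINT s|lborel. LINT r|lborel. k s r)"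
    unfolding set_lebesgue_integral_def
  proof (intro Bochner_Integration.integral_cong refl)
    fix s
    show "indicator {0..t} s *\<^sub>R inner (memconv \<beta> (t - s)) (\<gamma> s) = (LINT r|lborel. k s r)"
    proof (cases "s \<in> {0..t}")
      case True
      have "inner (memconv \<beta> (t - s)) (\<gamma> s) = (LINT r|lborel. inner (indicator {0..t - s} r *\<^sub>R (\<mu> r *\<^sub>R \<beta> (t - s - r))) (\<gamma> s))"
        unfolding memconv_def set_lebesgue_integral_def
        by (rule integral_inner_left[symmetric]) (use memconv_integrable[OF \<beta>, of "t - s"] in \<open>simp add: set_integrable_def\<close>)
      also have "\<dots> = (LINT r|lborel. k s r)"
        by (intro Bochner_Integration.integral_cong) (use True in \<open>auto simp: k_def b_def g_def indicator_def\<close>)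
      finally show ?thesis using True by simp
    next
      case False then have "k s r = 0" for r by (auto simp: k_def)
      then show ?thesis using False by simp
    qed
  qed
  also have "\<dots> = (LINT r|lborel. LINT s|lborel. k s r)"
    by (rule lborel_pair.Fubini_integral[OF prod, symmetric])
  \<comment> \<open>The shear s to s - r between two applications of Fubini moves the weight \<mu> r
    from \<beta> to \<gamma>.\<close>
  also have "\<dots> = (LINT r|lborel. LINT s|lborel. k (s - r) r)"
  proof (rule Bochner_Integration.integral_cong[OF refl])
    fix r show "(LINT s|lborel. k s r) = (LINT s|lborel. k (s - r) r)"
      by (subst lborel_integral_shift[of "\<lambda>s. k s r" "- r", symmetric]) (simp only: uminus_add_conv_diff)
  qed
  also have "\<dots> = (LINT s|lborel. LINT r|lborel. k (s - r) r)" by (rule lborel_pair.Fubini_integral[OF prod'])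
  also have "\<dots> = (LINT s:{0..t}|lborel. inner (\<beta> (t - s)) (memconv \<gamma> s))"
    unfolding set_lebesgue_integral_def
  proof (intro Bochner_Integration.integral_cong refl)
    fix s
    show "(LINT r|lborel. k (s - r) r) = indicator {0..t} s *\<^sub>R inner (\<beta> (t - s)) (memconv \<gamma> s)"
    proof (cases "s \<in> {0..t}")
      case True
      have "inner (\<beta> (t - s)) (memconv \<gamma> s) = (LINT r|lborel. inner (\<beta> (t - s)) (indicator {0..s} r *\<^sub>R (\<mu> r *\<^sub>R \<gamma> (s - r))))"
        unfolding memconv_def set_lebesgue_integral_def
        by (rule integral_inner_right[symmetric]) (use memconv_integrable[OF \<gamma>, of s] in \<open>simp add: set_integrable_def\<close>)
      also have "\<dots> = (LINT r|lborel. k (s - r) r)"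
        by (intro Bochner_Integration.integral_cong) (use True in \<open>auto simp: k_def b_def g_def indicator_def\<close>)
      finally show ?thesis using True by simp
    next
      case False then have "k (s - r) r = 0" for r by (auto simp: k_def)
      then show ?thesis using False by simp
    qed
  qed
  finally show ?thesis .
qed

end

section \<open>Orbits\<close>
lemma deriv_shift:
  fixes f :: "real \<Rightarrow> real"
  assumes "\<And>x. f differentiable at x"
  shows "deriv (\<lambda>x. f (x - r)) = (\<lambda>x. deriv f (x - r))"
proof
  fix x
  have "(f has_real_derivative deriv f (x - r)) (at (x - r))" using assms by (simp add: DERIV_deriv_iff_real_differentiable)
  then have "((\<lambda>x. f (x - r)) has_real_derivative deriv f (x - r)) (at x)"
    using DERIV_shift[of f "deriv f (x - r)" x "- r"] by simp
  then show "deriv (\<lambda>x. f (x - r)) x = deriv f (x - r)" by (rule DERIV_imp_deriv)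
qed

text \<open>Test functions on {0<..} are invariant under right shifts, which those on a bounded
  Omega would not be; leaving Omega does no harm, as profiles vanish there.\<close>

lemma test_fun_shift:
  assumes t: "test_fun {0<..} \<phi>" and r: "r \<ge> 0"
  shows "test_fun {0<..} (\<lambda>x. \<phi> (x - r))" "deriv (\<lambda>x. \<phi> (x - r)) = (\<lambda>x. deriv \<phi> (x - r))"
proof -
  have df: "(deriv ^^ n) \<phi> differentiable at x" for n x using t by (simp add: test_fun_def)
  show "deriv (\<lambda>x. \<phi> (x - r)) = (\<lambda>x. deriv \<phi> (x - r))" by (rule deriv_shift) (use df[of 0] in simp)
  have it: "(deriv ^^ n) (\<lambda>x. \<phi> (x - r)) = (\<lambda>x. (deriv ^^ n) \<phi> (x - r))" for n
  proof (induction n)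
    case (Suc n) then show ?case using deriv_shift[OF df[of n], of r] by simp
  qed simp
  have "(deriv ^^ n) (\<lambda>x. \<phi> (x - r)) differentiable at x" for n x
  proof -
    have "((deriv ^^ n) \<phi> has_real_derivative deriv ((deriv ^^ n) \<phi>) (x - r)) (at (x - r))"
      using df by (simp add: DERIV_deriv_iff_real_differentiable)
    then have "((\<lambda>x. (deriv ^^ n) \<phi> (x - r)) has_real_derivative deriv ((deriv ^^ n) \<phi>) (x - r)) (at x)"
      using DERIV_shift[of "(deriv ^^ n) \<phi>" _ x "- r"] by simp
    then show ?thesis unfolding it by (auto simp: real_differentiable_def)
  qed
  moreover obtain K where K: "compact K" "K \<subseteq> {0<..}" "\<And>x. x \<notin> K \<Longrightarrow> \<phi> x = 0" using t unfolding test_fun_def by blast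
  have "compact ((+) r ` K) \<and> (+) r ` K \<subseteq> {0<..} \<and> (\<forall>x. x \<notin> (+) r ` K \<longrightarrow> \<phi> (x - r) = 0)"
  proof (intro conjI allI impI)
    show "compact ((+) r ` K)" using K(1) by (rule compact_translation)
    show "(+) r ` K \<subseteq> {0<..}" using K(2) r by (auto intro: add_nonneg_pos)
    fix x assume x: "x \<notin> (+) r ` K"
    have "x - r \<notin> K"
    proof
      assume "x - r \<in> K" then have "r + (x - r) \<in> (+) r ` K" by blast
      then show False using x by simp
    qed
    then show "\<phi> (x - r) = 0" by (rule K(3))
  qed
  ultimately show "test_fun {0<..} (\<lambda>x. \<phi> (x - r))" unfolding test_fun_def by blast
qed

lemma test_fun_taylor:
  assumes t: "test_fun U \<phi>"
  shows "\<exists>M\<ge>0. \<forall>a h. \<bar>\<phi> (a + h) - \<phi> a - h * deriv \<phi> a\<bar> \<le> M * h\<^sup>2"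
proof -
  have t': "test_fun U (deriv \<phi>)" and t'': "test_fun U (deriv (deriv \<phi>))" using test_fun_deriv t by auto
  obtain M where M: "M \<ge> 0" "\<And>x. \<bar>deriv (deriv \<phi>) x\<bar> \<le> M" using test_fun_bounded[OF t''] by blast
  have b1: "\<bar>deriv \<phi> y - deriv \<phi> a\<bar> \<le> M * \<bar>y - a\<bar>" for y a
    using field_differentiable_bound[of UNIV "deriv \<phi>" "deriv (deriv \<phi>)" M y a] test_fun_DERIV[OF t'] M(2) by simp
  have "\<bar>\<phi> (a + h) - \<phi> a - h * deriv \<phi> a\<bar> \<le> M * h\<^sup>2" for a h
  proof -
    define k where "k y = \<phi> y - y * deriv \<phi> a" for y
    have "norm (k (a + h) - k a) \<le> (M * \<bar>h\<bar>) * norm (a + h - a)"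
    proof (rule field_differentiable_bound[of "closed_segment a (a + h)" k "\<lambda>y. deriv \<phi> y - deriv \<phi> a"])
      fix z assume z: "z \<in> closed_segment a (a + h)"
      have "(k has_real_derivative deriv \<phi> z - 1 * deriv \<phi> a) (at z)"
        unfolding k_def by (intro DERIV_diff test_fun_DERIV[OF t] DERIV_cmult_right DERIV_ident)
      then show "(k has_field_derivative deriv \<phi> z - deriv \<phi> a) (at z within closed_segment a (a + h))"
        by (simp add: has_field_derivative_at_within)
      have "\<bar>z - a\<bar> \<le> \<bar>h\<bar>" using z by (auto simp: closed_segment_eq_real_ivl split: if_splits)
      then show "norm (deriv \<phi> z - deriv \<phi> a) \<le> M * \<bar>h\<bar>"
        using b1[of z a] mult_left_mono[of "\<bar>z - a\<bar>" "\<bar>h\<bar>" M] M(1) by simp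
    qed auto
    then show ?thesis by (simp add: k_def power2_eq_square algebra_simps)
  qed
  then show ?thesis using M(1) by blast
qed

context visco_semigroup begin

lemma GR_data:
  assumes F: "FA x" "FA y" and g: "GR x y"
  obtains b d where "prof (snd (snd x)) b" "wL2 d" "b = (\<lambda>\<tau>. indicator (Omega l) \<tau> *\<^sub>R tail_prim d \<tau>)"
    "fst x \<in> DB" "fst (snd x) \<in> DB" "fst x + R (LINT \<tau>|lborel. b \<tau>) \<in> DA" "fst y = fst (snd x)"
    "fst (snd y) = - A (fst x + R (LINT \<tau>|lborel. b \<tau>))" "prof (snd (snd y)) (\<lambda>\<tau>. d \<tau> + \<mu> \<tau> *\<^sub>R B (fst (snd x)))"
proof -
  have "GR (fst x, fst (snd x), snd (snd x)) y" using g by simp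
  from gen_rel_profile[OF this F(2)] show thesis using that by blast
qed

theorem orbit_fst_derivative:
  assumes x: "FA x" and t: "t \<ge> 0"
  shows "((\<lambda>t. fst (S t x)) has_vector_derivative fst (snd (S t x))) (at t within {0..})"
proof (rule blf_S_derivative[OF blf_fst blf_snd _ x t])
  fix x y assume F: "FA x" "FA y" and g: "GR x y"
  show "fst y = fst (snd x)" by (rule GR_data[OF F g])
qed

lemma G_one:
  assumes "prof (snd (snd x)) b" shows "G (\<lambda>_. 1) x = (LINT \<tau>|lborel. b \<tau>)"
  using G_prof(1)[OF assms, of "\<lambda>_. 1" 1] by simp

text \<open>On the domain, R A w = B w, so after applying R the second component of the generator
  becomes a bounded functional and the equation holds along every orbit.\<close>

theorem orbit_R_snd_derivative:
  assumes x: "FA x" and t: "t \<ge> 0"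
  shows "((\<lambda>t. R (fst (snd (S t x)))) has_vector_derivative - (B (fst (S t x)) + G (\<lambda>_. 1) (S t x))) (at t within {0..})"
proof -
  have G1: "blf (G (\<lambda>_. 1))" by (rule blf_G[where C=1]) auto
  have "((\<lambda>t. R (fst (snd (S t x)))) has_vector_derivative (-1) *\<^sub>R B (fst (S t x)) + (-1) *\<^sub>R G (\<lambda>_. 1) (S t x)) (at t within {0..})"
  proof (rule blf_S_derivative[OF blf_R_comp[OF blf_snd] blf_combine[OF blf_B_fst G1] _ x t])
    fix x y assume F: "FA x" "FA y" and g: "GR x y"
    obtain b d where D0: "prof (snd (snd x)) b" "wL2 d" "b = (\<lambda>\<tau>. indicator (Omega l) \<tau> *\<^sub>R tail_prim d \<tau>)"
      "fst x \<in> DB" "fst (snd x) \<in> DB" "fst x + R (LINT \<tau>|lborel. b \<tau>) \<in> DA" "fst y = fst (snd x)"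
      "fst (snd y) = - A (fst x + R (LINT \<tau>|lborel. b \<tau>))" "prof (snd (snd y)) (\<lambda>\<tau>. d \<tau> + \<mu> \<tau> *\<^sub>R B (fst (snd x)))"
      by (rule GR_data[OF F g])
    note D = D0(1,4,6,8)
    let ?w = "fst x + R (LINT \<tau>|lborel. b \<tau>)"
    have "R (A ?w) = B ?w" using D(3) by (simp add: A_eq DA_iff)
    moreover have "B ?w = B (fst x) + (LINT \<tau>|lborel. b \<tau>)" using D(2) by (simp add: B_add)
    ultimately show "R (fst (snd y)) = (-1) *\<^sub>R B (fst x) + (-1) *\<^sub>R G (\<lambda>_. 1) x"
      by (simp add: D(4) R_minus G_one[OF D(1)])
  qed
  then show ?thesis by simp
qed

lemma tail_prim_zero:
  fixes d :: "real \<Rightarrow> 'h"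
  assumes d: "wL2 d" and \<tau>: "\<tau> > 0" "\<tau> \<notin> Omega l" shows "tail_prim d \<tau> = 0"
proof -
  have "(LINT \<sigma>:{\<tau>..}|lborel. d \<sigma>) = (LINT \<sigma>:{\<tau>..}|lborel. 0)"
  proof (rule set_lebesgue_integral_cong)
    show "\<forall>\<sigma>. \<sigma> \<in> {\<tau>..} \<longrightarrow> d \<sigma> = 0"
    proof (intro allI impI)
      fix \<sigma> assume "\<sigma> \<in> {\<tau>..}"
      then have "\<sigma> \<notin> Omega l" using Omega_down[of \<sigma> \<tau>] \<tau> by auto
      then show "d \<sigma> = 0" by (rule wL2_zero[OF d])
    qed
  qed simp
  then show ?thesis by (simp add: tail_prim_def set_lebesgue_integral_def)
qed

text \<open>Weak form of the history equation: \<phi> takes the derivative off xi, and R turns the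
  source profile \<mu> B v, meaningless for v in H, into \<mu> v.\<close>

theorem orbit_G_derivative:
  assumes ph: "test_fun {0<..} \<phi>" and x: "FA x" and t: "t \<ge> 0"
  shows "((\<lambda>t. R (G \<phi> (S t x))) has_vector_derivative
     (- R (G (deriv \<phi>) (S t x)) + (LINT \<tau>|lborel. \<phi> \<tau> * \<mu> \<tau>) *\<^sub>R fst (snd (S t x)))) (at t within {0..})"
proof -
  let ?c = "LINT \<tau>|lborel. \<phi> \<tau> * \<mu> \<tau>"
  have ph': "test_fun {0<..} (deriv \<phi>)" by (rule test_fun_deriv[OF ph])
  note m = test_fun_measurable[OF ph] and m' = test_fun_measurable[OF ph']
  obtain C where C: "\<And>x. \<bar>\<phi> x\<bar> \<le> C" using test_fun_bounded[OF ph] by blast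
  obtain C' where C': "\<And>x. \<bar>deriv \<phi> x\<bar> \<le> C'" using test_fun_bounded[OF ph'] by blast
  have "((\<lambda>t. R (G \<phi> (S t x))) has_vector_derivative (-1) *\<^sub>R R (G (deriv \<phi>) (S t x)) + ?c *\<^sub>R fst (snd (S t x))) (at t within {0..})"
  proof (rule blf_S_derivative[OF blf_R_comp[OF blf_G[OF m C]] blf_combine[OF blf_R_comp[OF blf_G[OF m' C']] blf_snd] _ x t])
    fix x y assume F: "FA x" "FA y" and g: "GR x y"
    obtain b d where D0: "prof (snd (snd x)) b" "wL2 d" "b = (\<lambda>\<tau>. indicator (Omega l) \<tau> *\<^sub>R tail_prim d \<tau>)"
      "fst x \<in> DB" "fst (snd x) \<in> DB" "fst x + R (LINT \<tau>|lborel. b \<tau>) \<in> DA" "fst y = fst (snd x)"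
      "fst (snd y) = - A (fst x + R (LINT \<tau>|lborel. b \<tau>))" "prof (snd (snd y)) (\<lambda>\<tau>. d \<tau> + \<mu> \<tau> *\<^sub>R B (fst (snd x)))"
      by (rule GR_data[OF F g])
    note D = D0(1,2,3,5,9)
    note di = prof_integral_bounded(1)[OF prof_R[OF D(2)] m C]
    note mi = prof_integral_bounded(1)[OF prof_mu[OF D(4)] m C]
    have pm: "integrable lborel (\<lambda>\<tau>. \<phi> \<tau> * \<mu> \<tau>)"
    proof -
      have "integrable lborel (\<lambda>\<tau>. \<mu> \<tau> *\<^sub>R \<phi> \<tau>)" by (rule mu_times_bounded_integrable[OF m, where C=C]) (use C in simp)
      then show ?thesis by (simp add: mult.commute)
    qed
    have "G \<phi> y = (LINT \<tau>|lborel. \<phi> \<tau> *\<^sub>R d \<tau> + \<phi> \<tau> *\<^sub>R (\<mu> \<tau> *\<^sub>R B (fst (snd x))))"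
      using G_prof(1)[OF D(5) m C] by (simp add: scaleR_add_right)
    also have "\<dots> = (LINT \<tau>|lborel. \<phi> \<tau> *\<^sub>R d \<tau>) + (LINT \<tau>|lborel. \<phi> \<tau> *\<^sub>R (\<mu> \<tau> *\<^sub>R B (fst (snd x))))"
      by (rule Bochner_Integration.integral_add[OF di mi])
    also have "(LINT \<tau>|lborel. \<phi> \<tau> *\<^sub>R (\<mu> \<tau> *\<^sub>R B (fst (snd x)))) = ?c *\<^sub>R B (fst (snd x))"
      using integral_scaleR_left[OF pm, of "B (fst (snd x))"] by simp
    also have "(LINT \<tau>|lborel. \<phi> \<tau> *\<^sub>R d \<tau>) = - (LINT \<tau>|lborel. deriv \<phi> \<tau> *\<^sub>R tail_prim d \<tau>)"
      using integral_deriv_test_fun_tail_prim[OF wL2_integrable[OF D(2)] wL2_meas[OF D(2)] ph] by simp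
    \<comment> \<open>The tail primitive vanishes from l on, so although \<phi> need not vanish at
      l, no boundary term arises there.\<close>
    also have "(\<lambda>\<tau>. deriv \<phi> \<tau> *\<^sub>R tail_prim d \<tau>) = (\<lambda>\<tau>. deriv \<phi> \<tau> *\<^sub>R b \<tau>)"
    proof
      fix \<tau> show "deriv \<phi> \<tau> *\<^sub>R tail_prim d \<tau> = deriv \<phi> \<tau> *\<^sub>R b \<tau>"
        using test_fun_zero_outside[OF ph', of \<tau>] tail_prim_zero[OF D(2), of \<tau>]
        by (cases "\<tau> \<in> Omega l"; cases "\<tau> > 0") (auto simp: D(3))
    qed
    also have "(LINT \<tau>|lborel. deriv \<phi> \<tau> *\<^sub>R b \<tau>) = G (deriv \<phi>) x" using G_prof(1)[OF D(1) m' C'] by simp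
    finally have "R (G \<phi> y) = - R (G (deriv \<phi>) x) + ?c *\<^sub>R R (B (fst (snd x)))"
      by (simp only: R_add R_minus R_scale)
    then show "R (G \<phi> y) = (-1) *\<^sub>R R (G (deriv \<phi>) x) + ?c *\<^sub>R fst (snd x)" using D(4) by simp
  qed
  then show ?thesis by simp
qed

text \<open>Contractivity makes the bound uniform in time and linear in the supremum of \<psi>; this
  controls the Taylor remainder of a moving test function.\<close>

lemma orbit_G_bound:
  assumes x: "FA x"
  shows "\<exists>L\<ge>0. \<forall>s \<psi> C. s \<ge> 0 \<longrightarrow> \<psi> \<in> borel_measurable borel \<longrightarrow> (\<forall>\<tau>. \<bar>\<psi> \<tau>\<bar> \<le> C) \<longrightarrow> norm (G \<psi> (S s x)) \<le> C * L"
proof -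
  obtain b where p: "prof (snd (snd x)) b" using FA_prof[OF x] by blast
  have "d2 x st_zero = ennreal ((norm (B (fst x)))\<^sup>2) + ennreal ((norm (fst (snd x)))\<^sup>2) + N2 b"
    using prof_norm[OF p] by (simp add: distA2_def st_zero_def)
  then have fin: "d2 x st_zero < \<infinity>" using prof_wL2[OF p] by (simp add: wL2_def)
  define e where "e = sqrt (enn2real (d2 x st_zero)) + 1"
  have e: "e > 0" by (simp add: e_def add_nonneg_pos)
  have "enn2real (d2 x st_zero) \<le> e\<^sup>2" by (simp add: e_def power2_sum)
  then have le: "d2 x st_zero \<le> ennreal (e\<^sup>2)" using fin by (metis ennreal_enn2real ennreal_leI infinity_ennreal_def)
  have "norm (G \<psi> (S s x)) \<le> C * ((1 + mass) * e)" if h: "s \<ge> 0" "\<psi> \<in> borel_measurable borel" "\<And>\<tau>. \<bar>\<psi> \<tau>\<bar> \<le> C" for s \<psi> C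
  proof -
    have Fs: "FA (S s x)" by (rule S_FA[OF h(1) x])
    obtain bs where ps: "prof (snd (snd (S s x))) bs" using FA_prof[OF Fs] by blast
    have les: "d2 (S s x) st_zero \<le> ennreal (e\<^sup>2)" using S_contr[OF h(1) x] le by (rule order_trans)
    have "N2 bs \<le> ennreal (e\<^sup>2)" using d2_zeroD(3)[OF les e] prof_norm[OF ps] by simp
    note b = wL2_integral_norm[OF prof_wL2[OF ps] this e]
    have C0: "C \<ge> 0" using h(3)[of 0] by linarith
    have "norm (G \<psi> (S s x)) \<le> (LINT \<tau>|lborel. norm (\<psi> \<tau> *\<^sub>R bs \<tau>))"
      unfolding G_prof(1)[OF ps h(2,3)] by (rule integral_norm_bound)
    also have "\<dots> \<le> (LINT \<tau>|lborel. C * norm (bs \<tau>))"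
    proof (rule integral_mono)
      show "norm (\<psi> \<tau> *\<^sub>R bs \<tau>) \<le> C * norm (bs \<tau>)" for \<tau> using h(3)[of \<tau>] by (simp add: mult_right_mono)
      show "integrable lborel (\<lambda>\<tau>. norm (\<psi> \<tau> *\<^sub>R bs \<tau>))" by (rule integrable_norm[OF G_prof(2)[OF ps h(2,3)]])
      show "integrable lborel (\<lambda>\<tau>. C * norm (bs \<tau>))" by (intro integrable_mult_right integrable_norm b(1))
    qed
    also have "\<dots> = C * (LINT \<tau>|lborel. norm (bs \<tau>))" by simp
    also have "\<dots> \<le> C * ((1 + mass) * e)" by (rule mult_left_mono[OF b(2) C0])
    finally show ?thesis .
  qed
  moreover have "(1 + mass) * e \<ge> 0" using mass_nonneg e by simp
  ultimately show ?thesis by blast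
qed

lemma G_linear:
  assumes x: "FA x" and 1: "\<phi> \<in> borel_measurable borel" "\<And>\<tau>. \<bar>\<phi> \<tau>\<bar> \<le> C" and 2: "\<psi> \<in> borel_measurable borel" "\<And>\<tau>. \<bar>\<psi> \<tau>\<bar> \<le> D"
  shows "G (\<lambda>\<tau>. \<phi> \<tau> + q * \<psi> \<tau>) x = G \<phi> x + q *\<^sub>R G \<psi> x"
proof -
  obtain b where p: "prof (snd (snd x)) b" using FA_prof[OF x] by blast
  have D0: "D \<ge> 0" using 2(2)[of 0] by linarith
  have m: "(\<lambda>\<tau>. \<phi> \<tau> + q * \<psi> \<tau>) \<in> borel_measurable borel" using 1(1) 2(1) by simp
  have bd: "\<bar>\<phi> \<tau> + q * \<psi> \<tau>\<bar> \<le> C + \<bar>q\<bar> * D" for \<tau>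
  proof -
    have "\<bar>\<phi> \<tau> + q * \<psi> \<tau>\<bar> \<le> \<bar>\<phi> \<tau>\<bar> + \<bar>q\<bar> * \<bar>\<psi> \<tau>\<bar>" using abs_triangle_ineq[of "\<phi> \<tau>" "q * \<psi> \<tau>"] by (simp add: abs_mult)
    also have "\<dots> \<le> C + \<bar>q\<bar> * D" by (intro add_mono 1 mult_left_mono 2) simp
    finally show ?thesis .
  qed
  have "G (\<lambda>\<tau>. \<phi> \<tau> + q * \<psi> \<tau>) x = (LINT \<tau>|lborel. \<phi> \<tau> *\<^sub>R b \<tau> + q *\<^sub>R (\<psi> \<tau> *\<^sub>R b \<tau>))"
    unfolding G_prof(1)[OF p m bd] by (simp add: scaleR_add_left)
  also have "\<dots> = (LINT \<tau>|lborel. \<phi> \<tau> *\<^sub>R b \<tau>) + q *\<^sub>R (LINT \<tau>|lborel. \<psi> \<tau> *\<^sub>R b \<tau>)"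
    by (simp only: Bochner_Integration.integral_add[OF G_prof(2)[OF p 1] integrable_scaleR_right[OF G_prof(2)[OF p 2]]] integral_scaleR_right)
  finally show ?thesis unfolding G_prof(1)[OF p 1] G_prof(1)[OF p 2] .
qed

section \<open>Transport along characteristics\<close>

text \<open>The test function moves with the characteristics: its own motion contributes +R
  G(\<phi>'), which cancels the transport term of the weak equation and leaves only the
  source.\<close>

lemma transport_derivative:
  assumes ph: "test_fun {0<..} \<phi>" and x: "FA x" and s: "s \<in> {0..T}"
  shows "((\<lambda>r. R (G (\<lambda>\<tau>. \<phi> (\<tau> - (T - r))) (S r x))) has_vector_derivative
     (LINT \<tau>|lborel. \<phi> (\<tau> - (T - s)) * \<mu> \<tau>) *\<^sub>R fst (snd (S s x))) (at s within {0..T})"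
proof -
  define p where "p r \<tau> = \<phi> (\<tau> - (T - r))" for r \<tau>
  have pt: "test_fun {0<..} (p r)" and pd: "deriv (p r) = (\<lambda>\<tau>. deriv \<phi> (\<tau> - (T - r)))" if "r \<le> T" for r
    using test_fun_shift[OF ph, of "T - r"] that by (auto simp: p_def[abs_def])
  have ps: "test_fun {0<..} (p s)" and sT: "s \<le> T" and s0: "s \<ge> 0" using s pt by auto
  have dps: "test_fun {0<..} (deriv (p s))" by (rule test_fun_deriv[OF ps])
  obtain C where C: "\<And>x. \<bar>\<phi> x\<bar> \<le> C" using test_fun_bounded[OF ph] by blast
  obtain C' where C': "\<And>x. \<bar>deriv (p s) x\<bar> \<le> C'" using test_fun_bounded[OF dps] by blast
  have pm: "p r \<in> borel_measurable borel" for r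
    using test_fun_measurable[OF ph] unfolding p_def[abs_def] by measurable
  have pb: "\<bar>p r \<tau>\<bar> \<le> C" for r \<tau> using C by (simp add: p_def)
  note dm = test_fun_measurable[OF dps]
  have 1: "((\<lambda>r. R (G (p s) (S r x))) has_vector_derivative
     (- R (G (deriv (p s)) (S s x)) + (LINT \<tau>|lborel. p s \<tau> * \<mu> \<tau>) *\<^sub>R fst (snd (S s x)))) (at s within {0..T})"
    by (rule has_vector_derivative_within_subset[OF orbit_G_derivative[OF ps x s0]]) auto
  \<comment> \<open>E isolates the effect of moving the test function while the fixed \<phi> at time
    s is handled by the weak equation. Its derivative at s comes from a Taylor expansion whose
    remainder is at most M (r - s)^2.\<close>
  define E where "E r = R (G (p r) (S r x)) - R (G (p s) (S r x))" for r
  obtain M where M: "M \<ge> 0" "\<And>a h. \<bar>\<phi> (a + h) - \<phi> a - h * deriv \<phi> a\<bar> \<le> M * h\<^sup>2" using test_fun_taylor[OF ph] by blast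
  obtain L where L: "L \<ge> 0" "\<And>s \<psi> C. s \<ge> 0 \<Longrightarrow> \<psi> \<in> borel_measurable borel \<Longrightarrow> (\<And>\<tau>. \<bar>\<psi> \<tau>\<bar> \<le> C) \<Longrightarrow> norm (G \<psi> (S s x)) \<le> C * L"
    using orbit_G_bound[OF x] by blast
  obtain K where K: "K > 0" "\<And>x. norm (R x) \<le> K * norm x" using R_bound by blast
  define g where "g = G (deriv (p s))"
  have gc: "continuous_on {0..} (\<lambda>r. g (S r x))" unfolding g_def by (rule blf_continuous[OF blf_G[OF dm C'] x])
  have est: "norm (E r - (r - s) *\<^sub>R R (g (S s x))) \<le> K * (M * (r - s)\<^sup>2 * L + \<bar>r - s\<bar> * norm (g (S r x) - g (S s x)))"
    if r: "r \<in> {0..T}" for r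
  proof -
    have Fr: "FA (S r x)" and r0: "r \<ge> 0" using r x by (auto intro: S_FA)
    define \<psi> where "\<psi> \<tau> = (p r \<tau> + (-1) * p s \<tau>) + (- (r - s)) * deriv (p s) \<tau>" for \<tau>
    have \<psi>m: "\<psi> \<in> borel_measurable borel" unfolding \<psi>_def[abs_def] using pm[of r] pm[of s] dm by measurable
    have \<psi>b: "\<bar>\<psi> \<tau>\<bar> \<le> M * (r - s)\<^sup>2" for \<tau>
      using M(2)[of "\<tau> - (T - s)" "r - s"] pd[OF sT] by (simp add: \<psi>_def p_def algebra_simps)
    have bd2: "\<bar>p r \<tau> + (-1) * p s \<tau>\<bar> \<le> 2 * C" for \<tau> using pb[of r \<tau>] pb[of s \<tau>] by linarith
    have m2: "(\<lambda>\<tau>. p r \<tau> + (-1) * p s \<tau>) \<in> borel_measurable borel" using pm[of r] pm[of s] by measurable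
    have "G \<psi> (S r x) = G (\<lambda>\<tau>. p r \<tau> + (-1) * p s \<tau>) (S r x) + (- (r - s)) *\<^sub>R g (S r x)"
      unfolding \<psi>_def g_def by (rule G_linear[OF Fr m2 bd2 dm C'])
    also have "G (\<lambda>\<tau>. p r \<tau> + (-1) * p s \<tau>) (S r x) = G (p r) (S r x) + (-1) *\<^sub>R G (p s) (S r x)"
      by (rule G_linear[OF Fr pm pb pm pb])
    finally have G\<psi>: "G (p r) (S r x) - G (p s) (S r x) = G \<psi> (S r x) + (r - s) *\<^sub>R g (S r x)"
      by (simp add: algebra_simps)
    have "E r - (r - s) *\<^sub>R R (g (S s x)) = R ((G (p r) (S r x) - G (p s) (S r x)) - (r - s) *\<^sub>R g (S s x))"
      by (simp only: E_def R.diff R_scale)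
    also have "\<dots> = R (G \<psi> (S r x) + (r - s) *\<^sub>R (g (S r x) - g (S s x)))"
      unfolding G\<psi> by (simp only: scaleR_diff_right add_diff_eq)
    finally have "E r - (r - s) *\<^sub>R R (g (S s x)) = R (G \<psi> (S r x) + (r - s) *\<^sub>R (g (S r x) - g (S s x)))" .
    then have "norm (E r - (r - s) *\<^sub>R R (g (S s x))) \<le> K * norm (G \<psi> (S r x) + (r - s) *\<^sub>R (g (S r x) - g (S s x)))"
      using K(2) by simp
    also have "norm (G \<psi> (S r x) + (r - s) *\<^sub>R (g (S r x) - g (S s x))) \<le> M * (r - s)\<^sup>2 * L + \<bar>r - s\<bar> * norm (g (S r x) - g (S s x))"
      by (rule order_trans[OF norm_triangle_ineq]) (use L(2)[OF r0 \<psi>m \<psi>b] in simp)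
    finally show ?thesis using K(1) by simp
  qed
  have 2: "(E has_vector_derivative R (g (S s x))) (at s within {0..T})"
    unfolding has_vector_derivative_def has_derivative_within_alt
  proof (intro conjI allI impI bounded_linear_scaleR_left)
    fix e :: real assume e: "0 < e"
    \<comment> \<open>The estimate will be K (e' a + a e') with a = |r - s|, one term from the
      Taylor remainder and one from continuity of the orbit; this choice makes it e a.\<close>
    define e' where "e' = e / (2 * K)"
    have e': "e' > 0" using e K by (simp add: e'_def)
    obtain \<delta>1 where \<delta>1: "\<delta>1 > 0" "\<And>r. r \<ge> 0 \<Longrightarrow> dist r s < \<delta>1 \<Longrightarrow> dist (g (S r x)) (g (S s x)) < e'"
      using gc s0 e' unfolding continuous_on_iff by (metis atLeast_iff)
    define \<delta>2 where "\<delta>2 = e' / (M * L + 1)"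
    have pos1: "M * L + 1 > 0" using M L by (simp add: add_nonneg_pos)
    have \<delta>2: "\<delta>2 > 0" using e' pos1 by (simp add: \<delta>2_def)
    show "\<exists>d>0. \<forall>r\<in>{0..T}. norm (r - s) < d \<longrightarrow> norm (E r - E s - (r - s) *\<^sub>R R (g (S s x))) \<le> e * norm (r - s)"
    proof (intro exI[of _ "min \<delta>1 \<delta>2"] conjI ballI impI)
      show "0 < min \<delta>1 \<delta>2" using \<delta>1 \<delta>2 by simp
      fix r assume r: "r \<in> {0..T}" and rs: "norm (r - s) < min \<delta>1 \<delta>2"
      define a where "a = \<bar>r - s\<bar>"
      have a: "a \<ge> 0" "a < \<delta>1" "a < \<delta>2" using rs by (auto simp: a_def)
      have i1: "norm (g (S r x) - g (S s x)) \<le> e'"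
        using \<delta>1(2)[of r] r a by (simp add: dist_norm a_def less_imp_le)
      have "a * (M * L + 1) \<le> e'" using a(3) pos1 by (simp add: \<delta>2_def pos_less_divide_eq less_imp_le)
      then have i2: "M * L * a \<le> e'" using a(1) by (simp add: algebra_simps)
      have "norm (E r - (r - s) *\<^sub>R R (g (S s x))) \<le> K * (M * (r - s)\<^sup>2 * L + \<bar>r - s\<bar> * norm (g (S r x) - g (S s x)))"
        by (rule est[OF r])
      also have "(r - s)\<^sup>2 = a * a" by (simp add: a_def power2_eq_square abs_mult[symmetric])
      also have "M * (a * a) * L + \<bar>r - s\<bar> * norm (g (S r x) - g (S s x)) \<le> e' * a + a * e'"
        using mult_right_mono[OF i2 a(1)] mult_left_mono[OF i1 a(1)] by (simp add: a_def[symmetric] mult_ac)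
      then have "K * (M * (a * a) * L + \<bar>r - s\<bar> * norm (g (S r x) - g (S s x))) \<le> K * (e' * a + a * e')"
        using K(1) by simp
      also have "K * (e' * a + a * e') = e * a" using K(1) by (simp add: e'_def)
      finally show "norm (E r - E s - (r - s) *\<^sub>R R (g (S s x))) \<le> e * norm (r - s)" by (simp add: a_def E_def)
    qed
  qed
  have "((\<lambda>r. R (G (p s) (S r x)) + E r) has_vector_derivative
     (- R (G (deriv (p s)) (S s x)) + (LINT \<tau>|lborel. p s \<tau> * \<mu> \<tau>) *\<^sub>R fst (snd (S s x))) + R (g (S s x))) (at s within {0..T})"
    by (rule has_vector_derivative_add[OF 1 2])
  then show ?thesis by (simp add: E_def g_def p_def[abs_def])
qed

lemma transport_coefficient:
  assumes ph: "test_fun {0<..} \<phi>" and s: "s \<le> T"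
  shows "(LINT \<tau>|lborel. \<phi> (\<tau> - (T - s)) * \<mu> \<tau>) = (LINT \<sigma>|lborel. \<phi> \<sigma> * (indicator {0<..} \<sigma> * \<mu> (\<sigma> + T - s)))"
proof -
  have "(LINT \<tau>|lborel. \<phi> (\<tau> - (T - s)) * \<mu> \<tau>) = (LINT \<sigma>|lborel. \<phi> ((T - s) + \<sigma> - (T - s)) * \<mu> ((T - s) + \<sigma>))"
    by (rule lborel_integral_shift[symmetric])
  also have "\<dots> = (LINT \<sigma>|lborel. \<phi> \<sigma> * (indicator {0<..} \<sigma> * \<mu> (\<sigma> + T - s)))"
  proof (intro Bochner_Integration.integral_cong refl)
    fix \<sigma>
    have e: "T - s + \<sigma> = \<sigma> + T - s" by simp
    show "\<phi> ((T - s) + \<sigma> - (T - s)) * \<mu> ((T - s) + \<sigma>) = \<phi> \<sigma> * (indicator {0<..} \<sigma> * \<mu> (\<sigma> + T - s))"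
      unfolding e using test_fun_zero_outside[OF ph, of \<sigma>] by (cases "\<sigma> > 0") auto
  qed
  finally show ?thesis .
qed

lemma transport_coefficient_continuous:
  assumes ph: "test_fun {0<..} \<phi>"
  shows "continuous_on W (\<lambda>s. LINT \<tau>|lborel. \<phi> (\<tau> - (T - s)) * \<mu> \<tau>)"
proof -
  obtain C where C: "C \<ge> 0" "\<And>x. \<bar>\<phi> x\<bar> \<le> C" using test_fun_bounded[OF ph] by blast
  have [measurable]: "\<phi> \<in> borel_measurable borel" by (rule test_fun_measurable[OF ph])
  show ?thesis unfolding continuous_on_sequentially
  proof (intro allI ballI impI)
    fix X :: "nat \<Rightarrow> real" and s assume X: "(\<forall>n. X n \<in> W) \<and> X \<longlonglongrightarrow> s"
    have "(\<lambda>n. LINT \<tau>|lborel. \<phi> (\<tau> - (T - X n)) * \<mu> \<tau>) \<longlonglongrightarrow> (LINT \<tau>|lborel. \<phi> (\<tau> - (T - s)) * \<mu> \<tau>)"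
    proof (rule integral_dominated_convergence[where w="\<lambda>\<tau>. C * \<mu> \<tau>"])
      show "AE \<tau> in lborel. (\<lambda>n. \<phi> (\<tau> - (T - X n)) * \<mu> \<tau>) \<longlonglongrightarrow> \<phi> (\<tau> - (T - s)) * \<mu> \<tau>"
      proof (intro AE_I2 tendsto_mult tendsto_const)
        fix \<tau>
        have "isCont \<phi> (\<tau> - (T - s))" using test_fun_DERIV[OF ph] by (rule DERIV_isCont)
        moreover have "(\<lambda>n. \<tau> - (T - X n)) \<longlonglongrightarrow> \<tau> - (T - s)" using X by (intro tendsto_diff tendsto_const) simp
        ultimately show "(\<lambda>n. \<phi> (\<tau> - (T - X n))) \<longlonglongrightarrow> \<phi> (\<tau> - (T - s))" by (rule isCont_tendsto_compose)
      qed
      show "AE \<tau> in lborel. norm (\<phi> (\<tau> - (T - X n)) * \<mu> \<tau>) \<le> C * \<mu> \<tau>" for n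
        using C(2) by (simp add: abs_mult mult_right_mono)
      show "integrable lborel (\<lambda>\<tau>. C * \<mu> \<tau>)" by (intro integrable_mult_right mu_integrable)
    qed measurable
    then show "((\<lambda>s. LINT \<tau>|lborel. \<phi> (\<tau> - (T - s)) * \<mu> \<tau>) \<circ> X) \<longlonglongrightarrow> (LINT \<tau>|lborel. \<phi> (\<tau> - (T - s)) * \<mu> \<tau>)" by (simp add: o_def)
  qed
qed

text \<open>Integrating the transport identity over [0,T] compares the final profile tested with
  \<phi> and the initial one tested with the shifted \<phi>. The fundamental lemma removes \<phi>; R
  stays, since v need not lie in V.\<close>

theorem orbit_history:
  assumes x: "FA x" and T: "T \<ge> 0" and p0: "prof (snd (snd x)) b0" and pT: "prof (snd (snd (S T x))) bT"
  shows "AE \<sigma> in lborel. \<sigma> > 0 \<longrightarrow> R (bT \<sigma>) = R (b0 (T + \<sigma>)) + (LINT s|lborel. \<mu> (\<sigma> + T - s) *\<^sub>R cut T (\<lambda>s. fst (snd (S s x))) s)"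
proof -
  define V where "V s = fst (snd (S s x))" for s
  have Vc: "continuous_on {0..} V" unfolding V_def by (rule blf_continuous[OF blf_snd x])
  note cv = cut_integrable[OF Vc, of T]
  define W where "W \<sigma> = (LINT s|lborel. \<mu> (\<sigma> + T - s) *\<^sub>R cut T V s)" for \<sigma>
  define f where "f \<sigma> = R (bT \<sigma>) - R (b0 (T + \<sigma>)) - W \<sigma>" for \<sigma>
  have FT: "FA (S T x)" and F0: "FA (S 0 x)" using x T by (auto intro: S_FA)
  have core: "integrable lborel (\<lambda>\<sigma>. \<phi> \<sigma> *\<^sub>R (indicator {0<..} \<sigma> *\<^sub>R f \<sigma>)) \<and> (LINT \<sigma>|lborel. \<phi> \<sigma> *\<^sub>R (indicator {0<..} \<sigma> *\<^sub>R f \<sigma>)) = 0"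
    if ph: "test_fun {0<..} \<phi>" for \<phi>
  proof -
    obtain C where C: "\<And>x. \<bar>\<phi> x\<bar> \<le> C" using test_fun_bounded[OF ph] by blast
    have pm[measurable]: "\<phi> \<in> borel_measurable borel" by (rule test_fun_measurable[OF ph])
    have sm: "(\<lambda>\<tau>. \<phi> (\<tau> - T)) \<in> borel_measurable borel" by measurable
    have sb: "\<bar>\<phi> (\<tau> - T)\<bar> \<le> C" for \<tau> by (rule C)
    define H where "H r = R (G (\<lambda>\<tau>. \<phi> (\<tau> - (T - r))) (S r x))" for r
    define c where "c s = (LINT \<tau>|lborel. \<phi> (\<tau> - (T - s)) * \<mu> \<tau>)" for s
    have "(LINT s:{0..T}|lborel. c s *\<^sub>R V s) = H T - H 0"
    proof (rule FTC_Icc[OF _ _ T])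
      show "continuous_on {0..T} (\<lambda>s. c s *\<^sub>R V s)" unfolding c_def
        by (intro continuous_on_scaleR transport_coefficient_continuous[OF ph] continuous_on_subset[OF Vc]) auto
      show "(H has_vector_derivative c s *\<^sub>R V s) (at s within {0..T})" if "s \<in> {0..T}" for s
        unfolding H_def c_def V_def by (rule transport_derivative[OF ph x that])
    qed
    moreover have "(LINT s:{0..T}|lborel. c s *\<^sub>R V s) = (LINT s|lborel. (LINT \<sigma>|lborel. \<phi> \<sigma> * (indicator {0<..} \<sigma> * \<mu> (\<sigma> + T - s))) *\<^sub>R cut T V s)"
      unfolding set_lebesgue_integral_def
    proof (intro Bochner_Integration.integral_cong refl)
      fix s show "indicator {0..T} s *\<^sub>R (c s *\<^sub>R V s) = (LINT \<sigma>|lborel. \<phi> \<sigma> * (indicator {0<..} \<sigma> * \<mu> (\<sigma> + T - s))) *\<^sub>R cut T V s"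
        using transport_coefficient[OF ph, of s T] by (cases "s \<in> {0..T}") (auto simp: cut_def c_def)
    qed
    ultimately have HW: "H T - H 0 = (LINT \<sigma>|lborel. \<phi> \<sigma> *\<^sub>R (indicator {0<..} \<sigma> *\<^sub>R W \<sigma>))"
      using memory_product(1)[OF cv pm C, of T] by (simp add: W_def)
    note iW = memory_product(2)[OF cv pm C, of T, folded W_def]
    have iT: "integrable lborel (\<lambda>\<sigma>. \<phi> \<sigma> *\<^sub>R bT \<sigma>)" and HT: "H T = R (LINT \<sigma>|lborel. \<phi> \<sigma> *\<^sub>R bT \<sigma>)"
      using G_prof[OF pT pm C] by (simp_all add: H_def)
    have "G (\<lambda>\<tau>. \<phi> (\<tau> - T)) (S 0 x) = G (\<lambda>\<tau>. \<phi> (\<tau> - T)) x"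
      by (rule blf_cong[OF blf_G[OF sm sb] F0 x S_0[OF x]])
    then have "H 0 = R (LINT \<tau>|lborel. \<phi> (\<tau> - T) *\<^sub>R b0 \<tau>)" using G_prof(1)[OF p0 sm sb] by (simp add: H_def)
    \<comment> \<open>The shift of the test function becomes a shift of the initial history.\<close>
    also have "(LINT \<tau>|lborel. \<phi> (\<tau> - T) *\<^sub>R b0 \<tau>) = (LINT \<sigma>|lborel. \<phi> \<sigma> *\<^sub>R b0 (T + \<sigma>))"
      using lborel_integral_shift[of "\<lambda>\<tau>. \<phi> (\<tau> - T) *\<^sub>R b0 \<tau>" T] by simp
    finally have H0: "H 0 = R (LINT \<sigma>|lborel. \<phi> \<sigma> *\<^sub>R b0 (T + \<sigma>))" .
    have i0: "integrable lborel (\<lambda>\<sigma>. \<phi> \<sigma> *\<^sub>R b0 (T + \<sigma>))"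
      using lborel_integrable_shift[OF G_prof(2)[OF p0 sm sb], of T] by simp
    note RiT = integrable_bounded_linear[OF R_bounded_linear iT] and Ri0 = integrable_bounded_linear[OF R_bounded_linear i0]
    have eq: "\<phi> \<sigma> *\<^sub>R (indicator {0<..} \<sigma> *\<^sub>R f \<sigma>) = R (\<phi> \<sigma> *\<^sub>R bT \<sigma>) - R (\<phi> \<sigma> *\<^sub>R b0 (T + \<sigma>)) - \<phi> \<sigma> *\<^sub>R (indicator {0<..} \<sigma> *\<^sub>R W \<sigma>)" for \<sigma>
      using test_fun_zero_outside[OF ph, of \<sigma>] by (cases "\<sigma> > 0") (auto simp: f_def R_scale scaleR_diff_right R_0)
    note d1 = Bochner_Integration.integrable_diff[OF RiT Ri0]
    have "integrable lborel (\<lambda>\<sigma>. \<phi> \<sigma> *\<^sub>R (indicator {0<..} \<sigma> *\<^sub>R f \<sigma>))"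
      unfolding eq by (rule Bochner_Integration.integrable_diff[OF d1 iW])
    moreover have "(LINT \<sigma>|lborel. \<phi> \<sigma> *\<^sub>R (indicator {0<..} \<sigma> *\<^sub>R f \<sigma>)) = H T - H 0 - (LINT \<sigma>|lborel. \<phi> \<sigma> *\<^sub>R (indicator {0<..} \<sigma> *\<^sub>R W \<sigma>))"
      unfolding eq Bochner_Integration.integral_diff[OF d1 iW] Bochner_Integration.integral_diff[OF RiT Ri0]
        integral_bounded_linear[OF R_bounded_linear iT] integral_bounded_linear[OF R_bounded_linear i0] HT H0 ..
    ultimately show ?thesis using HW by simp
  qed
  have Ul: "{0<..} \<in> sets (lebesgue :: real measure)" by simp
  have "AE \<sigma> in lborel. \<sigma> \<in> {0<..} \<longrightarrow> f \<sigma> = 0"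
  proof (rule fundamental_lemma_test_fun)
    fix \<phi> :: "real \<Rightarrow> real" assume ph: "test_fun {0<..} \<phi>"
    have g: "(\<lambda>\<sigma>. \<phi> \<sigma> *\<^sub>R (indicator {0<..} \<sigma> *\<^sub>R f \<sigma>)) \<in> borel_measurable borel" using core[OF ph] by auto
    have ae: "AE \<sigma> in lborel. indicator {0<..} \<sigma> *\<^sub>R (\<phi> \<sigma> *\<^sub>R f \<sigma>) = \<phi> \<sigma> *\<^sub>R (indicator {0<..} \<sigma> *\<^sub>R f \<sigma>)"
      by (simp add: mult.commute)
    note I = integral_lebesgue_eq_lborel[OF g conjunct1[OF core[OF ph]] ae]
    show "integrable (lebesgue_on {0<..}) (\<lambda>x. \<phi> x *\<^sub>R f x)" "integral\<^sup>L (lebesgue_on {0<..}) (\<lambda>x. \<phi> x *\<^sub>R f x) = 0"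
      unfolding set_integral_lebesgue_on[OF Ul] using I core[OF ph] by auto
  qed simp
  then show ?thesis by eventually_elim (simp add: f_def W_def V_def[abs_def] algebra_simps)
qed

text \<open>Integrates the history formula over \<sigma> > 0. Although the individual memory terms
  have values only in H, the total is in the range of R, because u is continuous into V; applying B
  then gives the force.\<close>

theorem orbit_mass:
  assumes x: "FA x" and T: "T \<ge> 0" and p0: "prof (snd (snd x)) b0"
  shows "G (\<lambda>_. 1) (S T x) = (LINT \<tau>:{T<..}|lborel. b0 \<tau>) + mass *\<^sub>R B (fst (S T x))
     - memconv (\<lambda>t. B (fst (S t x))) T - tail_mass T *\<^sub>R B (fst x)"
proof -
  have FT: "FA (S T x)" and F0: "FA (S 0 x)" using x T by (auto intro: S_FA)
  obtain bT where pT: "prof (snd (snd (S T x))) bT" using FA_prof[OF FT] by blast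
  define V where "V s = fst (snd (S s x))" for s
  define U where "U s = fst (S s x)" for s
  have UDB: "U s \<in> DB" if "s \<ge> 0" for s using S_FA[OF that x] by (simp add: U_def in_frakA_def)
  have Vc: "continuous_on {0..} V" unfolding V_def by (rule blf_continuous[OF blf_snd x])
  have Ud: "(U has_vector_derivative V t) (at t within {0..})" if "t \<ge> 0" for t
    unfolding U_def V_def by (rule orbit_fst_derivative[OF x that])
  have BUc: "continuous_on {0..} (\<lambda>t. B (U t))" unfolding U_def by (rule blf_continuous[OF blf_B_fst x])
  note cv = cut_integrable[OF Vc, of T]
  define W where "W \<sigma> = (LINT s|lborel. \<mu> (\<sigma> + T - s) *\<^sub>R cut T V s)" for \<sigma>
  have iW: "integrable lborel (\<lambda>\<sigma>. indicator {0<..} \<sigma> *\<^sub>R W \<sigma>)"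
    using memory_product(2)[OF cv, of "\<lambda>_. 1" 1 T] by (simp add: W_def)
  have IW: "(LINT \<sigma>|lborel. indicator {0<..} \<sigma> *\<^sub>R W \<sigma>) = mass *\<^sub>R U T - memconv U T - tail_mass T *\<^sub>R U 0"
    unfolding W_def by (rule memory_total[OF Vc Ud T])
  have U0: "U 0 = fst x" unfolding U_def by (rule blf_cong[OF blf_fst F0 x S_0[OF x]])
  have mc: "memconv U T = R (memconv (\<lambda>t. B (U t)) T)"
  proof -
    have "memconv U T = memconv (\<lambda>t. R (B (U t))) T"
      unfolding memconv_def by (rule set_lebesgue_integral_cong) (use UDB in auto)
    then show ?thesis using memconv_bounded_linear[OF R_bounded_linear BUc] by simp
  qed
  have iT: "integrable lborel bT" and i0: "integrable lborel b0" using prof_wL2[OF pT] prof_wL2[OF p0] by (auto intro: wL2_integrable)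
  have i0s: "integrable lborel (\<lambda>\<sigma>. indicator {0<..} \<sigma> *\<^sub>R b0 (T + \<sigma>))"
    by (intro integrable_mult_indicator lborel_integrable_shift i0) simp
  have ae: "AE \<sigma> in lborel. R (bT \<sigma>) = R (indicator {0<..} \<sigma> *\<^sub>R b0 (T + \<sigma>)) + indicator {0<..} \<sigma> *\<^sub>R W \<sigma>"
    using orbit_history[OF x T p0 pT]
  proof eventually_elim
    case (elim \<sigma>)
    show ?case
    proof (cases "\<sigma> > 0")
      case True then show ?thesis using elim by (simp add: W_def V_def[abs_def])
    next
      case False
      then have "bT \<sigma> = 0" by (intro wL2_zero[OF prof_wL2[OF pT]]) (auto dest: Omega_pos)
      then show ?thesis using False by (simp add: R_0)
    qed
  qed
  note RiT = integrable_bounded_linear[OF R_bounded_linear iT] and Ri0 = integrable_bounded_linear[OF R_bounded_linear i0s]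
  have "R (LINT \<sigma>|lborel. bT \<sigma>) = (LINT \<sigma>|lborel. R (bT \<sigma>))" by (rule integral_bounded_linear[OF R_bounded_linear iT, symmetric])
  also have "\<dots> = (LINT \<sigma>|lborel. R (indicator {0<..} \<sigma> *\<^sub>R b0 (T + \<sigma>)) + indicator {0<..} \<sigma> *\<^sub>R W \<sigma>)"
    by (rule integral_cong_AE[OF _ _ ae]) (use RiT Ri0 iW in \<open>auto intro: borel_measurable_add borel_measurable_integrable\<close>)
  also have "\<dots> = R (LINT \<sigma>|lborel. indicator {0<..} \<sigma> *\<^sub>R b0 (T + \<sigma>)) + (LINT \<sigma>|lborel. indicator {0<..} \<sigma> *\<^sub>R W \<sigma>)"
    unfolding Bochner_Integration.integral_add[OF Ri0 iW] integral_bounded_linear[OF R_bounded_linear i0s] ..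
  also have "(LINT \<sigma>|lborel. indicator {0<..} \<sigma> *\<^sub>R b0 (T + \<sigma>)) = (LINT \<tau>:{T<..}|lborel. b0 \<tau>)"
  proof -
    have "(LINT \<sigma>|lborel. indicator {0<..} \<sigma> *\<^sub>R b0 (T + \<sigma>)) = (LINT \<sigma>|lborel. indicator {T<..} (T + \<sigma>) *\<^sub>R b0 (T + \<sigma>))"
      by (intro Bochner_Integration.integral_cong) (auto simp: indicator_def)
    also have "\<dots> = (LINT \<tau>|lborel. indicator {T<..} \<tau> *\<^sub>R b0 \<tau>)"
      using lborel_integral_shift[of "\<lambda>\<tau>. indicator {T<..} \<tau> *\<^sub>R b0 \<tau>" T] by simp
    finally show ?thesis by (simp add: set_lebesgue_integral_def)
  qed
  also have "(LINT \<sigma>|lborel. indicator {0<..} \<sigma> *\<^sub>R W \<sigma>)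
     = R (mass *\<^sub>R B (U T) - memconv (\<lambda>t. B (U t)) T - tail_mass T *\<^sub>R B (fst x))"
    unfolding IW mc U0 using UDB[OF T] x by (simp add: R.diff R_scale in_frakA_def)
  finally have "R (LINT \<sigma>|lborel. bT \<sigma>) = R ((LINT \<tau>:{T<..}|lborel. b0 \<tau>) + (mass *\<^sub>R B (U T) - memconv (\<lambda>t. B (U t)) T - tail_mass T *\<^sub>R B (fst x)))"
    by (simp add: R_add)
  then have "(LINT \<sigma>|lborel. bT \<sigma>) = (LINT \<tau>:{T<..}|lborel. b0 \<tau>) + (mass *\<^sub>R B (U T) - memconv (\<lambda>t. B (U t)) T - tail_mass T *\<^sub>R B (fst x))"
    by (metis B_R)
  then show ?thesis by (simp add: G_one[OF pT] U_def)
qed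

end

section \<open>Uniqueness\<close>
lemma at_within_Ici_neq_bot:
  assumes "t \<ge> (a::real)" shows "at t within {a..} \<noteq> bot"
proof -
  have "at_right t \<le> at t within {a..}" by (rule at_le) (use assms in auto)
  moreover have "at_right t \<noteq> bot" by simp
  ultimately show ?thesis using bot.extremum_uniqueI by metis
qed

lemma vector_derivative_Ici:
  assumes "(u has_vector_derivative d) (at t within {a..})" "t \<ge> (a::real)"
  shows "vector_derivative u (at t within {a..}) = d"
  using assms at_within_Ici_neq_bot[OF assms(2)] by (intro vector_derivative_within) simp_all

lemma has_vector_derivative_reflect:
  assumes d: "(z has_vector_derivative d) (at (t - s) within {0..})" and s: "s \<in> {0..(t::real)}"
  shows "((\<lambda>s. z (t - s)) has_vector_derivative - d) (at s within {0..t})"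
proof -
  have 1: "((\<lambda>s. t - s) has_vector_derivative - 1) (at s within {0..t})"
    by (auto intro!: derivative_eq_intros)
  have 2: "(z has_vector_derivative d) (at (t - s) within (\<lambda>s. t - s) ` {0..t})"
    by (rule has_vector_derivative_within_subset[OF d]) auto
  show ?thesis using vector_diff_chain_within[OF 1 2] by (simp add: o_def)
qed

text \<open>Where the first factor vanishes, the product is differentiable with a merely continuous
  second factor.\<close>

lemma has_vector_derivative_inner_zero:
  fixes k c :: "real \<Rightarrow> 'b::real_inner"
  assumes k: "(k has_vector_derivative k1) (at s within X)" and k0: "k s = 0"
    and c: "(c \<longlongrightarrow> c s) (at s within X)"
  shows "((\<lambda>r. inner (k r) (c r)) has_vector_derivative inner k1 (c s)) (at s within X)"
  unfolding has_vector_derivative_def has_derivative_within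
proof
  have "((\<lambda>r. inner ((1 / norm (r - s)) *\<^sub>R (k r - (k s + (r - s) *\<^sub>R k1))) (c r)) \<longlongrightarrow> inner 0 (c s)) (at s within X)"
    using k unfolding has_vector_derivative_def has_derivative_within by (intro tendsto_inner c) simp
  moreover have "((\<lambda>r. ((r - s) / norm (r - s)) * inner k1 (c r - c s)) \<longlongrightarrow> 0) (at s within X)"
  proof (rule Lim_null_comparison)
    show "\<forall>\<^sub>F r in at s within X. norm (((r - s) / norm (r - s)) * inner k1 (c r - c s)) \<le> norm (inner k1 (c r - c s))"
      by (simp add: abs_mult)
    have "((\<lambda>r. norm (inner k1 (c r - c s))) \<longlongrightarrow> norm (inner k1 (c s - c s))) (at s within X)"
      by (intro tendsto_intros c)
    then show "((\<lambda>r. norm (inner k1 (c r - c s))) \<longlongrightarrow> 0) (at s within X)" by simp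
  qed
  ultimately have "((\<lambda>r. inner ((1 / norm (r - s)) *\<^sub>R (k r - (k s + (r - s) *\<^sub>R k1))) (c r)
     + ((r - s) / norm (r - s)) * inner k1 (c r - c s)) \<longlongrightarrow> 0) (at s within X)"
    using tendsto_add[of _ "inner 0 (c s)" _ _ 0] by fastforce
  then show "((\<lambda>r. (1 / norm (r - s)) *\<^sub>R (inner (k r) (c r) - (inner (k s) (c s) + (r - s) *\<^sub>R inner k1 (c s)))) \<longlongrightarrow> 0) (at s within X)"
    by (simp add: k0 inner_diff_left inner_diff_right algebra_simps diff_divide_distrib add_divide_distrib)
qed (rule bounded_linear_scaleR_left)

context operator_sqrt begin

text \<open>Product rule when p is differentiable only after R. Splitting <p(r), a(r)> as <R p(r) -
  R p(s), B a(r)> + <p(s), a(r)> leaves a first factor that vanishes at s, so continuity of B a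
  suffices.\<close>

lemma inner_R_derivative:
  assumes p: "((\<lambda>r. R (p r)) has_vector_derivative p1) (at s within X)" and a: "(a has_vector_derivative a1) (at s within X)"
    and DB: "\<And>r. r \<in> X \<Longrightarrow> a r \<in> DB" and s: "s \<in> X" and c: "continuous_on X (\<lambda>r. B (a r))"
  shows "((\<lambda>r. inner (p r) (a r)) has_vector_derivative inner p1 (B (a s)) + inner (p s) a1) (at s within X)"
proof -
  have 1: "((\<lambda>r. inner (R (p r) - R (p s)) (B (a r))) has_vector_derivative inner p1 (B (a s))) (at s within X)"
  proof (rule has_vector_derivative_inner_zero)
    show "((\<lambda>r. R (p r) - R (p s)) has_vector_derivative p1) (at s within X)"
      using has_vector_derivative_diff[OF p has_vector_derivative_const] by simp
    show "((\<lambda>r. B (a r)) \<longlongrightarrow> B (a s)) (at s within X)" using c s by (auto simp: continuous_on)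
  qed simp
  have 2: "((\<lambda>r. inner (p s) (a r)) has_vector_derivative inner (p s) a1) (at s within X)"
    by (rule bounded_linear.has_vector_derivative[OF bounded_linear_inner_right a])
  have eq: "inner (p r) (a r) = inner (R (p r) - R (p s)) (B (a r)) + inner (p s) (a r)" if "r \<in> X" for r
    using DB[OF that] by (simp add: inner_diff_left R_sym)
  show ?thesis
    by (rule has_vector_derivative_transform[OF s _ has_vector_derivative_add[OF 1 2]]) (simp add: eq)
qed

end

text \<open>The exceptional null set depends on w. Testing with R c for c in a countable dense set
  gives a single null set, and continuity of the inner product extends to all vectors.\<close>

lemma (in operator_sqrt) AE_eq_if_tested:
  assumes "\<And>w. w \<in> DB \<Longrightarrow> AE x in M. inner (f x - g x) (B w) = 0"
  shows "AE x in M. f x = g x"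
proof -
  obtain C :: "'h set" where C: "countable C" "\<And>X. open X \<Longrightarrow> X \<noteq> {} \<Longrightarrow> \<exists>d\<in>C. d \<in> X"
    using countable_dense_exists by blast
  have "AE x in M. \<forall>c\<in>C. inner (f x - g x) (B (R c)) = 0"
    unfolding AE_ball_countable[OF C(1)] using assms[OF R_DB] by blast
  then show ?thesis
  proof eventually_elim
    case (elim x)
    let ?h = "f x - g x"
    have "open {c. inner ?h c \<noteq> 0}" by (intro open_Collect_neq continuous_intros)
    then have "{c. inner ?h c \<noteq> 0} = {}" using C(2) elim by fastforce
    then have "inner ?h ?h = 0" by blast
    then show ?case by simp
  qed
qed

context memory_kernel_locale begin

lemma memconv_diff:
  fixes \<beta> \<gamma> :: "real \<Rightarrow> 'b::{banach, second_countable_topology}"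
  assumes "continuous_on {0..} \<beta>" "continuous_on {0..} \<gamma>"
  shows "memconv (\<lambda>t. \<beta> t - \<gamma> t) T = memconv \<beta> T - memconv \<gamma> T"
  unfolding memconv_def scaleR_diff_right by (rule set_integral_diff(2)[OF memconv_integrable[OF assms(1)] memconv_integrable[OF assms(2)]])

lemma memconv_inner:
  fixes \<beta> :: "real \<Rightarrow> 'b::{real_inner, banach, second_countable_topology}"
  assumes "continuous_on {0..} \<beta>"
  shows "(LINT s:{0..T}|lborel. \<mu> s * inner (\<beta> (T - s)) w) = inner (memconv \<beta> T) w"
  using memconv_bounded_linear[OF bounded_linear_inner_left assms, of w T] by (simp add: memconv_def)

end

lemma (in memory_kernel_locale) memconv_cong:
  assumes "\<And>t. t \<in> {0..T} \<Longrightarrow> \<beta> t = \<gamma> t" shows "memconv \<beta> T = memconv \<gamma> T"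
  unfolding memconv_def by (rule set_lebesgue_integral_cong) (use assms in auto)

lemma tail_prim_Ioi:
  fixes d :: "real \<Rightarrow> 'b::{banach, second_countable_topology}"
  assumes [measurable]: "d \<in> borel_measurable borel"
  shows "(LINT \<tau>:{T<..}|lborel. d \<tau>) = - tail_prim d T"
proof -
  have "(LINT \<tau>:{T<..}|lborel. d \<tau>) = (LINT \<tau>:{T..}|lborel. d \<tau>)" unfolding set_lebesgue_integral_def
  proof (rule integral_cong_AE)
    show "AE \<tau> in lborel. indicator {T<..} \<tau> *\<^sub>R d \<tau> = indicator {T..} \<tau> *\<^sub>R d \<tau>"
      using AE_lborel_singleton[of T] by eventually_elim (auto simp: indicator_def)
  qed measurable
  then show ?thesis by (simp add: tail_prim_def)
qed

context visco_semigroup begin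

lemma FA_zero_history: "u \<in> DB \<Longrightarrow> FA (u, v, \<lambda>_. 0)"
  using prof_calV[OF prof_0] by (simp add: in_frakA_def)

lemma orbit_init:
  assumes x: "FA x" shows "fst (S 0 x) = fst x" "fst (snd (S 0 x)) = fst (snd x)"
  using blf_cong[OF blf_fst S_FA[OF order_refl x] x S_0[OF x]] blf_cong[OF blf_snd S_FA[OF order_refl x] x S_0[OF x]] .

text \<open>The mild equation is paired with the time-reversed orbit issued from \<open>(0, v1, 0)\<close>; the memory
  terms cancel because the convolution is symmetric.\<close>
theorem homogeneous_equation_unique:
  assumes y: "\<And>t. t \<ge> 0 \<Longrightarrow> y t \<in> DB" and By: "continuous_on {0..} (\<lambda>t. B (y t))"
    and yd: "\<And>t. t \<ge> 0 \<Longrightarrow> (y has_vector_derivative z t) (at t within {0..})" and y0: "y 0 = 0" and z0: "z 0 = 0"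
    and eq: "\<And>t. t \<ge> 0 \<Longrightarrow> R (z t) = - (LINT s:{0..t}|lborel. (1 + mass) *\<^sub>R B (y s) - memconv (\<lambda>t. B (y t)) s)"
    and t: "t \<ge> 0"
  shows "y t = 0"
proof -
  define \<beta> where "\<beta> s = B (y s)" for s
  have \<beta>c: "continuous_on {0..} \<beta>" using By by (simp add: \<beta>_def[abs_def])
  have \<beta>0: "\<beta> 0 = 0" by (simp add: \<beta>_def y0 B_0)
  define Q where "Q s = (1 + mass) *\<^sub>R \<beta> s - memconv \<beta> s" for s
  have Qc: "continuous_on {0..} Q" unfolding Q_def by (intro continuous_intros \<beta>c memconv_continuous \<beta>0)
  have Rz: "((\<lambda>s. R (z s)) has_vector_derivative - Q s) (at s within {0..})" if s: "s \<ge> 0" for s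
  proof (rule has_vector_derivative_transform)
    note d = integral_has_vector_derivative_Ici[OF Qc]
    show "((\<lambda>s. - integral {0..s} Q) has_vector_derivative - Q s) (at s within {0..})"
      by (rule has_vector_derivative_minus[OF d[OF s]])
    show "R (z r) = - integral {0..r} Q" if "r \<in> {0..}" for r
    proof -
      have "(LINT s:{0..r}|lborel. Q s) = integral {0..r} Q - integral {0..0} Q"
        by (rule FTC_Ici[OF Qc d]) (use that in auto)
      then show ?thesis using eq[of r] that by (simp add: Q_def[abs_def] \<beta>_def[abs_def])
    qed
  qed (use s in simp)
  \<comment> \<open>The initial velocity of the test orbit is y t itself, so comparing end points
    produces |y t|^2.\<close>
  define x where "x = (0::'h, y t, \<lambda>_::real. 0::'h)"
  have x: "FA x" unfolding x_def by (rule FA_zero_history[OF DB_0])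
  define \<psi> where "\<psi> s = fst (S s x)" for s
  define \<phi> where "\<phi> s = fst (snd (S s x))" for s
  have \<psi>0: "\<psi> 0 = 0" and \<phi>0: "\<phi> 0 = y t" using orbit_init[OF x] by (simp_all add: \<psi>_def \<phi>_def x_def)
  have \<psi>DB: "\<psi> s \<in> DB" if "s \<ge> 0" for s using S_FA[OF that x] by (simp add: \<psi>_def in_frakA_def)
  have \<psi>d: "(\<psi> has_vector_derivative \<phi> s) (at s within {0..})" if "s \<ge> 0" for s
    unfolding \<psi>_def \<phi>_def by (rule orbit_fst_derivative[OF x that])
  define \<gamma> where "\<gamma> s = B (\<psi> s)" for s
  have \<gamma>c: "continuous_on {0..} \<gamma>" unfolding \<gamma>_def \<psi>_def by (rule blf_continuous[OF blf_B_fst x])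
  have \<gamma>0: "\<gamma> 0 = 0" by (simp add: \<gamma>_def \<psi>0 B_0)
  have R\<phi>: "((\<lambda>s. R (\<phi> s)) has_vector_derivative - ((1 + mass) *\<^sub>R \<gamma> s - memconv \<gamma> s)) (at s within {0..})" if s: "s \<ge> 0" for s
  proof -
    have p: "prof (snd (snd x)) (\<lambda>_. 0)" using prof_0 by (simp add: x_def)
    have "G (\<lambda>_. 1) (S s x) = mass *\<^sub>R \<gamma> s - memconv \<gamma> s"
      using orbit_mass[OF x s p] by (simp add: \<gamma>_def[abs_def] \<psi>_def[abs_def] set_lebesgue_integral_def) (simp add: x_def B_0)
    then have "- (B (fst (S s x)) + G (\<lambda>_. 1) (S s x)) = - ((1 + mass) *\<^sub>R \<gamma> s - memconv \<gamma> s)"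
      by (simp add: \<gamma>_def \<psi>_def scaleR_add_left)
    then show ?thesis using orbit_R_snd_derivative[OF x s] by (simp only: \<phi>_def)
  qed
  define \<Phi> where "\<Phi> s = inner (z (t - s)) (\<psi> s) + inner (\<phi> s) (y (t - s))" for s
  \<comment> \<open>What remains of the derivative of \<Phi>: the terms with 1 + mass and the
    products of velocities cancel pointwise, the memory terms only after integration.\<close>
  define D where "D s = inner (\<beta> (t - s)) (memconv \<gamma> s) - inner (memconv \<beta> (t - s)) (\<gamma> s)" for s
  have rc: "continuous_on {0..t} (\<lambda>s. f (t - s))" if "continuous_on {0..} f" for f :: "real \<Rightarrow> 'h"
    by (rule continuous_on_compose2[OF that]) (auto intro!: continuous_intros)
  have \<Phi>d: "(\<Phi> has_vector_derivative D s) (at s within {0..t})" if s: "s \<in> {0..t}" for s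
  proof -
    have s': "s \<ge> 0" "t - s \<ge> 0" using s by auto
    have sub: "{0..t} \<subseteq> {0..}" by auto
    have 1: "((\<lambda>s. inner (z (t - s)) (\<psi> s)) has_vector_derivative inner (- (- Q (t - s))) (B (\<psi> s)) + inner (z (t - s)) (\<phi> s)) (at s within {0..t})"
    proof (rule inner_R_derivative)
      show "((\<lambda>s. R (z (t - s))) has_vector_derivative - (- Q (t - s))) (at s within {0..t})"
        by (rule has_vector_derivative_reflect[OF Rz[OF s'(2)] s])
      show "(\<psi> has_vector_derivative \<phi> s) (at s within {0..t})" by (rule has_vector_derivative_within_subset[OF \<psi>d[OF s'(1)] sub])
      show "continuous_on {0..t} (\<lambda>r. B (\<psi> r))" using continuous_on_subset[OF \<gamma>c sub] by (simp add: \<gamma>_def[abs_def])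
    qed (use s \<psi>DB in auto)
    have 2: "((\<lambda>s. inner (\<phi> s) (y (t - s))) has_vector_derivative inner (- ((1 + mass) *\<^sub>R \<gamma> s - memconv \<gamma> s)) (B (y (t - s))) + inner (\<phi> s) (- z (t - s))) (at s within {0..t})"
    proof (rule inner_R_derivative)
      show "((\<lambda>s. R (\<phi> s)) has_vector_derivative - ((1 + mass) *\<^sub>R \<gamma> s - memconv \<gamma> s)) (at s within {0..t})"
        by (rule has_vector_derivative_within_subset[OF R\<phi>[OF s'(1)] sub])
      show "((\<lambda>s. y (t - s)) has_vector_derivative - z (t - s)) (at s within {0..t})"
        by (rule has_vector_derivative_reflect[OF yd[OF s'(2)] s])
      show "continuous_on {0..t} (\<lambda>r. B (y (t - r)))" by (rule rc[OF By])
    qed (use s y in auto)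
    have "inner (- (- Q (t - s))) (B (\<psi> s)) + inner (z (t - s)) (\<phi> s)
       + (inner (- ((1 + mass) *\<^sub>R \<gamma> s - memconv \<gamma> s)) (B (y (t - s))) + inner (\<phi> s) (- z (t - s))) = D s"
      unfolding D_def Q_def \<gamma>_def[symmetric] \<beta>_def[symmetric]
      using inner_commute[of "z (t - s)" "\<phi> s"] inner_commute[of "\<beta> (t - s)" "\<gamma> s"] inner_commute[of "\<beta> (t - s)" "memconv \<gamma> s"]
      by (simp add: inner_diff_left)
    then show ?thesis unfolding \<Phi>_def using has_vector_derivative_add[OF 1 2] by simp
  qed
  have c1: "continuous_on {0..t} (\<lambda>s. inner (\<beta> (t - s)) (memconv \<gamma> s))"
    and c2: "continuous_on {0..t} (\<lambda>s. inner (memconv \<beta> (t - s)) (\<gamma> s))"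
    by (intro continuous_on_inner rc \<beta>c memconv_continuous \<beta>0 continuous_on_subset[OF memconv_continuous[OF \<gamma>c \<gamma>0]] continuous_on_subset[OF \<gamma>c]; auto)+
  have "(LINT s:{0..t}|lborel. D s) = \<Phi> t - \<Phi> 0"
    by (rule FTC_Icc[OF _ \<Phi>d t]) (unfold D_def, intro continuous_on_diff c1 c2)
  moreover have "(LINT s:{0..t}|lborel. D s) = 0"
    unfolding D_def set_integral_diff(2)[OF borel_integrable_atLeastAtMost'[OF c1] borel_integrable_atLeastAtMost'[OF c2]]
    using memconv_symmetric[OF \<beta>c \<gamma>c t] by simp
  moreover have "\<Phi> t = 0" by (simp add: \<Phi>_def z0 y0)
  moreover have "\<Phi> 0 = inner (y t) (y t)" by (simp add: \<Phi>_def \<psi>0 \<phi>0)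
  ultimately show ?thesis by simp
qed

end

section \<open>Comparison of solutions and forcings\<close>

lemma AE_zero_if_Icc_integrals_zero:
  fixes h :: "real \<Rightarrow> real"
  assumes i: "\<And>t. t \<ge> 0 \<Longrightarrow> set_integrable lborel {0..t} h" and z: "\<And>t. t \<ge> 0 \<Longrightarrow> (LINT s:{0..t}|lborel. h s) = 0"
  shows "AE s in lborel. s > 0 \<longrightarrow> h s = 0"
proof -
  have "AE s in lborel. indicator {0..real n} s * h s = 0" for n
  proof (rule AE_zero_if_Ioc_integrals_zero)
    let ?g = "\<lambda>s. indicator {0..real n} s * h s"
    show "integrable lborel ?g" using i[of "real n"] by (simp add: set_integrable_def)
    fix a b :: real assume ab: "a \<le> b"
    \<comment> \<open>Up to the null point 0, the part of {a<..b} inside {0..n} is {0..c b} without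
      {0..c a}.\<close>
    define c where "c x = min (real n) (max 0 x)" for x :: real
    have c0: "c x \<ge> 0" for x by (simp add: c_def)
    note si = i[OF c0, unfolded set_integrable_def]
    have gm: "?g \<in> borel_measurable lborel" using i[of "real n"] by (auto simp: set_integrable_def)
    have "(LINT s:{a<..b}|lborel. ?g s) = (LINT s|lborel. indicator {0..c b} s *\<^sub>R h s - indicator {0..c a} s *\<^sub>R h s)"
      unfolding set_lebesgue_integral_def
    proof (rule integral_cong_AE)
      show "AE s in lborel. indicator {a<..b} s *\<^sub>R ?g s = indicator {0..c b} s *\<^sub>R h s - indicator {0..c a} s *\<^sub>R h s"
        using AE_lborel_singleton[of 0] by eventually_elim (use ab in \<open>auto simp: c_def indicator_def\<close>)
      show "(\<lambda>s. indicator {0..c b} s *\<^sub>R h s - indicator {0..c a} s *\<^sub>R h s) \<in> borel_measurable lborel"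
        by (intro borel_measurable_diff borel_measurable_integrable si)
      show "(\<lambda>s. indicator {a<..b} s *\<^sub>R ?g s) \<in> borel_measurable lborel"
        by (intro borel_measurable_scaleR gm) simp
    qed
    also have "\<dots> = 0"
      by (rule trans[OF Bochner_Integration.integral_diff[OF si si]]) (use z[OF c0] in \<open>simp add: set_lebesgue_integral_def\<close>)
    finally show "(LINT s:{a<..b}|lborel. ?g s) = 0" .
  qed
  then have "AE s in lborel. \<forall>n. indicator {0..real n} s * h s = 0" unfolding AE_all_countable by blast
  then show ?thesis
  proof eventually_elim
    case (elim s)
    show ?case
    proof
      assume "s > 0"
      obtain n where "s \<le> real n" using real_arch_simple by blast
      then show "h s = 0" using elim[rule_format, of n] \<open>s > 0\<close> by simp
    qed
  qed
qed

context visco_semigroup begin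

text \<open>The two forcings may differ: equal forcings lead to uniqueness of solutions, equal
  solutions to uniqueness of the forcing. h depends on w because second derivatives are functionals
  on V.\<close>

lemma solution_difference:
  assumes 1: "is_solution l \<mu> (1 + mass) B DB F1 u0 v0 u1" and 2: "is_solution l \<mu> (1 + mass) B DB F2 u0 v0 u2"
  defines "y \<equiv> \<lambda>t. u1 t - u2 t"
    and "z \<equiv> \<lambda>t. vector_derivative u1 (at t within {0..}) - vector_derivative u2 (at t within {0..})"
  shows "\<And>t. t \<ge> 0 \<Longrightarrow> y t \<in> DB" "continuous_on {0..} (\<lambda>t. B (y t))"
    "\<And>t. t \<ge> 0 \<Longrightarrow> (y has_vector_derivative z t) (at t within {0..})" "y 0 = 0" "z 0 = 0"
    "\<And>w. w \<in> DB \<Longrightarrow> \<exists>h. (\<forall>t\<ge>0. set_integrable lborel {0..t} h \<and> inner (z t) w = (LINT s:{0..t}|lborel. h s)) \<and>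
      (AE s in lborel. s > 0 \<longrightarrow> h s = inner (B (F1 s) - B (F2 s)) (B w)
          - inner ((1 + mass) *\<^sub>R B (y s) - memconv (\<lambda>t. B (y t)) s) (B w))"
proof -
  have D1: "u1 t \<in> DB" and D2: "u2 t \<in> DB" if "t \<ge> 0" for t using 1 2 that unfolding is_solution_def by auto
  then show "y t \<in> DB" if "t \<ge> 0" for t using that by (simp add: y_def DB_diff)
  have c1: "continuous_on {0..} (\<lambda>t. B (u1 t))" and c2: "continuous_on {0..} (\<lambda>t. B (u2 t))"
    using 1 2 unfolding is_solution_def by auto
  have By: "B (y t) = B (u1 t) - B (u2 t)" if "t \<ge> 0" for t using D1 D2 that by (simp add: y_def B_diff)
  show "continuous_on {0..} (\<lambda>t. B (y t))"
    by (subst continuous_on_cong[OF refl, of _ _ "\<lambda>t. B (u1 t) - B (u2 t)"]) (auto simp: By intro: continuous_on_diff c1 c2)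
  show "(y has_vector_derivative z t) (at t within {0..})" if "t \<ge> 0" for t
    unfolding y_def z_def
  proof (rule has_vector_derivative_diff)
    show "(u1 has_vector_derivative vector_derivative u1 (at t within {0..})) (at t within {0..})"
      "(u2 has_vector_derivative vector_derivative u2 (at t within {0..})) (at t within {0..})"
      using 1 2 that unfolding is_solution_def by (auto simp: vector_derivative_works)
  qed
  show "y 0 = 0" "z 0 = 0" using 1 2 unfolding is_solution_def by (auto simp: y_def z_def)
  have mem: "memconv (\<lambda>t. B (y t)) s = memconv (\<lambda>t. B (u1 t)) s - memconv (\<lambda>t. B (u2 t)) s" for s
    unfolding memconv_diff[OF c1 c2, symmetric] by (rule memconv_cong) (simp add: By)
  fix w assume w: "w \<in> DB"
  obtain g1 where g1: "\<And>t. t \<ge> 0 \<Longrightarrow> set_integrable lborel {0..t} (\<lambda>s. g1 s w)"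
      "\<And>t. t \<ge> 0 \<Longrightarrow> inner (vector_derivative u1 (at t within {0..})) w = inner v0 w + (LINT s:{0..t}|lborel. g1 s w)"
      "AE t in lebesgue_on {0<..}. g1 t w + (1 + mass) * innerV B (u1 t) w
              - (LINT s:{0..t}|lborel. \<mu> s * innerV B (u1 (t - s)) w) - innerV B (F1 t) w = 0"
    using 1 w unfolding is_solution_def by blast
  obtain g2 where g2: "\<And>t. t \<ge> 0 \<Longrightarrow> set_integrable lborel {0..t} (\<lambda>s. g2 s w)"
      "\<And>t. t \<ge> 0 \<Longrightarrow> inner (vector_derivative u2 (at t within {0..})) w = inner v0 w + (LINT s:{0..t}|lborel. g2 s w)"
      "AE t in lebesgue_on {0<..}. g2 t w + (1 + mass) * innerV B (u2 t) w
              - (LINT s:{0..t}|lborel. \<mu> s * innerV B (u2 (t - s)) w) - innerV B (F2 t) w = 0"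
    using 2 w unfolding is_solution_def by blast
  have Il: "{0::real<..} \<in> sets lebesgue" by simp
  note ae = g1(3)[unfolded AE_lebesgue_on_iff[OF Il] innerV_def memconv_inner[OF c1]]
    g2(3)[unfolded AE_lebesgue_on_iff[OF Il] innerV_def memconv_inner[OF c2]]
  have "AE s in lborel. s > 0 \<longrightarrow> g1 s w - g2 s w = inner (B (F1 s) - B (F2 s)) (B w)
          - inner ((1 + mass) *\<^sub>R B (y s) - memconv (\<lambda>t. B (y t)) s) (B w)"
    using ae by eventually_elim (auto simp: By mem inner_diff_left right_diff_distrib)
  moreover have "set_integrable lborel {0..t} (\<lambda>s. g1 s w - g2 s w)"
    "inner (z t) w = (LINT s:{0..t}|lborel. g1 s w - g2 s w)" if "t \<ge> 0" for t
    using set_integral_diff[OF g1(1)[OF that] g2(1)[OF that]] g1(2)[OF that] g2(2)[OF that] that by (auto simp: z_def inner_diff_left)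
  ultimately show "\<exists>h. (\<forall>t\<ge>0. set_integrable lborel {0..t} h \<and> inner (z t) w = (LINT s:{0..t}|lborel. h s)) \<and>
      (AE s in lborel. s > 0 \<longrightarrow> h s = inner (B (F1 s) - B (F2 s)) (B w)
          - inner ((1 + mass) *\<^sub>R B (y s) - memconv (\<lambda>t. B (y t)) s) (B w))"
    by (intro exI[of _ "\<lambda>s. g1 s w - g2 s w"]) blast
qed

theorem solution_unique:
  assumes 1: "is_solution l \<mu> (1 + mass) B DB F1 u0 v0 u1" and 2: "is_solution l \<mu> (1 + mass) B DB F2 u0 v0 u2"
    and F: "AE s in lborel. s > 0 \<longrightarrow> B (F1 s) = B (F2 s)" and t: "t \<ge> 0"
  shows "u1 t = u2 t"
proof -
  define y where "y t = u1 t - u2 t" for t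
  define z where "z t = vector_derivative u1 (at t within {0..}) - vector_derivative u2 (at t within {0..})" for t
  note d = solution_difference[OF 1 2, folded y_def z_def]
  define Q where "Q s = (1 + mass) *\<^sub>R B (y s) - memconv (\<lambda>t. B (y t)) s" for s
  have Qc: "continuous_on {0..} Q"
    unfolding Q_def by (intro continuous_intros memconv_continuous d(2)) (simp add: d(4) B_0)
  have eq: "R (z r) = - (LINT s:{0..r}|lborel. Q s)" if r: "r \<ge> 0" for r
  proof -
    have qc: "continuous_on {0..r} Q" by (rule continuous_on_subset[OF Qc]) auto
    note qi = borel_integrable_atLeastAtMost'[OF qc, unfolded set_integrable_def]
    \<comment> \<open>Since <z, w> = <R z, B w> and B is onto, testing the integrated equation with
      all w in V yields the mild equation in H.\<close>
    have "inner (R (z r) + (LINT s:{0..r}|lborel. Q s)) (B w) = 0" if w: "w \<in> DB" for w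
    proof -
      obtain h where h: "set_integrable lborel {0..r} h" "inner (z r) w = (LINT s:{0..r}|lborel. h s)"
        "AE s in lborel. s > 0 \<longrightarrow> h s = inner (B (F1 s) - B (F2 s)) (B w) - inner (Q s) (B w)"
        using d(6)[OF w] r unfolding Q_def by blast
      have "(LINT s:{0..r}|lborel. h s) = (LINT s|lborel. - inner (indicator {0..r} s *\<^sub>R Q s) (B w))"
        unfolding set_lebesgue_integral_def
      proof (rule integral_cong_AE)
        show "AE s in lborel. indicator {0..r} s *\<^sub>R h s = - inner (indicator {0..r} s *\<^sub>R Q s) (B w)"
          using h(3) F AE_lborel_singleton[of 0] by eventually_elim (auto simp: indicator_def)
        show "(\<lambda>s. indicator {0..r} s *\<^sub>R h s) \<in> borel_measurable lborel" using h(1) by (auto simp: set_integrable_def)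
        show "(\<lambda>s. - inner (indicator {0..r} s *\<^sub>R Q s) (B w)) \<in> borel_measurable lborel"
          by (intro borel_measurable_uminus borel_measurable_inner borel_measurable_integrable[OF qi]) simp
      qed
      also have "\<dots> = - inner (LINT s:{0..r}|lborel. Q s) (B w)"
        using integral_inner_left[OF qi, of "B w"] by (simp add: set_lebesgue_integral_def)
      finally show ?thesis using h(2) w by (simp add: inner_add_left R_sym)
    qed
    then have "R (z r) + (LINT s:{0..r}|lborel. Q s) = 0" by (rule inner_B_eq_0D)
    then show ?thesis by (simp add: eq_neg_iff_add_eq_0)
  qed
  have "y t = 0" by (rule homogeneous_equation_unique[OF d(1-5) eq[unfolded Q_def] t])
  then show ?thesis by (simp add: y_def)
qed

text \<open>If the solutions agree, the second derivative of the difference integrates to 0 over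
  every {0..t}, so it vanishes a.e. for each w, and only the forcings remain in the
  equation.\<close>

theorem forcing_unique:
  assumes 1: "is_solution l \<mu> (1 + mass) B DB F1 u0 v0 u1" and 2: "is_solution l \<mu> (1 + mass) B DB F2 u0 v0 u2"
    and u: "\<And>t. t \<ge> 0 \<Longrightarrow> u1 t = u2 t"
  shows "AE s in lborel. s > 0 \<longrightarrow> B (F1 s) = B (F2 s)"
proof -
  define y where "y t = u1 t - u2 t" for t
  define z where "z t = vector_derivative u1 (at t within {0..}) - vector_derivative u2 (at t within {0..})" for t
  note d = solution_difference[OF 1 2, folded y_def z_def]
  have y: "y t = 0" if "t \<ge> 0" for t using u[OF that] by (simp add: y_def)
  have z: "z t = 0" if t: "t \<ge> 0" for t
  proof -
    have "(y has_vector_derivative 0) (at t within {0..})"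
      by (rule has_vector_derivative_transform[OF _ _ has_vector_derivative_const]) (use t y in auto)
    then show ?thesis using vector_derivative_Ici[OF d(3)[OF t] t] vector_derivative_Ici[of y 0 t 0] t by simp
  qed
  have mz: "memconv (\<lambda>t. B (y t)) s = 0" for s
    using memconv_cong[of s "\<lambda>t. B (y t)" "\<lambda>_. 0"] by (simp add: y B_0 memconv_def set_lebesgue_integral_def)
  \<comment> \<open>Cutting to s > 0 lets the testing lemma be applied with the measure on the whole
    line.\<close>
  have "AE s in lborel. (if s > 0 then B (F1 s) else 0) = (if s > 0 then B (F2 s) else 0)"
  proof (rule AE_eq_if_tested)
    fix w assume w: "w \<in> DB"
    obtain h where h: "\<And>t. t \<ge> 0 \<Longrightarrow> set_integrable lborel {0..t} h" "\<And>t. t \<ge> 0 \<Longrightarrow> inner (z t) w = (LINT s:{0..t}|lborel. h s)"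
        "AE s in lborel. s > 0 \<longrightarrow> h s = inner (B (F1 s) - B (F2 s)) (B w)
          - inner ((1 + mass) *\<^sub>R B (y s) - memconv (\<lambda>t. B (y t)) s) (B w)"
      using d(6)[OF w] by blast
    have "AE s in lborel. s > 0 \<longrightarrow> h s = 0"
      by (rule AE_zero_if_Icc_integrals_zero[OF h(1)]) (use h(2) z in auto)
    then show "AE s in lborel. inner ((if s > 0 then B (F1 s) else 0) - (if s > 0 then B (F2 s) else 0)) (B w) = 0"
      using h(3) by eventually_elim (auto simp: y B_0 mz)
  qed
  then show ?thesis by eventually_elim (auto split: if_splits)
qed

theorem orbit_is_solution:
  assumes x: "FA (u0, v0, \<xi>0)" and p: "prof \<xi>0 b0"
    and F: "AE t in lborel. t > 0 \<longrightarrow> B (F t) = tail_mass t *\<^sub>R B u0 - (LINT \<tau>:{t<..}|lborel. b0 \<tau>)"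
    and u: "\<And>t. t \<ge> 0 \<Longrightarrow> u t = fst (S t (u0, v0, \<xi>0))"
  shows "is_solution l \<mu> (1 + mass) B DB F u0 v0 u"
proof -
  define x where "x = (u0, v0, \<xi>0)"
  have x: "FA x" using x by (simp add: x_def)
  have p: "prof (snd (snd x)) b0" using p by (simp add: x_def)
  have u: "u t = fst (S t x)" if "t \<ge> 0" for t using u[OF that] by (simp add: x_def)
  define V where "V t = fst (snd (S t x))" for t
  define Q where "Q t = B (fst (S t x)) + G (\<lambda>_. 1) (S t x)" for t
  have UDB: "u t \<in> DB" if "t \<ge> 0" for t using S_FA[OF that x] by (simp add: u[OF that] in_frakA_def)
  have BUc: "continuous_on {0..} (\<lambda>t. B (u t))"
    by (subst continuous_on_cong[OF refl, of _ _ "\<lambda>t. B (fst (S t x))"]) (auto simp: u intro: blf_continuous[OF blf_B_fst x])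
  have G1: "blf (G (\<lambda>_. 1))" by (rule blf_G[where C=1]) auto
  have Qc: "continuous_on {0..} Q"
    unfolding Q_def by (intro continuous_on_add blf_continuous[OF blf_B_fst x] blf_continuous[OF G1 x])
  have Ud: "(u has_vector_derivative V t) (at t within {0..})" if "t \<ge> 0" for t
    unfolding V_def by (rule has_vector_derivative_transform[OF _ _ orbit_fst_derivative[OF x that]]) (use that u in auto)
  have vd: "vector_derivative u (at t within {0..}) = V t" if "t \<ge> 0" for t by (rule vector_derivative_Ici[OF Ud[OF that] that])
  have U0: "u 0 = u0" and V0: "V 0 = v0" using orbit_init[OF x] by (simp_all add: u V_def x_def)
  have wd: "((\<lambda>t. inner (R (V t)) (B w)) has_vector_derivative - inner (Q t) (B w)) (at t within {0..})" if "t \<ge> 0" for t w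
    using bounded_linear.has_vector_derivative[OF bounded_linear_inner_left orbit_R_snd_derivative[OF x that], of "B w"]
    by (simp only: V_def Q_def inner_minus_left)
  have qwc: "continuous_on {0..} (\<lambda>t. - inner (Q t) (B w))" for w by (intro continuous_intros Qc)
  have Il: "{0::real<..} \<in> sets lebesgue" by simp
  show ?thesis
    unfolding is_solution_def
  \<comment> \<open>The second derivative is the functional that pairs minus the total force Q with
    B w; it is the derivative of <v, w> = <R v, B w>.\<close>
  proof (intro conjI exI[of _ "\<lambda>t w. - inner (Q t) (B w)"] allI impI ballI)
    show "u t \<in> DB" if "t \<ge> 0" for t by (rule UDB[OF that])
    show "continuous_on {0..} (\<lambda>t. B (u t))" by (rule BUc)
    show "u differentiable at t within {0..}" if "t \<ge> 0" for t
      using Ud[OF that] by (rule differentiableI_vector)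
    have "continuous_on {0..} V" unfolding V_def by (rule blf_continuous[OF blf_snd x])
    then show "continuous_on {0..} (\<lambda>t. vector_derivative u (at t within {0..}))"
      by (subst continuous_on_cong[OF refl, of _ _ V]) (auto simp: vd)
    show "u 0 = u0" by (rule U0)
    show "vector_derivative u (at 0 within {0..}) = v0" using vd[of 0] V0 by simp
    show "AE t in lebesgue_on {0..}. in_Vdual B DB (\<lambda>w. - inner (Q t) (B w))"
    proof (rule AE_I2)
      fix t show "in_Vdual B DB (\<lambda>w. - inner (Q t) (B w))" unfolding in_Vdual_def
      proof (intro conjI ballI allI exI[of _ "norm (Q t)"])
        show "\<bar>- inner (Q t) (B w)\<bar> \<le> norm (Q t) * norm (B w)" for w using Cauchy_Schwarz_ineq2[of "Q t" "B w"] by simp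
        show "- inner (Q t) (B (a *\<^sub>R x + b *\<^sub>R y)) = a * - inner (Q t) (B x) + b * - inner (Q t) (B y)"
          if "x \<in> DB" "y \<in> DB" for x y a b
          using that by (simp add: B_add B_scale DB_scale inner_add_right)
      qed
    qed
    fix w assume w: "w \<in> DB"
    show "set_integrable lborel {0..t} (\<lambda>s. - inner (Q s) (B w))" if "t \<ge> 0" for t
      by (rule borel_integrable_atLeastAtMost', rule continuous_on_subset[OF qwc]) auto
    show "inner (vector_derivative u (at t within {0..})) w = inner v0 w + (LINT s:{0..t}|lborel. - inner (Q s) (B w))" if t: "t \<ge> 0" for t
      using FTC_Ici[OF qwc wd order_refl t, of w] w vd[OF t] by (simp add: R_sym V0)
    show "AE t in lebesgue_on {0<..}. - inner (Q t) (B w) + (1 + mass) * innerV B (u t) w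
         - (LINT s:{0..t}|lborel. \<mu> s * innerV B (u (t - s)) w) - innerV B (F t) w = 0"
      unfolding AE_lebesgue_on_iff[OF Il] innerV_def memconv_inner[OF BUc]
      using F
    proof eventually_elim
      case (elim t)
      show ?case
      proof
        assume t: "t \<in> {0<..}"
        have m: "memconv (\<lambda>t. B (fst (S t x))) t = memconv (\<lambda>t. B (u t)) t" by (rule memconv_cong) (simp add: u)
        have "Q t = (1 + mass) *\<^sub>R B (u t) - memconv (\<lambda>t. B (u t)) t - B (F t)"
          using orbit_mass[OF x _ p, of t] elim t by (simp add: Q_def m[unfolded x_def] u x_def scaleR_add_left)
        then show "- inner (Q t) (B w) + (1 + mass) * inner (B (u t)) (B w) - inner (memconv (\<lambda>t. B (u t)) t) (B w) - inner (B (F t)) (B w) = 0"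
          by (simp add: inner_diff_left)
      qed
    qed
  qed
qed

end

section \<open>Proper states\<close>
lemma integrable_test_fun_scaleR_continuous:
  fixes f :: "real \<Rightarrow> 'b::{banach, second_countable_topology}"
  assumes t: "test_fun U \<phi>" and f: "\<And>W. continuous_on W f"
  shows "integrable lborel (\<lambda>x. \<phi> x *\<^sub>R f x)"
proof -
  obtain p q where pq: "\<And>x. x \<notin> {p..q} \<Longrightarrow> \<phi> x = 0" using test_fun_support[OF t] by blast
  have "set_integrable lborel {p..q} (\<lambda>x. \<phi> x *\<^sub>R f x)"
    by (rule borel_integrable_atLeastAtMost') (intro continuous_on_scaleR test_fun_continuous_on[OF t] f)
  moreover have "(\<lambda>x. indicator {p..q} x *\<^sub>R (\<phi> x *\<^sub>R f x)) = (\<lambda>x. \<phi> x *\<^sub>R f x)"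
    using pq by (auto simp: indicator_def fun_eq_iff)
  ultimately show ?thesis by (simp add: set_integrable_def)
qed

context visco begin

lemma Ivl_eq: "t \<ge> 0 \<Longrightarrow> Ivl t l = {t<..} \<inter> Omega l" by (auto simp: Ivl_def Omega_def)

lemma Gam_eq:
  assumes p: "prof \<xi> b" and t: "t \<ge> 0" shows "Gam l \<xi> t = R (tail_prim b t)"
proof -
  note b = wL2_integrable[OF prof_wL2[OF p]] wL2_meas[OF prof_wL2[OF p]]
  have eq: "indicator ({t<..} \<inter> Omega l) \<tau> *\<^sub>R (1 *\<^sub>R b \<tau>) = indicator {t<..} \<tau> *\<^sub>R b \<tau>" for \<tau>
    using wL2_zero[OF prof_wL2[OF p], of \<tau>] by (auto simp: indicator_def)
  have i: "integrable lborel (\<lambda>\<tau>. indicator ({t<..} \<inter> Omega l) \<tau> *\<^sub>R (1 *\<^sub>R b \<tau>))"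
    unfolding eq by (rule integrable_mult_indicator[OF _ b(1)]) simp
  have "integral\<^sup>L (lebesgue_on ({t<..} \<inter> Omega l)) (\<lambda>\<tau>. 1 *\<^sub>R \<xi> \<tau>)
     = R (LINT \<tau>|lborel. indicator ({t<..} \<inter> Omega l) \<tau> *\<^sub>R (1 *\<^sub>R b \<tau>))"
    by (rule prof_integral(2)[OF p _ _ _ i]) auto
  also have "\<dots> = R (LINT \<tau>:{t<..}|lborel. b \<tau>)" unfolding eq set_lebesgue_integral_def ..
  finally have "integral\<^sup>L (lebesgue_on ({t<..} \<inter> Omega l)) \<xi> = R (LINT \<tau>:{t<..}|lborel. b \<tau>)" by simp
  then show ?thesis by (simp add: Gam_def Ivl_eq[OF t] tail_prim_Ioi[OF b(2)] R_minus)
qed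

text \<open>Gamma xi is R applied to the tail primitive of the profile. The latter is continuous
  across l, so extending xi by 0 beyond l creates no singular part there.\<close>

lemma Gam_dist_deriv:
  assumes p: "prof \<xi> b" and F: "AE t in lborel. t > 0 \<longrightarrow> F t = Gam l \<xi> t"
  shows "dist_deriv {0<..} F (\<lambda>\<tau>. if \<tau> \<in> Omega l then \<xi> \<tau> else 0)"
  unfolding dist_deriv_def
proof (intro allI impI)
  fix \<phi> :: "real \<Rightarrow> real" assume ph: "test_fun {0<..} \<phi>"
  note b = wL2_integrable[OF prof_wL2[OF p]] wL2_meas[OF prof_wL2[OF p]]
  have ph': "test_fun {0<..} (deriv \<phi>)" by (rule test_fun_deriv[OF ph])
  obtain C where C: "\<And>x. \<bar>\<phi> x\<bar> \<le> C" using test_fun_bounded[OF ph] by blast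
  have Ul: "{0::real<..} \<in> sets lebesgue" by simp
  have i1: "integrable lborel (\<lambda>\<tau>. \<phi> \<tau> *\<^sub>R b \<tau>)" by (rule prof_integral_bounded(1)[OF p test_fun_measurable[OF ph] C])
  have i2: "integrable lborel (\<lambda>\<tau>. deriv \<phi> \<tau> *\<^sub>R tail_prim b \<tau>)"
    by (rule integrable_test_fun_scaleR_continuous[OF ph' tail_prim_continuous[OF b(1)]])
  note Ri1 = integrable_bounded_linear[OF R_bounded_linear i1] and Ri2 = integrable_bounded_linear[OF R_bounded_linear i2]
  have a1: "AE \<tau> in lborel. indicator {0<..} \<tau> *\<^sub>R (\<phi> \<tau> *\<^sub>R (if \<tau> \<in> Omega l then \<xi> \<tau> else 0)) = R (\<phi> \<tau> *\<^sub>R b \<tau>)"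
    using prof_AE_R[OF p]
  proof eventually_elim
    case (elim \<tau>)
    then show ?case using wL2_zero[OF prof_wL2[OF p], of \<tau>] Omega_pos[of \<tau>] by (auto simp: R_scale R_0)
  qed
  have a2: "AE \<tau> in lborel. indicator {0<..} \<tau> *\<^sub>R (deriv \<phi> \<tau> *\<^sub>R F \<tau>) = R (deriv \<phi> \<tau> *\<^sub>R tail_prim b \<tau>)"
    using F
  proof eventually_elim
    case (elim \<tau>)
    then show ?case using Gam_eq[OF p, of \<tau>] test_fun_zero_outside[OF ph', of \<tau>]
      by (cases "\<tau> > 0") (auto simp: R_scale R_0)
  qed
  note I1 = integral_lebesgue_eq_lborel[OF borel_measurable_integrable[OF Ri1, simplified] Ri1 a1]
  note I2 = integral_lebesgue_eq_lborel[OF borel_measurable_integrable[OF Ri2, simplified] Ri2 a2]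
  show "integrable (lebesgue_on {0<..}) (\<lambda>x. deriv \<phi> x *\<^sub>R F x) \<and>
      integrable (lebesgue_on {0<..}) (\<lambda>x. \<phi> x *\<^sub>R (if x \<in> Omega l then \<xi> x else 0)) \<and>
      integral\<^sup>L (lebesgue_on {0<..}) (\<lambda>x. deriv \<phi> x *\<^sub>R F x) = - integral\<^sup>L (lebesgue_on {0<..}) (\<lambda>x. \<phi> x *\<^sub>R (if x \<in> Omega l then \<xi> x else 0))"
    unfolding set_integral_lebesgue_on[OF Ul]
  proof (intro conjI I1(1) I2(1))
    show "integral\<^sup>L lebesgue (\<lambda>x. indicator {0<..} x *\<^sub>R (deriv \<phi> x *\<^sub>R F x)) = - integral\<^sup>L lebesgue (\<lambda>x. indicator {0<..} x *\<^sub>R (\<phi> x *\<^sub>R (if x \<in> Omega l then \<xi> x else 0)))"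
      unfolding I1(2) I2(2) integral_bounded_linear[OF R_bounded_linear i1] integral_bounded_linear[OF R_bounded_linear i2]
        integral_deriv_test_fun_tail_prim[OF b ph] R_minus ..
  qed
qed

text \<open>The forcing generated by an initial history loses its part \<mu> u_0 against the tail
  mass term of the convolution, leaving Gamma of the remainder.\<close>

lemma tail_integral_mu_add:
  fixes b :: "real \<Rightarrow> 'h"
  assumes b: "wL2 b"
  shows "tail_mass t *\<^sub>R c - (LINT \<tau>:{t<..}|lborel. \<mu> \<tau> *\<^sub>R c + b \<tau>) = tail_prim b t"
proof -
  have im: "set_integrable lborel {t<..} \<mu>" unfolding set_integrable_def by (rule integrable_mult_indicator[OF _ mu_integrable]) simp
  have ib: "set_integrable lborel {t<..} b" unfolding set_integrable_def by (rule integrable_mult_indicator[OF _ wL2_integrable[OF b]]) simp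
  have imc: "set_integrable lborel {t<..} (\<lambda>\<tau>. \<mu> \<tau> *\<^sub>R c)"
    unfolding set_integrable_def
    by (rule integrable_mult_indicator[OF _ integrable_scaleR_left[OF mu_integrable]]) simp
  have "(LINT \<tau>:{t<..}|lborel. \<mu> \<tau> *\<^sub>R c + b \<tau>) = (LINT \<tau>:{t<..}|lborel. \<mu> \<tau> *\<^sub>R c) + (LINT \<tau>:{t<..}|lborel. b \<tau>)"
    by (rule set_integral_add(2)[OF imc ib])
  also have "(LINT \<tau>:{t<..}|lborel. \<mu> \<tau> *\<^sub>R c) = tail_mass t *\<^sub>R c"
    using integral_scaleR_left[OF im[unfolded set_integrable_def], of c]
    by (simp add: set_lebesgue_integral_def tail_mass_def)
  also have "(LINT \<tau>:{t<..}|lborel. b \<tau>) = - tail_prim b t" by (rule tail_prim_Ioi[OF wL2_meas[OF b]])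
  finally show ?thesis by simp
qed

lemma Mk_0: "Mk l \<mu> 0 = mass"
proof -
  have Ol: "Omega l \<in> sets lebesgue" by simp
  have "Ivl 0 l = Omega l" by (auto simp: Ivl_def Omega_def)
  moreover have "integral\<^sup>L lebesgue (\<lambda>x. indicator (Omega l) x *\<^sub>R \<mu> x) = integral\<^sup>L lborel \<mu>"
    by (rule integral_lebesgue_eq_lborel(2)[OF mu_measurable mu_integrable]) (auto simp: mu_zero indicator_def)
  ultimately show ?thesis by (simp add: Mk_def set_integral_lebesgue_on(2)[OF Ol] mass_def)
qed

end

lemma dist_deriv_unique:
  assumes U: "open U" and d: "dist_deriv U f g" and d': "dist_deriv U f g'"
  shows "AE x in lborel. x \<in> U \<longrightarrow> g x = g' x"
proof -
  have "AE x in lborel. x \<in> U \<longrightarrow> g x - g' x = 0"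
  proof (rule fundamental_lemma_test_fun[OF U])
    fix \<phi> assume ph: "test_fun U \<phi>"
    have i: "integrable (lebesgue_on U) (\<lambda>x. \<phi> x *\<^sub>R g x)" "integrable (lebesgue_on U) (\<lambda>x. \<phi> x *\<^sub>R g' x)"
      and e: "integral\<^sup>L (lebesgue_on U) (\<lambda>x. \<phi> x *\<^sub>R g x) = integral\<^sup>L (lebesgue_on U) (\<lambda>x. \<phi> x *\<^sub>R g' x)"
      using d d' ph unfolding dist_deriv_def by (auto simp: minus_equation_iff)
    show "integrable (lebesgue_on U) (\<lambda>x. \<phi> x *\<^sub>R (g x - g' x))"
      unfolding scaleR_diff_right by (rule Bochner_Integration.integrable_diff[OF i])
    show "integral\<^sup>L (lebesgue_on U) (\<lambda>x. \<phi> x *\<^sub>R (g x - g' x)) = 0"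
      unfolding scaleR_diff_right Bochner_Integration.integral_diff[OF i] e by simp
  qed
  then show ?thesis by simp
qed

lemma AE_lborel_shift:
  assumes "AE x in lborel. P (x::real)" shows "AE x in lborel. P (c + x)"
proof -
  obtain N where N: "N \<in> null_sets lborel" "{x. \<not> P x} \<subseteq> N"
    using assms by (auto simp: eventually_ae_filter)
  have "{x. x - (- c) \<in> N} \<in> null_sets lborel" by (rule null_sets_translation[OF N(1)])
  then show ?thesis by (rule AE_I'[rotated 0]) (use N(2) in \<open>auto simp: add.commute\<close>)
qed

section \<open>Equivalence for proper states and the converse\<close>

context visco_semigroup begin

text \<open>\<open>xi_t\<close> evaluates the initial history at T + \<tau>, possibly beyond l, so
  its values have to be known a.e. on the whole half-line and not only on Omega.\<close>

theorem orbit_xi_t: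
  assumes x: "FA (u0, v0, \<xi>0)" and p: "prof \<xi>0 b0" and \<xi>0: "AE \<tau> in lborel. \<tau> > 0 \<longrightarrow> \<xi>0 \<tau> = R (b0 \<tau>)"
    and u: "\<And>t. t \<ge> 0 \<Longrightarrow> u t = fst (S t (u0, v0, \<xi>0))" and T: "T \<ge> 0"
  shows "AE \<tau> in lebesgue_on (Omega l). xi_t \<mu> \<xi>0 u0 u T \<tau> = snd (snd (S T (u0, v0, \<xi>0))) \<tau>"
proof -
  define x where "x = (u0, v0, \<xi>0)"
  have x: "FA x" using x by (simp add: x_def)
  have p: "prof (snd (snd x)) b0" using p by (simp add: x_def)
  have u: "u t = fst (S t x)" if "t \<ge> 0" for t using u[OF that] by (simp add: x_def)
  obtain bT where pT: "prof (snd (snd (S T x))) bT" using FA_prof[OF S_FA[OF T x]] by blast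
  have Ol: "Omega l \<in> sets lebesgue" by simp
  have u0: "u 0 = u0" using u[of 0] orbit_init(1)[OF x] by (simp add: x_def)
  have ud: "(u has_vector_derivative fst (snd (S t x))) (at t within {0..})" if "t \<ge> 0" for t
    by (rule has_vector_derivative_transform[OF _ _ orbit_fst_derivative[OF x that]]) (use that u in auto)
  have vc: "continuous_on {0..} (\<lambda>s. fst (snd (S s x)))" by (rule blf_continuous[OF blf_snd x])
  show ?thesis unfolding AE_lebesgue_on_iff[OF Ol] x_def[symmetric]
    using orbit_history[OF x T p pT] prof_AE_R[OF pT] AE_lborel_shift[OF \<xi>0, of T]
  proof eventually_elim
    case (elim \<sigma>)
    show ?case
    proof
      assume \<sigma>\<Omega>: "\<sigma> \<in> Omega l"
      then have \<sigma>: "\<sigma> > 0" by (rule Omega_pos)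
      have "snd (snd (S T x)) \<sigma> = R (bT \<sigma>)" using elim(2) \<sigma>\<Omega> by blast
      also have "\<dots> = \<xi>0 (T + \<sigma>) + (\<mu> \<sigma> *\<^sub>R u T - \<mu> (\<sigma> + T) *\<^sub>R u 0 + (LINT s:{0..T}|lborel. deriv \<mu> (\<sigma> + s) *\<^sub>R u (T - s)))"
        using elim(1,3) \<sigma> T memory_by_parts[OF vc ud \<sigma> T] by simp
      finally show "xi_t \<mu> \<xi>0 u0 u T \<sigma> = snd (snd (S T x)) \<sigma>"
        by (simp add: xi_t_def u0 add.commute algebra_simps)
    qed
  qed
qed

text \<open>The orbit from xi_0 solves the equation with forcing F_0, so one direction is the
  uniqueness of solutions and the other is immediate.\<close>

lemma proper_state_solution:
  assumes u0: "u0 \<in> DB" and F: "in_GammaP l \<mu> B DB F0" and \<eta>: "dist_deriv {0<..} F0 \<eta>"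
  defines "\<xi>0 \<equiv> \<lambda>\<tau>. \<mu> \<tau> *\<^sub>R u0 + \<eta> \<tau>"
  shows "is_solution l \<mu> (1 + mass) B DB F0 u0 v0 u \<longleftrightarrow>
    (\<forall>t\<ge>0. u t = fst (S t (u0, v0, \<xi>0)) \<and>
      (u has_vector_derivative fst (snd (S t (u0, v0, \<xi>0)))) (at t within {0..}) \<and>
      (AE \<tau> in lebesgue_on (Omega l). xi_t \<mu> \<xi>0 u0 u t \<tau> = snd (snd (S t (u0, v0, \<xi>0))) \<tau>))"
proof -
  obtain \<xi> where \<xi>: "in_calP l \<mu> B DB \<xi>" "AE t in lebesgue_on {0..}. F0 t = Gam l \<xi> t"
    using F unfolding in_GammaP_def by blast
  have Il: "{0::real..} \<in> sets lebesgue" by simp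
  obtain b where pb: "prof \<xi> b" using prof_ex \<xi>(1) unfolding in_calP_def by blast
  note wb = prof_wL2[OF pb]
  have F0: "AE t in lborel. t > 0 \<longrightarrow> F0 t = Gam l \<xi> t"
    using \<xi>(2) unfolding AE_lebesgue_on_iff[OF Il] by eventually_elim auto
  \<comment> \<open>Any distributional derivative \<eta> of F_0 agrees a.e. on {0<..} with the
    proper history extended by 0; this fixes it beyond l as well.\<close>
  have "AE \<tau> in lborel. \<tau> \<in> {0<..} \<longrightarrow> \<eta> \<tau> = (if \<tau> \<in> Omega l then \<xi> \<tau> else 0)"
    by (rule dist_deriv_unique[OF _ \<eta> Gam_dist_deriv[OF pb F0]]) simp
  then have \<eta>R: "AE \<tau> in lborel. \<tau> > 0 \<longrightarrow> \<eta> \<tau> = R (b \<tau>)"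
    using prof_AE_R[OF pb] by eventually_elim (auto simp: wL2_zero[OF wb] R_0)
  define b0 where "b0 \<tau> = \<mu> \<tau> *\<^sub>R B u0 + b \<tau>" for \<tau>
  have \<xi>0R: "AE \<tau> in lborel. \<tau> > 0 \<longrightarrow> \<xi>0 \<tau> = R (b0 \<tau>)"
    using \<eta>R by eventually_elim (use u0 in \<open>simp add: \<xi>0_def b0_def R_add R_scale\<close>)
  have p0: "prof \<xi>0 b0" unfolding b0_def
  proof (rule prof_cong[OF prof_add[OF prof_mu[OF u0] pb]])
    show "AE \<tau> in lborel. \<tau> \<in> Omega l \<longrightarrow> \<xi>0 \<tau> = \<mu> \<tau> *\<^sub>R u0 + \<xi> \<tau>"
      using \<eta>R prof_AE_R[OF pb] by eventually_elim (auto simp: \<xi>0_def dest: Omega_pos)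
  qed
  have x: "FA (u0, v0, \<xi>0)" using u0 prof_calV[OF p0] by (simp add: in_frakA_def)
  have BF: "AE t in lborel. t > 0 \<longrightarrow> B (F0 t) = tail_mass t *\<^sub>R B u0 - (LINT \<tau>:{t<..}|lborel. b0 \<tau>)"
    using F0 by eventually_elim (simp add: Gam_eq[OF pb] b0_def tail_integral_mu_add[OF wb])
  note sol = orbit_is_solution[OF x p0 BF]
  show ?thesis
  proof
    assume s: "is_solution l \<mu> (1 + mass) B DB F0 u0 v0 u"
    have eq: "u t = fst (S t (u0, v0, \<xi>0))" if "t \<ge> 0" for t
      by (rule solution_unique[OF s sol[OF refl] _ that]) simp
    have "(u has_vector_derivative fst (snd (S t (u0, v0, \<xi>0)))) (at t within {0..})" if "t \<ge> 0" for t
      by (rule has_vector_derivative_transform[OF _ _ orbit_fst_derivative[OF x that]]) (use that eq in auto)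
    then show "\<forall>t\<ge>0. u t = fst (S t (u0, v0, \<xi>0)) \<and>
      (u has_vector_derivative fst (snd (S t (u0, v0, \<xi>0)))) (at t within {0..}) \<and>
      (AE \<tau> in lebesgue_on (Omega l). xi_t \<mu> \<xi>0 u0 u t \<tau> = snd (snd (S t (u0, v0, \<xi>0))) \<tau>)"
      using eq orbit_xi_t[OF x p0 \<xi>0R eq] by simp
  qed (use sol in blast)
qed

lemma first_component_imp_proper_state:
  assumes u0: "u0 \<in> DB" and F: "in_calS l \<mu> B DB F0" and s: "is_solution l \<mu> (1 + mass) B DB F0 u0 v0 u"
    and \<xi>0: "in_calV l \<mu> B DB \<xi>0" and u: "\<And>t. t \<ge> 0 \<Longrightarrow> u t = fst (S t (u0, v0, \<xi>0))"
  shows "in_GammaP l \<mu> B DB F0"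
proof -
  obtain b0 where p0: "prof \<xi>0 b0" using prof_ex[OF \<xi>0] by blast
  have x: "FA (u0, v0, \<xi>0)" using u0 \<xi>0 by (simp add: in_frakA_def)
  define \<xi> where "\<xi> \<tau> = \<xi>0 \<tau> - \<mu> \<tau> *\<^sub>R u0" for \<tau>
  define b where "b \<tau> = b0 \<tau> - \<mu> \<tau> *\<^sub>R B u0" for \<tau>
  have pb: "prof \<xi> b" unfolding \<xi>_def b_def by (rule prof_diff[OF p0 prof_mu[OF u0]])
  define F1 where "F1 t = R (tail_prim b t)" for t
  have F1: "tail_mass t *\<^sub>R B u0 - (LINT \<tau>:{t<..}|lborel. b0 \<tau>) = B (F1 t)" for t
    using tail_integral_mu_add[OF prof_wL2[OF pb], of t "B u0"] by (simp add: F1_def b_def)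
  have s1: "is_solution l \<mu> (1 + mass) B DB F1 u0 v0 u"
    by (rule orbit_is_solution[OF x p0 _ u]) (simp add: F1)
  have Il: "{0::real..} \<in> sets lebesgue" by simp
  obtain \<phi> where \<phi>: "in_calA l \<mu> B DB \<phi>" "AE t in lebesgue_on {0..}. F0 t = Lam l \<mu> \<phi> t"
    using F unfolding in_calS_def by blast
  \<comment> \<open>Comparing forcings gives equality only after B, which is injective on DB alone;
    membership of F_0 in DB comes from its representation in calS.\<close>
  have DB: "AE t in lebesgue_on {0..}. Lam l \<mu> \<phi> t \<in> DB" using \<phi>(1) unfolding in_calA_def loc_int_V_def by blast
  have F0: "AE t in lborel. t > 0 \<longrightarrow> F0 t = Gam l \<xi> t"
    using forcing_unique[OF s s1 refl] \<phi>(2)[unfolded AE_lebesgue_on_iff[OF Il]] DB[unfolded AE_lebesgue_on_iff[OF Il]]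
  proof eventually_elim
    case (elim t)
    show ?case
    proof
      assume t: "t > 0"
      then have "F0 t \<in> DB" "B (F0 t) = tail_prim b t" using elim by (auto simp: F1_def)
      then have "F0 t = R (tail_prim b t)" by (metis R_B)
      then show "F0 t = Gam l \<xi> t" using Gam_eq[OF pb, of t] t by simp
    qed
  qed
  \<comment> \<open>F_0 itself is the element of calS that witnesses properness.\<close>
  have "in_calP l \<mu> B DB \<xi>"
    unfolding in_calP_def using prof_calV[OF pb] F Gam_dist_deriv[OF pb F0] by blast
  moreover have "AE t in lebesgue_on {0..}. F0 t = Gam l \<xi> t"
    unfolding AE_lebesgue_on_iff[OF Il] using F0 AE_lborel_singleton[of 0] by eventually_elim auto
  ultimately show ?thesis unfolding in_GammaP_def by blast
qed

end

theorem theorem11p5: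
  fixes A B :: "'h::{real_inner,banach,second_countable_topology} \<Rightarrow> 'h"
    and DA DB :: "'h set"
    and l :: ereal and \<mu> :: "real \<Rightarrow> real" and \<alpha> :: real
    and S :: "real \<Rightarrow> 'h st \<Rightarrow> 'h st"
    and u0 v0 :: 'h and F0 :: "real \<Rightarrow> 'h" and u :: "real \<Rightarrow> 'h"
  assumes A: "selfadjoint_op A DA" "strictly_positive_op A DA" "has_compact_inverse A DA"
    and B: "is_op_sqrt B DB A DA"
    and l: "l > 0"
    and mu: "memory_kernel l \<mu>"
    and alpha: "\<alpha> > 0" "\<alpha> - Mk l \<mu> 0 = 1"
    and S: "is_generated_semigroup l \<mu> A DA B DB S"
    and init: "u0 \<in> DB" "in_calS l \<mu> B DB F0"
  shows "(in_GammaP l \<mu> B DB F0 \<longrightarrow>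
            (\<forall>\<eta>. dist_deriv {0<..} F0 \<eta> \<longrightarrow>
              (let \<xi>0 = (\<lambda>\<tau>. \<mu> \<tau> *\<^sub>R u0 + \<eta> \<tau>) in
                is_solution l \<mu> \<alpha> B DB F0 u0 v0 u \<longleftrightarrow>
                (\<forall>t\<ge>0. u t = fst (S t (u0, v0, \<xi>0)) \<and>
                        (u has_vector_derivative fst (snd (S t (u0, v0, \<xi>0)))) (at t within {0..}) \<and>
                        (AE \<tau> in lebesgue_on (Omega l).
                           xi_t \<mu> \<xi>0 u0 u t \<tau> = snd (snd (S t (u0, v0, \<xi>0))) \<tau>)))))
       \<and> (is_solution l \<mu> \<alpha> B DB F0 u0 v0 u \<and> \<not> in_GammaP l \<mu> B DB F0 \<longrightarrow>
            \<not> (\<exists>\<xi>0. in_calV l \<mu> B DB \<xi>0 \<and> (\<forall>t\<ge>0. u t = fst (S t (u0, v0, \<xi>0)))))"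
proof -
  interpret visco_semigroup A B DA DB l \<mu> S
    by unfold_locales (fact A B l mu S)+
  \<comment> \<open>The normalisation of \<alpha> produces the coefficient with which orbits were
    shown to solve the equation: 1 from B u and mass from the history.\<close>
  have \<alpha>: "\<alpha> = 1 + mass" using alpha(2) Mk_0 by simp
  show ?thesis
    unfolding \<alpha> Let_def using proper_state_solution[OF init(1)] first_component_imp_proper_state[OF init] by blast
qed

end
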